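(* There exists a set $\Omega_0\subset\mathbb{R}^2$, which is not a ball, that minimizes the functional $$\mathcal{F}(\Omega)=\frac{\delta(\Omega)}{\lambda^2(\Omega)}$$ among all subsets $\Omega$ of $\mathbb{R}^2$ (the balls excluded). That is, $\mathcal{F}(\Omega_0)\le \mathcal{F}(\Omega)$ for every Borel set $\Omega\subset\mathbb{R}^2$ with $0<|\Omega|<\infty$ that is not a ball.
   Context: $|\cdot|$ is Lebesgue measure on $\mathbb{R}^2$ and $P(\Omega)$ is the perimeter of $\Omega$ in the sense of De Giorgi (possibly $+\infty$). Sets are considered up to Lebesgue-null sets; "ball" means a set equal to a Euclidean disk up to a null set. For a Borel set $\Omega\subset\mathbb{R}^2$ with $0<|\Omega|<\infty$: the isoperimetric deficit is $\delta(\Omega)=\dfrac{P(\Omega)-P(B)}{P(B)}$, where $B$ is a ball with $|B|=|\Omega|$; the Fraenkel asymmetry is $\lambda(\Omega)=\min_{x\in\mathbb{R}^2}\left\{\dfrac{|\Omega\Delta B_x|}{|\Omega|}\right\}$, where $B_x$ is the ball centered at $x$ with $|B_x|=|\Omega|$ and $\Delta$ is the symmetric difference. For $\Omega$ not a ball, $\lambda(\Omega)>0$ and $\mathcal{F}(\Omega)=\delta(\Omega)/\lambda^2(\Omega)$. *)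

theory Defs
  imports "HOL-Analysis.Analysis"
begin

definition divergence :: "(real^2 \<Rightarrow> real^2) \<Rightarrow> real^2 \<Rightarrow> real" where
  "divergence \<phi> x = (\<Sum>i\<in>UNIV. frechet_derivative \<phi> (at x) (axis i 1) $ i)"

text \<open>The fields in \<open>C\<^sub>c\<^sup>1(\<real>\<^sup>2; \<real>\<^sup>2)\<close> with pointwise Euclidean norm at most 1.\<close>

definition test_fields :: "(real^2 \<Rightarrow> real^2) set" where
  "test_fields = {\<phi>.
     (\<exists>D :: real^2 \<Rightarrow> (real^2) \<Rightarrow>\<^sub>L (real^2).
        (\<forall>x. (\<phi> has_derivative blinfun_apply (D x)) (at x)) \<and> continuous_on UNIV D) \<and>
     compact (closure {x. \<phi> x \<noteq> 0}) \<and>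
     (\<forall>x. norm (\<phi> x) \<le> 1)}"

text \<open>De Giorgi perimeter. It is nonnegative since \<open>0\<close> is a test field, and may be \<open>\<infinity>\<close>.\<close>

definition perimeter :: "(real^2) set \<Rightarrow> ereal" where
  "perimeter \<Omega> = (SUP \<phi>\<in>test_fields. ereal (LINT x:\<Omega>|lborel. divergence \<phi> x))"

definition is_ball :: "(real^2) set \<Rightarrow> bool" where
  "is_ball \<Omega> \<longleftrightarrow> (\<exists>x r. 0 < r \<and> sym_diff \<Omega> (ball x r) \<in> null_sets lborel)"

definition equal_area_ball :: "(real^2) set \<Rightarrow> real^2 \<Rightarrow> (real^2) set" where
  "equal_area_ball \<Omega> x = ball x (sqrt (measure lborel \<Omega> / pi))"

lemma measure_equal_area_ball:
  "measure lborel (equal_area_ball \<Omega> x) = measure lborel \<Omega>"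
  by (simp add: equal_area_ball_def content_ball unit_ball_vol_2)

text \<open>The choice of centre in the comparison ball is immaterial, as the perimeter is
  translation invariant. The deficit is \<open>\<infinity>\<close> when the perimeter of \<open>\<Omega>\<close> is.\<close>

definition isoperimetric_deficit :: "(real^2) set \<Rightarrow> ereal" where
  "isoperimetric_deficit \<Omega> =
     (perimeter \<Omega> - perimeter (equal_area_ball \<Omega> 0)) / perimeter (equal_area_ball \<Omega> 0)"

text \<open>For Borel sets of finite positive area the infimum is a minimum: the quotient depends
  continuously on \<open>x\<close> and tends to its upper bound \<open>2\<close> as \<open>x\<close> tends to infinity.\<close>

definition fraenkel_asymmetry :: "(real^2) set \<Rightarrow> real" where
  "fraenkel_asymmetry \<Omega> =
     (INF x. measure lborel (sym_diff \<Omega> (equal_area_ball \<Omega> x)) / measure lborel \<Omega>)"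

definition isoperimetric_quotient :: "(real^2) set \<Rightarrow> ereal" where
  "isoperimetric_quotient \<Omega> = isoperimetric_deficit \<Omega> / ereal ((fraenkel_asymmetry \<Omega>)\<^sup>2)"

definition admissible :: "(real^2) set \<Rightarrow> bool" where
  "admissible \<Omega> \<longleftrightarrow>
     \<Omega> \<in> sets borel \<and> 0 < emeasure lborel \<Omega> \<and> emeasure lborel \<Omega> < \<infinity> \<and> \<not> is_ball \<Omega>"

end

theory Submission
 imports Defs "HOL-Complex_Analysis.Great_Picard"
begin

text \<open>Two equal disks far apart have \<open>F = \<surd>2 - 1\<close>. If no set does better, they are a minimiser. Otherwise take a
minimising sequence with \<open>F < \<surd>2 - 1\<close>, normalised to area \<open>\<pi>\<close>. Three facts make it converge.

\<^item> For small asymmetry \<open>\<delta> \<ge> 0.415 \<lambda>\<^sup>2\<close>, and \<open>0.415 > \<surd>2 - 1\<close>; so \<open>\<lambda>\<close> stays away from 0. Here a mollified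
indicator is tested against a field that tilts the radial direction by its clipped angular variation, which reduces the
bound to one for the functions \<open>w\<close> on the circle with modes 0 and 1 removed: \<open>(\<integral>\<bar>w\<bar>)\<^sup>2\<close> is controlled by
\<open>\<integral>w'\<^sup>2 - w\<^sup>2\<close>.
\<^item> The sets may be compressed into a fixed disk. A long set has a window carrying little area \<open>m\<close>; cutting it out gains
\<open>sqrt (pi m)\<close> in perimeter, which outweighs the loss of area, and the two parts may then be moved together
without increasing the overlap with any unit disk, hence without decreasing \<open>\<lambda>\<close>.
\<^item> In a fixed disk, a perimeter bound gives compactness in \<open>L\<^sup>1\<close>; the asymmetry is continuous and the perimeter is lower
semicontinuous.\<close>

text \<open>Near a disk the quotient is 0/0, so a local lower bound is needed that strictly exceeds
  the value of one explicit competitor, and the two numbers are close. With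
  \<open>K = pi / 4 + 10 / (3 * pi)\<close> the square of the L1 norm of \<open>w\<close> is at most
  \<open>K\<close> times the integral of w'^2 - w^2. That integral is at most about 2 (P - 2 pi),
  and the L1 norm is at least about pi \<lambda>; together \<delta> >= pi / (4 K) \<lambda>^2, with
  pi / (4 K) about 0.4253. The value 0.415 leaves room for error terms and still exceeds sqrt 2 - 1,
  about 0.4142. Cauchy-Schwarz with the spectral gap 3 alone would give K = 2 pi / 3 and only 0.375,
  which is why mode 2 is treated separately.

  The perimeter is known only as a supremum over C^1 fields, so no boundary, normal or polar graph
  of a set is at hand. Near a disk each ray carries a mollified profile instead; how far it is from
  a sharp decreasing step is measured by two error integrals, one paid for by the perimeter and the
  other by the scale of mollification.\<close>

abbreviation area :: "'a::euclidean_space set => real" where "area == measure lborel"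
abbreviation finarea :: "'a::euclidean_space set => bool" where "finarea A == emeasure lborel A < \<infinity>"
abbreviation fasym :: "(real^2) set => real" where "fasym == fraenkel_asymmetry"
abbreviation ind :: "'a set => 'a => 'b::zero_neq_one" where "ind == indicator"
abbreviation integ :: "('a::euclidean_space => 'b::{banach,second_countable_topology}) => bool" where "integ == integrable lborel"

declare [[argo_timeout = 100]]

lemmas int_bound = Bochner_Integration.integrable_bound and int_cong = Bochner_Integration.integral_cong

section \<open>Test fields\<close>

text \<open>The derivative is an explicit operator-valued witness \<open>D\<close>. Divergences of
  products and composites then become traces that are computed by rewriting;
  \<open>frechet_derivative\<close> is met only in \<open>divergence_C1w\<close>.\<close>

definition C1w :: "('a::real_normed_vector => 'b::real_normed_vector) => ('a => 'a \<Rightarrow>\<^sub>L 'b) => bool" where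
 "C1w f D \<longleftrightarrow> (\<forall>x. (f has_derivative blinfun_apply (D x)) (at x)) \<and> continuous_on UNIV D"

lemma C1w_deriv: "C1w f D ==> (f has_derivative blinfun_apply (D x)) (at x within S)"
 by (auto simp: C1w_def intro: has_derivative_at_withinI)

lemma C1w_contD: "C1w f D ==> continuous_on S D"
 by (auto simp: C1w_def intro: continuous_on_subset)

lemma C1w_cont: "C1w f D ==> continuous_on S f"
 by (intro continuous_at_imp_continuous_on ballI has_derivative_continuous) (auto intro: C1w_deriv)

lemma C1w_add: "C1w f D ==> C1w g E ==> C1w (\<lambda>x. f x + g x) (\<lambda>x. D x + E x)"
 unfolding C1w_def plus_blinfun.rep_eq by (auto intro!: derivative_intros continuous_intros)

lemma C1w_diff: "C1w f D ==> C1w g E ==> C1w (\<lambda>x. f x - g x) (\<lambda>x. D x - E x)"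
 unfolding C1w_def minus_blinfun.rep_eq by (auto intro!: derivative_intros continuous_intros)

lemma C1w_const: "C1w (\<lambda>x. c) (\<lambda>x. 0)"
 unfolding C1w_def zero_blinfun.rep_eq by (auto intro!: derivative_intros continuous_intros)

lemma C1w_linear: "bounded_linear f ==> C1w f (\<lambda>x. Blinfun f)"
 unfolding C1w_def by (auto simp: bounded_linear_Blinfun_apply bounded_linear_imp_has_derivative)

lemma C1w_compose: "C1w f D ==> C1w g E ==> C1w (\<lambda>x. f (g x)) (\<lambda>x. D (g x) o\<^sub>L E x)"
proof -
 assume f: "C1w f D" and g: "C1w g E"
 have "((\<lambda>x. f (g x)) has_derivative blinfun_apply (D (g x) o\<^sub>L E x)) (at x)" for x
  using diff_chain_at[of g _ x f] f g by (auto simp: C1w_def o_def blinfun_compose.rep_eq)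
 moreover have "continuous_on UNIV (\<lambda>x. D (g x))"
  using continuous_on_compose2[of UNIV D UNIV g] f g C1w_cont[OF g] by (auto simp: C1w_def)
 ultimately show ?thesis using g by (auto simp: C1w_def intro!: continuous_intros)
qed

lemma C1w_scaleR: "C1w c C ==> C1w f D ==> C1w (\<lambda>x. c x *\<^sub>R f x) (\<lambda>x. c x *\<^sub>R D x + (blinfun_scaleR_left (f x) o\<^sub>L C x))"
 for c :: "'a::real_normed_vector => real"
proof -
 assume c: "C1w c C" and f: "C1w f D"
 have "((\<lambda>x. c x *\<^sub>R f x) has_derivative blinfun_apply (c x *\<^sub>R D x + (blinfun_scaleR_left (f x) o\<^sub>L C x))) (at x)" for x
  by (rule has_derivative_eq_rhs[OF has_derivative_scaleR[OF C1w_deriv[OF c] C1w_deriv[OF f]]])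
   (auto simp: blinfun.bilinear_simps blinfun_compose.rep_eq)
 moreover have "continuous_on UNIV (\<lambda>x. c x *\<^sub>R D x + (blinfun_scaleR_left (f x) o\<^sub>L C x))"
  using C1w_contD[OF c] C1w_contD[OF f] C1w_cont[OF c] C1w_cont[OF f]
  by (auto intro!: continuous_intros bounded_linear.continuous_on[OF bounded_linear_blinfun_scaleR_left])
 ultimately show ?thesis by (auto simp: C1w_def)
qed

lemma C1w_real: "(\<And>x. (H has_real_derivative h x) (at x)) ==> continuous_on UNIV h ==> C1w H (\<lambda>x. blinfun_mult_right (h x))"
 unfolding C1w_def has_field_derivative_def
 by (auto intro!: bounded_linear.continuous_on[OF bounded_linear_blinfun_mult_right])

lemma C1w_inner: "C1w f D ==> C1w (\<lambda>x. f x \<bullet> v) (\<lambda>x. blinfun_inner_right v o\<^sub>L D x)"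
 unfolding C1w_def
proof (intro conjI allI)
 fix x assume *: "(\<forall>x. (f has_derivative blinfun_apply (D x)) (at x)) \<and> continuous_on UNIV D"
 show "((\<lambda>x. f x \<bullet> v) has_derivative blinfun_apply (blinfun_inner_right v o\<^sub>L D x)) (at x)"
  by (rule has_derivative_eq_rhs[OF has_derivative_inner_left]) (use * in \<open>auto simp: blinfun_compose.rep_eq inner_commute\<close>)
 show "continuous_on UNIV (\<lambda>x. blinfun_inner_right v o\<^sub>L D x)" using * by (auto intro!: continuous_intros)
qed

definition dv :: "((real^2) \<Rightarrow>\<^sub>L (real^2)) => real" where
 "dv L = (\<Sum>i\<in>UNIV. blinfun_apply L (axis i 1) $ i)"

lemma dv_add: "dv (L + M) = dv L + dv M" and dv_diff: "dv (L - M) = dv L - dv M"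
 and dv_scaleR: "dv (c *\<^sub>R L) = c * dv L" and dv_zero[simp]: "dv 0 = 0"
 by (auto simp: dv_def sum_2 blinfun.bilinear_simps algebra_simps)

text \<open>The trace of the rank one operator h -> L(h) v is L(v). Applied to
  \<open>C1w_scaleR\<close> this gives div (c f) = c div f + grad c . f.\<close>

lemma dv_rank1: "dv (blinfun_scaleR_left v o\<^sub>L L) = blinfun_apply L v"
proof -
 have "blinfun_apply L v = blinfun_apply L (v$1 *\<^sub>R axis 1 1 + v$2 *\<^sub>R axis 2 1)"
  by (rule arg_cong[of _ _ "blinfun_apply L"]) (simp add: vec_eq_iff forall_2 axis_def)
 thus ?thesis
  by (simp add: dv_def sum_2 blinfun_compose.rep_eq blinfun.bilinear_simps)
qed

lemma bounded_linear_dv: "bounded_linear dv"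
 unfolding dv_def
 by (intro bounded_linear_sum bounded_linear_compose[OF bounded_linear_vec_nth] blinfun.bounded_linear_left)

lemma divergence_C1w: "C1w phi D ==> divergence phi x = dv (D x)"
 unfolding divergence_def dv_def using frechet_derivative_at[OF C1w_deriv[of phi D x UNIV]] by auto

lemma continuous_on_divergence: "C1w phi D ==> continuous_on S (divergence phi)"
 using bounded_linear.continuous_on[OF bounded_linear_dv C1w_contD[of phi D S]]
 by (simp add: divergence_C1w[of phi D] cong: continuous_on_cong)

lemma test_fields_iff:
 "phi \<in> test_fields \<longleftrightarrow> (\<exists>D. C1w phi D) \<and> (\<exists>R. \<forall>x. R < norm x \<longrightarrow> phi x = 0) \<and> (\<forall>x. norm (phi x) <= 1)"
proof -
 have "compact (closure {x. phi x \<noteq> 0}) \<longleftrightarrow> (\<exists>R. \<forall>x. R < norm x \<longrightarrow> phi x = 0)"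
  by (auto simp: compact_closure bounded_iff not_less[symmetric])
 thus ?thesis by (auto simp: test_fields_def C1w_def)
qed

lemma test_fieldsI:
 assumes "C1w phi D" "\<And>x. R < norm x ==> phi x = 0" "\<And>x. norm (phi x) <= 1"
 shows "phi \<in> test_fields"
 using assms unfolding test_fields_iff by blast

lemma test_fieldsE:
 assumes "phi \<in> test_fields"
 obtains D R where "C1w phi D" "0 < R" "\<And>x. R < norm x ==> phi x = 0" "\<And>x. norm (phi x) <= 1"
  "\<And>x. divergence phi x = dv (D x)" "\<And>x. R < norm x ==> D x = 0"
proof -
 from assms obtain D R where *: "C1w phi D" "\<And>x. R < norm x ==> phi x = 0" "\<And>x. norm (phi x) <= 1"
  unfolding test_fields_iff by blast
 \<comment> \<open>The exterior of the ball is open, so \<open>phi\<close> vanishes near each of its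
   points and so does the derivative. Passing from R to |R| + 1 also makes the radius
   positive.\<close>
 have "D x = 0" if "\<bar>R\<bar> + 1 < norm x" for x
 proof (rule blinfun_eqI)
  fix h
  have "open {x::real^2. R < norm x}" by (auto intro!: open_Collect_less continuous_intros)
  hence "(phi has_derivative (\<lambda>h. 0)) (at x)"
   by (rule has_derivative_transform_within_open[OF has_derivative_const[of 0]]) (use * that in auto)
  thus "blinfun_apply (D x) h = blinfun_apply 0 h"
   using has_derivative_unique[OF _ C1w_deriv[OF *(1), of x UNIV]] by (auto simp: fun_eq_iff)
 qed
 thus thesis using * that[of D "\<bar>R\<bar> + 1"] divergence_C1w[OF *(1)] by auto
qed

lemma divergence_borel[measurable]: "phi \<in> test_fields ==> divergence phi \<in> borel_measurable borel"
 by (erule test_fieldsE) (auto intro: borel_measurable_continuous_onI continuous_on_divergence)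

lemma divergence_bounded:
 assumes "phi \<in> test_fields" obtains B where "0 < B" "\<And>x. \<bar>divergence phi x\<bar> <= B"
proof -
 obtain D R where *: "C1w phi D" "0 < R" "\<And>x. divergence phi x = dv (D x)" "\<And>x. R < norm x ==> D x = 0"
  using test_fieldsE[OF assms] by metis
 have "bounded (divergence phi ` cball 0 R)"
  by (intro compact_imp_bounded compact_continuous_image continuous_on_divergence[OF *(1)] compact_cball)
 then obtain B where B: "\<And>x. norm x <= R ==> \<bar>divergence phi x\<bar> <= B"
  by (auto simp: bounded_iff) (metis mem_cball_0)
 have "\<bar>divergence phi x\<bar> <= \<bar>B\<bar> + 1" for x
  using B[of x] *(3,4)[of x] by (cases "norm x <= R") auto
 thus thesis using that[of "\<bar>B\<bar> + 1"] by auto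
qed

lemma set_integrable_bounded_finite:
 fixes f :: "'a::euclidean_space => real"
 assumes "A \<in> sets borel" "finarea A" "f \<in> borel_measurable borel" "\<And>x. x \<in> A ==> \<bar>f x\<bar> <= B"
 shows "set_integrable lborel A f"
 unfolding set_integrable_def
proof (rule integrableI_bounded_set[where A=A and B=B])
qed (use assms in \<open>auto simp: indicator_def\<close>)

lemma divergence_integrable:
 assumes "phi \<in> test_fields" shows "integ (divergence phi)"
proof -
 obtain B where B: "\<And>x. \<bar>divergence phi x\<bar> <= B" using divergence_bounded[OF assms] by metis
 obtain D R where R: "\<And>x. divergence phi x = dv (D x)" "\<And>x. R < norm x ==> D x = 0" using test_fieldsE[OF assms] by metis
 show ?thesis
 proof (rule integrableI_bounded_set[where A="cball 0 R" and B=B])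
  show "finarea (cball (0::real^2) R)" using emeasure_lborel_cball_finite by auto
 qed (use B R assms in auto)
qed

lemma divergence_set_integrable:
 assumes "phi \<in> test_fields" "A \<in> sets borel" shows "set_integrable lborel A (divergence phi)"
 unfolding set_integrable_def using integrable_mult_indicator[OF _ divergence_integrable[OF assms(1)], of A] assms(2) by simp

text \<open>Most estimates need only a real upper bound for the perimeter. This form avoids
  \<open>ereal\<close> and the case of infinite perimeter.\<close>

definition per_le :: "(real^2) set => real => bool" where
 "per_le A p \<longleftrightarrow> (\<forall>phi\<in>test_fields. (LINT x:A|lborel. divergence phi x) <= p)"

lemma zero_test_field: "(\<lambda>x. 0) \<in> test_fields"
 by (rule test_fieldsI[OF C1w_const]) auto

lemma perimeter_nonneg: "0 <= perimeter A"
proof -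
 have "(LINT x:A|lborel. divergence (\<lambda>x. 0) x) = 0"
  by (simp add: divergence_C1w[OF C1w_const])
 hence "ereal 0 <= perimeter A"
  unfolding perimeter_def by (intro SUP_upper2[OF zero_test_field]) auto
 thus ?thesis by (simp add: zero_ereal_def)
qed

lemma perimeter_le_iff: "perimeter A <= ereal p \<longleftrightarrow> per_le A p"
 by (auto simp: perimeter_def per_le_def SUP_le_iff)

lemma per_le_nonneg: "per_le A p ==> 0 <= p"
proof -
 assume "per_le A p"
 hence "0 <= ereal p" using perimeter_nonneg[of A] order_trans unfolding perimeter_le_iff[symmetric] by blast
 thus ?thesis by simp
qed

lemma per_leD: "per_le A p ==> phi \<in> test_fields ==> (LINT x:A|lborel. divergence phi x) <= p"
 by (auto simp: per_le_def)

lemma perimeter_real: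
 assumes "perimeter A < \<infinity>" obtains p where "perimeter A = ereal p" "0 <= p" "per_le A p"
proof -
 obtain p where p: "perimeter A = ereal p" using assms perimeter_nonneg[of A] by (cases "perimeter A") auto
 moreover have "per_le A p" using p by (simp flip: perimeter_le_iff)
 ultimately show thesis using that per_le_nonneg by blast
qed

section \<open>Planar coordinates and affine maps\<close>

definition vec2 :: "real => real => real^2" where
 "vec2 a b = (\<chi> i. if i = 1 then a else b)"

lemma vec2_nth[simp]: "vec2 a b $ 1 = a" "vec2 a b $ 2 = b"
 by (auto simp: vec2_def)

lemma vec2_eta[simp]: "vec2 (x $ 1) (x $ 2) = x"
 by (simp add: vec_eq_iff forall_2)

lemma norm_vec2: "norm x = sqrt ((x $ 1)^2 + (x $ 2)^2)" for x :: "real^2"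
 by (simp add: norm_vec_def L2_set_def sum_2)

lemma inner_vec2: "x \<bullet> y = x $ 1 * y $ 1 + x $ 2 * y $ 2" for x :: "real^2"
 by (simp add: inner_vec_def sum_2)

lemma vec2_decomp: "vec2 a b = a *\<^sub>R axis 1 1 + b *\<^sub>R axis 2 1"
 by (simp add: vec_eq_iff forall_2 axis_def)

lemma continuous_on_vec2[continuous_intros]:
 "continuous_on S f ==> continuous_on S g ==> continuous_on S (\<lambda>x. vec2 (f x) (g x))"
 unfolding vec2_decomp by (intro continuous_intros)

lemma measurable_vec2_pair: "(\<lambda>p. vec2 (fst p) (snd p)) \<in> borel_measurable borel"
 by (intro borel_measurable_continuous_onI continuous_intros)

lemma measurable_vec2[measurable]:
 "f \<in> borel_measurable M ==> g \<in> borel_measurable M ==> (\<lambda>x. vec2 (f x) (g x)) \<in> borel_measurable M"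
proof -
 assume "f \<in> borel_measurable M" "g \<in> borel_measurable M"
 hence "(\<lambda>x. (f x, g x)) \<in> borel_measurable M" by (simp add: borel_prod[symmetric])
 from measurable_compose[OF this measurable_vec2_pair] show ?thesis by simp
qed

lemma measurable_vec_nth2[measurable]: "(\<lambda>x::real^2. x $ i) \<in> borel_measurable borel"
 by (intro borel_measurable_continuous_onI continuous_intros)

lemma Basis_vec2: "(Basis :: (real^2) set) = {axis 1 1, axis 2 1}"
 by (auto simp: Basis_vec_def UNIV_2)

text \<open>It suffices to compare the two measures on boxes. This transports Fubini and Tonelli
  from the product measure to \<open>real^2\<close>.\<close>

lemma distr_vec2: "distr (lborel \<Otimes>\<^sub>M lborel) borel (\<lambda>p. vec2 (fst p) (snd p)) = lborel"
proof (rule lborel_eqI[symmetric])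
 show "sets (distr (lborel \<Otimes>\<^sub>M lborel) borel (\<lambda>p. vec2 (fst p) (snd p))) = sets borel" by simp
 fix l u :: "real^2" assume lu: "\<And>b. b \<in> Basis ==> l \<bullet> b <= u \<bullet> b"
 have ax: "(axis (1::2) (1::real)) \<noteq> axis 2 1" by (simp add: axis_eq_axis)
 have lu': "l $ 1 <= u $ 1" "l $ 2 <= u $ 2"
  using lu[of "axis 1 1"] lu[of "axis 2 1"] by (auto simp: Basis_vec2 inner_axis)
 have "(\<lambda>p. vec2 (fst p) (snd p)) -` box l u \<inter> space (lborel \<Otimes>\<^sub>M lborel) = box (l$1) (u$1) \<times> box (l$2) (u$2)"
  by (auto simp: mem_box Basis_vec2 inner_axis space_pair_measure)
 thus "emeasure (distr (lborel \<Otimes>\<^sub>M lborel) borel (\<lambda>p. vec2 (fst p) (snd p))) (box l u) = (\<Prod>b\<in>Basis. (u - l) \<bullet> b)"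
  using lu' ax
  by (subst emeasure_distr) (auto simp: lborel.emeasure_pair_measure_Times Basis_vec2 inner_axis ennreal_mult inner_diff_left)
qed

lemma nn_integral_vec2:
 fixes f :: "real^2 => ennreal" assumes [measurable]: "f \<in> borel_measurable borel"
 shows "(\<integral>\<^sup>+x. f x \<partial>lborel) = (\<integral>\<^sup>+a. (\<integral>\<^sup>+b. f (vec2 a b) \<partial>lborel) \<partial>lborel)"
proof -
 have "(\<integral>\<^sup>+x. f x \<partial>lborel) = (\<integral>\<^sup>+p. f (vec2 (fst p) (snd p)) \<partial>(lborel \<Otimes>\<^sub>M lborel))"
  by (subst distr_vec2[symmetric]) (simp add: nn_integral_distr)
 also have "... = (\<integral>\<^sup>+a. (\<integral>\<^sup>+b. f (vec2 a b) \<partial>lborel) \<partial>lborel)"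
  by (subst lborel.nn_integral_fst[symmetric]) auto
 finally show ?thesis .
qed

lemma integrable_vec2_pair:
 fixes f :: "real^2 => 'b::{banach,second_countable_topology}" assumes [measurable]: "f \<in> borel_measurable borel"
 shows "integ f \<longleftrightarrow> integrable (lborel \<Otimes>\<^sub>M lborel) (\<lambda>p. f (vec2 (fst p) (snd p)))"
 by (subst distr_vec2[symmetric]) (subst integrable_distr_eq; simp)

lemma integral_vec2:
 fixes f :: "real^2 => 'b::{banach,second_countable_topology}" assumes "integ f"
 shows "(LINT x|lborel. f x) = (LINT a|lborel. (LINT b|lborel. f (vec2 a b)))"
  and "integ (\<lambda>a. LINT b|lborel. f (vec2 a b))"
  and "AE a in lborel. integ (\<lambda>b. f (vec2 a b))"
proof -
 have [measurable]: "f \<in> borel_measurable borel" using assms by auto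
 have 1: "integrable (lborel \<Otimes>\<^sub>M lborel) (\<lambda>(a,b). f (vec2 a b))"
  using assms unfolding integrable_vec2_pair[OF \<open>f \<in> borel_measurable borel\<close>] by (simp add: case_prod_unfold)
 have "(LINT x|lborel. f x) = (LINT p|(lborel \<Otimes>\<^sub>M lborel). f (vec2 (fst p) (snd p)))"
  by (subst distr_vec2[symmetric]) (simp add: integral_distr)
 also have "... = (LINT p|(lborel \<Otimes>\<^sub>M lborel). (\<lambda>(a,b). f (vec2 a b)) p)" by (simp add: case_prod_unfold)
 also have "... = (LINT a|lborel. (LINT b|lborel. f (vec2 a b)))"
  using lborel_pair.integral_fst[OF 1] by simp
 finally show "(LINT x|lborel. f x) = (LINT a|lborel. (LINT b|lborel. f (vec2 a b)))" .
 show "integ (\<lambda>a. LINT b|lborel. f (vec2 a b))" using lborel_pair.integrable_fst[OF 1] by simp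
 show "AE a in lborel. integ (\<lambda>b. f (vec2 a b))" using lborel_pair.AE_integrable_fst[OF 1] by simp
qed

section \<open>Interchange of the coordinate axes\<close>

definition swp :: "real^2 => real^2" where "swp x = vec2 (x $ 2) (x $ 1)"

lemma swp_swp[simp]: "swp (swp x) = x" by (simp add: swp_def)
lemma swp_nth[simp]: "swp x $ 1 = x $ 2" "swp x $ 2 = x $ 1" by (auto simp: swp_def)
lemma norm_swp[simp]: "norm (swp x) = norm x" by (simp add: norm_vec2 add.commute)
lemma swp_diff: "swp (x - y) = swp x - swp y" by (simp add: vec_eq_iff forall_2)
lemma bounded_linear_swp: "bounded_linear swp"
 by (rule bounded_linear_intro[of _ 1]) (auto simp: vec_eq_iff forall_2)
lemma measurable_swp[measurable]: "swp \<in> borel_measurable borel"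
 unfolding swp_def by measurable
lemma inj_swp: "inj swp" by (metis injI swp_swp)

lemma distr_swp: "distr lborel borel swp = lborel"
proof -
 have "distr lborel borel swp = distr (distr (lborel \<Otimes>\<^sub>M lborel) borel (\<lambda>p. vec2 (fst p) (snd p))) borel swp"
  by (simp add: distr_vec2)
 also have "... = distr (lborel \<Otimes>\<^sub>M lborel) borel (\<lambda>p. vec2 (snd p) (fst p))"
  by (subst distr_distr) (auto simp: o_def swp_def)
 also have "... = distr (distr (lborel \<Otimes>\<^sub>M lborel) (lborel \<Otimes>\<^sub>M lborel) (\<lambda>(x,y). (y,x))) borel (\<lambda>p. vec2 (snd p) (fst p))"
  by (simp add: lborel_pair.distr_pair_swap[symmetric])
 also have "... = distr (lborel \<Otimes>\<^sub>M lborel) borel (\<lambda>p. vec2 (fst p) (snd p))"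
  by (subst distr_distr) (auto simp: o_def case_prod_unfold)
 finally show ?thesis by (simp add: distr_vec2)
qed

lemma vimage_swp: "swp ` A = swp -` A"
 by (metis bij_vimage_eq_inv_image bij_betw_def inj_swp inv_equality swp_swp surjI)

lemma integral_swp_image:
 fixes f :: "real^2 => real" assumes [measurable]: "f \<in> borel_measurable borel" "A \<in> sets borel"
 shows "(LINT x:swp`A|lborel. f x) = (LINT x:A|lborel. f (swp x))"
proof -
 have "(LINT x:swp`A|lborel. f x) = (LINT x|distr lborel borel swp. ind (swp -` A) x *\<^sub>R f x)"
  by (simp add: distr_swp set_lebesgue_integral_def vimage_swp)
 also have "... = (LINT x|lborel. ind (swp -` A) (swp x) *\<^sub>R f (swp x))"
  by (subst integral_distr) (auto intro!: borel_measurable_scaleR borel_measurable_indicator measurable_sets_borel[OF measurable_swp])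
 also have "... = (LINT x:A|lborel. f (swp x))"
  by (simp add: set_lebesgue_integral_def indicator_def)
 finally show ?thesis .
qed

lemma borel_swp_image: "A \<in> sets borel ==> swp ` A \<in> sets borel"
 by (simp add: vimage_swp measurable_sets_borel[OF measurable_swp])

lemma emeasure_swp_image: "A \<in> sets borel ==> emeasure lborel (swp ` A) = emeasure lborel A"
proof -
 assume A: "A \<in> sets borel"
 have "emeasure lborel A = emeasure (distr lborel borel swp) A" by (simp add: distr_swp)
 also have "... = emeasure lborel (swp ` A)" using A by (subst emeasure_distr) (auto simp: vimage_swp)
 finally show ?thesis by simp
qed

text \<open>Conjugating a test field by the reflection gives a test field, and conjugation preserves
  the trace of the derivative. Statements about the first axis thereby carry over to the
  second.\<close>

lemma per_le_swp:
 assumes A: "A \<in> sets borel" and p: "per_le A p" shows "per_le (swp ` A) p"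
 unfolding per_le_def
proof
 fix phi assume phi: "phi \<in> test_fields"
 from test_fieldsE[OF phi] obtain D R where D: "C1w phi D" "\<And>x. R < norm x ==> phi x = 0" "\<And>x. norm (phi x) <= 1" 
  "\<And>x. divergence phi x = dv (D x)" by metis
 define E where "E = (\<lambda>x. Blinfun swp o\<^sub>L (D (swp x) o\<^sub>L Blinfun swp))"
 have E: "C1w (\<lambda>x. swp (phi (swp x))) E"
  unfolding E_def using C1w_compose[OF C1w_linear[OF bounded_linear_swp] C1w_compose[OF D(1) C1w_linear[OF bounded_linear_swp]]] by simp
 have sa: "swp (axis 1 1) = axis 2 1" "swp (axis 2 1) = axis 1 1"
  by (auto simp: vec_eq_iff forall_2 axis_def)
 have "dv (E x) = dv (D (swp x))" for x
  by (simp add: dv_def E_def blinfun_compose.rep_eq bounded_linear_Blinfun_apply[OF bounded_linear_swp] sum_2 sa)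
 hence dE: "divergence (\<lambda>x. swp (phi (swp x))) x = divergence phi (swp x)" for x
  using divergence_C1w[OF E] D(4) by simp
 have "(\<lambda>x. swp (phi (swp x))) \<in> test_fields"
  by (rule test_fieldsI[OF E, of R]) (use D in \<open>auto simp: vec_eq_iff forall_2\<close>)
 from per_leD[OF p this] show "(LINT x:swp ` A|lborel. divergence phi x) <= p"
  using A phi by (subst integral_swp_image) (auto simp: dE)
qed

section \<open>Translations and homotheties\<close>

definition aff :: "real^2 => real => real^2 => real^2" where "aff v c x = v + c *\<^sub>R x"

lemma aff_image_vimage: "0 < c ==> aff v c ` A = (\<lambda>x. (x - v) /\<^sub>R c) -` A"
 unfolding aff_def by (auto simp: image_iff intro!: bexI[of _ "(_ - v) /\<^sub>R c"])

lemma inj_aff: "0 < c ==> inj (aff v c)" by (auto simp: aff_def inj_on_def)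

lemma borel_aff_image: "A \<in> sets borel ==> 0 < c ==> aff v c ` A \<in> sets borel"
 unfolding aff_image_vimage by (rule measurable_sets_borel[where M=borel]) (auto intro: borel_measurable_continuous_onI continuous_intros)

lemma integral_aff_image:
 fixes f :: "real^2 => real" assumes [measurable]: "f \<in> borel_measurable borel" "A \<in> sets borel" and c: "0 < c"
 shows "(LINT x:aff v c`A|lborel. f x) = c^2 * (LINT x:A|lborel. f (aff v c x))"
proof -
 have m[measurable]: "aff v c \<in> borel_measurable borel" unfolding aff_def by measurable
 have [measurable]: "aff v c ` A \<in> sets borel" using assms by (intro borel_aff_image)
 have "(LINT x:aff v c`A|lborel. f x) = (LINT x|density (distr lborel borel (aff v c)) (\<lambda>_. ennreal (c^2)). ind (aff v c ` A) x * f x)"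
  using lborel_affine[of c v] c by (simp add: set_lebesgue_integral_def aff_def[abs_def])
 also have "... = (LINT x|distr lborel borel (aff v c). c^2 *\<^sub>R (ind (aff v c ` A) x * f x))"
  by (subst integral_density) auto
 also have "... = (LINT x|lborel. c^2 *\<^sub>R (ind (aff v c ` A) (aff v c x) * f (aff v c x)))"
  by (subst integral_distr) auto
 also have "... = c^2 * (LINT x:A|lborel. f (aff v c x))"
  using inj_aff[OF c, of v] by (simp add: set_lebesgue_integral_def indicator_def inj_image_mem_iff)
 finally show ?thesis .
qed

lemma emeasure_aff_image:
 assumes A: "A \<in> sets borel" and c: "0 < c"
 shows "emeasure lborel (aff v c ` A) = ennreal (c^2) * emeasure lborel A"
proof -
 have m[measurable]: "aff v c \<in> borel_measurable borel" unfolding aff_def by measurable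
 have B[measurable]: "aff v c ` A \<in> sets borel" using assms by (intro borel_aff_image)
 have "emeasure lborel (aff v c ` A) = emeasure (density (distr lborel borel (aff v c)) (\<lambda>_. ennreal (c^2))) (aff v c ` A)"
  using lborel_affine[of c v] c by (simp add: aff_def[abs_def])
 also have "... = ennreal (c^2) * emeasure lborel (aff v c -` (aff v c ` A))"
  by (simp add: emeasure_density nn_integral_cmult_indicator emeasure_distr)
 also have "aff v c -` (aff v c ` A) = A" using inj_aff[OF c, of v] by (simp add: inj_vimage_image_eq)
 finally show ?thesis .
qed

lemma measure_aff_image: "A \<in> sets borel ==> 0 < c ==> area (aff v c ` A) = c^2 * area A"
 by (simp add: measure_def emeasure_aff_image enn2real_mult)

text \<open>The composite of \<open>phi\<close> with the map is again a test field. Its divergence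
  gains a factor \<open>c\<close> and the change of variables a factor \<open>c^2\<close>, which
  leaves a net factor \<open>c\<close>.\<close>

lemma per_le_aff:
 assumes A: "A \<in> sets borel" and c: "0 < c" and p: "per_le A p" shows "per_le (aff v c ` A) (c * p)"
 unfolding per_le_def
proof
 fix phi assume phi: "phi \<in> test_fields"
 from test_fieldsE[OF phi] obtain D R where D: "C1w phi D" "0 < R" "\<And>x. R < norm x ==> phi x = 0" "\<And>x. norm (phi x) <= 1" 
  "\<And>x. divergence phi x = dv (D x)" by metis
 have "C1w (\<lambda>x. v + c *\<^sub>R x) (\<lambda>x. 0 + Blinfun ((*\<^sub>R) c))"
  by (intro C1w_add C1w_const C1w_linear bounded_linear_scaleR_right)
 hence 1: "C1w (aff v c) (\<lambda>x. Blinfun ((*\<^sub>R) c))"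
  by (simp add: aff_def[abs_def])
 have E: "C1w (\<lambda>x. phi (aff v c x)) (\<lambda>x. D (aff v c x) o\<^sub>L Blinfun ((*\<^sub>R) c))"
  by (rule C1w_compose[OF D(1) 1])
 have dE: "divergence (\<lambda>x. phi (aff v c x)) x = c * divergence phi (aff v c x)" for x
  unfolding divergence_C1w[OF E] D(5) 
  by (simp add: dv_def blinfun_compose.rep_eq bounded_linear_Blinfun_apply bounded_linear_scaleR_right blinfun.bilinear_simps sum_distrib_left)
 have "(\<lambda>x. phi (aff v c x)) \<in> test_fields"
 proof (rule test_fieldsI[OF E, of "(R + norm v) / c"])
  fix x :: "real^2" assume "(R + norm v) / c < norm x"
  hence "R + norm v < norm (c *\<^sub>R x)" using c by (simp add: field_simps)
  also have "norm (c *\<^sub>R x) <= norm (aff v c x) + norm v" using norm_triangle_ineq4[of "aff v c x" v] by (simp add: aff_def)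
  finally show "phi (aff v c x) = 0" using D by auto
 qed (use D in auto)
 from per_leD[OF p this] have "(LINT x:A|lborel. c * divergence phi (aff v c x)) <= p" unfolding dE .
 hence "c * (LINT x:A|lborel. divergence phi (aff v c x)) <= p" by simp
 hence "c * (c * (LINT x:A|lborel. divergence phi (aff v c x))) <= c * p" using c by simp
 thus "(LINT x:aff v c ` A|lborel. divergence phi x) <= c * p"
  using A phi c by (subst integral_aff_image) (auto simp: power2_eq_square)
qed

lemma perimeter_aff:
 assumes A: "A \<in> sets borel" and c: "0 < c" shows "perimeter (aff v c ` A) = ereal c * perimeter A"
proof -
 have le: "perimeter (aff v c ` B) <= ereal c * perimeter B" if "B \<in> sets borel" "0 < c" for B v and c :: real
 proof (cases "perimeter B")
  case (real p)
  thus ?thesis using per_le_aff[OF that, of p v] by (simp add: perimeter_le_iff flip: perimeter_le_iff)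
 next
  case PInf thus ?thesis using that by simp
 next
  case MInf thus ?thesis using perimeter_nonneg[of B] by simp
 qed
 \<comment> \<open>The reverse inequality is \<open>le\<close> applied to the inverse map.\<close>
 have inv: "aff (- (v /\<^sub>R c)) (1/c) ` (aff v c ` A) = A"
  using c by (auto simp: aff_def image_image algebra_simps divide_inverse)
 have "perimeter A <= ereal (1/c) * perimeter (aff v c ` A)"
  using le[of "aff v c ` A" "1/c" "- (v /\<^sub>R c)"] c borel_aff_image[OF A c] by (simp add: inv)
 hence "ereal c * perimeter A <= ereal c * (ereal (1/c) * perimeter (aff v c ` A))"
  using c by (intro ereal_mult_left_mono) auto
 also have "... = perimeter (aff v c ` A)" using c by (simp add: mult.assoc[symmetric] one_ereal_def[symmetric])
 finally show ?thesis using le[OF A c] by (simp add: antisym)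
qed

lemma perimeter_cong_AE:
 assumes "A \<in> sets borel" "B \<in> sets borel" "sym_diff A B \<in> null_sets lborel"
 shows "perimeter A = perimeter B"
proof -
 have "(LINT x:A|lborel. f x) = (LINT x:B|lborel. f x)" if [measurable]: "f \<in> borel_measurable borel" for f :: "real^2 => real"
  unfolding set_lebesgue_integral_def
 proof (rule integral_cong_AE)
  show "AE x in lborel. ind A x *\<^sub>R f x = ind B x *\<^sub>R f x"
   using AE_not_in[OF assms(3)] by eventually_elim (auto simp: indicator_def)
 qed (use assms in measurable)
 thus ?thesis unfolding perimeter_def by (intro SUP_cong) auto
qed

section \<open>Cutting along level sets\<close>

lemma antiderivative_ex:
 fixes f :: "real => real" assumes "continuous_on UNIV f"
 obtains F where "\<And>x. (F has_real_derivative f x) (at x)"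
proof -
 have "\<exists>F. \<forall>x::real. -\<infinity> < ereal x \<longrightarrow> ereal x < \<infinity> \<longrightarrow> (F has_vector_derivative f x) (at x)"
  using assms by (intro einterval_antiderivative) (auto simp: continuous_on_eq_continuous_at)
 thus thesis using that by (auto simp: has_real_derivative_iff_has_vector_derivative)
qed

text \<open>A linear ramp of the shorter width (b - a) / (1 + \<eta>) is averaged over a window of
  the remaining width \<sigma>. Averaging makes it C^1, and the slope exceeds that of the plain ramp
  only by the factor 1 + \<eta>.\<close>

lemma C1_cut:
 fixes a b \<eta> :: real assumes "a < b" "0 < \<eta>"
 obtains H h where "\<And>t. (H has_real_derivative h t) (at t)" "continuous_on UNIV h"
  "\<And>t. t <= a ==> H t = 1" "\<And>t. b <= t ==> H t = 0" "\<And>t. 0 <= H t" "\<And>t. H t <= 1"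
  "\<And>t. \<bar>h t\<bar> <= (1 + \<eta>) / (b - a)" "\<And>t. t <= a \<or> b <= t ==> h t = 0"
proof -
 define m where "m = (1 + \<eta>) / (b - a)"
 define \<sigma> where "\<sigma> = (b - a) * \<eta> / (1 + \<eta>)"
 define c where "c = (\<lambda>s. max 0 (min 1 ((b - s) * m)))"
 have m: "0 < m" and \<sigma>: "0 < \<sigma>" using assms by (auto simp: m_def \<sigma>_def)
 have am: "(b - a - \<sigma>) * m = 1" 
 proof -
  have "b - a - \<sigma> = (b - a) / (1 + \<eta>)" using assms by (simp add: \<sigma>_def field_simps)
  thus ?thesis using assms by (simp add: m_def)
 qed
 have cc: "continuous_on UNIV c" unfolding c_def by (intro continuous_intros)
 obtain F where F: "\<And>x. (F has_real_derivative c x) (at x)" using antiderivative_ex[OF cc] by metis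
 have c1: "c s = 1" if "s <= a + \<sigma>" for s
 proof -
  have "1 <= (b - s) * m" using that am m mult_right_mono[of "b-a-\<sigma>" "b-s" m] by simp
  thus ?thesis by (simp add: c_def)
 qed
 have c0: "c s = 0" if "b <= s" for s using that m mult_nonpos_nonneg[of "b - s" m] by (simp add: c_def min_def max_def)
 have cb: "0 <= c s" "c s <= 1" for s by (auto simp: c_def)
 have clip: "\<bar>c x - c y\<bar> <= m * \<bar>x - y\<bar>" for x y
 proof -
  have "\<bar>c x - c y\<bar> <= \<bar>(b - x) * m - (b - y) * m\<bar>" unfolding c_def by (auto simp: max_def min_def abs_if)
  also have "... = m * \<bar>x - y\<bar>" using m by (simp add: left_diff_distrib[symmetric] abs_mult)
  finally show ?thesis .
 qed
 define H where "H = (\<lambda>t. (F (t + \<sigma>) - F t) / \<sigma>)"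
 define h where "h = (\<lambda>t. (c (t + \<sigma>) - c t) / \<sigma>)"
 have mv: "\<exists>z. t < z \<and> z < t + \<sigma> \<and> H t = c z" for t
 proof -
  obtain z where "t < z" "z < t + \<sigma>" "F (t + \<sigma>) - F t = (t + \<sigma> - t) * c z"
   using MVT2[of t "t + \<sigma>" F c] F \<sigma> by auto
  thus ?thesis using \<sigma> by (auto simp: H_def)
 qed
 show thesis
 proof (rule that)
  show "(H has_real_derivative h t) (at t)" for t
  proof -
   have "((\<lambda>t. F (t + \<sigma>)) has_real_derivative c (t + \<sigma>)) (at t)"
    using DERIV_shift[of F "c (t+\<sigma>)" t \<sigma>] F by simp
   thus ?thesis unfolding H_def h_def by (intro DERIV_cdivide DERIV_diff F)
  qed
  show "continuous_on UNIV h" unfolding h_def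
   using \<sigma> by (intro continuous_intros continuous_on_compose2[OF cc]) auto
  show "H t = 1" if "t <= a" for t using mv[of t] c1 that by force
  show "H t = 0" if "b <= t" for t using mv[of t] c0 that by force
  show "0 <= H t" "H t <= 1" for t using mv[of t] cb by auto
  show "\<bar>h t\<bar> <= (1 + \<eta>) / (b - a)" for t
   using clip[of "t+\<sigma>" t] \<sigma> by (simp add: h_def m_def[symmetric] field_simps)
  show "h t = 0" if "t <= a \<or> b <= t" for t
   using that c1[of t] c1[of "t+\<sigma>"] c0[of t] c0[of "t+\<sigma>"] \<sigma> by (auto simp: h_def)
 qed
qed

text \<open>Convex combinations of values stay in the unit disk, so two test fields may be glued
  across the levels of \<open>d\<close>. The only new term in the divergence carries the derivative
  \<open>h\<close> of the cutoff.\<close>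

lemma test_field_convex_combination:
 assumes phi: "phi \<in> test_fields" and \<psi>: "\<psi> \<in> test_fields" and d: "C1w d Dd"
  and H: "\<And>t. (H has_real_derivative h t) (at t)" "continuous_on UNIV h" "\<And>t. 0 <= H t" "\<And>t. H t <= (1::real)"
 defines "\<Phi> \<equiv> \<lambda>x. \<psi> x + H (d x) *\<^sub>R (phi x - \<psi> x)"
 shows "\<Phi> \<in> test_fields" 
  "divergence \<Phi> x = divergence \<psi> x + H (d x) * (divergence phi x - divergence \<psi> x) + h (d x) * blinfun_apply (Dd x) (phi x - \<psi> x)"
proof -
 from test_fieldsE[OF phi] obtain D R where D: "C1w phi D" "\<And>x. R < norm x ==> phi x = 0" "\<And>x. norm (phi x) <= 1" 
  "\<And>x. divergence phi x = dv (D x)" by metis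
 from test_fieldsE[OF \<psi>] obtain E S where E: "C1w \<psi> E" "\<And>x. S < norm x ==> \<psi> x = 0" "\<And>x. norm (\<psi> x) <= 1" 
  "\<And>x. divergence \<psi> x = dv (E x)" by metis
 note G = C1w_add[OF E(1) C1w_scaleR[OF C1w_compose[OF C1w_real[OF H(1,2)] d] C1w_diff[OF D(1) E(1)]]]
 show "\<Phi> \<in> test_fields" unfolding \<Phi>_def
 proof (rule test_fieldsI[OF G, of "max R S"])
  fix x
  have "\<psi> x + H (d x) *\<^sub>R (phi x - \<psi> x) = (1 - H (d x)) *\<^sub>R \<psi> x + H (d x) *\<^sub>R phi x" by (simp add: algebra_simps)
  also have "norm ... <= (1 - H (d x)) * norm (\<psi> x) + H (d x) * norm (phi x)"
   using H(3,4)[of "d x"] by (intro order_trans[OF norm_triangle_ineq]) auto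
  also have "... <= (1 - H (d x)) * 1 + H (d x) * 1"
   using H(3,4)[of "d x"] D(3)[of x] E(3)[of x] by (intro add_mono mult_left_mono) auto
  finally show "norm (\<psi> x + H (d x) *\<^sub>R (phi x - \<psi> x)) <= 1" by simp
 qed (use D E in auto)
 show "divergence \<Phi> x = divergence \<psi> x + H (d x) * (divergence phi x - divergence \<psi> x) + h (d x) * blinfun_apply (Dd x) (phi x - \<psi> x)"
  unfolding \<Phi>_def divergence_C1w[OF G] D(4) E(4)
  by (simp add: dv_add dv_diff dv_scaleR dv_rank1 blinfun_compose.rep_eq)
qed

lemma borel_measurable_C1w[measurable_dest]: "C1w f D ==> f \<in> borel_measurable borel"
 by (rule borel_measurable_continuous_onI) (rule C1w_cont)

text \<open>At a minimiser of sqrt (m s) + c s the square root drops over [s, s + h] by at most c h;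
  factoring the difference of squares turns this into a bound on the drop of \<open>m\<close>. The
  assumption on \<open>sqrt (m s0)\<close> keeps the minimiser away from the right end of the
  interval.\<close>

lemma truncation_level:
 fixes m :: "real => real"
 assumes anti: "\<And>s t. s <= t ==> m t <= m s" and nn: "\<And>s. 0 <= m s"
  and rc: "\<And>s. (\<lambda>n. m (s + 1 / real (Suc n))) \<longlonglongrightarrow> m s"
  and c: "0 < c" "0 < T" "sqrt (m s0) < c * T"
 obtains s where "s0 <= s" "s < s0 + T" "\<And>h. 0 < h ==> s + h <= s0 + T ==> m s - m (s + h) <= 2 * c * sqrt (m s) * h"
proof -
 define f where "f = (\<lambda>s. sqrt (m s) + c * s)"
 define I where "I = Inf (f ` {s0..s0+T})"
 have ne: "f ` {s0..s0+T} \<noteq> {}" using c by auto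
 have bdd: "bdd_below (f ` {s0..s0+T})"
  using nn c by (intro bdd_belowI[of _ "c * s0"]) (auto simp: f_def intro!: add_increasing)
 have I: "I <= f s" if "s \<in> {s0..s0+T}" for s unfolding I_def using that bdd by (intro cInf_lower) auto
 have "\<exists>s\<in>{s0..s0+T}. f s < I + 1 / real (Suc n)" for n
  using cInf_lessD[OF ne, of "I + 1 / real (Suc n)"] unfolding I_def by force
 then obtain u where u: "\<And>n. u n \<in> {s0..s0+T}" "\<And>n. f (u n) < I + 1 / real (Suc n)" by metis
 obtain s r where s: "s \<in> {s0..s0+T}" "strict_mono r" "(u \<circ> r) \<longlonglongrightarrow> s"
  using compact_imp_seq_compact[OF compact_Icc[of s0 "s0+T"]] u(1) unfolding seq_compact_def by metis
 \<comment> \<open>\<open>m\<close> is continuous only from the right, so the values along a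
   minimising sequence need not converge to the value at its limit \<open>s\<close>. Monotonicity
   gives the bound with any s' > s under the root, and right continuity lets s' decrease to
   \<open>s\<close>.\<close>
 have le: "sqrt (m s') + c * s <= I" if "s < s'" for s'
 proof (rule LIMSEQ_le)
  show "(\<lambda>n. sqrt (m s') + c * (u \<circ> r) n) \<longlonglongrightarrow> sqrt (m s') + c * s" by (intro tendsto_intros s)
  show "(\<lambda>n. I + 1 / real (Suc (r n))) \<longlonglongrightarrow> I"
   using LIMSEQ_subseq_LIMSEQ[OF LIMSEQ_inverse_real_of_nat_add[of I] s(2)] by (simp add: o_def inverse_eq_divide)
  have "eventually (\<lambda>n. (u \<circ> r) n < s') sequentially" using s(3) that by (rule order_tendstoD)
  then obtain N where N: "\<And>n. n \<ge> N ==> (u \<circ> r) n < s'" by (auto simp: eventually_sequentially)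
  show "\<exists>N. \<forall>n\<ge>N. sqrt (m s') + c * (u \<circ> r) n <= I + 1 / real (Suc (r n))"
  proof (intro exI allI impI)
   fix n assume "n \<ge> N"
   hence "m s' <= m (u (r n))" using N[of n] by (intro anti) auto
   thus "sqrt (m s') + c * (u \<circ> r) n <= I + 1 / real (Suc (r n))"
    using u(2)[of "r n"] by (auto simp: f_def intro: order_trans[OF add_right_mono[OF real_sqrt_le_mono]])
  qed
 qed
 have fs: "f s <= I"
 proof (rule LIMSEQ_le_const2)
  show "(\<lambda>n. sqrt (m (s + 1 / real (Suc n))) + c * s) \<longlonglongrightarrow> f s"
   unfolding f_def by (intro tendsto_intros rc)
 qed (use le in auto)
 have "s \<noteq> s0 + T"
 proof
  assume "s = s0 + T"
  hence "c * (s0 + T) <= f s" using nn by (simp add: f_def)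
  moreover have "f s <= f s0" using fs I[of s0] c by auto
  ultimately show False using c by (simp add: f_def algebra_simps)
 qed
 moreover have "m s - m (s + h) <= 2 * c * sqrt (m s) * h" if h: "0 < h" "s + h <= s0 + T" for h
 proof -
  have "f s <= f (s + h)" using fs I[of "s+h"] h s by auto
  hence 1: "sqrt (m s) - sqrt (m (s+h)) <= c * h" by (simp add: f_def algebra_simps)
  have 2: "sqrt (m (s+h)) <= sqrt (m s)" using anti h by auto
  have "m s - m (s+h) = (sqrt (m s) - sqrt (m (s+h))) * (sqrt (m s) + sqrt (m (s+h)))"
   using nn by (simp add: algebra_simps flip: power2_eq_square)
  also have "... <= (c * h) * (2 * sqrt (m s))"
   using 1 2 nn c h by (intro mult_mono) auto
  finally show ?thesis by (simp add: algebra_simps)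
 qed
 ultimately show thesis using that s by auto
qed

text \<open>Gluing \<open>phi\<close> to \<psi> across the layer s < d < s + h costs at most
  \<open>M\<close> times the area of the layer over its thickness. So \<open>kap\<close> stands for
  the length of the cut, and the layer is shrunk to thickness 0.\<close>

lemma cut_at_level:
 assumes A[measurable]: "A \<in> sets borel" and p: "per_le A p" and d: "C1w d Dd" and d1: "\<And>x. norm (Dd x) <= 1"
  and phi: "phi \<in> test_fields" and \<psi>: "\<psi> \<in> test_fields" and M: "\<And>x. norm (phi x - \<psi> x) <= M" and h0: "0 < h0" "0 <= kap"
  and rate: "\<And>h. 0 < h ==> h <= h0 ==> emeasure lborel (A \<inter> {x. s < d x \<and> d x < s + h}) <= ennreal (kap * h)"
 shows "(LINT x:A \<inter> {x. d x <= s}|lborel. divergence phi x) + (LINT x:A \<inter> {x. s < d x}|lborel. divergence \<psi> x) <= p + kap * M"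
proof -
 have [measurable]: "d \<in> borel_measurable borel" using d by (rule borel_measurable_C1w)
 note [measurable] = divergence_borel[OF phi] divergence_borel[OF \<psi>]
 have M0: "0 <= M" using M norm_ge_zero order_trans by blast
 define \<delta> \<eta> where "\<delta> n = h0 / real (Suc n)" and "\<eta> n = inverse (real (Suc n))" for n
 have \<delta>: "0 < \<delta> n" "\<delta> n <= h0" "0 < \<eta> n" for n using h0 divide_left_mono[of 1 "real (Suc n)" h0] by (auto simp: \<delta>_def \<eta>_def)
 have \<delta>0: "\<delta> \<longlonglongrightarrow> 0" unfolding \<delta>_def using LIMSEQ_inverse_real_of_nat
  by (auto simp: divide_inverse intro!: tendsto_mult_right_zero)
 define cutoff where "cutoff n H h \<longleftrightarrow> (\<forall>t. (H has_real_derivative h t) (at t)) \<and> continuous_on UNIV h \<and>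
  (\<forall>t\<le>s. H t = 1) \<and> (\<forall>t\<ge>s + \<delta> n. H t = 0) \<and> (\<forall>t. 0 <= H t) \<and> (\<forall>t. H t <= 1) \<and>
  (\<forall>t. \<bar>h t\<bar> <= (1 + \<eta> n) / \<delta> n) \<and> (\<forall>t. t <= s \<or> s + \<delta> n <= t \<longrightarrow> h t = 0)" for n H h
 have "\<exists>H h. cutoff n H h" for n
 proof (rule C1_cut[of s "s + \<delta> n" "\<eta> n"])
  fix H h assume "\<And>t. (H has_real_derivative h t) (at t)" "continuous_on UNIV h"
   "\<And>t. t <= s ==> H t = 1" "\<And>t. s + \<delta> n <= t ==> H t = 0" "\<And>t. 0 <= H t" "\<And>t. H t <= 1"
   "\<And>t. \<bar>h t\<bar> <= (1 + \<eta> n) / (s + \<delta> n - s)" "\<And>t. t <= s \<or> s + \<delta> n <= t ==> h t = 0"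
  hence "cutoff n H h" by (simp add: cutoff_def)
  thus "\<exists>H h. cutoff n H h" by blast
 qed (use \<delta>[of n] in auto)
 then obtain H h where "\<And>n. cutoff n (H n) (h n)" by metis
 hence H: "\<And>n t. (H n has_real_derivative h n t) (at t)" "\<And>n. continuous_on UNIV (h n)"
  "\<And>n t. t <= s ==> H n t = 1" "\<And>n t. s + \<delta> n <= t ==> H n t = 0" "\<And>n t. 0 <= H n t" "\<And>n t. H n t <= 1"
  "\<And>n t. \<bar>h n t\<bar> <= (1 + \<eta> n) / \<delta> n" "\<And>n t. t <= s \<or> s + \<delta> n <= t ==> h n t = 0"
  unfolding cutoff_def by blast+
 have [measurable]: "H n \<in> borel_measurable borel" for n
  using H(1)[of n] by (auto intro!: borel_measurable_continuous_onI DERIV_isCont continuous_at_imp_continuous_on)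
 define G where "G n x = divergence \<psi> x + H n (d x) * (divergence phi x - divergence \<psi> x)" for n x
 define F where "F x = (if d x <= s then divergence phi x else divergence \<psi> x)" for x
 define w where "w x = ind A x * (\<bar>divergence \<psi> x\<bar> + \<bar>divergence phi x - divergence \<psi> x\<bar>)" for x
 have [measurable]: "G n \<in> borel_measurable borel" "F \<in> borel_measurable borel" for n unfolding G_def F_def by measurable
 have iw: "integ w"
  unfolding w_def using integrable_mult_indicator[of A lborel "\<lambda>x. \<bar>divergence \<psi> x\<bar> + \<bar>divergence phi x - divergence \<psi> x\<bar>"]
   divergence_integrable[OF phi] divergence_integrable[OF \<psi>] A by simp
 have Gw: "norm (ind A x *\<^sub>R G n x) <= w x" for n x
 proof -
  have "\<bar>H n (d x) * (divergence phi x - divergence \<psi> x)\<bar> <= 1 * \<bar>divergence phi x - divergence \<psi> x\<bar>"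
   unfolding abs_mult using H(5,6)[of n "d x"] by (intro mult_right_mono) auto
  thus ?thesis by (auto simp: G_def w_def indicator_def)
 qed
 have lim: "(\<lambda>n. LINT x:A|lborel. G n x) \<longlonglongrightarrow> (LINT x:A|lborel. F x)"
  unfolding set_lebesgue_integral_def
 proof (rule integral_dominated_convergence[OF _ _ iw])
  show "AE x in lborel. (\<lambda>n. ind A x *\<^sub>R G n x) \<longlonglongrightarrow> ind A x *\<^sub>R F x"
  proof (rule AE_I2)
   fix x
   show "(\<lambda>n. ind A x *\<^sub>R G n x) \<longlonglongrightarrow> ind A x *\<^sub>R F x"
   proof (cases "d x <= s")
    case True thus ?thesis using H(3) by (simp add: G_def F_def)
   next
    case False
    hence "eventually (\<lambda>n. \<delta> n < d x - s) sequentially" using order_tendstoD(2)[OF \<delta>0, of "d x - s"] by auto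
    hence "eventually (\<lambda>n. ind A x *\<^sub>R G n x = ind A x *\<^sub>R F x) sequentially"
     by eventually_elim (use H(4) False in \<open>auto simp: G_def F_def\<close>)
    thus ?thesis by (simp add: tendsto_eventually)
   qed
  qed
 qed (use Gw in auto)
 have le: "(LINT x:A|lborel. G n x) <= p + (1 + \<eta> n) * (kap * M)" for n
 proof -
  define K where "K = (1 + \<eta> n) / \<delta> n * M"
  have K0: "0 <= K" using \<delta>[of n] M0 by (simp add: K_def)
  note \<Phi> = test_field_convex_combination[OF phi \<psi> d H(1)[of n] H(2)[of n] H(5)[of n] H(6)[of n], folded G_def]
  define L where "L = A \<inter> {x. s < d x \<and> d x < s + \<delta> n}"
  have L[measurable]: "L \<in> sets borel" unfolding L_def by measurable
  have eL: "emeasure lborel L <= ennreal (kap * \<delta> n)" unfolding L_def by (rule rate[OF \<delta>(1,2)])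
  hence iL: "integ (\<lambda>x. K * ind L x)"
   by (intro integrable_mult_right integrable_real_indicator) (auto intro: le_less_trans)
  have mL: "area L <= kap * \<delta> n" using eL h0 \<delta>[of n] by (simp add: measure_def enn2real_leI)
  have pt: "ind A x *\<^sub>R G n x <= ind A x *\<^sub>R divergence (\<lambda>x. \<psi> x + H n (d x) *\<^sub>R (phi x - \<psi> x)) x + K * ind L x" for x
  proof (cases "x \<in> L")
   case True
   have "\<bar>blinfun_apply (Dd x) (phi x - \<psi> x)\<bar> <= norm (Dd x) * norm (phi x - \<psi> x)" using norm_blinfun[of "Dd x"] by simp
   also have "... <= 1 * M" using d1[of x] M by (intro mult_mono) auto
   finally have "\<bar>h n (d x) * blinfun_apply (Dd x) (phi x - \<psi> x)\<bar> <= K"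
    unfolding abs_mult K_def using H(7)[of n "d x"] by (intro mult_mono order_trans[OF abs_ge_zero H(7)]) auto
   thus ?thesis using True unfolding \<Phi>(2) by (auto simp: L_def)
  next
   case False
   hence "x \<in> A ==> h n (d x) = 0" using H(8) by (auto simp: L_def not_less)
   thus ?thesis using False unfolding \<Phi>(2) by (cases "x \<in> A") auto
  qed
  have si: "integ (\<lambda>x. ind A x *\<^sub>R divergence (\<lambda>x. \<psi> x + H n (d x) *\<^sub>R (phi x - \<psi> x)) x)"
   using divergence_set_integrable[OF \<Phi>(1) A] by (simp add: set_integrable_def)
  have "(LINT x:A|lborel. G n x) <= (LINT x|lborel. ind A x *\<^sub>R divergence (\<lambda>x. \<psi> x + H n (d x) *\<^sub>R (phi x - \<psi> x)) x + K * ind L x)"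
   unfolding set_lebesgue_integral_def
   by (intro integral_mono Bochner_Integration.integrable_add si iL pt int_bound[OF iw]) (use Gw in \<open>auto intro!: AE_I2 intro: order_trans[OF _ abs_ge_self]\<close>)
  also have "... = (LINT x:A|lborel. divergence (\<lambda>x. \<psi> x + H n (d x) *\<^sub>R (phi x - \<psi> x)) x) + K * area L"
   unfolding set_lebesgue_integral_def by (subst Bochner_Integration.integral_add[OF si iL]) simp
  also have "... <= p + K * (kap * \<delta> n)" by (intro add_mono per_leD[OF p \<Phi>(1)] mult_left_mono mL K0)
  also have "K * (kap * \<delta> n) = (1 + \<eta> n) * (kap * M)" using \<delta>(1)[of n] by (simp add: K_def)
  finally show ?thesis .
 qed
 have "(LINT x:A|lborel. F x) <= p + (1 + 0) * (kap * M)"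
 proof (rule LIMSEQ_le[OF lim])
  show "(\<lambda>n. p + (1 + \<eta> n) * (kap * M)) \<longlonglongrightarrow> p + (1 + 0) * (kap * M)"
   unfolding \<eta>_def by (intro tendsto_intros LIMSEQ_inverse_real_of_nat)
 qed (use le in auto)
 moreover have "(LINT x:A|lborel. F x) = (LINT x|lborel. ind (A \<inter> {x. d x <= s}) x *\<^sub>R divergence phi x + ind (A \<inter> {x. s < d x}) x *\<^sub>R divergence \<psi> x)"
  unfolding set_lebesgue_integral_def by (intro int_cong) (auto simp: indicator_def F_def)
 moreover have "... = (LINT x:A \<inter> {x. d x <= s}|lborel. divergence phi x) + (LINT x:A \<inter> {x. s < d x}|lborel. divergence \<psi> x)"
  unfolding set_lebesgue_integral_def using divergence_set_integrable[OF phi] divergence_set_integrable[OF \<psi>]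
  by (intro Bochner_Integration.integral_add) (auto simp: set_integrable_def)
 ultimately show ?thesis by simp
qed

text \<open>Cutting at a level \<open>s\<close> of \<open>d\<close> that minimises \<open>sqrt m + c s\<close>, where \<open>m s\<close> is the area beyond \<open>s\<close>,
 bounds the length of the cut by a multiple of \<open>c sqrt m\<close>, with no need for the coarea formula.\<close>

lemma truncation:
 assumes A[measurable]: "A \<in> sets borel" and fin: "finarea A" and p: "per_le A p"
  and d: "C1w d Dd" and d1: "\<And>x. norm (Dd x) <= 1"
  and c: "0 < c" "0 < T" "sqrt (area (A \<inter> {x. s0 < d x})) < c * T"
 obtains s where "s0 <= s" "s < s0 + T"
  "\<And>phi \<psi>. phi \<in> test_fields ==> \<psi> \<in> test_fields ==>
   (LINT x:A \<inter> {x. d x <= s}|lborel. divergence phi x) + (LINT x:A \<inter> {x. s < d x}|lborel. divergence \<psi> x)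
    <= p + 4 * c * sqrt (area (A \<inter> {x. s < d x}))"
proof -
 have [measurable]: "d \<in> borel_measurable borel" using d by (rule borel_measurable_C1w)
 define m where "m = (\<lambda>s. area (A \<inter> {x. s < d x}))"
 have finB: "finarea B" if "B \<subseteq> A" for B by (rule le_less_trans[OF emeasure_mono fin]) (use that A in auto)
 have rc: "(\<lambda>n. m (s + 1 / real (Suc n))) \<longlonglongrightarrow> m s" for s
 proof -
  have un: "(\<Union>n. A \<inter> {x. s + 1 / real (Suc n) < d x}) = A \<inter> {x. s < d x}"
  proof (auto)
   fix x assume "s < d x"
   then obtain n where "inverse (real (Suc n)) < d x - s" using reals_Archimedean[of "d x - s"] by auto
   thus "\<exists>n. s + 1 / (1 + real n) < d x" by (auto simp: inverse_eq_divide add.commute intro!: exI[of _ n])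
  next
   fix x n assume "s + 1 / (1 + real n) < d x"
   moreover have "0 < 1 / (1 + real n)" by simp
   ultimately show "s < d x" by linarith
  qed
  have "(\<lambda>n. m (s + 1 / real (Suc n))) \<longlonglongrightarrow> area (\<Union>n. A \<inter> {x. s + 1 / real (Suc n) < d x})"
   unfolding m_def
  proof (rule Lim_measure_incseq)
   show "incseq (\<lambda>n. A \<inter> {x. s + 1 / real (Suc n) < d x})"
   proof (intro incseq_SucI subsetI)
    fix n x assume x: "x \<in> A \<inter> {x. s + 1 / real (Suc n) < d x}"
    have "1 / real (Suc (Suc n)) <= 1 / real (Suc n)" by (simp add: frac_le)
    with x show "x \<in> A \<inter> {x. s + 1 / real (Suc (Suc n)) < d x}" by auto
   qed
  qed (use finB in \<open>auto simp: less_top\<close>)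
  thus ?thesis unfolding un m_def .
 qed
 have anti: "m t <= m s" if "s <= t" for s t
  unfolding m_def using that by (intro measure_mono_fmeasurable) (auto intro!: fmeasurableI finB)
 obtain s where s: "s0 <= s" "s < s0 + T" "\<And>h. 0 < h ==> s + h <= s0 + T ==> m s - m (s + h) <= 2 * c * sqrt (m s) * h"
  using truncation_level[of m c T s0] anti rc c by (auto simp: m_def)
 show thesis
 proof (rule that[OF s(1,2)])
  fix phi \<psi> assume phi: "phi \<in> test_fields" and \<psi>: "\<psi> \<in> test_fields"
  \<comment> \<open>The chosen level gives the rate kap = 2 c sqrt (m s), and two fields of norm at
    most 1 differ by at most 2; the product is 4 c sqrt (m s).\<close>
  have "(LINT x:A \<inter> {x. d x <= s}|lborel. divergence phi x) + (LINT x:A \<inter> {x. s < d x}|lborel. divergence \<psi> x) <= p + 2 * c * sqrt (m s) * 2"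
  proof (rule cut_at_level[OF A p d d1 phi \<psi>, of 2 "s0 + T - s"])
   show "norm (phi x - \<psi> x) <= 2" for x using phi \<psi> norm_triangle_ineq4[of "phi x" "\<psi> x"] unfolding test_fields_iff by (smt (verit))
   fix h :: real assume h: "0 < h" "h <= s0 + T - s"
   let ?L = "A \<inter> {x. s < d x} - A \<inter> {x. s + h < d x}"
   have "area ?L = m s - m (s + h)"
    unfolding m_def by (subst measure_Diff) (use h finB[of "A \<inter> {x. s < d x}"] in \<open>auto simp: less_top\<close>)
   hence "emeasure lborel ?L <= ennreal (2 * c * sqrt (m s) * h)"
    using s(3)[of h] h finB[of ?L] by (subst emeasure_eq_ennreal_measure) (auto simp: less_top intro!: ennreal_leI)
   moreover have "emeasure lborel (A \<inter> {x. s < d x \<and> d x < s + h}) <= emeasure lborel ?L" by (rule emeasure_mono) auto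
   ultimately show "emeasure lborel (A \<inter> {x. s < d x \<and> d x < s + h}) <= ennreal (2 * c * sqrt (m s) * h)" by (rule order_trans[rotated])
  qed (use c s in \<open>auto simp: m_def\<close>)
  thus "(LINT x:A \<inter> {x. d x <= s}|lborel. divergence phi x) + (LINT x:A \<inter> {x. s < d x}|lborel. divergence \<psi> x)
    <= p + 4 * c * sqrt (area (A \<inter> {x. s < d x}))" by (simp add: m_def)
 qed
qed

section \<open>Mollification\<close>

text \<open>A C^1 kernel is smooth enough, since test fields are only C^1. \<open>dbump\<close> is
  its gradient and \<open>bumpZ\<close> its mass.\<close>

definition bump :: "real^2 => real" where "bump z = (max 0 (1 - z \<bullet> z))^2"
definition dbump :: "real^2 => real^2" where "dbump z = (-4 * max 0 (1 - z \<bullet> z)) *\<^sub>R z"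
definition bumpZ :: real where "bumpZ = (LINT z|lborel. bump z)"

lemma continuous_on_bump[continuous_intros]: "continuous_on S bump" "continuous_on S dbump"
 unfolding bump_def dbump_def by (intro continuous_intros)+

lemma bump_borel[measurable]: "bump \<in> borel_measurable borel" "dbump \<in> borel_measurable borel"
 by (auto intro: borel_measurable_continuous_onI continuous_intros)

lemma bump_nonneg: "0 <= bump z" by (simp add: bump_def)

lemma bump_le1: "bump z <= 1"
 using power_mono[of "max 0 (1 - z \<bullet> z)" 1 2] by (simp add: bump_def)

lemma inner_ge_1: "1 <= norm z ==> 1 <= z \<bullet> z" for z :: "'a::real_inner"
 using power_mono[of 1 "norm z" 2] by (simp add: dot_square_norm)

lemma bump_zero: "1 <= norm z ==> bump z = 0" and dbump_zero: "1 <= norm z ==> dbump z = 0"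
 using inner_ge_1[of z] by (auto simp: bump_def dbump_def max_def)

lemma bump_uminus[simp]: "bump (- z) = bump z" "dbump (- z) = - dbump z" by (auto simp: bump_def dbump_def)

lemma norm_dbump: "norm (dbump z) <= 4"
proof (cases "1 <= norm z")
 case False
 have "\<bar>max 0 (1 - z \<bullet> z)\<bar> * norm z <= 1 * 1" using False by (intro mult_mono) auto
 thus ?thesis by (simp add: dbump_def abs_mult)
qed (simp add: dbump_zero)

lemma square_cut_taylor: "\<bar>(max 0 (1 - s))^2 - (max 0 (1 - t))^2 - (- 2 * max 0 (1 - t)) * (s - t)\<bar> <= (s - t)^2" for s t :: real
proof -
 consider "s <= 1" "t <= 1" | "s > 1" "t > 1" | "s > 1" "t <= 1" | "s <= 1" "t > 1" by linarith
 thus ?thesis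
 proof cases
  case 1
  have "(1 - s)^2 - (1 - t)^2 - (- 2 * (1 - t)) * (s - t) = (s - t)^2" by (simp add: power2_eq_square algebra_simps)
  thus ?thesis using 1 by simp
 next
  case 2 thus ?thesis by simp
 next
  case 3
  have "\<bar>(1 - t) * (2 * s - 1 - t)\<bar> <= (s - t)^2"
  proof -
   have "0 <= (1 - t) * (2 * s - 1 - t)" using 3 by (intro mult_nonneg_nonneg) auto
   moreover have "(s - t)^2 - (1 - t) * (2 * s - 1 - t) = (s - 1)^2" by (simp add: power2_eq_square algebra_simps)
   ultimately show ?thesis using zero_le_power2[of "s - 1"] by linarith
  qed
  moreover have "- ((1 - t)^2) - (- 2 * (1 - t)) * (s - t) = (1 - t) * (2 * s - 1 - t)"
   by (simp add: power2_eq_square algebra_simps)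
  ultimately show ?thesis using 3 by simp
 next
  case 4
  have "(1 - s)^2 <= (t - s)^2" using 4 by (intro power_mono) auto
  thus ?thesis using 4 by (simp add: power2_commute[of t s])
 qed
qed

text \<open>The quadratic remainder has a constant independent of \<open>z\<close>. Integrated
  against an integrable function it shows at once that a convolution is differentiable, with no
  separate argument for differentiation under the integral.\<close>

lemma bump_taylor:
 assumes h: "norm h <= 1" shows "\<bar>bump (z + h) - bump z - dbump z \<bullet> h\<bar> <= 27 * (norm h)^2"
proof (cases "norm z \<ge> 2")
 case True
 have "norm z <= norm (z + h) + norm h" using norm_triangle_ineq4[of "z+h" h] by simp
 thus ?thesis using True h by (simp add: bump_zero dbump_zero)
next
 case False
 define t where "t = z \<bullet> z"
 define s where "s = (z + h) \<bullet> (z + h)"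
 have st: "s - t = 2 * (z \<bullet> h) + (norm h)^2"
  by (simp add: s_def t_def inner_add_left inner_add_right inner_commute power2_norm_eq_inner)
 have "\<bar>z \<bullet> h\<bar> <= norm z * norm h" by (rule Cauchy_Schwarz_ineq2)
 also have "... <= 2 * norm h" using False by (intro mult_right_mono) auto
 finally have zh: "\<bar>z \<bullet> h\<bar> <= 2 * norm h" .
 have hh: "(norm h)^2 <= norm h" using h by (simp add: power2_eq_square mult_left_le)
 \<comment> \<open>The constant 27 is 25 + 2: \<open>square_cut_taylor\<close> contributes (s - t)^2
   <= 25 |h|^2, and the summand |h|^2 of s - t, which is not linear in h, contributes at most 2
   |h|^2.\<close>
 have "\<bar>s - t\<bar> <= 5 * norm h" using zh hh st zero_le_power2[of "norm h"] by linarith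
 hence "\<bar>s - t\<bar>^2 <= (5 * norm h)^2" by (intro power_mono) auto
 hence 1: "(s - t)^2 <= 25 * (norm h)^2" by (simp add: power_mult_distrib)
 have 2: "\<bar>2 * max 0 (1 - t)\<bar> <= 2" by (auto simp: t_def)
 have eq: "bump (z + h) - bump z - dbump z \<bullet> h = ((max 0 (1 - s))^2 - (max 0 (1 - t))^2 - (- 2 * max 0 (1 - t)) * (s - t)) - (2 * max 0 (1 - t)) * (norm h)^2"
 proof -
  have "bump (z + h) = (max 0 (1 - s))^2" "bump z = (max 0 (1 - t))^2" "dbump z \<bullet> h = - 4 * max 0 (1 - t) * (z \<bullet> h)"
   by (simp_all only: bump_def dbump_def s_def t_def inner_scaleR_left)
  thus ?thesis unfolding st by (simp add: algebra_simps)
 qed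
 have "\<bar>(2 * max 0 (1 - t)) * (norm h)^2\<bar> <= 2 * (norm h)^2"
  unfolding abs_mult using 2 by (intro mult_mono) auto
 thus ?thesis unfolding eq using square_cut_taylor[of s t] 1 by linarith
qed

lemma integral_reflect:
 fixes f :: "real^2 => 'b::{banach,second_countable_topology}" assumes [measurable]: "f \<in> borel_measurable borel"
 shows "(LINT y|lborel. f (x - y)) = (LINT y|lborel. f y)" "integ (\<lambda>y. f (x - y)) \<longleftrightarrow> integ f"
proof -
 have l: "distr lborel borel (\<lambda>y. x - y) = (lborel :: (real^2) measure)"
  using lborel_affine[of "-1" x] by (simp add: density_1)
 show "(LINT y|lborel. f (x - y)) = (LINT y|lborel. f y)" 
  by (subst (2) l[symmetric]) (simp add: integral_distr)
 show "integ (\<lambda>y. f (x - y)) \<longleftrightarrow> integ f"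
  by (subst (2) l[symmetric]) (simp add: integrable_distr_eq)
qed

lemma nn_integral_reflect:
 fixes x :: "real^2" assumes [measurable]: "g \<in> borel_measurable borel" 
 shows "(\<integral>\<^sup>+y. g (x - y) \<partial>lborel) = (\<integral>\<^sup>+y. g y \<partial>lborel)"
proof -
 have l: "distr lborel borel (\<lambda>y. x - y) = (lborel :: (real^2) measure)"
  using lborel_affine[of "-1" x] by (simp add: density_1)
 show ?thesis by (subst (2) l[symmetric]) (simp add: nn_integral_distr)
qed

lemma nn_integral_shift:
 fixes x :: "real^2" assumes [measurable]: "g \<in> borel_measurable borel" 
 shows "(\<integral>\<^sup>+y. g (x + y) \<partial>lborel) = (\<integral>\<^sup>+y. g y \<partial>lborel)"
proof -
 have l: "distr lborel borel (\<lambda>y. x + y) = (lborel :: (real^2) measure)"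
  using lborel_affine[of "1" x] by (simp add: density_1)
 show ?thesis by (subst (2) l[symmetric]) (simp add: nn_integral_distr)
qed

lemma integrable_compact_support:
 fixes f :: "'a::euclidean_space => 'b::{banach,second_countable_topology}"
 assumes [measurable]: "f \<in> borel_measurable borel" and "\<And>x. norm (f x) <= B" "\<And>x. R < norm x ==> f x = 0"
 shows "integ f"
proof (rule integrableI_bounded_set[where A="cball 0 R" and B=B])
 show "finarea (cball (0::'a) R)" using emeasure_lborel_cball_finite by auto
qed (use assms in auto)

lemma integrable_bump: "integ bump"
 by (rule integrable_compact_support[where B=1 and R=1]) (use bump_nonneg bump_le1 bump_zero in auto)

lemma bumpZ_pos: "0 < bumpZ"
proof -
 have "bump z \<ge> (9/16) * ind (ball 0 (1/2)) z" for z
 proof (cases "norm z < 1/2")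
  case True
  hence "(norm z)^2 <= (1/2)^2" by (intro power_mono) auto
  hence "3/4 <= 1 - z \<bullet> z" by (simp add: dot_square_norm power2_eq_square)
  hence "(3/4)^2 <= (max 0 (1 - z \<bullet> z))^2" by (intro power_mono) auto
  thus ?thesis using True by (simp add: bump_def power2_eq_square)
 qed (auto simp: bump_nonneg indicator_def)
 hence "(LINT z|lborel. (9/16) * ind (ball (0::real^2) (1/2)) z) <= bumpZ"
  unfolding bumpZ_def using emeasure_lborel_ball_finite by (intro integral_mono integrable_bump integrable_mult_right integrable_real_indicator) auto
 moreover have "(LINT z|lborel. (9/16) * ind (ball (0::real^2) (1/2)) z) = (9/16) * (pi * (1/2)^2)"
  by (simp add: content_ball unit_ball_vol_2)
 moreover have "(9/16) * (pi * (1/2)^2) > (0::real)" by simp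
 ultimately show ?thesis by linarith
qed

definition mk :: "real => real^2 => real" where "mk eps x = bump (x /\<^sub>R eps) / (bumpZ * eps^2)"
definition mg :: "real => real^2 => real^2" where "mg eps x = dbump (x /\<^sub>R eps) /\<^sub>R (bumpZ * eps^3)"

lemma mk_borel[measurable]: "mk eps \<in> borel_measurable borel" "mg eps \<in> borel_measurable borel"
 unfolding mk_def[abs_def] mg_def[abs_def] by measurable

lemma continuous_on_mk: "continuous_on S (mk eps)" "continuous_on S (mg eps)"
 unfolding mk_def[abs_def] mg_def[abs_def] divide_inverse
 by (intro continuous_intros continuous_on_compose2[OF continuous_on_bump(1)[of UNIV]] continuous_on_compose2[OF continuous_on_bump(2)[of UNIV]]; auto)+

lemma mk_uminus: "mk eps (- x) = mk eps x" "mg eps (- x) = - mg eps x" by (auto simp: mk_def mg_def)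

lemma mk_commute: "mk eps (x - y) = mk eps (y - x)" "mg eps (x - y) = - mg eps (y - x)"
 using mk_uminus[of eps "y - x"] by auto

lemma mk_nonneg: "0 <= mk eps x" using bumpZ_pos by (simp add: mk_def bump_nonneg)

lemma mk_zero: "0 < eps ==> eps <= norm x ==> mk eps x = 0" "0 < eps ==> eps <= norm x ==> mg eps x = 0"
 by (auto simp: mk_def mg_def bump_zero dbump_zero field_simps)

lemma mk_bound: "0 < eps ==> \<bar>mk eps x\<bar> <= 1 / (bumpZ * eps^2)" 
 using bumpZ_pos bump_le1 bump_nonneg by (simp add: mk_def abs_mult divide_right_mono)

lemma mg_bound: "0 < eps ==> norm (mg eps x) <= 4 / (bumpZ * eps^3)" 
 using bumpZ_pos norm_dbump[of "x /\<^sub>R eps"] by (simp add: mg_def field_simps)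

lemma mk_integrable: "0 < eps ==> integ (mk eps)"
 by (rule integrable_compact_support[where B="1 / (bumpZ * eps^2)" and R=eps]) (use mk_bound mk_zero in auto)

lemma mk_integral: assumes "0 < eps" shows "(LINT x|lborel. mk eps x) = 1"
proof -
 have "(LINT x:aff 0 eps ` UNIV|lborel. mk eps x) = eps^2 * (LINT x:UNIV|lborel. mk eps (aff 0 eps x))"
  using assms by (intro integral_aff_image) auto
 moreover have "aff 0 eps ` UNIV = UNIV" using assms by (auto simp: aff_image_vimage)
 moreover have "(LINT x|lborel. mk eps (aff 0 eps x)) = bumpZ / (bumpZ * eps^2)"
  using assms by (simp add: mk_def aff_def bumpZ_def)
 ultimately show ?thesis using assms bumpZ_pos by (simp add: set_lebesgue_integral_def)
qed

lemma mk_taylor: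
 assumes e: "0 < eps" and h: "norm h <= eps"
 shows "\<bar>mk eps (x + h) - mk eps x - mg eps x \<bullet> h\<bar> <= 27 / (bumpZ * eps^4) * (norm h)^2"
proof -
 have "\<bar>bump (x /\<^sub>R eps + h /\<^sub>R eps) - bump (x /\<^sub>R eps) - dbump (x /\<^sub>R eps) \<bullet> (h /\<^sub>R eps)\<bar> <= 27 * (norm (h /\<^sub>R eps))^2"
  using e h by (intro bump_taylor) (auto simp: field_simps)
 hence "\<bar>bump (x /\<^sub>R eps + h /\<^sub>R eps) - bump (x /\<^sub>R eps) - dbump (x /\<^sub>R eps) \<bullet> (h /\<^sub>R eps)\<bar> / (bumpZ * eps^2) <= 27 * (norm (h /\<^sub>R eps))^2 / (bumpZ * eps^2)"
  using bumpZ_pos e by (intro divide_right_mono) auto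
 moreover have "27 * (norm (h /\<^sub>R eps))^2 / (bumpZ * eps^2) = 27 / (bumpZ * eps^4) * (norm h)^2"
  using e bumpZ_pos by (simp add: field_simps power_mult_distrib power2_eq_square power4_eq_xxxx)
 moreover have "\<bar>bump (x /\<^sub>R eps + h /\<^sub>R eps) - bump (x /\<^sub>R eps) - dbump (x /\<^sub>R eps) \<bullet> (h /\<^sub>R eps)\<bar> / (bumpZ * eps^2) = \<bar>mk eps (x + h) - mk eps x - mg eps x \<bullet> h\<bar>"
 proof -
  have K: "0 < bumpZ * eps^2" using bumpZ_pos e by simp
  have eq: "(bump (x /\<^sub>R eps + h /\<^sub>R eps) - bump (x /\<^sub>R eps) - dbump (x /\<^sub>R eps) \<bullet> (h /\<^sub>R eps)) / (bumpZ * eps^2) = mk eps (x + h) - mk eps x - mg eps x \<bullet> h"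
   using e by (simp add: mk_def mg_def scaleR_add_right diff_divide_distrib divide_inverse power2_eq_square power3_eq_cube algebra_simps)
  show ?thesis by (simp only: eq[symmetric] abs_divide abs_of_pos[OF K])
 qed
 ultimately show ?thesis by simp
qed

section \<open>Convolutions and their gradients\<close>

definition conv :: "real => (real^2 => real) => real^2 => real" where
 "conv eps f x = (LINT y|lborel. f y * mk eps (x - y))"
definition cgrad :: "real => (real^2 => real) => real^2 => real^2" where
 "cgrad eps f x = (LINT y|lborel. f y *\<^sub>R mg eps (x - y))"

lemma conv_integrable:
 assumes f: "integ f" and e: "0 < eps"
 shows "integ (\<lambda>y. f y * mk eps (x - y))" "integ (\<lambda>y. f y *\<^sub>R mg eps (x - y))"
proof -
 have [measurable]: "f \<in> borel_measurable borel" using f by auto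
 have bm: "norm (f y * mk eps (x - y)) <= norm (f y * (1 / (bumpZ * eps^2)))" for y
  unfolding real_norm_def abs_mult using order_trans[OF mk_bound[OF e, of "x - y"] abs_ge_self] by (intro mult_left_mono) auto
 have bg: "norm (f y *\<^sub>R mg eps (x - y)) <= norm (f y * (4 / (bumpZ * eps^3)))" for y
  unfolding norm_scaleR real_norm_def abs_mult using order_trans[OF mg_bound[OF e, of "x - y"] abs_ge_self] by (intro mult_left_mono) auto
 show "integ (\<lambda>y. f y * mk eps (x - y))"
  by (rule int_bound[where f="\<lambda>y. f y * (1 / (bumpZ * eps^2))"])
   (use f bm in auto)
 show "integ (\<lambda>y. f y *\<^sub>R mg eps (x - y))"
  by (rule int_bound[where f="\<lambda>y. f y * (4 / (bumpZ * eps^3))"])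
   (use f bg in auto)
qed

lemma has_derivative_quadratic_bound:
 fixes f :: "'a::real_normed_vector => 'b::real_normed_vector"
 assumes L: "bounded_linear L" and d: "0 < \<delta>" and b: "\<And>h. norm h <= \<delta> ==> norm (f (x + h) - f x - L h) <= C * (norm h)^2"
 shows "(f has_derivative L) (at x)"
 unfolding has_derivative_at
proof (intro conjI L)
 show "(\<lambda>h. norm (f (x + h) - f x - L h) / norm h) \<midarrow>0\<rightarrow> 0"
 proof (rule tendsto_sandwich[where f="\<lambda>_. 0" and h="\<lambda>h. C * norm h"])
  show "eventually (\<lambda>h. norm (f (x + h) - f x - L h) / norm h <= C * norm h) (at 0)"
   unfolding eventually_at using d b
   by (intro exI[of _ \<delta>]) (auto simp: field_simps power2_eq_square dist_norm)
  show "(\<lambda>h. C * norm h) \<midarrow>0\<rightarrow> 0" by (intro tendsto_eq_intros) auto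
 qed auto
qed

lemma continuous_on_cgrad:
 assumes f: "integ f" and e: "0 < eps" shows "continuous_on S (cgrad eps f)"
proof -
 have [measurable]: "f \<in> borel_measurable borel" using f by auto
 have "isCont (cgrad eps f) x" for x
  unfolding continuous_at_sequentially o_def
 proof (intro allI impI)
  fix u assume u: "u \<longlonglongrightarrow> x"
  show "(\<lambda>n. cgrad eps f (u n)) \<longlonglongrightarrow> cgrad eps f x"
   unfolding cgrad_def
  proof (rule integral_dominated_convergence[where w="\<lambda>y. \<bar>f y\<bar> * (4 / (bumpZ * eps^3))"])
   show "AE y in lborel. (\<lambda>n. f y *\<^sub>R mg eps (u n - y)) \<longlonglongrightarrow> f y *\<^sub>R mg eps (x - y)"
    using u by (intro AE_I2 tendsto_intros continuous_on_tendsto_compose[OF continuous_on_mk(2)[of UNIV]]) auto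
   show "AE y in lborel. norm (f y *\<^sub>R mg eps (u n - y)) <= \<bar>f y\<bar> * (4 / (bumpZ * eps^3))" for n
    using mult_left_mono[OF mg_bound[OF e] abs_ge_zero] by (intro AE_I2) simp
  qed (use f in auto)
 qed
 thus ?thesis by (simp add: continuous_at_imp_continuous_on)
qed

lemma C1w_conv:
 assumes f: "integ f" and e: "0 < eps"
 shows "C1w (conv eps f) (\<lambda>x. blinfun_inner_right (cgrad eps f x))"
 unfolding C1w_def
proof (intro conjI allI)
 have [measurable]: "f \<in> borel_measurable borel" using f by auto
 note i = conv_integrable[OF f e]
 show "continuous_on UNIV (\<lambda>x. blinfun_inner_right (cgrad eps f x))"
  by (intro bounded_linear.continuous_on[OF bounded_linear_blinfun_inner_right] continuous_on_cgrad f e)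
 fix x
 show "(conv eps f has_derivative blinfun_apply (blinfun_inner_right (cgrad eps f x))) (at x)"
 proof (rule has_derivative_quadratic_bound[OF blinfun.bounded_linear_right e])
  fix h :: "real^2" assume h: "norm h <= eps"
  have eq: "conv eps f (x + h) - conv eps f x - cgrad eps f x \<bullet> h = (LINT y|lborel. f y * (mk eps (x - y + h) - mk eps (x - y) - mg eps (x - y) \<bullet> h))"
  proof -
   have "conv eps f (x + h) - conv eps f x - cgrad eps f x \<bullet> h = (LINT y|lborel. f y * mk eps (x + h - y)) - (LINT y|lborel. f y * mk eps (x - y)) - (LINT y|lborel. (f y *\<^sub>R mg eps (x - y)) \<bullet> h)"
    unfolding conv_def cgrad_def using integral_inner_left[OF i(2)[of x], of h] by simp
   also have "... = (LINT y|lborel. f y * mk eps (x + h - y) - f y * mk eps (x - y) - (f y *\<^sub>R mg eps (x - y)) \<bullet> h)"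
    using i(1)[of "x+h"] i(1)[of x] integrable_inner_left[OF i(2)[of x], of h] by (subst Bochner_Integration.integral_diff; (subst Bochner_Integration.integral_diff)?) auto
   also have "... = (LINT y|lborel. f y * (mk eps (x - y + h) - mk eps (x - y) - mg eps (x - y) \<bullet> h))"
    by (intro int_cong) (auto simp: algebra_simps)
   finally show ?thesis .
  qed
  define K where "K = 27 / (bumpZ * eps^4) * (norm h)^2"
  have K: "\<bar>f y * (mk eps (x - y + h) - mk eps (x - y) - mg eps (x - y) \<bullet> h)\<bar> <= \<bar>f y\<bar> * K" for y
   unfolding abs_mult K_def by (intro mult_left_mono mk_taylor[OF e h]) auto
  have "norm (conv eps f (x + h) - conv eps f x - cgrad eps f x \<bullet> h) <= (LINT y|lborel. \<bar>f y\<bar> * K)"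
   unfolding eq
  proof (rule Bochner_Integration.integral_norm_bound_integral)
   show "integ (\<lambda>y. f y * (mk eps (x - y + h) - mk eps (x - y) - mg eps (x - y) \<bullet> h))"
    by (rule int_bound[where f="\<lambda>y. \<bar>f y\<bar> * K"])
     (use f order_trans[OF K abs_ge_self] in auto)
  qed (use f K in auto)
  thus "norm (conv eps f (x + h) - conv eps f x - blinfun_apply (blinfun_inner_right (cgrad eps f x)) h) <= (LINT y|lborel. \<bar>f y\<bar>) * (27 / (bumpZ * eps^4)) * (norm h)^2"
   by (simp add: K_def mult.assoc)
 qed
qed

lemma integrable_pair_mult:
 fixes f g :: "real^2 => real"
 assumes f: "integ f" and g: "integ g"
 shows "integrable (lborel \<Otimes>\<^sub>M lborel) (\<lambda>p. f (fst p) * g (snd p))"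
proof -
 have [measurable]: "f \<in> borel_measurable borel" "g \<in> borel_measurable borel" using f g by auto
 show ?thesis
 proof (rule lborel_pair.Fubini_integrable)
  show "integ (\<lambda>x. LINT y|lborel. norm (f (fst (x, y)) * g (snd (x, y))))"
   using f by (simp add: abs_mult)
  show "AE x in lborel. integ (\<lambda>y. f (fst (x, y)) * g (snd (x, y)))"
   using g by simp
 qed measurable
qed

text \<open>The mollified field \<open>phi * mk\<close> is a test field, and by the oddness of \<open>mg\<close> the flux of its divergence
 through \<open>A\<close> is the pairing of \<open>- phi\<close> with the gradient of the mollified indicator.\<close>

lemma mollified_pairing:
 fixes phi :: "real^2 => real^2"
 assumes A[measurable]: "A \<in> sets borel" and fin: "finarea A" and p: "per_le A p" and e: "0 < eps"
  and phi: "continuous_on UNIV phi" "\<And>x. norm (phi x) <= 1" "\<And>x. R < norm x ==> phi x = 0"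
 shows "(LINT y|lborel. - (phi y \<bullet> cgrad eps (ind A) y)) <= p"
proof -
 have [measurable]: "phi \<in> borel_measurable borel" using phi(1) by (rule borel_measurable_continuous_onI)
 define f where "f = (\<lambda>i x. phi x $ i)"
 have if1: "integ (f i)" for i unfolding f_def
  by (rule integrable_compact_support[where B=1 and R=R])
   (use phi order_trans[OF component_le_norm_cart phi(2)] in auto)
 have iA: "integ (ind A :: real^2 => real)" using A fin by auto
 define \<Phi> where "\<Phi> = (\<lambda>x. conv eps (f 1) x *\<^sub>R axis 1 (1::real) + conv eps (f 2) x *\<^sub>R axis (2::2) 1)"
 note C = C1w_add[OF C1w_scaleR[OF C1w_conv[OF if1 e] C1w_const] C1w_scaleR[OF C1w_conv[OF if1 e] C1w_const], of 1 "axis 1 1" 2 "axis 2 1"]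
 have iphi: "integ phi"
  by (rule integrable_compact_support[where B=1 and R=R]) (use phi in auto)
 have imk: "integ (\<lambda>y. mk eps (x - y) *\<^sub>R phi y)" for x
 proof (rule int_bound[where f="\<lambda>y. mk eps (x - y)"])
  show "integ (\<lambda>y. mk eps (x - y))" using mk_integrable[OF e] by (subst integral_reflect) auto
  show "AE y in lborel. norm (mk eps (x - y) *\<^sub>R phi y) <= norm (mk eps (x - y))"
   using phi(2) by (intro AE_I2) (simp add: mult_left_le)
 qed measurable
 have \<Phi>eq: "\<Phi> x = (LINT y|lborel. mk eps (x - y) *\<^sub>R phi y)" for x
 proof -
  have "(LINT y|lborel. mk eps (x - y) *\<^sub>R phi y) $ i = conv eps (f i) x" for i
   using integral_inner_left[OF imk[of x], of "axis i 1"]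
   by (simp add: inner_axis conv_def f_def mult.commute)
  thus ?thesis by (simp add: vec_eq_iff forall_2 \<Phi>_def axis_def)
 qed
 have n1: "norm (\<Phi> x) <= 1" for x
 proof -
  have "norm (\<Phi> x) <= (LINT y|lborel. mk eps (x - y))"
   unfolding \<Phi>eq
  proof (rule Bochner_Integration.integral_norm_bound_integral[OF imk])
   show "integ (\<lambda>y. mk eps (x - y))" using mk_integrable[OF e] by (subst integral_reflect) auto
   show "norm (mk eps (x - y) *\<^sub>R phi y) <= mk eps (x - y)" for y
    using phi(2) mk_nonneg by (simp add: mult_left_le)
  qed
  also have "... = 1" using mk_integral[OF e] by (subst integral_reflect) auto
  finally show ?thesis .
 qed
 have T: "\<Phi> \<in> test_fields"
 proof (rule test_fieldsI[where R="R + eps"])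
  fix x :: "real^2" assume x: "R + eps < norm x"
  have z: "mk eps (x - y) *\<^sub>R phi y = 0" for y
  proof (cases "R < norm y")
   case False
   hence "eps <= norm (x - y)" using x norm_triangle_ineq2[of x y] by linarith
   thus ?thesis using mk_zero[OF e] by simp
  qed (simp add: phi)
  show "\<Phi> x = 0" unfolding \<Phi>eq z by simp
 qed (use C n1 in \<open>auto simp: \<Phi>_def\<close>)
 have ax: "(LINT y|lborel. f i y *\<^sub>R mg eps (x - y)) $ i = (LINT y|lborel. phi y $ i * mg eps (x - y) $ i)" for i x
  using integral_inner_left[OF conv_integrable(2)[OF if1[of i] e, of x], of "axis i 1"] by (simp add: inner_axis f_def)
 have iax: "integ (\<lambda>y. phi y $ i * mg eps (x - y) $ i)" for i x
  using integrable_inner_left[OF conv_integrable(2)[OF if1[of i] e, of x], of "axis i 1"] by (simp add: inner_axis f_def)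
 have div: "divergence \<Phi> x = (LINT y|lborel. phi y \<bullet> mg eps (x - y))" for x
 proof -
  have "divergence \<Phi> x = cgrad eps (f 1) x $ 1 + cgrad eps (f 2) x $ 2"
   unfolding \<Phi>_def divergence_C1w[OF C] by (simp add: dv_add dv_scaleR dv_rank1 inner_axis)
  also have "... = (LINT y|lborel. phi y \<bullet> mg eps (x - y))"
   unfolding cgrad_def ax inner_vec2 using iax by simp
  finally show ?thesis .
 qed
 have int2: "integrable (lborel \<Otimes>\<^sub>M lborel) (\<lambda>(x, y). ind A x * (phi y \<bullet> mg eps (x - y)))"
 proof (rule int_bound[OF integrable_pair_mult[OF iA, of "\<lambda>y. norm (phi y) * (4 / (bumpZ * eps^3))"]])
  show "integ (\<lambda>y. norm (phi y) * (4 / (bumpZ * eps^3)))" using iphi by simp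
  show "AE q in lborel \<Otimes>\<^sub>M lborel. norm (case q of (x, y) => ind A x * (phi y \<bullet> mg eps (x - y)))
   <= norm (ind A (fst q) * (norm (phi (snd q)) * (4 / (bumpZ * eps ^ 3))))"
  proof (rule AE_I2, clarify)
   fix x y :: "real^2"
   have "norm (phi y \<bullet> mg eps (x - y)) <= norm (phi y) * norm (mg eps (x - y))" using Cauchy_Schwarz_ineq2 by simp
   also have "... <= norm (phi y) * (4 / (bumpZ * eps^3))" by (intro mult_left_mono mg_bound e) auto
   finally have "\<bar>phi y \<bullet> mg eps (x - y)\<bar> <= \<bar>norm (phi y) * (4 / (bumpZ * eps^3))\<bar>" unfolding real_norm_def by (rule order_trans[OF _ abs_ge_self])
   thus "norm (ind A x * (phi y \<bullet> mg eps (x - y))) <= norm (ind A (fst (x, y)) * (norm (phi (snd (x, y))) * (4 / (bumpZ * eps ^ 3))))"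
    by (simp add: abs_mult indicator_def)
  qed
 qed measurable
 have "p \<ge> (LINT x:A|lborel. divergence \<Phi> x)" by (rule per_leD[OF p T])
 also have "(LINT x:A|lborel. divergence \<Phi> x) = (LINT x|lborel. LINT y|lborel. ind A x * (phi y \<bullet> mg eps (x - y)))"
  by (simp add: set_lebesgue_integral_def div)
 also have "... = (LINT y|lborel. LINT x|lborel. ind A x * (phi y \<bullet> mg eps (x - y)))"
  by (rule lborel_pair.Fubini_integral[OF int2, symmetric])
 also have "... = (LINT y|lborel. - (phi y \<bullet> cgrad eps (ind A) y))"
 proof (rule int_cong[OF refl])
  fix y
  have "(LINT x|lborel. ind A x * (phi y \<bullet> mg eps (x - y))) = (LINT x|lborel. phi y \<bullet> (- (ind A x *\<^sub>R mg eps (y - x))))"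
   by (intro int_cong refl) (simp add: mk_commute(2)[of eps _ y])
  also have "... = phi y \<bullet> (LINT x|lborel. - (ind A x *\<^sub>R mg eps (y - x)))"
   using conv_integrable(2)[OF iA e, of y] by (intro integral_inner_right) auto
  finally show "(LINT x|lborel. ind A x * (phi y \<bullet> mg eps (x - y))) = - (phi y \<bullet> cgrad eps (ind A) y)"
   by (simp add: cgrad_def)
 qed
 finally show ?thesis by simp
qed

text \<open>The ideal field for \<open>mollified_pairing\<close> is - G / |G| with G the gradient of
  the mollified indicator. It need not be continuous or compactly supported, so |G| is regularised
  and a cutoff \<open>cu R\<close> is inserted; both are removed by limits.\<close>

lemma gradient_bound:
 assumes A[measurable]: "A \<in> sets borel" and fin: "finarea A" and p: "per_le A p" and e: "0 < eps"
 shows "(\<integral>\<^sup>+x. ennreal (norm (cgrad eps (ind A) x)) \<partial>lborel) <= ennreal p"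
proof -
 define G where "G = cgrad eps (ind A)"
 have iA: "integ (ind A :: real^2 => real)" using A fin by auto
 have cG: "continuous_on S G" for S unfolding G_def by (rule continuous_on_cgrad[OF iA e])
 have [measurable]: "G \<in> borel_measurable borel" by (intro borel_measurable_continuous_onI cG)
 define cu where "cu = (\<lambda>R (x::real^2). max 0 (min 1 (R + 1 - norm x)))"
 have cu: "0 <= cu R x" "cu R x <= 1" "R + 1 < norm x ==> cu R x = 0" for R x by (auto simp: cu_def)
 have ccu: "continuous_on S (cu R)" for S R unfolding cu_def by (intro continuous_intros)
 have [measurable]: "cu R \<in> borel_measurable borel" for R by (intro borel_measurable_continuous_onI ccu)
 have icu: "integ (\<lambda>x. cu R x * norm (G x))" for R
 proof -
  obtain B where B: "\<And>x. norm x <= R + 1 ==> norm (G x) <= B"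
   using compact_imp_bounded[OF compact_continuous_image[OF cG compact_cball[of 0 "R+1"]]]
   by (auto simp: bounded_iff) (metis mem_cball_0)
  show ?thesis
  proof (rule integrable_compact_support[where B="\<bar>B\<bar>" and R="R+1"])
   show "norm (cu R x * norm (G x)) <= \<bar>B\<bar>" for x
   proof (cases "norm x <= R + 1")
    case True
    have "cu R x * norm (G x) <= 1 * \<bar>B\<bar>" using cu[of R x] B[OF True] by (intro mult_mono) auto
    thus ?thesis using cu(1)[of R x] by (simp add: abs_mult)
   qed (use cu in auto)
  qed (use cu in auto)
 qed
 have icu1: "integ (cu R)" for R
  by (rule integrable_compact_support[where B=1 and R="R+1"]) (use cu in auto)
 have step: "(LINT x|lborel. cu R x * norm (G x)) <= p + k * (LINT x|lborel. cu R x)" if k: "0 < k" for R k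
 proof -
  define s where "s = (\<lambda>x. sqrt ((norm (G x))^2 + k^2))"
  have s: "norm (G x) <= s x" "0 < s x" "s x <= norm (G x) + k" for x
   using k sqrt_sum_squares_le_sum[of "norm (G x)" k] by (auto simp: s_def real_le_rsqrt add_nonneg_pos intro: real_sqrt_gt_zero)
  define phi where "phi = (\<lambda>x. - ((cu R x / s x) *\<^sub>R G x))"
  have cs: "continuous_on UNIV s" unfolding s_def by (intro continuous_intros cG)
  have "(LINT y|lborel. - (phi y \<bullet> G y)) <= p" unfolding G_def
  proof (rule mollified_pairing[OF A fin p e])
   show "continuous_on UNIV phi" unfolding phi_def using s(2) by (intro continuous_intros ccu cG cs) (auto simp: less_imp_neq[THEN not_sym])
   show "norm (phi x) <= 1" for x
   proof -
    have "norm (phi x) = cu R x * (norm (G x) / s x)" using cu[of R x] s(2)[of x] by (simp add: phi_def)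
    also have "... <= 1 * 1" using cu[of R x] s[of x] by (intro mult_mono) auto
    finally show ?thesis by simp
   qed
   show "phi x = 0" if "R + 1 < norm x" for x using that cu(3) by (simp add: phi_def)
  qed
  moreover have "- (phi y \<bullet> G y) = cu R y * ((norm (G y))^2 / s y)" for y
   by (simp add: phi_def power2_norm_eq_inner)
  ultimately have 1: "(LINT y|lborel. cu R y * ((norm (G y))^2 / s y)) <= p" by simp
  \<comment> \<open>Replacing |G| by sqrt (|G|^2 + k^2) in the denominator loses at most k
    pointwise, hence at most k times the finite integral of the cutoff.\<close>
  have lo: "norm (G y) - k <= (norm (G y))^2 / s y" for y
  proof -
   have "(norm (G y) - k) * s y <= (norm (G y))^2"
   proof (cases "norm (G y) <= k")
    case True thus ?thesis using s(2)[of y] by (intro order_trans[OF mult_nonpos_nonneg]) auto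
   next
    case False
    hence "(norm (G y) - k) * s y <= (norm (G y) - k) * (norm (G y) + k)" using s by (intro mult_left_mono) auto
    also have "... <= (norm (G y))^2" by (simp add: power2_eq_square algebra_simps)
    finally show ?thesis .
   qed
   thus ?thesis using s(2)[of y] by (simp add: pos_le_divide_eq)
  qed
  have hi: "(norm (G y))^2 / s y <= norm (G y)" for y
   using s[of y] mult_left_mono[of "norm (G y)" "s y" "norm (G y)"] by (simp add: pos_divide_le_eq power2_eq_square)
  have [measurable]: "s \<in> borel_measurable borel" unfolding s_def by measurable
  have i2: "integ (\<lambda>y. cu R y * ((norm (G y))^2 / s y))"
  proof (rule int_bound[OF icu[of R]])
   show "AE y in lborel. norm (cu R y * ((norm (G y))^2 / s y)) <= norm (cu R y * norm (G y))"
   proof (rule AE_I2)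
    fix y
    have "0 <= (norm (G y))^2 / s y" using s(2)[of y] by simp
    thus "norm (cu R y * ((norm (G y))^2 / s y)) <= norm (cu R y * norm (G y))"
     unfolding real_norm_def abs_mult using hi[of y] by (intro mult_left_mono) auto
   qed
  qed measurable
  have "(LINT x|lborel. cu R x * norm (G x)) - k * (LINT x|lborel. cu R x) = (LINT x|lborel. cu R x * norm (G x) - k * cu R x)"
   using icu icu1 by simp
  also have "... <= (LINT y|lborel. cu R y * ((norm (G y))^2 / s y))"
  proof (rule integral_mono[OF _ i2])
   show "integ (\<lambda>x. cu R x * norm (G x) - k * cu R x)" using icu icu1 by auto
   show "cu R x * norm (G x) - k * cu R x <= cu R x * ((norm (G x))^2 / s x)" for x
    using mult_left_mono[OF lo[of x] cu(1)[of R x]] by (simp add: algebra_simps)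
  qed
  finally show ?thesis using 1 by linarith
 qed
 have step2: "(LINT x|lborel. cu R x * norm (G x)) <= p" for R
 proof (rule field_le_epsilon)
  fix d :: real assume d: "0 < d"
  have "0 <= (LINT x|lborel. cu R x)" using cu by (intro Bochner_Integration.integral_nonneg) auto
  hence "d / ((LINT x|lborel. cu R x) + 1) * (LINT x|lborel. cu R x) <= d" using d by (simp add: field_simps)
  thus "(LINT x|lborel. cu R x * norm (G x)) <= p + d"
   using step[of "d / ((LINT x|lborel. cu R x) + 1)" R] d \<open>0 <= (LINT x|lborel. cu R x)\<close> by (smt (verit) divide_pos_pos)
 qed
 have "(\<integral>\<^sup>+x. ennreal (norm (G x)) \<partial>lborel) = (\<integral>\<^sup>+x. (SUP n::nat. ennreal (cu (real n) x * norm (G x))) \<partial>lborel)"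
 proof (rule nn_integral_cong)
  fix x :: "real^2"
  obtain n :: nat where n: "norm x <= real n" using real_arch_simple by blast
  hence "cu (real n) x = 1" by (simp add: cu_def)
  thus "ennreal (norm (G x)) = (SUP n::nat. ennreal (cu (real n) x * norm (G x)))"
   by (intro antisym SUP_upper2[of n] SUP_least ennreal_leI) (use cu in \<open>auto simp: mult_left_le_one_le\<close>)
 qed
 also have "... = (SUP n::nat. (\<integral>\<^sup>+x. ennreal (cu (real n) x * norm (G x)) \<partial>lborel))"
 proof (rule nn_integral_monotone_convergence_SUP)
  show "incseq (\<lambda>n x. ennreal (cu (real n) x * norm (G x)))"
   by (intro incseq_SucI le_funI ennreal_leI mult_right_mono) (auto simp: cu_def)
 qed measurable
 also have "... <= ennreal p"
 proof (rule SUP_least)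
  fix n :: nat
  have "(\<integral>\<^sup>+x. ennreal (cu (real n) x * norm (G x)) \<partial>lborel) = ennreal (LINT x|lborel. cu (real n) x * norm (G x))"
   using cu icu by (intro nn_integral_eq_integral) auto
  thus "(\<integral>\<^sup>+x. ennreal (cu (real n) x * norm (G x)) \<partial>lborel) <= ennreal p" using step2 by (simp add: ennreal_leI)
 qed
 finally show ?thesis by (simp add: G_def)
qed

section \<open>Mollified indicators and their L1 distance to the set\<close>

abbreviation mu :: "real => (real^2) set => real^2 => real" where "mu eps A \<equiv> conv eps (ind A)"
abbreviation gmu :: "real => (real^2) set => real^2 => real^2" where "gmu eps A \<equiv> cgrad eps (ind A)"

lemma integ_bounded:
 assumes "A \<in> sets borel" "A \<subseteq> cball 0 R"
 shows "integ (ind A :: 'a::euclidean_space => real)"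
 by (rule integrable_compact_support[where B=1 and R=R]) (use assms in \<open>auto simp: indicator_def\<close>)

lemma finarea_bounded:
 assumes "A \<subseteq> cball 0 R" shows "finarea (A::'a::euclidean_space set)"
 by (rule le_less_trans[OF emeasure_mono[OF assms]]) (use emeasure_lborel_cball_finite in auto)

lemma mu_range:
 assumes "integ (ind A :: real^2 => real)" "0 < eps"
 shows "0 <= mu eps A x" "mu eps A x <= 1"
proof -
 show "0 <= mu eps A x" unfolding conv_def using mk_nonneg by (intro Bochner_Integration.integral_nonneg) auto
 have "mu eps A x <= (LINT y|lborel. mk eps (x - y))" unfolding conv_def
 proof (rule integral_mono[OF conv_integrable(1)[OF assms]])
  show "integ (\<lambda>y. mk eps (x - y))" using mk_integrable[OF assms(2)] by (subst integral_reflect) auto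
 qed (use mk_nonneg in \<open>auto simp: indicator_def\<close>)
 also have "... = 1" using mk_integral[OF assms(2)] by (subst integral_reflect) auto
 finally show "mu eps A x <= 1" .
qed

lemma mu_zero:
 assumes "0 < eps" "\<And>y. y \<in> A ==> eps <= norm (x - y)"
 shows "mu eps A x = 0" "gmu eps A x = 0"
proof -
 have z: "ind A y * mk eps (x - y) = 0" for y using assms mk_zero(1)[of eps "x - y"] by (auto simp: indicator_def)
 show "mu eps A x = 0" unfolding conv_def z by simp
 have z: "ind A y *\<^sub>R mg eps (x - y) = 0" for y using assms mk_zero(2)[of eps "x - y"] by (auto simp: indicator_def)
 show "gmu eps A x = 0" unfolding cgrad_def z by simp
qed

lemma mu_zero_outside:
 assumes "0 < eps" "A \<subseteq> cball 0 R" "R + eps <= norm x"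
 shows "mu eps A x = 0" "gmu eps A x = 0"
proof -
 have "eps <= norm (x - y)" if "y \<in> A" for y
 proof -
  have "norm y <= R" using that assms(2) by auto
  thus ?thesis using assms(3) norm_triangle_ineq2[of x y] by linarith
 qed
 thus "mu eps A x = 0" "gmu eps A x = 0" using mu_zero[OF assms(1)] by auto
qed

lemma mu_borel: "integ (ind A :: real^2 => real) ==> 0 < eps ==> mu eps A \<in> borel_measurable borel"
 by (rule borel_measurable_C1w[OF C1w_conv])

lemma gmu_borel: "integ (ind A :: real^2 => real) ==> 0 < eps ==> gmu eps A \<in> borel_measurable borel"
 by (rule borel_measurable_continuous_onI[OF continuous_on_cgrad])

lemma mu_integral:
 assumes A[measurable]: "A \<in> sets borel" and fin: "finarea A" and e: "0 < eps"
 shows "integ (mu eps A)" "(LINT x|lborel. mu eps A x) = area A"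
proof -
 have iA: "integ (ind A :: real^2 => real)" using A fin by auto
 have [measurable]: "mu eps A \<in> borel_measurable borel" by (rule mu_borel[OF iA e])
 have "(\<integral>\<^sup>+x. ennreal (mu eps A x) \<partial>lborel) = (\<integral>\<^sup>+x. \<integral>\<^sup>+y. ennreal (ind A y * mk eps (x - y)) \<partial>lborel \<partial>lborel)"
  unfolding conv_def using mk_nonneg
  by (intro nn_integral_cong nn_integral_eq_integral[symmetric] conv_integrable[OF iA e]) auto
 also have "... = (\<integral>\<^sup>+y. \<integral>\<^sup>+x. ennreal (ind A y * mk eps (x - y)) \<partial>lborel \<partial>lborel)"
  by (rule lborel_pair.Fubini'[symmetric]) measurable
 also have "... = (\<integral>\<^sup>+y. ind A y \<partial>lborel)"
 proof (rule nn_integral_cong)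
  fix y
  have "(\<integral>\<^sup>+x. ennreal (ind A y * mk eps (x - y)) \<partial>lborel) = (\<integral>\<^sup>+x. ind A y * ennreal (mk eps (y - x)) \<partial>lborel)"
   by (intro nn_integral_cong) (auto simp: mk_commute(1)[of eps _ y] indicator_def)
  also have "... = ind A y * (\<integral>\<^sup>+x. ennreal (mk eps (y - x)) \<partial>lborel)" by (intro nn_integral_cmult) measurable
  also have "(\<integral>\<^sup>+x. ennreal (mk eps (y - x)) \<partial>lborel) = (\<integral>\<^sup>+x. ennreal (mk eps x) \<partial>lborel)" 
   by (rule nn_integral_reflect) measurable
  also have "... = 1" using mk_integral[OF e] mk_nonneg mk_integrable[OF e] by (subst nn_integral_eq_integral) auto
  finally show "(\<integral>\<^sup>+x. ennreal (ind A y * mk eps (x - y)) \<partial>lborel) = ind A y" by simp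
 qed
 also have "... = emeasure lborel A" by simp
 finally have *: "(\<integral>\<^sup>+x. ennreal (mu eps A x) \<partial>lborel) = ennreal (area A)"
  using fin by (simp add: emeasure_eq_ennreal_measure top.not_eq_extremum)
 show i: "integ (mu eps A)"
  by (rule integrableI_nonneg) (use * mu_range[OF iA e] in auto)
 show "(LINT x|lborel. mu eps A x) = area A"
  using nn_integral_eq_integral[OF i] mu_range[OF iA e] * by (simp add: Bochner_Integration.integral_nonneg)
qed

lemma mu_diff:
 assumes "integ (ind A :: real^2 => real)" "integ (ind K :: real^2 => real)" "K \<subseteq> A" "0 < eps"
 shows "mu eps A x - mu eps K x = mu eps (A - K) x"
proof -
 have "mu eps A x - mu eps K x = (LINT y|lborel. ind A y * mk eps (x - y) - ind K y * mk eps (x - y))"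
  unfolding conv_def using conv_integrable(1)[OF assms(1,4)] conv_integrable(1)[OF assms(2,4)] by simp
 also have "... = mu eps (A - K) x" unfolding conv_def
  using assms(3) by (intro int_cong) (auto simp: indicator_def)
 finally show ?thesis .
qed

text \<open>For a small scale the mollified indicator is 0 off a thin neighbourhood of
  \<open>K\<close>, whose area tends to that of \<open>K\<close>. Conservation of mass turns this
  one-sided control into an L1 bound.\<close>

lemma mu_L1_compact:
 assumes K: "compact (K::(real^2) set)" and d: "0 < \<delta>"
 obtains eps0 where "0 < eps0" "\<And>eps. 0 < eps ==> eps < eps0 ==> (LINT x|lborel. \<bar>mu eps K x - ind K x\<bar>) < \<delta>"
proof (cases "K = {}")
 case True
 thus thesis using that[of 1] d by (simp add: conv_def)
next
 case False
 have Kb[measurable]: "K \<in> sets borel" using K by (simp add: borel_closed compact_imp_closed)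
 obtain R where R: "K \<subseteq> cball 0 R" using compact_imp_bounded[OF K] bounded_subset_ballD[of K 0] ball_subset_cball by (metis order_trans)
 have iK: "integ (ind K :: real^2 => real)" by (rule integ_bounded[OF Kb R])
 have finK: "finarea K" by (rule finarea_bounded[OF R])
 define N where "N = (\<lambda>n::nat. {x. infdist x K <= 1 / real (Suc n)})"
 have Nb[measurable]: "N n \<in> sets borel" for n unfolding N_def
  by (intro borel_closed closed_Collect_le continuous_intros)
 have NR: "N n \<subseteq> cball 0 (R + 1)" for n
 proof
  fix x assume "x \<in> N n"
  hence "infdist x K <= 1 / real (Suc n)" by (simp add: N_def)
  also have "... <= 1" by simp
  finally have "infdist x K <= 1" .
  moreover obtain y where "y \<in> K" "infdist x K = dist x y"
   using infdist_attains_inf[OF compact_imp_closed[OF K] False] by metis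
  ultimately show "x \<in> cball 0 (R + 1)" using R norm_triangle_ineq2[of x y] by (force simp: dist_norm)
 qed
 have finN: "finarea (N n)" for n by (rule finarea_bounded[OF NR])
 have KN: "K \<subseteq> N n" for n by (auto simp: N_def)
 have Int: "(\<Inter>n. N n) = K"
 proof
  show "(\<Inter>n. N n) \<subseteq> K"
  proof
   fix x assume x: "x \<in> (\<Inter>n. N n)"
   have "infdist x K <= 0"
   proof (rule LIMSEQ_le_const[OF LIMSEQ_inverse_real_of_nat])
    show "\<exists>N. \<forall>n\<ge>N. infdist x K <= inverse (real (Suc n))" using x by (auto simp: N_def inverse_eq_divide)
   qed
   thus "x \<in> K" using in_closed_iff_infdist_zero[OF compact_imp_closed[OF K] False, of x] infdist_nonneg[of x K] by simp
  qed
 qed (use KN in auto)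
 have "(\<lambda>n. area (N n)) \<longlonglongrightarrow> area (\<Inter>n. N n)"
 proof (rule Lim_measure_decseq)
  show "decseq N"
  proof (intro decseq_SucI subsetI)
   fix n x assume "x \<in> N (Suc n)"
   moreover have "1 / real (Suc (Suc n)) <= 1 / real (Suc n)" by (simp add: frac_le)
   ultimately show "x \<in> N n" by (auto simp: N_def)
  qed
 qed (use finN in \<open>auto simp: less_top\<close>)
 hence "eventually (\<lambda>n. area (N n) < area K + \<delta> / 2) sequentially"
  unfolding Int using d by (intro order_tendstoD) auto
 then obtain n where n: "area (N n) < area K + \<delta> / 2" by (auto simp: eventually_sequentially)
 show thesis
 proof (rule that[of "1 / real (Suc n)"])
  fix eps assume e: "0 < eps" "eps < 1 / real (Suc n)"
  note m = mu_integral[OF Kb finK e(1)]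
  \<comment> \<open>The first bracket integrates to 0 because mollification preserves the area; only
    twice the area of \<open>N n - K\<close> is left.\<close>
  have pt: "\<bar>mu eps K x - ind K x\<bar> <= (ind K x - mu eps K x) + 2 * (ind (N n) x - ind K x)" for x
  proof (cases "x \<in> N n")
   case True thus ?thesis using KN[of n] mu_range[OF iK e(1), of x] by (auto simp: indicator_def)
  next
   case False
   have "mu eps K x = 0"
   proof (rule mu_zero[OF e(1)])
    fix y assume "y \<in> K"
    hence "infdist x K <= norm (x - y)" using infdist_le[of y K x] by (simp add: dist_norm)
    thus "eps <= norm (x - y)" using False e(2) by (simp add: N_def)
   qed
   thus ?thesis using False KN[of n] by (auto simp: indicator_def)
  qed
  have iN: "integ (ind (N n) :: real^2 => real)" by (rule integ_bounded[OF Nb NR])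
  have "(LINT x|lborel. \<bar>mu eps K x - ind K x\<bar>) <= (LINT x|lborel. (ind K x - mu eps K x) + 2 * (ind (N n) x - ind K x))"
   using pt m iK iN by (intro integral_mono) auto
  also have "... = (area K - area K) + 2 * (area (N n) - area K)"
   using m iK iN by simp
  also have "... < \<delta>" using n by simp
  finally show "(LINT x|lborel. \<bar>mu eps K x - ind K x\<bar>) < \<delta>" .
 qed simp
qed

text \<open>By inner regularity a compact set fills \<open>A\<close> up to area \<delta> / 4, and
  the mollification of the remainder has the same small mass as the remainder.\<close>

lemma mu_L1:
 assumes A[measurable]: "A \<in> sets borel" and R: "A \<subseteq> cball 0 R" and d: "0 < \<delta>"
 obtains eps0 where "0 < eps0" "\<And>eps. 0 < eps ==> eps < eps0 ==> (LINT x|lborel. \<bar>mu eps A x - ind A x\<bar>) < \<delta>"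
proof -
 have "A \<in> sets lebesgue" by simp
 then obtain K where K: "closed K" "K \<subseteq> A" "emeasure lebesgue (A - K) < ennreal (\<delta>/4)"
  by (rule sets_lebesgue_inner_closed[of A "\<delta>/4"]) (use d in \<open>simp_all\<close>)
 have cK: "compact K" using K R by (meson bounded_cball bounded_subset compact_eq_bounded_closed order_trans)
 have Kb[measurable]: "K \<in> sets borel" using K by simp
 have iA: "integ (ind A :: real^2 => real)" by (rule integ_bounded[OF A R])
 have KR: "K \<subseteq> cball 0 R" "A - K \<subseteq> cball 0 R" using K R by auto
 have iK: "integ (ind K :: real^2 => real)" by (rule integ_bounded[OF Kb KR(1)])
 have AK[measurable]: "A - K \<in> sets borel" by simp
 have finAK: "finarea (A - K)" by (rule finarea_bounded[OF KR(2)])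
 have "emeasure lborel (A - K) < ennreal (\<delta>/4)" using K(3) by simp
 hence mAK: "area (A - K) < \<delta>/4" 
  using finAK by (simp add: emeasure_eq_ennreal_measure less_top[symmetric] ennreal_less_iff)
 obtain eps0 where e0: "0 < eps0" "\<And>eps. 0 < eps ==> eps < eps0 ==> (LINT x|lborel. \<bar>mu eps K x - ind K x\<bar>) < \<delta>/2"
  using mu_L1_compact[OF cK, of "\<delta>/2"] d by auto
 show thesis
 proof (rule that[OF e0(1)])
  fix eps assume e: "0 < eps" "eps < eps0"
  note m = mu_integral[OF AK finAK e(1)]
  have iK': "integ (mu eps K)" by (rule mu_integral[OF Kb finarea_bounded[OF KR(1)] e(1)])
  have iA': "integ (mu eps A)" by (rule mu_integral[OF A finarea_bounded[OF R] e(1)])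
  have iAK: "integ (ind (A - K) :: real^2 => real)" by (rule integ_bounded[OF AK KR(2)])
  have pt: "\<bar>mu eps A x - ind A x\<bar> <= mu eps (A - K) x + \<bar>mu eps K x - ind K x\<bar> + ind (A - K) x" for x
   using mu_diff[OF iA iK K(2) e(1), of x] mu_range(1)[OF iAK e(1), of x] K(2) by (auto simp: indicator_def)
  have "(LINT x|lborel. \<bar>mu eps A x - ind A x\<bar>) <= (LINT x|lborel. mu eps (A - K) x + \<bar>mu eps K x - ind K x\<bar> + ind (A - K) x)"
   using pt m iK' iA' iA iK iAK by (intro integral_mono) auto
  also have "... = area (A - K) + (LINT x|lborel. \<bar>mu eps K x - ind K x\<bar>) + area (A - K)"
   using m iK' iK iAK by simp
  also have "... < \<delta>" using mAK e0(2)[OF e] by linarith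
  finally show "(LINT x|lborel. \<bar>mu eps A x - ind A x\<bar>) < \<delta>" .
 qed
qed

text \<open>The increment is the integral of the gradient along the segment from x to x + h. For
  each fixed position on the segment, integration over x yields the same total gradient, which
  \<open>gradient_bound\<close> controls.\<close>

lemma mu_translate:
 assumes A[measurable]: "A \<in> sets borel" and fin: "finarea A" and p: "per_le A p" and e: "0 < eps"
 shows "(\<integral>\<^sup>+x. ennreal \<bar>mu eps A (x + h) - mu eps A x\<bar> \<partial>lborel) <= ennreal (norm h * p)"
proof -
 have iA: "integ (ind A :: real^2 => real)" using A fin by auto
 have [measurable]: "mu eps A \<in> borel_measurable borel" by (rule mu_borel[OF iA e])
 have [measurable]: "gmu eps A \<in> borel_measurable borel" by (rule gmu_borel[OF iA e])
 have cG: "continuous_on S (gmu eps A)" for S by (rule continuous_on_cgrad[OF iA e])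
 have pt: "ennreal \<bar>mu eps A (x + h) - mu eps A x\<bar> <= (\<integral>\<^sup>+t. ennreal (norm h) * ennreal (norm (gmu eps A (x + t *\<^sub>R h))) * ind {0..1} t \<partial>lborel)" for x
 proof -
  define g where "g = (\<lambda>t. gmu eps A (x + t *\<^sub>R h) \<bullet> h)"
  have cg: "continuous_on S g" for S unfolding g_def by (intro continuous_intros continuous_on_compose2[OF cG[of UNIV]]) auto
  have D: "((\<lambda>t. mu eps A (x + t *\<^sub>R h)) has_vector_derivative g t) (at t within S)" for t S
  proof -
   have "((\<lambda>t. mu eps A (x + t *\<^sub>R h)) has_derivative (\<lambda>s. blinfun_apply (blinfun_inner_right (gmu eps A (x + t *\<^sub>R h))) (s *\<^sub>R h))) (at t within S)"
    by (rule has_derivative_compose[OF _ C1w_deriv[OF C1w_conv[OF iA e]], of "\<lambda>t. x + t *\<^sub>R h"]) (auto intro!: derivative_eq_intros)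
   thus ?thesis unfolding has_vector_derivative_def g_def by simp
  qed
  have "mu eps A (x + h) - mu eps A x = (LINT t:{0..1}|lborel. g t)"
   using integral_FTC_Icc[of 0 1 "\<lambda>t. mu eps A (x + t *\<^sub>R h)" g] D cg by (simp add: set_lebesgue_integral_def has_vector_derivative_at_within)
  hence "ennreal \<bar>mu eps A (x + h) - mu eps A x\<bar> = ennreal (norm (LINT t|lborel. ind {0..1} t *\<^sub>R g t))" by (simp add: set_lebesgue_integral_def)
  also have "... <= (\<integral>\<^sup>+t. norm (ind {0..1} t *\<^sub>R g t) \<partial>lborel)"
   by (rule integral_norm_bound_ennreal) (use borel_integrable_atLeastAtMost'[OF cg[of "{0..1}"]] in \<open>simp add: set_integrable_def\<close>)
  also have "... <= (\<integral>\<^sup>+t. ennreal (norm h) * ennreal (norm (gmu eps A (x + t *\<^sub>R h))) * ind {0..1} t \<partial>lborel)"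
  proof (rule nn_integral_mono)
   fix t
   have "\<bar>g t\<bar> <= norm h * norm (gmu eps A (x + t *\<^sub>R h))"
    unfolding g_def using Cauchy_Schwarz_ineq2[of "gmu eps A (x + t *\<^sub>R h)" h] by (simp add: mult.commute)
   thus "ennreal (norm (ind {0..1} t *\<^sub>R g t)) <= ennreal (norm h) * ennreal (norm (gmu eps A (x + t *\<^sub>R h))) * ind {0..1} t"
    by (auto simp: indicator_def ennreal_mult[symmetric] intro!: ennreal_leI)
  qed
  finally show ?thesis .
 qed
 have "(\<integral>\<^sup>+x. ennreal \<bar>mu eps A (x + h) - mu eps A x\<bar> \<partial>lborel)
  <= (\<integral>\<^sup>+x. \<integral>\<^sup>+t. ennreal (norm h) * ennreal (norm (gmu eps A (x + t *\<^sub>R h))) * ind {0..1} t \<partial>lborel \<partial>lborel)"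
  by (intro nn_integral_mono pt)
 also have "... = (\<integral>\<^sup>+t. \<integral>\<^sup>+x. ennreal (norm h) * ennreal (norm (gmu eps A (x + t *\<^sub>R h))) * ind {0..1} t \<partial>lborel \<partial>(lborel :: real measure))"
  by (rule lborel_pair.Fubini'[symmetric]) measurable
 also have "... <= (\<integral>\<^sup>+t. ennreal (norm h * p) * ind {0..1} t \<partial>(lborel :: real measure))"
 proof (rule nn_integral_mono)
  fix t :: real
  have "(\<integral>\<^sup>+x. ennreal (norm h) * ennreal (norm (gmu eps A (x + t *\<^sub>R h))) * ind {0..1} t \<partial>lborel)
   = ennreal (norm h) * ind {0..1} t * (\<integral>\<^sup>+x. ennreal (norm (gmu eps A (t *\<^sub>R h + x))) \<partial>lborel)"
   by (subst nn_integral_cmult[symmetric]) (auto simp: ac_simps)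
  also have "(\<integral>\<^sup>+x. ennreal (norm (gmu eps A (t *\<^sub>R h + x))) \<partial>lborel) = (\<integral>\<^sup>+x. ennreal (norm (gmu eps A x)) \<partial>lborel)"
   by (rule nn_integral_shift) measurable
  also have "ennreal (norm h) * ind {0..1} t * ... <= ennreal (norm h) * ind {0..1} t * ennreal p"
   by (intro mult_left_mono gradient_bound[OF A fin p e]) auto
  also have "... = ennreal (norm h * p) * ind {0..1} t"
   using per_le_nonneg[OF p] by (simp add: ennreal_mult ac_simps)
  finally show "(\<integral>\<^sup>+x. ennreal (norm h) * ennreal (norm (gmu eps A (x + t *\<^sub>R h))) * ind {0..1} t \<partial>lborel) <= ennreal (norm h * p) * ind {0..1} t" .
 qed
 also have "... = ennreal (norm h * p)" by (subst nn_integral_cmult_indicator) auto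
 finally show ?thesis .
qed

lemma perimeter_translate:
 assumes A[measurable]: "A \<in> sets borel" and R: "A \<subseteq> cball 0 R" and p: "per_le A p"
 shows "(\<integral>\<^sup>+x. ennreal \<bar>ind A (x + h) - ind A x\<bar> \<partial>lborel) <= ennreal (norm h * p)"
proof (rule ennreal_le_epsilon)
 fix d :: real assume d: "0 < d"
 have fin: "finarea A" by (rule finarea_bounded[OF R])
 have iA: "integ (ind A :: real^2 => real)" using A fin by auto
 obtain eps where e: "0 < eps" "(LINT x|lborel. \<bar>mu eps A x - ind A x\<bar>) < d/2"
  using mu_L1[OF A R, of "d/2"] d by (metis dense half_gt_zero)
 have [measurable]: "mu eps A \<in> borel_measurable borel" by (rule mu_borel[OF iA e(1)])
 define q where "q = (\<integral>\<^sup>+x. ennreal \<bar>mu eps A x - ind A x\<bar> \<partial>lborel)"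
 have q: "q <= ennreal (d/2)" unfolding q_def
  using e mu_integral(1)[OF A fin e(1)] iA by (subst nn_integral_eq_integral) (auto intro!: ennreal_leI)
 have "(\<integral>\<^sup>+x. ennreal \<bar>ind A (x + h) - ind A x\<bar> \<partial>lborel)
  <= (\<integral>\<^sup>+x. ennreal \<bar>mu eps A (h + x) - ind A (h + x)\<bar> + (ennreal \<bar>mu eps A (x + h) - mu eps A x\<bar> + ennreal \<bar>mu eps A x - ind A x\<bar>) \<partial>lborel)"
  by (intro nn_integral_mono) (auto simp flip: ennreal_plus intro!: ennreal_leI simp: add.commute)
 also have "... = (\<integral>\<^sup>+x. ennreal \<bar>mu eps A (h + x) - ind A (h + x)\<bar> \<partial>lborel) + ((\<integral>\<^sup>+x. ennreal \<bar>mu eps A (x + h) - mu eps A x\<bar> \<partial>lborel) + q)"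
  unfolding q_def by (simp add: nn_integral_add)
 also have "(\<integral>\<^sup>+x. ennreal \<bar>mu eps A (h + x) - ind A (h + x)\<bar> \<partial>lborel) = q"
  unfolding q_def by (rule nn_integral_shift) measurable
 also have "q + ((\<integral>\<^sup>+x. ennreal \<bar>mu eps A (x + h) - mu eps A x\<bar> \<partial>lborel) + q) <= ennreal (d/2) + (ennreal (norm h * p) + ennreal (d/2))"
  by (intro add_mono q mu_translate[OF A fin p e(1)])
 also have "... = ennreal (norm h * p) + ennreal d" 
  using d per_le_nonneg[OF p] by (simp flip: ennreal_plus)
 finally show "(\<integral>\<^sup>+x. ennreal \<bar>ind A (x + h) - ind A x\<bar> \<partial>lborel) <= ennreal (norm h * p) + ennreal d" .
qed

text \<open>The kernel averages translates by less than \<open>eps\<close>, and each costs at most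
  \<open>eps * p\<close>. The rate depends on the set only through its perimeter bound; the
  compactness proof rests on this uniformity.\<close>

lemma mu_rate:
 assumes A[measurable]: "A \<in> sets borel" and R: "A \<subseteq> cball 0 R" and p: "per_le A p" and e: "0 < eps"
 shows "(LINT x|lborel. \<bar>mu eps A x - ind A x\<bar>) <= eps * p"
proof -
 have fin: "finarea A" by (rule finarea_bounded[OF R])
 have iA: "integ (ind A :: real^2 => real)" using A fin by auto
 have [measurable]: "mu eps A \<in> borel_measurable borel" by (rule mu_borel[OF iA e])
 have p0: "0 <= p" by (rule per_le_nonneg[OF p])
 have imk: "integ (\<lambda>z. ind A (x - z) * mk eps z)" for x
 proof (rule int_bound[OF mk_integrable[OF e]])
  show "AE z in lborel. norm (ind A (x - z) * mk eps z) <= norm (mk eps z)" by (intro AE_I2) (auto simp: indicator_def)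
 qed measurable
 have pt: "ennreal \<bar>mu eps A x - ind A x\<bar> <= (\<integral>\<^sup>+z. ennreal (mk eps z) * ennreal \<bar>ind A (x - z) - ind A x\<bar> \<partial>lborel)" for x
 proof -
  have "mu eps A x = (LINT z|lborel. ind A (x - z) * mk eps z)"
   unfolding conv_def using integral_reflect(1)[of "\<lambda>z. ind A (x - z) * mk eps z" x] by simp
  moreover have "ind A x = (LINT z|lborel. ind A x * mk eps z)" using mk_integral[OF e] by simp
  ultimately have "mu eps A x - ind A x = (LINT z|lborel. ind A (x - z) * mk eps z - ind A x * mk eps z)"
   using imk mk_integrable[OF e] by simp
  hence "ennreal \<bar>mu eps A x - ind A x\<bar> = ennreal (norm (LINT z|lborel. ind A (x - z) * mk eps z - ind A x * mk eps z))" by simp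
  also have "... <= (\<integral>\<^sup>+z. norm (ind A (x - z) * mk eps z - ind A x * mk eps z) \<partial>lborel)"
   using imk mk_integrable[OF e] by (intro integral_norm_bound_ennreal) auto
  also have "... = (\<integral>\<^sup>+z. ennreal (mk eps z) * ennreal \<bar>ind A (x - z) - ind A x\<bar> \<partial>lborel)"
   using mk_nonneg by (intro nn_integral_cong) (auto simp: indicator_def)
  finally show ?thesis .
 qed
 have "(\<integral>\<^sup>+x. ennreal \<bar>mu eps A x - ind A x\<bar> \<partial>lborel)
   <= (\<integral>\<^sup>+x. \<integral>\<^sup>+z. ennreal (mk eps z) * ennreal \<bar>ind A (x - z) - ind A x\<bar> \<partial>lborel \<partial>lborel)"
  by (intro nn_integral_mono pt)
 also have "... = (\<integral>\<^sup>+z. \<integral>\<^sup>+x. ennreal (mk eps z) * ennreal \<bar>ind A (x - z) - ind A x\<bar> \<partial>lborel \<partial>lborel)"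
  by (rule lborel_pair.Fubini'[symmetric]) measurable
 also have "... <= (\<integral>\<^sup>+z. ennreal (mk eps z) * ennreal (eps * p) \<partial>lborel)"
 proof (rule nn_integral_mono)
  fix z :: "real^2"
  have "(\<integral>\<^sup>+x. ennreal (mk eps z) * ennreal \<bar>ind A (x - z) - ind A x\<bar> \<partial>lborel) = ennreal (mk eps z) * (\<integral>\<^sup>+x. ennreal \<bar>ind A (x + (-z)) - ind A x\<bar> \<partial>lborel)"
   by (subst nn_integral_cmult) auto
  also have "... <= ennreal (mk eps z) * ennreal (eps * p)"
  proof (cases "eps <= norm z")
   case True thus ?thesis using mk_zero[OF e] by simp
  next
   case False
   hence "ennreal (norm (-z) * p) <= ennreal (eps * p)" using p0 by (intro ennreal_leI mult_right_mono) auto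
   thus ?thesis using perimeter_translate[OF A R p, of "-z"] by (intro mult_left_mono) (auto intro: order_trans)
  qed
  finally show "(\<integral>\<^sup>+x. ennreal (mk eps z) * ennreal \<bar>ind A (x - z) - ind A x\<bar> \<partial>lborel) <= ennreal (mk eps z) * ennreal (eps * p)" .
 qed
 also have "... = (\<integral>\<^sup>+z. ennreal (mk eps z) \<partial>lborel) * ennreal (eps * p)" by (intro nn_integral_multc) measurable
 also have "(\<integral>\<^sup>+z. ennreal (mk eps z) \<partial>lborel) = 1"
  using mk_integral[OF e] mk_nonneg mk_integrable[OF e] by (subst nn_integral_eq_integral) auto
 finally have "(\<integral>\<^sup>+x. ennreal \<bar>mu eps A x - ind A x\<bar> \<partial>lborel) <= ennreal (eps * p)" by simp
 thus ?thesis
  using mu_integral(1)[OF A fin e] iA e p0 by (subst (asm) nn_integral_eq_integral) (auto simp: ennreal_le_iff)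
qed

section \<open>The divergence theorem\<close>

lemma integral_vec2':
 fixes f :: "real^2 => real" assumes f: "integ f"
 shows "(LINT x|lborel. f x) = (LINT b|lborel. (LINT a|lborel. f (vec2 a b)))"
  and "integ (\<lambda>b. LINT a|lborel. f (vec2 a b))"
proof -
 have [measurable]: "f \<in> borel_measurable borel" using assms by auto
 have 1: "integrable (lborel \<Otimes>\<^sub>M lborel) (\<lambda>(a,b). f (vec2 a b))"
  using assms unfolding integrable_vec2_pair[OF \<open>f \<in> borel_measurable borel\<close>] by (simp add: case_prod_unfold)
 show "(LINT x|lborel. f x) = (LINT b|lborel. (LINT a|lborel. f (vec2 a b)))"
  using lborel_pair.Fubini_integral[of "\<lambda>a b. f (vec2 a b)"] 1 integral_vec2(1)[OF f] by simp
 show "integ (\<lambda>b. LINT a|lborel. f (vec2 a b))"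
  using lborel_pair.integrable_snd[OF 1] by simp
qed

lemma integrable_cont_supp:
 fixes f :: "'a::euclidean_space => real"
 assumes "continuous_on UNIV f" "\<And>x. R < norm x ==> f x = 0"
 shows "integ f"
proof -
 obtain B where B: "\<And>x. norm x <= R ==> norm (f x) <= B"
  using compact_imp_bounded[OF compact_continuous_image[OF continuous_on_subset[OF assms(1)] compact_cball[of 0 R]]]
  by (auto simp: bounded_iff) (metis mem_cball_0)
 show ?thesis
 proof (rule integrable_compact_support[where R=R and B="\<bar>B\<bar>"])
  show "norm (f x) <= \<bar>B\<bar>" for x using B[of x] assms(2)[of x] by (cases "norm x <= R") auto
 qed (use assms in \<open>auto intro: borel_measurable_continuous_onI\<close>)
qed

lemma abs_le_norm2: "\<bar>x $ i\<bar> <= norm (x::real^2)" by (rule component_le_norm_cart)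

lemma integral_derivative_compact_support:
 fixes f g :: "real => real"
 assumes "\<And>x. (f has_real_derivative g x) (at x)" "continuous_on UNIV g" "\<And>x. R < \<bar>x\<bar> ==> f x = 0" "\<And>x. R < \<bar>x\<bar> ==> g x = 0"
 shows "(LINT x|lborel. g x) = 0"
proof -
 have "(LINT x|lborel. g x) = (LINT x:{-(\<bar>R\<bar>+1)..\<bar>R\<bar>+1}|lborel. g x)"
  unfolding set_lebesgue_integral_def
 proof (intro int_cong refl)
  fix x show "g x = ind {-(\<bar>R\<bar>+1)..\<bar>R\<bar>+1} x *\<^sub>R g x"
   using assms(4)[of x] by (cases "R < \<bar>x\<bar>") (auto simp: indicator_def)
 qed
 also have "... = f (\<bar>R\<bar>+1) - f (-(\<bar>R\<bar>+1))"
  using integral_FTC_Icc_real[of "-(\<bar>R\<bar>+1)" "\<bar>R\<bar>+1" f g] assms(1,2)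
  by (simp add: set_lebesgue_integral_def mult.commute continuous_on_eq_continuous_at)
 finally show ?thesis using assms(3) by simp
qed

lemma vec2_curve_derivatives:
 assumes "C1w w D"
 shows "((\<lambda>a. w (vec2 a b)) has_vector_derivative blinfun_apply (D (vec2 a b)) (axis 1 1)) (at a within S)"
  and "((\<lambda>b. w (vec2 a b)) has_vector_derivative blinfun_apply (D (vec2 a b)) (axis 2 1)) (at b within S)"
proof -
 have "((\<lambda>a. vec2 a b) has_derivative (\<lambda>s. s *\<^sub>R axis 1 1)) (at a within S)"
  unfolding vec2_decomp by (auto intro!: derivative_eq_intros)
 from has_derivative_compose[OF this C1w_deriv[OF assms]]
 show "((\<lambda>a. w (vec2 a b)) has_vector_derivative blinfun_apply (D (vec2 a b)) (axis 1 1)) (at a within S)"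
  by (simp add: has_vector_derivative_def blinfun.bilinear_simps)
 have "((\<lambda>b. vec2 a b) has_derivative (\<lambda>s. s *\<^sub>R axis 2 1)) (at b within S)"
  unfolding vec2_decomp by (auto intro!: derivative_eq_intros)
 from has_derivative_compose[OF this C1w_deriv[OF assms]]
 show "((\<lambda>b. w (vec2 a b)) has_vector_derivative blinfun_apply (D (vec2 a b)) (axis 2 1)) (at b within S)"
  by (simp add: has_vector_derivative_def blinfun.bilinear_simps)
qed

lemma C1w_zero_outside:
 fixes w :: "real^2 => 'b::real_normed_vector"
 assumes "C1w w D" "\<And>x. R < norm x ==> w x = 0" "R < norm x" shows "D x = 0"
proof (rule blinfun_eqI)
 fix h
 have "open {x::real^2. R < norm x}" by (auto intro!: open_Collect_less continuous_intros)
 hence "(w has_derivative (\<lambda>h. 0)) (at x)"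
  by (rule has_derivative_transform_within_open[OF has_derivative_const[of 0]]) (use assms in auto)
 thus "blinfun_apply (D x) h = blinfun_apply 0 h"
  using has_derivative_unique[OF _ C1w_deriv[OF assms(1), of x UNIV]] by (auto simp: fun_eq_iff)
qed

lemma continuous_on_C1w_apply: "C1w w D ==> continuous_on S (\<lambda>x. blinfun_apply (D x) v)"
 by (intro continuous_intros C1w_contD)

lemma norm_vec2_gt: "R < \<bar>a\<bar> ==> R < norm (vec2 a b)" "R < \<bar>b\<bar> ==> R < norm (vec2 a b)"
 using abs_le_norm2[of "vec2 a b" 1] abs_le_norm2[of "vec2 a b" 2] by auto

lemma integral_partial_zero:
 fixes w :: "real^2 => real"
 assumes w: "C1w w D" and z: "\<And>x. R < norm x ==> w x = 0"
 shows "(LINT x|lborel. blinfun_apply (D x) (axis i 1)) = 0"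
proof -
 have Dz: "D x = 0" if "R < norm x" for x by (rule C1w_zero_outside[OF w z that])
 have i: "integ (\<lambda>x. blinfun_apply (D x) (axis i 1))" for i
  by (rule integrable_cont_supp[where R=R]) (auto simp: Dz intro!: continuous_on_C1w_apply[OF w])
 have 1: "(LINT a|lborel. blinfun_apply (D (vec2 a b)) (axis 1 1)) = 0" for b
 proof (rule integral_derivative_compact_support[where f="\<lambda>a. w (vec2 a b)" and R=R])
  show "continuous_on UNIV (\<lambda>a. blinfun_apply (D (vec2 a b)) (axis 1 1))"
   by (rule continuous_on_compose2[OF continuous_on_C1w_apply[OF w, of UNIV]]) (auto intro!: continuous_intros)
 qed (use vec2_curve_derivatives[OF w] z Dz norm_vec2_gt in \<open>auto simp: has_real_derivative_iff_has_vector_derivative\<close>)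
 have 2: "(LINT b|lborel. blinfun_apply (D (vec2 a b)) (axis 2 1)) = 0" for a
 proof (rule integral_derivative_compact_support[where f="\<lambda>b. w (vec2 a b)" and R=R])
  show "continuous_on UNIV (\<lambda>b. blinfun_apply (D (vec2 a b)) (axis 2 1))"
   by (rule continuous_on_compose2[OF continuous_on_C1w_apply[OF w, of UNIV]]) (auto intro!: continuous_intros)
 qed (use vec2_curve_derivatives[OF w] z Dz norm_vec2_gt in \<open>auto simp: has_real_derivative_iff_has_vector_derivative\<close>)
 have "i = 1 \<or> i = 2" by (rule exhaust_2)
 thus ?thesis
 proof
  assume "i = 1" thus ?thesis using integral_vec2'(1)[OF i[of 1]] 1 by simp
 next
  assume "i = 2" thus ?thesis using integral_vec2(1)[OF i[of 2]] 2 by simp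
 qed
qed

lemma integral_divergence:
 assumes phi: "phi \<in> test_fields" shows "(LINT x|lborel. divergence phi x) = 0"
proof -
 from test_fieldsE[OF phi] obtain D R where D: "C1w phi D" "\<And>x. divergence phi x = dv (D x)" "\<And>x. R < norm x ==> phi x = 0"
  "\<And>x. R < norm x ==> D x = 0" by metis
 have z: "(LINT x|lborel. blinfun_apply (blinfun_inner_right (axis i 1) o\<^sub>L D x) (axis i 1)) = 0" for i
  by (rule integral_partial_zero[OF C1w_inner[OF D(1), of "axis i 1"], of R]) (simp add: D)
 have "integ (\<lambda>x. blinfun_apply (D x) (axis i 1) $ i)" for i
  by (rule integrable_cont_supp[where R=R])
   (use D(4) in \<open>auto intro!: continuous_on_component blinfun.continuous_on continuous_on_const C1w_contD[OF D(1)] simp: blinfun.bilinear_simps\<close>)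
 thus ?thesis
  using z by (simp add: D(2) dv_def sum_2 blinfun_compose.rep_eq inner_axis inner_axis')
qed

text \<open>The inverse of the area of the part of the unit disk to the left of the abscissa \<open>sin s\<close>.\<close>

lemma disk_segment_angle:
 obtains \<Psi> :: "real => real" where
  "\<And>m. 0 < m ==> m < pi ==> - (pi/2) < \<Psi> m \<and> \<Psi> m < pi/2"
  "\<And>m. 0 < m ==> m < pi ==> (\<Psi> has_real_derivative inverse (2 * (cos (\<Psi> m))^2)) (at m)"
proof -
 \<comment> \<open>This is the integral of 2 sqrt (1 - x^2) over x from -1 to sin s.\<close>
 define \<alpha> where "\<alpha> = (\<lambda>s::real. s + sin s * cos s + pi/2)"
 have D: "(\<alpha> has_real_derivative 2 * (cos s)^2) (at s)" for s
 proof -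
  have "1 + (cos s * cos s - sin s * sin s) = 2 * (cos s)^2"
   using sin_cos_squared_add[of s] by (simp add: power2_eq_square)
  thus ?thesis unfolding \<alpha>_def by (auto intro!: derivative_eq_intros simp: algebra_simps)
 qed
 have cont: "continuous_on S \<alpha>" for S using D by (meson DERIV_isCont continuous_at_imp_continuous_on)
 have mono: "\<alpha> s < \<alpha> t" if "- (pi/2) <= s" "s < t" "t <= pi/2" for s t
 proof (rule DERIV_pos_imp_increasing_open[OF that(2)])
  fix x assume "s < x" "x < t"
  hence "0 < cos x" using that by (intro cos_gt_zero_pi) auto
  thus "\<exists>y. (\<alpha> has_real_derivative y) (at x) \<and> 0 < y" using D by (intro exI[of _ "2 * (cos x)^2"]) auto
 qed (use cont in auto)
 have inj: "inj_on \<alpha> {-(pi/2)..pi/2}"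
  by (rule linorder_inj_onI) (use mono in \<open>force\<close>)+
 define \<Psi> where "\<Psi> = inv_into {-(pi/2)..pi/2} \<alpha>"
 have ends: "\<alpha> (-(pi/2)) = 0" "\<alpha> (pi/2) = pi" by (auto simp: \<alpha>_def)
 have surj: "m \<in> \<alpha> ` {-(pi/2)..pi/2}" if "0 <= m" "m <= pi" for m
  using IVT'[of \<alpha> "-(pi/2)" m "pi/2"] that ends cont by auto
 have r: "\<alpha> (\<Psi> m) = m" "\<Psi> m \<in> {-(pi/2)..pi/2}" if "0 <= m" "m <= pi" for m
  using surj[OF that] unfolding \<Psi>_def by (rule f_inv_into_f, rule inv_into_into)
 have img: "\<alpha> ` {-(pi/2)..pi/2} = {0..pi}"
 proof
  show "\<alpha> ` {-(pi/2)..pi/2} \<subseteq> {0..pi}"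
  proof safe
   fix s assume s: "s \<in> {-(pi/2)..pi/2}"
   have "\<alpha> (-(pi/2)) <= \<alpha> s" using mono[of "-(pi/2)" s] s by (cases "s = -(pi/2)") auto
   moreover have "\<alpha> s <= \<alpha> (pi/2)" using mono[of s "pi/2"] s by (metis atLeastAtMost_iff less_eq_real_def order_refl)
   ultimately show "\<alpha> s \<in> {0..pi}" using ends by auto
  qed
 qed (use surj in auto)
 have "continuous_on {0..pi} \<Psi>"
  unfolding \<Psi>_def img[symmetric] by (intro continuous_on_inv cont compact_Icc) (use inj in auto)
 hence ic: "isCont \<Psi> m" if "0 < m" "m < pi" for m
  using that by (intro continuous_on_interior[of "{0..pi}"]) auto
 have b: "- (pi/2) < \<Psi> m \<and> \<Psi> m < pi/2" if "0 < m" "m < pi" for m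
 proof -
  have "\<Psi> m \<noteq> - (pi/2)" "\<Psi> m \<noteq> pi/2" using r(1)[of m] ends that by (metis less_imp_le less_irrefl)+
  thus ?thesis using r(2)[of m] that by (auto simp: less_le)
 qed
 show thesis
 proof (rule that[OF b])
  fix m assume m: "0 < m" "m < pi"
  have "0 < cos (\<Psi> m)" using b[OF m] by (intro cos_gt_zero_pi) auto
  thus "(\<Psi> has_real_derivative inverse (2 * (cos (\<Psi> m))^2)) (at m)"
   by (intro DERIV_inverse_function[OF D _ m r(1) ic[OF m]]) auto
 qed
qed

section \<open>The isoperimetric inequality\<close>

text \<open>The function has to climb from 0 to its value at \<open>y\<close> and return to 0, so
  its variation is at least twice that value.\<close>

lemma compact_support_oscillation:
 fixes f g :: "real => real"
 assumes d: "\<And>x. (f has_real_derivative g x) (at x)" and g: "continuous_on UNIV g" 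
  and z: "\<And>x. R < \<bar>x\<bar> ==> f x = 0" "\<And>x. R < \<bar>x\<bar> ==> g x = 0"
 shows "2 * f y <= (LINT x|lborel. \<bar>g x\<bar>)" "integ (\<lambda>x. \<bar>g x\<bar>)"
proof -
 define S where "S = \<bar>R\<bar> + \<bar>y\<bar> + 1"
 show i: "integ (\<lambda>x. \<bar>g x\<bar>)"
  by (rule integrable_cont_supp[where R=R]) (use g z in \<open>auto intro!: continuous_intros\<close>)
 have FTC: "(LINT x:{a..b}|lborel. g x) = f b - f a" if "a <= b" for a b
  using integral_FTC_Icc_real[of a b f g] d g that
  by (simp add: set_lebesgue_integral_def mult.commute continuous_on_eq_continuous_at)
 have ia: "integ (\<lambda>x. ind {a..b} x * \<bar>g x\<bar>)" for a b
  using integrable_real_mult_indicator[OF _ i, of "{a..b}"] by (simp add: mult.commute)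
 have le: "\<bar>f b - f a\<bar> <= (LINT x|lborel. ind {a..b} x * \<bar>g x\<bar>)" if "a <= b" for a b
 proof -
  have "\<bar>LINT x:{a..b}|lborel. g x\<bar> <= (LINT x|lborel. \<bar>ind {a..b} x *\<^sub>R g x\<bar>)"
   unfolding set_lebesgue_integral_def by (rule integral_abs_bound)
  thus ?thesis using FTC[OF that] by (simp add: abs_mult)
 qed
 have "2 * f y = (f y - f (- S)) + (f y - f S)" using z(1)[of S] z(1)[of "-S"] by (simp add: S_def)
 also have "... <= (LINT x|lborel. ind {-S..y} x * \<bar>g x\<bar>) + (LINT x|lborel. ind {y..S} x * \<bar>g x\<bar>)"
 proof -
  have "-S <= y" "y <= S" by (auto simp: S_def)
  from le[OF this(1)] le[OF this(2)] show ?thesis by linarith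
 qed
 also have "... = (LINT x|lborel. ind {-S..y} x * \<bar>g x\<bar> + ind {y..S} x * \<bar>g x\<bar>)"
  using ia by simp
 also have "... <= (LINT x|lborel. \<bar>g x\<bar>)"
 proof (rule integral_mono_AE)
  have "AE x in lborel. x \<noteq> y" by (rule AE_lborel_singleton)
  thus "AE x in lborel. ind {-S..y} x * \<bar>g x\<bar> + ind {y..S} x * \<bar>g x\<bar> <= \<bar>g x\<bar>"
   by eventually_elim (auto simp: indicator_def)
 qed (use ia i in auto)
 finally show "2 * f y <= (LINT x|lborel. \<bar>g x\<bar>)" .
qed

text \<open>Schmidt's argument: \<open>b = sin \<circ> \<Psi>\<close> carries the distribution of area of \<open>A\<close> along the first axis to that
 of the disk, and \<open>|u\<^sub>y| cos \<Psi> - u\<^sub>x b <= |\<nabla>u|\<close>.\<close>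

lemma isoperimetric_bounded:
 assumes A[measurable]: "A \<in> sets borel" and R: "A \<subseteq> cball 0 R" and p: "per_le A p"
 shows "2 * sqrt (pi * area A) <= p"
proof (cases "area A = 0")
 case True thus ?thesis using per_le_nonneg[OF p] by simp
next
 case False
 define a where "a = area A"
 have a: "0 < a" using False by (simp add: a_def less_le)
 have fin: "finarea A" by (rule finarea_bounded[OF R])
 have iA: "integ (ind A :: real^2 => real)" using A fin by auto
 \<comment> \<open>The parameter \<sigma> keeps the rescaled area \<open>M x\<close> strictly
   between 0 and pi, where \<Psi> is differentiable; \<delta> bounds the mollification error. Both
   tend to 0 at the end.\<close>
 have main: "2 * sqrt (pi * (1 - \<sigma>) / a) * (a - \<delta>) <= p" if \<sigma>: "0 < \<sigma>" "\<sigma> < 1" and \<delta>: "0 < \<delta>" for \<sigma> \<delta>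
 proof -
  obtain eps where e: "0 < eps" "eps < 1" "(LINT x|lborel. \<bar>mu eps A x - ind A x\<bar>) < \<delta>"
  proof -
   obtain eps0 where "0 < eps0" "\<And>eps. 0 < eps ==> eps < eps0 ==> (LINT x|lborel. \<bar>mu eps A x - ind A x\<bar>) < \<delta>"
    using mu_L1[OF A R \<delta>] by metis
   thus thesis using that[of "min (eps0/2) (1/2)"] by auto
  qed
  define u where "u = mu eps A"
  define G where "G = gmu eps A"
  define S where "S = \<bar>R\<bar> + 1"
  have S: "u x = 0" "G x = 0" if "S < norm x" for x
   using mu_zero_outside[OF e(1) R, of x] that e by (auto simp: S_def u_def G_def)
  have Cu: "C1w u (\<lambda>x. blinfun_inner_right (G x))" unfolding u_def G_def by (rule C1w_conv[OF iA e(1)])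
  have cu: "continuous_on T u" for T by (rule C1w_cont[OF Cu])
  have cG: "continuous_on T G" for T unfolding G_def by (rule continuous_on_cgrad[OF iA e(1)])
  have u01: "0 <= u x" "u x <= 1" for x using mu_range[OF iA e(1)] by (auto simp: u_def)
  have ui: "integ u" "(LINT x|lborel. u x) = a" unfolding u_def a_def using mu_integral[OF A fin e(1)] by auto
  define f where "f = (\<lambda>x. LINT y|lborel. u (vec2 x y))"
  have uz: "u (vec2 x y) = 0" "G (vec2 x y) = 0" if "S < \<bar>x\<bar> \<or> S < \<bar>y\<bar>" for x y using S norm_vec2_gt that by auto
  have cu2: "continuous_on T (\<lambda>y. u (vec2 x y))" "continuous_on T (\<lambda>y. G (vec2 x y))" for x T
   by (rule continuous_on_compose2[OF cu[of UNIV]] continuous_on_compose2[OF cG[of UNIV]]; auto intro!: continuous_intros)+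
  have iu: "integ (\<lambda>y. u (vec2 x y))" for x
   by (rule integrable_cont_supp[where R=S]) (use cu2 uz in auto)
  have cf: "continuous_on UNIV f"
  proof -
   have "isCont f x" for x
    unfolding continuous_at_sequentially o_def
   proof (intro allI impI)
    fix v assume v: "v \<longlonglongrightarrow> x"
    show "(\<lambda>n. f (v n)) \<longlonglongrightarrow> f x" unfolding f_def
    proof (rule integral_dominated_convergence[where w="ind {-S..S}"])
     show "AE y in lborel. (\<lambda>n. u (vec2 (v n) y)) \<longlonglongrightarrow> u (vec2 x y)"
     proof (rule AE_I2)
      fix y
      have "continuous_on UNIV (\<lambda>x. u (vec2 x y))" by (rule continuous_on_compose2[OF cu[of UNIV]]) (auto intro!: continuous_intros)
      from continuous_on_tendsto_compose[OF this v] show "(\<lambda>n. u (vec2 (v n) y)) \<longlonglongrightarrow> u (vec2 x y)" by auto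
     qed
     show "AE y in lborel. norm (u (vec2 (v n) y)) <= ind {-S..S} y" for n
     proof (rule AE_I2)
      fix y show "norm (u (vec2 (v n) y)) <= ind {-S..S} y"
       using u01[of "vec2 (v n) y"] uz[of "v n" y] by (cases "S < \<bar>y\<bar>") (auto simp: indicator_def)
     qed
     show "integ (ind {-S..S} :: real => real)" by (rule integrable_real_indicator) (auto simp: emeasure_lborel_Icc_eq)
    qed (use borel_measurable_integrable[OF iu] in auto)
   qed
   thus ?thesis by (simp add: continuous_at_imp_continuous_on)
  qed
  have f0: "0 <= f x" for x unfolding f_def using u01 by (intro Bochner_Integration.integral_nonneg) auto
  have fz: "f x = 0" if "S < \<bar>x\<bar>" for x unfolding f_def using uz that by simp
  have fi: "(LINT x|lborel. f x) = a" unfolding f_def using integral_vec2(1)[OF ui(1)] ui(2) by simp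
  obtain F0 where F0: "\<And>x. (F0 has_real_derivative f x) (at x)" using antiderivative_ex[OF cf] by metis
  define F where "F = (\<lambda>x. F0 x - F0 (-(S+1)))"
  have F: "(F has_real_derivative f x) (at x)" for x unfolding F_def using F0[of x] by (auto intro!: derivative_eq_intros)
  have Fmono: "F x <= F y" if "x <= y" for x y
   using DERIV_nonneg_imp_nondecreasing[OF that, of F] F f0 by blast
  have FS: "F (S + 1) = a"
  proof -
   have "F (S+1) - F (-(S+1)) = (LINT x:{-(S+1)..S+1}|lborel. f x)"
    using integral_FTC_Icc_real[of "-(S+1)" "S+1" F f] F cf
    by (simp add: set_lebesgue_integral_def mult.commute continuous_on_eq_continuous_at S_def)
   also have "... = (LINT x|lborel. f x)" unfolding set_lebesgue_integral_def
   proof (intro int_cong refl)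
    fix x show "ind {-(S+1)..S+1} x *\<^sub>R f x = f x" using fz[of x] by (cases "S < \<bar>x\<bar>") (auto simp: indicator_def)
   qed
   finally show ?thesis using fi by (simp add: F_def)
  qed
  have Fb: "0 <= F x" "F x <= a" for x
  proof -
   have "F x <= F (S+1)"
   proof (cases "x <= S + 1")
    case False
    have "F x - F (S + 1) = (x - (S+1)) * 0"
     using MVT2[of "S+1" x F f] False F fz by (smt (verit) mult_cancel_right1 mult_zero_right)
    thus ?thesis by simp
   qed (rule Fmono)
   thus "F x <= a" using FS by simp
   have "F (-(S+1)) <= F x"
   proof (cases "-(S + 1) <= x")
    case False
    have "F (-(S + 1)) - F x = (-(S+1) - x) * 0"
     using MVT2[of x "-(S+1)" F f] False F fz by (smt (verit) mult_cancel_right1 mult_zero_right)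
    thus ?thesis by simp
   qed (rule Fmono)
   thus "0 <= F x" by (simp add: F_def)
  qed
  obtain \<Psi> :: "real => real" where \<Psi>:
   "\<And>m. 0 < m ==> m < pi ==> - (pi/2) < \<Psi> m \<and> \<Psi> m < pi/2"
   "\<And>m. 0 < m ==> m < pi ==> (\<Psi> has_real_derivative inverse (2 * (cos (\<Psi> m))^2)) (at m)"
   using disk_segment_angle by blast
  define M where "M = (\<lambda>x. pi * ((1 - \<sigma>) * F x / a + \<sigma> / 2))"
  have M: "0 < M x" "M x < pi" for x
  proof -
   have "0 <= (1 - \<sigma>) * F x / a" using \<sigma> Fb[of x] a by simp
   thus "0 < M x" using \<sigma> by (simp add: M_def add_nonneg_pos)
   have "(1 - \<sigma>) * F x / a <= (1 - \<sigma>) * 1" using \<sigma> Fb[of x] a by (simp add: divide_le_eq mult_left_mono)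
   hence "(1 - \<sigma>) * F x / a + \<sigma> / 2 <= (1 - \<sigma>) * 1 + \<sigma> / 2" by (rule add_right_mono)
   also have "... < 1" using \<sigma> by simp
   finally have "(1 - \<sigma>) * F x / a + \<sigma> / 2 < 1" .
   thus "M x < pi" unfolding M_def using mult_strict_left_mono[OF _ pi_gt_zero] by force
  qed
  have dM: "(M has_real_derivative pi * (1 - \<sigma>) * f x / a) (at x)" for x
   unfolding M_def using F[of x] a by (auto intro!: derivative_eq_intros)
  define k where "k = (\<lambda>x. cos (\<Psi> (M x)))"
  define b where "b = (\<lambda>x. sin (\<Psi> (M x)))"
  define c where "c = pi * (1 - \<sigma>) / (2 * a)"
  define b' where "b' = (\<lambda>x. c * f x / k x)"
  have c0: "0 < c" using \<sigma> a by (simp add: c_def)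
  have k: "0 < k x" for x unfolding k_def using \<Psi>(1)[OF M] by (intro cos_gt_zero_pi) auto
  have kb: "(k x)^2 + (b x)^2 = 1" for x by (simp add: k_def b_def)
  have d\<Psi>: "((\<lambda>x. \<Psi> (M x)) has_real_derivative inverse (2 * (k x)^2) * (pi * (1 - \<sigma>) * f x / a)) (at x)" for x
   using DERIV_chain2[OF \<Psi>(2)[OF M] dM[of x]] by (simp add: k_def)
  have kx: "cos (\<Psi> (M x)) = k x" for x by (simp add: k_def)
  have db: "(b has_real_derivative b' x) (at x)" for x
   unfolding b_def by (rule DERIV_cong[OF DERIV_fun_sin[OF d\<Psi>]])
    (use k[of x] a in \<open>simp add: b'_def c_def kx field_simps power2_eq_square\<close>)
  have ck: "continuous_on UNIV k"
  proof -
   have "(k has_real_derivative - sin (\<Psi> (M x)) * (inverse (2 * (k x)^2) * (pi * (1 - \<sigma>) * f x / a))) (at x)" for x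
    unfolding k_def by (rule DERIV_fun_cos[OF d\<Psi>[unfolded k_def]])
   thus ?thesis by (meson DERIV_isCont continuous_at_imp_continuous_on)
  qed
  have cb': "continuous_on UNIV b'" unfolding b'_def using k by (intro continuous_intros cf ck) (auto simp: less_imp_neq[THEN not_sym])
  have cb: "continuous_on UNIV b" using db by (meson DERIV_isCont continuous_at_imp_continuous_on)
  have comp: "continuous_on UNIV (\<lambda>x::real^2. h (x $ 1))" if "continuous_on UNIV h" for h :: "real => real"
   by (rule continuous_on_compose2[OF that]) (auto intro!: continuous_intros)
  have C1b: "C1w (\<lambda>x::real^2. b (x \<bullet> axis 1 1)) (\<lambda>x. blinfun_mult_right (b' (x \<bullet> axis 1 1)) o\<^sub>L (blinfun_inner_right (axis 1 1) o\<^sub>L Blinfun (\<lambda>x. x)))"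
   by (rule C1w_compose[OF C1w_real[OF db cb'] C1w_inner[OF C1w_linear[OF bounded_linear_ident]]])
  \<comment> \<open>The first partial derivative of the compactly supported function b u integrates
    to 0. This trades b times the first component of \<open>G\<close> for - b' u.\<close>
  have "(LINT x|lborel. blinfun_apply (b (x \<bullet> axis 1 1) *\<^sub>R blinfun_inner_right (G x) + (blinfun_scaleR_left (u x) o\<^sub>L
    (blinfun_mult_right (b' (x \<bullet> axis 1 1)) o\<^sub>L (blinfun_inner_right (axis 1 1) o\<^sub>L Blinfun (\<lambda>x. x))))) (axis 1 1)) = 0"
   by (rule integral_partial_zero[OF C1w_scaleR[OF C1b Cu], of S]) (simp add: S)
  hence parts: "(LINT x|lborel. b (x $ 1) * G x $ 1 + b' (x $ 1) * u x) = 0"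
   by (simp add: inner_axis blinfun.bilinear_simps blinfun_compose.rep_eq bounded_linear_Blinfun_apply bounded_linear_ident)
  have ibG: "integ (\<lambda>x. b (x $ 1) * G x $ 1)"
   by (rule integrable_cont_supp[where R=S]) (use S in \<open>auto intro!: continuous_intros comp cb cG\<close>)
  have ib'u: "integ (\<lambda>x. b' (x $ 1) * u x)"
   by (rule integrable_cont_supp[where R=S]) (use S in \<open>auto intro!: continuous_intros comp cb' cu\<close>)
  have ikG: "integ (\<lambda>x. k (x $ 1) * \<bar>G x $ 2\<bar>)"
   by (rule integrable_cont_supp[where R=S]) (use S in \<open>auto intro!: continuous_intros comp ck cG\<close>)
  have inG: "integ (\<lambda>x. norm (G x))"
   by (rule integrable_cont_supp[where R=S]) (use S in \<open>auto intro!: continuous_intros cG\<close>)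
  have iuu: "integ (\<lambda>x. (u x)^2)"
   by (rule integrable_cont_supp[where R=S]) (use S in \<open>auto intro!: continuous_intros cu\<close>)
  have Gp: "(LINT x|lborel. norm (G x)) <= p"
   using gradient_bound[OF A fin p e(1)] inG per_le_nonneg[OF p] unfolding G_def
   by (subst (asm) nn_integral_eq_integral) auto
  have cs: "k (x $ 1) * \<bar>G x $ 2\<bar> - b (x $ 1) * G x $ 1 <= norm (G x)" for x
  proof -
   have "vec2 (- b (x $ 1)) (k (x $ 1)) \<bullet> vec2 (G x $ 1) \<bar>G x $ 2\<bar> <= norm (vec2 (- b (x $ 1)) (k (x $ 1))) * norm (vec2 (G x $ 1) \<bar>G x $ 2\<bar>)"
    by (rule norm_cauchy_schwarz)
   moreover have "norm (vec2 (- b (x $ 1)) (k (x $ 1))) = 1" using kb[of "x $ 1"] by (simp add: norm_vec2 add.commute)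
   moreover have "norm (vec2 (G x $ 1) \<bar>G x $ 2\<bar>) = norm (G x)" by (simp add: norm_vec2)
   ultimately show ?thesis by (simp add: inner_vec2)
  qed
  have iline: "integ (\<lambda>y. \<bar>G (vec2 x y) $ 2\<bar>)" and lines: "2 * u (vec2 x y) <= (LINT y|lborel. \<bar>G (vec2 x y) $ 2\<bar>)" for x y
  proof -
   have d: "((\<lambda>y. u (vec2 x y)) has_real_derivative G (vec2 x y) $ 2) (at y)" for y
    using vec2_curve_derivatives(2)[OF Cu, of x y UNIV] by (simp add: has_real_derivative_iff_has_vector_derivative inner_axis)
   have cg: "continuous_on UNIV (\<lambda>y. G (vec2 x y) $ 2)" by (intro continuous_on_component cu2)
   show "integ (\<lambda>y. \<bar>G (vec2 x y) $ 2\<bar>)" "2 * u (vec2 x y) <= (LINT y|lborel. \<bar>G (vec2 x y) $ 2\<bar>)"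
    using compact_support_oscillation[OF d cg, of S] uz by auto
  qed
  \<comment> \<open>On a vertical line let \<open>g\<close> be half the integral of the second
    component of \<open>G\<close> in absolute value. Then 2 k g + b' f >= 2 sqrt (2 k g b' f), and k
    b' = c f makes the right side 2 sqrt (2 c) sqrt g f. Since u <= 1 and u <= g, the integral of
    u^2 is at most sqrt g f. For an indicator u^2 is u.\<close>
  have pt: "2 * sqrt (2 * c) * (LINT y|lborel. (u (vec2 x y))^2) <= (LINT y|lborel. k x * \<bar>G (vec2 x y) $ 2\<bar> + b' x * u (vec2 x y))" for x
  proof -
   define g where "g = (LINT y|lborel. \<bar>G (vec2 x y) $ 2\<bar>) / 2"
   have g: "u (vec2 x y) <= g" for y using lines[of x y] by (simp add: g_def)
   have g0: "0 <= g" using g[of 0] u01[of "vec2 x 0"] by linarith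
   have sq: "(u (vec2 x y))^2 <= sqrt g * u (vec2 x y)" for y
   proof -
    have "(u (vec2 x y))^2 <= u (vec2 x y)" using u01[of "vec2 x y"] by (simp add: power2_eq_square mult_left_le)
    hence "u (vec2 x y) <= sqrt g" using g[of y] by (intro real_le_rsqrt) linarith
    thus ?thesis using u01[of "vec2 x y"] by (simp add: power2_eq_square mult_right_mono)
   qed
   have i2: "integ (\<lambda>y. (u (vec2 x y))^2)"
    by (rule integrable_cont_supp[where R=S]) (use cu2 uz in \<open>auto intro!: continuous_intros\<close>)
   have "(LINT y|lborel. (u (vec2 x y))^2) <= (LINT y|lborel. sqrt g * u (vec2 x y))"
    using i2 iu sq by (intro integral_mono) auto
   also have "... = sqrt g * f x" by (simp add: f_def)
   finally have w: "(LINT y|lborel. (u (vec2 x y))^2) <= sqrt g * f x" .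
   have "0 <= (sqrt (2 * k x * g) - sqrt (b' x * f x))^2" by simp
   also have "... = 2 * k x * g + b' x * f x - 2 * (sqrt (2 * k x * g) * sqrt (b' x * f x))"
    using k[of x] g0 f0[of x] c0 by (simp add: power2_diff b'_def)
   also have "sqrt (2 * k x * g) * sqrt (b' x * f x) = sqrt (2 * c) * (sqrt g * f x)"
   proof -
    have "sqrt (2 * k x * g) * sqrt (b' x * f x) = sqrt (2 * c * g * (f x)^2)"
     using k[of x] by (simp add: real_sqrt_mult[symmetric] b'_def power2_eq_square)
    thus ?thesis using f0[of x] by (simp add: real_sqrt_mult)
   qed
   finally have "2 * (sqrt (2 * c) * (sqrt g * f x)) <= 2 * k x * g + b' x * f x" by simp
   moreover have "2 * sqrt (2 * c) * (LINT y|lborel. (u (vec2 x y))^2) <= 2 * (sqrt (2 * c) * (sqrt g * f x))"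
    using w c0 by (simp add: mult_left_mono)
   moreover have "(LINT y|lborel. k x * \<bar>G (vec2 x y) $ 2\<bar> + b' x * u (vec2 x y)) = 2 * k x * g + b' x * f x"
    using iline iu by (simp add: g_def f_def)
   ultimately show ?thesis by linarith
  qed
  have ikb: "integ (\<lambda>x. k (x $ 1) * \<bar>G x $ 2\<bar> + b' (x $ 1) * u x)" using ikG ib'u by auto
  have "2 * sqrt (2 * c) * (LINT x|lborel. (u x)^2) = (LINT x|lborel. 2 * sqrt (2 * c) * (LINT y|lborel. (u (vec2 x y))^2))"
   using integral_vec2(1)[OF iuu] by simp
  also have "... <= (LINT x|lborel. LINT y|lborel. k x * \<bar>G (vec2 x y) $ 2\<bar> + b' x * u (vec2 x y))"
   using pt integral_vec2(2)[OF iuu] integral_vec2(2)[OF ikb] by (intro integral_mono) auto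
  also have "... = (LINT x|lborel. k (x $ 1) * \<bar>G x $ 2\<bar> + b' (x $ 1) * u x)"
   using integral_vec2(1)[OF ikb] by simp
  also have "... = (LINT x|lborel. k (x $ 1) * \<bar>G x $ 2\<bar> - b (x $ 1) * G x $ 1)"
   using parts ibG ib'u ikG by simp
  also have "... <= (LINT x|lborel. norm (G x))"
   using cs ibG ikG inG by (intro integral_mono) auto
  also note Gp
  finally have 1: "2 * sqrt (2 * c) * (LINT x|lborel. (u x)^2) <= p" .
  \<comment> \<open>The function u - u^2 vanishes where u is 0 or 1, so the distance from u to the
    indicator dominates it.\<close>
  have "a - (LINT x|lborel. (u x)^2) = (LINT x|lborel. u x - (u x)^2)" using ui iuu by simp
  also have "... <= (LINT x|lborel. \<bar>mu eps A x - ind A x\<bar>)"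
  proof (rule integral_mono)
   show "u x - (u x)^2 <= \<bar>mu eps A x - ind A x\<bar>" for x
    using u01[of x] mult_nonneg_nonneg[of "u x" "1 - u x"] mult_left_le[of "u x" "u x"] mult_nonneg_nonneg[of "1 - u x" "1 - u x"]
    by (auto simp: indicator_def u_def[symmetric] power2_eq_square algebra_simps)
  qed (use ui iuu iA mu_integral(1)[OF A fin e(1)] in auto)
  finally have "a - \<delta> <= (LINT x|lborel. (u x)^2)" using e(3) by linarith
  hence "2 * sqrt (2 * c) * (a - \<delta>) <= 2 * sqrt (2 * c) * (LINT x|lborel. (u x)^2)" using c0 by (intro mult_left_mono) auto
  moreover have "2 * c = pi * (1 - \<sigma>) / a" by (simp add: c_def)
  ultimately show ?thesis using 1 by simp
 qed
 have "(\<lambda>n. 2 * sqrt (pi * (1 - inverse (real (Suc n))) / a) * (a - inverse (real (Suc n)))) \<longlonglongrightarrow> 2 * sqrt (pi * (1 - 0) / a) * (a - 0)"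
  by (intro tendsto_intros LIMSEQ_inverse_real_of_nat) (use a in auto)
 hence "2 * sqrt (pi * (1 - 0) / a) * (a - 0) <= p"
 proof (rule LIMSEQ_le_const2)
  show "\<exists>N. \<forall>n\<ge>N. 2 * sqrt (pi * (1 - inverse (real (Suc n))) / a) * (a - inverse (real (Suc n))) <= p"
  proof (intro exI[of _ 1] allI impI)
   fix n :: nat assume "n \<ge> 1"
   hence "inverse (real (Suc n)) < 1" by (simp add: inverse_less_1_iff)
   thus "2 * sqrt (pi * (1 - inverse (real (Suc n))) / a) * (a - inverse (real (Suc n))) <= p" by (intro main) auto
  qed
 qed
 moreover have "sqrt (pi / a) * a = sqrt (pi * a)"
 proof -
  have "sqrt (pi / a) * a = sqrt (pi / a * a^2)" using a by (simp only: real_sqrt_mult real_sqrt_abs abs_of_pos)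
  also have "pi / a * a^2 = pi * a" using a by (simp add: power2_eq_square)
  finally show ?thesis .
 qed
 ultimately show ?thesis by (simp add: a_def[symmetric] mult.assoc)
qed

section \<open>Unbounded sets and the gain from truncation\<close>

lemma C1w_inner_self: "C1w (\<lambda>x::'a::real_inner. x \<bullet> x) (\<lambda>x. 2 *\<^sub>R blinfun_inner_right x)"
 unfolding C1w_def
proof (intro conjI allI)
 fix x :: 'a
 show "((\<lambda>x. x \<bullet> x) has_derivative blinfun_apply (2 *\<^sub>R blinfun_inner_right x)) (at x)"
  by (rule has_derivative_eq_rhs[OF has_derivative_inner[OF has_derivative_ident has_derivative_ident]])
   (auto simp: blinfun.bilinear_simps inner_commute)
 show "continuous_on UNIV (\<lambda>x::'a. 2 *\<^sub>R blinfun_inner_right x)"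
  by (intro continuous_intros bounded_linear.continuous_on[OF bounded_linear_blinfun_inner_right])
qed

text \<open>A substitute for the norm that is C^1 at the origin too. It is 1-Lipschitz, and its
  sublevel sets are still concentric disks.\<close>

definition rad :: "real^2 => real" where "rad x = sqrt (1 + x \<bullet> x)"

lemma rad_pos: "0 < rad x" unfolding rad_def by (intro real_sqrt_gt_zero add_pos_nonneg) auto

lemma C1w_rad: "C1w rad (\<lambda>x. blinfun_inner_right (x /\<^sub>R rad x))"
 unfolding C1w_def
proof (intro conjI allI)
 fix x :: "real^2"
 have p: "0 < 1 + x \<bullet> x" by (intro add_pos_nonneg) auto
 have *: "((\<lambda>x. 1 + x \<bullet> x) has_derivative (\<lambda>h. 2 * (x \<bullet> h))) (at x)"
  using C1w_deriv[OF C1w_add[OF C1w_const[of 1] C1w_inner_self], of x UNIV]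
  by (rule has_derivative_eq_rhs) (simp add: blinfun.bilinear_simps fun_eq_iff)
 have eq: "2 * (x \<bullet> h) * (inverse (rad x) / 2) = blinfun_apply (blinfun_inner_right (x /\<^sub>R rad x)) h" for h
  by simp
 show "(rad has_derivative blinfun_apply (blinfun_inner_right (x /\<^sub>R rad x))) (at x)"
  using has_derivative_real_sqrt[OF p *] unfolding rad_def[symmetric, abs_def] eq .
 show "continuous_on UNIV (\<lambda>x. blinfun_inner_right (x /\<^sub>R rad x))"
  using rad_pos unfolding rad_def
  by (intro bounded_linear.continuous_on[OF bounded_linear_blinfun_inner_right] continuous_intros) (auto simp: less_imp_neq[THEN not_sym])
qed

lemma norm_rad: "norm (blinfun_inner_right (x /\<^sub>R rad x)) <= 1"
proof (rule norm_blinfun_bound)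
 fix h :: "real^2"
 have "norm x <= rad x" unfolding rad_def norm_eq_sqrt_inner by (intro real_sqrt_le_mono) simp
 hence "norm (x /\<^sub>R rad x) <= 1" using rad_pos[of x] by (simp add: field_simps)
 hence "norm (x /\<^sub>R rad x) * norm h <= 1 * norm h" by (intro mult_right_mono) auto
 thus "norm (blinfun_apply (blinfun_inner_right (x /\<^sub>R rad x)) h) <= 1 * norm h"
  unfolding blinfun_inner_right.rep_eq real_norm_def using Cauchy_Schwarz_ineq2[of "x /\<^sub>R rad x" h] by linarith
qed simp

lemma rad_le_iff: "1 <= s ==> rad x <= s \<longleftrightarrow> norm x <= sqrt (s^2 - 1)"
proof -
 assume s: "1 <= s"
 hence "rad x <= s \<longleftrightarrow> 1 + (norm x)^2 <= s^2"
  unfolding rad_def power2_norm_eq_inner using real_sqrt_le_iff[of "1 + x \<bullet> x" "s^2"] by simp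
 also have "... \<longleftrightarrow> norm x <= sqrt (s^2 - 1)"
  using s power_mono[of 1 s 2] real_le_rsqrt[of "norm x" "s^2 - 1"] real_sqrt_le_iff[of "(norm x)^2" "s^2 - 1"] by auto
 finally show ?thesis .
qed

lemma finarea_mono:
 "emeasure M A < \<infinity> ==> B \<subseteq> A ==> A \<in> sets M ==> emeasure M B < \<infinity>"
 using emeasure_mono[of B A M] by (auto intro: le_less_trans)

lemma area_mono:
 "B \<subseteq> A ==> A \<in> sets M ==> emeasure M A < \<infinity> ==> measure M B <= measure M A"
 unfolding measure_def by (intro enn2real_mono emeasure_mono) auto

lemma tail_measure_small:
 assumes A[measurable]: "A \<in> sets borel" and fin: "finarea A" and e: "0 < eps"
 obtains n where "area (A \<inter> {x. real n < rad x}) < eps" "2 <= n"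
proof -
 have [measurable]: "rad \<in> borel_measurable borel" by (rule borel_measurable_C1w[OF C1w_rad])
 have "(\<lambda>n. area (A \<inter> {x. real n < rad x})) \<longlonglongrightarrow> area (\<Inter>n. A \<inter> {x. real n < rad x})"
 proof (rule Lim_measure_decseq)
  show "emeasure lborel (A \<inter> {x. real n < rad x}) \<noteq> \<infinity>" for n
   using finarea_mono[OF fin, of "A \<inter> {x. real n < rad x}"] by auto
 qed (auto simp: decseq_def)
 moreover have "(\<Inter>n. A \<inter> {x. real n < rad x}) = {}"
  using reals_Archimedean2 by (auto intro: less_asym)
 ultimately have "eventually (\<lambda>n. area (A \<inter> {x. real n < rad x}) < eps) sequentially"
  using e by (intro order_tendstoD) auto
 hence "eventually (\<lambda>n. area (A \<inter> {x. real n < rad x}) < eps \<and> 2 <= n) sequentially"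
  using eventually_ge_at_top[of 2] by eventually_elim auto
 thus thesis using that by (auto simp: eventually_sequentially)
qed

lemma measure_split_level:
 assumes [measurable]: "A \<in> sets M" "d \<in> borel_measurable M" and "emeasure M A < \<infinity>" "A \<subseteq> space M"
 shows "measure M (A \<inter> {x. d x <= s}) = measure M A - measure M (A \<inter> {x. s < (d x :: real)})"
proof -
 have e: "A \<inter> {x. d x <= s} = A - A \<inter> {x. s < d x}" "A \<inter> {x. s < d x} = {x \<in> space M. s < d x} \<inter> A" using assms(4) by auto
 hence "A \<inter> {x. s < d x} \<in> sets M" by simp
 thus ?thesis using assms(3) finarea_mono[OF assms(3), of "A \<inter> {x. s < d x}"] unfolding e(1) by (subst measure_Diff) auto
qed

lemma bounded_truncation:
 assumes A[measurable]: "A \<in> sets borel" and fin: "finarea A" and p: "per_le A p" and e: "0 < eps"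
 obtains R where "per_le (A \<inter> cball 0 R) (p + eps)" "area A - eps < area (A \<inter> cball 0 R)"
proof -
 have rb[measurable]: "rad \<in> borel_measurable borel" by (rule borel_measurable_C1w[OF C1w_rad])
 \<comment> \<open>Once the tail area is below c^2, the lost area is below c^2 and the cost 4 c sqrt
   m of the cut is at most 4 c^2; both are to be bounded by \<open>eps\<close>.\<close>
 define c where "c = min (sqrt eps / 2) 1"
 have c: "0 < c" "c <= 1" using e by (auto simp: c_def)
 have c2: "0 <= c^2" by simp
 have "c^2 <= (sqrt eps / 2)^2" using c by (intro power_mono) (auto simp: c_def)
 hence c4: "4 * c^2 <= eps" using e by (simp add: power_divide)
 obtain n where n: "area (A \<inter> {x. real n < rad x}) < c^2" "2 <= n" by (rule tail_measure_small[OF A fin, of "c^2"]) (use c in auto)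
 have "sqrt (area (A \<inter> {x. real n < rad x})) < c * 1"
  using n c real_sqrt_less_mono[OF n(1)] by simp
 then obtain s where s: "real n <= s" "\<And>phi \<psi>. phi \<in> test_fields ==> \<psi> \<in> test_fields ==>
   (LINT x:A \<inter> {x. rad x <= s}|lborel. divergence phi x) + (LINT x:A \<inter> {x. s < rad x}|lborel. divergence \<psi> x)
    <= p + 4 * c * sqrt (area (A \<inter> {x. s < rad x}))"
  by (rule truncation[OF A fin p C1w_rad norm_rad c(1) zero_less_one]) blast
 have s1: "1 <= s" using s(1) n(2) by linarith
 have eq: "A \<inter> {x. rad x <= s} = A \<inter> cball 0 (sqrt (s^2 - 1))" by (simp add: set_eq_iff rad_le_iff[OF s1])
 have "area (A \<inter> {x. s < rad x}) <= area (A \<inter> {x. real n < rad x})"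
  using s(1) by (intro area_mono finarea_mono[OF fin]) auto
 hence m: "area (A \<inter> {x. s < rad x}) < c^2" using n by linarith
 have me: "area (A \<inter> {x. s < rad x}) < eps" using m c4 c2 by linarith
 show thesis
 proof (rule that)
  show "area A - eps < area (A \<inter> cball 0 (sqrt (s^2 - 1)))"
   using measure_split_level[of A lborel rad s] fin me unfolding eq by auto
  show "per_le (A \<inter> cball 0 (sqrt (s^2 - 1))) (p + eps)" unfolding per_le_def
  proof
   fix phi assume phi: "phi \<in> test_fields"
   have "sqrt (area (A \<inter> {x. s < rad x})) <= c" using real_sqrt_le_mono[OF less_imp_le[OF m]] c by simp
   hence "4 * c * sqrt (area (A \<inter> {x. s < rad x})) <= 4 * c * c" using c by (intro mult_left_mono) auto
   thus "(LINT x:A \<inter> cball 0 (sqrt (s^2 - 1))|lborel. divergence phi x) <= p + eps"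
    using s(2)[OF phi zero_test_field] c4 unfolding eq
    by (simp add: divergence_C1w[OF C1w_const] power2_eq_square)
  qed
 qed
qed

theorem isoperimetric:
 assumes A[measurable]: "A \<in> sets borel" and fin: "finarea A" and p: "per_le A p"
 shows "2 * sqrt (pi * area A) <= p"
proof (rule ccontr)
 define a where "a = area A"
 assume "\<not> 2 * sqrt (pi * area A) <= p"
 hence lt: "p < 2 * sqrt (pi * (a - 0)) - 0" by (simp add: a_def)
 have "(\<lambda>n. 2 * sqrt (pi * (a - inverse (real (Suc n)))) - inverse (real (Suc n))) \<longlonglongrightarrow> 2 * sqrt (pi * (a - 0)) - 0"
  by (intro tendsto_intros LIMSEQ_inverse_real_of_nat)
 from order_tendstoD(1)[OF this lt] obtain n where n: "p < 2 * sqrt (pi * (a - inverse (real (Suc n)))) - inverse (real (Suc n))"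
  by (auto simp: eventually_sequentially)
 obtain R where R: "per_le (A \<inter> cball 0 R) (p + inverse (real (Suc n)))" "a - inverse (real (Suc n)) < area (A \<inter> cball 0 R)"
  unfolding a_def by (rule bounded_truncation[OF A fin p, of "inverse (real (Suc n))"]) auto
 have "2 * sqrt (pi * (a - inverse (real (Suc n)))) <= 2 * sqrt (pi * area (A \<inter> cball 0 R))"
  using R(2) by simp
 also have "... <= p + inverse (real (Suc n))" by (rule isoperimetric_bounded[OF _ _ R(1)]) auto
 finally show False using n by linarith
qed

text \<open>With the slope sqrt pi / 4 the cut costs at most sqrt (pi m), while by the isoperimetric
  inequality the removed part alone has perimeter at least 2 sqrt (pi m). The net gain sqrt (pi m)
  outweighs, for small \<open>m\<close>, every loss that is linear in \<open>m\<close>.\<close>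

lemma isoperimetric_truncation:
 assumes A[measurable]: "A \<in> sets borel" and fin: "finarea A" and p: "per_le A p"
  and d: "C1w d Dd" and d1: "\<And>x. norm (Dd x) <= 1"
  and T: "0 < T" "sqrt (area (A \<inter> {x. s0 < d x})) < sqrt pi / 4 * T"
 obtains s B m where "s0 <= s" "s < s0 + T" "B = A \<inter> {x. d x <= s}" "m = area (A \<inter> {x. s < d x})"
  "per_le B (p - sqrt (pi * m))" "B \<in> sets borel" "finarea B" "area B = area A - m"
  "m <= area (A \<inter> {x. s0 < d x})"
proof -
 have [measurable]: "d \<in> borel_measurable borel" by (rule borel_measurable_C1w[OF d])
 obtain s where s: "s0 <= s" "s < s0 + T"
  "\<And>phi \<psi>. phi \<in> test_fields ==> \<psi> \<in> test_fields ==>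
   (LINT x:A \<inter> {x. d x <= s}|lborel. divergence phi x) + (LINT x:A \<inter> {x. s < d x}|lborel. divergence \<psi> x)
    <= p + 4 * (sqrt pi / 4) * sqrt (area (A \<inter> {x. s < d x}))"
  by (rule truncation[OF A fin p d d1 _ T]) auto
 define m where "m = area (A \<inter> {x. s < d x})"
 show thesis
 proof (rule that[OF s(1,2) refl m_def])
  show "per_le (A \<inter> {x. d x <= s}) (p - sqrt (pi * m))"
   unfolding per_le_def
  proof
   fix phi assume phi: "phi \<in> test_fields"
   let ?I = "LINT x:A \<inter> {x. d x <= s}|lborel. divergence phi x"
   have "per_le (A \<inter> {x. s < d x}) (p + sqrt pi * sqrt m - ?I)"
    unfolding per_le_def using s(3)[OF phi] by (simp add: m_def algebra_simps)
   from isoperimetric[OF _ _ this] have "2 * sqrt (pi * m) <= p + sqrt pi * sqrt m - ?I"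
    using finarea_mono[OF fin, of "A \<inter> {x. s < d x}"] by (simp add: m_def)
   thus "?I <= p - sqrt (pi * m)" by (simp add: real_sqrt_mult)
  qed
  show "m <= area (A \<inter> {x. s0 < d x})"
   unfolding m_def using s(1) finarea_mono[OF fin, of "A \<inter> {x. s0 < d x}"] by (intro area_mono) auto
 qed (use measure_split_level[of A lborel d s] fin finarea_mono[OF fin, of "A \<inter> {x. d x <= s}"] in \<open>auto simp: m_def\<close>)
qed

section \<open>The perimeter of a disk\<close>

lemma measure_ball2: "0 <= r ==> area (ball x r) = pi * r^2" for x :: "real^2"
 by (simp add: content_ball unit_ball_vol_2)

lemma measure_cball2: "0 <= r ==> area (cball x r) = pi * r^2" for x :: "real^2"
 by (simp add: content_cball unit_ball_vol_2)

lemma per_le_UNIV: "per_le UNIV 0"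
 unfolding per_le_def using integral_divergence by (simp add: set_lebesgue_integral_def)

text \<open>The disk is cut out of the whole plane, whose perimeter is 0. Layers of
  \<open>rad\<close> are annuli of known area, which gives the rate 2 pi sqrt (1 + \<rho>^2); the
  excess over 2 pi \<rho> arises because \<open>rad\<close> is not the norm.\<close>

lemma per_le_large_disk:
 assumes \<rho>: "0 < \<rho>" shows "per_le (cball (0::real^2) \<rho>) (2 * pi * sqrt (1 + \<rho>^2))"
 unfolding per_le_def
proof
 fix phi assume phi: "phi \<in> test_fields"
 define s where "s = sqrt (1 + \<rho>^2)"
 have s: "1 <= s" "s^2 - 1 = \<rho>^2" by (auto simp: s_def)
 have e: "UNIV \<inter> {x. rad x <= s} = cball (0::real^2) \<rho>" using \<rho> by (simp add: set_eq_iff rad_le_iff[OF s(1)] s(2))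
 show "(LINT x:cball 0 \<rho>|lborel. divergence phi x) <= 2 * pi * sqrt (1 + \<rho>^2)"
 proof (rule field_le_epsilon)
  fix eps :: real assume eps: "0 < eps"
  have "(LINT x:UNIV \<inter> {x. rad x <= s}|lborel. divergence phi x) + (LINT x:UNIV \<inter> {x. s < rad x}|lborel. divergence (\<lambda>x. 0) x) <= 0 + (pi * (2 * s + eps / pi)) * 1"
  proof (rule cut_at_level[OF _ per_le_UNIV C1w_rad norm_rad phi zero_test_field])
   show "norm (phi x - 0) <= 1" for x using phi by (simp add: test_fields_iff)
   fix h :: real assume h: "0 < h" "h <= eps / pi"
   define S where "S = sqrt ((s + h)^2 - 1)"
   have S: "\<rho>^2 <= S^2" "S^2 = (s + h)^2 - 1" "0 <= S"
   proof -
    have "s^2 <= (s + h)^2" "1^2 <= (s + h)^2" using s h by (intro power_mono; simp)+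
    thus "\<rho>^2 <= S^2" "S^2 = (s + h)^2 - 1" "0 <= S" using s(2) by (auto simp: S_def)
   qed
   have rS: "\<rho> <= S" by (rule power2_le_imp_le[OF S(1,3)])
   have "UNIV \<inter> {x. s < rad x \<and> rad x < s + h} \<subseteq> cball 0 S - cball (0::real^2) \<rho>"
   proof
    fix x assume "x \<in> UNIV \<inter> {x. s < rad x \<and> rad x < s + h}"
    hence x: "\<not> rad x <= s" "rad x <= s + h" by auto
    have "1 <= s + h" using s h by simp
    from x(2)[unfolded rad_le_iff[OF this]] x(1)[unfolded rad_le_iff[OF s(1)] s(2)]
    show "x \<in> cball 0 S - cball 0 \<rho>" using \<rho> by (simp add: S_def)
   qed
   hence "emeasure lborel (UNIV \<inter> {x. s < rad x \<and> rad x < s + h}) <= emeasure lborel (cball 0 S - cball (0::real^2) \<rho>)"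
    by (intro emeasure_mono) auto
   also have "... = ennreal (area (cball 0 S - cball (0::real^2) \<rho>))"
    using finarea_mono[of lborel "cball 0 S" "cball 0 S - cball (0::real^2) \<rho>"] emeasure_lborel_cball_finite[of "0::real^2" S]
    by (intro emeasure_eq_ennreal_measure) auto
   also have "area (cball 0 S - cball (0::real^2) \<rho>) = pi * S^2 - pi * \<rho>^2"
    using S \<rho> rS emeasure_lborel_cball_finite[of "0::real^2" S] by (subst measure_Diff) (auto simp: measure_cball2)
   also have "... = pi * (2 * s + h) * h" unfolding S(2) s(2)[symmetric] by (simp add: power2_eq_square algebra_simps)
   also have "... <= pi * (2 * s + eps / pi) * h" using h by (intro mult_right_mono mult_left_mono) auto
   finally show "emeasure lborel (UNIV \<inter> {x. s < rad x \<and> rad x < s + h}) <= ennreal (pi * (2 * s + eps / pi) * h)"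
    by (simp add: ennreal_leI)
  qed (use eps s in auto)
  thus "(LINT x:cball 0 \<rho>|lborel. divergence phi x) <= 2 * pi * sqrt (1 + \<rho>^2) + eps"
   unfolding e by (simp add: divergence_C1w[OF C1w_const] s_def algebra_simps)
 qed
qed

text \<open>Shrinking a disk of large radius \<rho> to radius \<open>r\<close> makes the relative
  excess of \<open>per_le_large_disk\<close> vanish in the limit.\<close>

lemma per_le_cball0:
 assumes r: "0 < r" shows "per_le (cball (0::real^2) r) (2 * pi * r)"
 unfolding per_le_def
proof
 fix phi assume phi: "phi \<in> test_fields"
 have b: "(LINT x:cball 0 r|lborel. divergence phi x) <= 2 * pi * r * (1 + inverse (real (Suc n)))" for n
 proof -
  define \<rho> where "\<rho> = real (Suc n)"
  have \<rho>: "0 < \<rho>" "sqrt (1 + \<rho>^2) <= 1 + \<rho>" by (auto simp: \<rho>_def power2_eq_square algebra_simps intro!: real_le_lsqrt)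
  have "cball (0::real^2) r = aff 0 (r / \<rho>) ` cball 0 \<rho>" using r \<rho> by (auto simp: aff_image_vimage field_simps)
  hence "per_le (cball (0::real^2) r) (r / \<rho> * (2 * pi * sqrt (1 + \<rho>^2)))"
   using per_le_aff[OF _ _ per_le_large_disk[OF \<rho>(1)], of "r / \<rho>" 0] r \<rho> by simp
  from per_leD[OF this phi] have "(LINT x:cball 0 r|lborel. divergence phi x) <= (r / \<rho> * (2 * pi)) * sqrt (1 + \<rho>^2)" by (simp add: mult.assoc)
  also have "... <= (r / \<rho> * (2 * pi)) * (1 + \<rho>)" using \<rho> r by (intro mult_left_mono) auto
  also have "... = 2 * pi * r * (1 + inverse \<rho>)" using \<rho>(1) by (simp add: field_simps)
  finally show ?thesis by (simp add: \<rho>_def)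
 qed
 have "(\<lambda>n. 2 * pi * r * (1 + inverse (real (Suc n)))) \<longlonglongrightarrow> 2 * pi * r * (1 + 0)"
  by (intro tendsto_intros LIMSEQ_inverse_real_of_nat)
 from LIMSEQ_le_const[OF this] b show "(LINT x:cball 0 r|lborel. divergence phi x) <= 2 * pi * r" by auto
qed

text \<open>The upper bound comes from the closed disk, which differs by a null circle; the lower
  bound is the isoperimetric inequality.\<close>

lemma perimeter_ball:
 assumes r: "0 < r" shows "perimeter (ball (x::real^2) r) = ereal (2 * pi * r)"
proof -
 have "cball x r = aff x 1 ` cball 0 r" by (auto simp: aff_image_vimage dist_norm norm_minus_commute)
 hence "per_le (cball x r) (2 * pi * r)" using per_le_aff[OF _ _ per_le_cball0[OF r], of 1 x] by simp
 moreover have "perimeter (ball x r) = perimeter (cball x r)"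
 proof (rule perimeter_cong_AE)
  have "sphere x r \<in> null_sets lborel"
   using negligible_sphere[of x r] by (auto simp: null_sets_completion_iff negligible_iff_null_sets)
  thus "sym_diff (ball x r) (cball x r) \<in> null_sets lborel" by (rule null_sets_subset) auto
 qed auto
 ultimately have "perimeter (ball x r) <= ereal (2 * pi * r)" by (simp add: perimeter_le_iff)
 hence "perimeter (ball x r) < \<infinity>" by (rule le_less_trans) simp
 then obtain p where p: "perimeter (ball x r) = ereal p" "per_le (ball x r) p" by (rule perimeter_real)
 have "2 * sqrt (pi * area (ball x r)) <= p"
  by (rule isoperimetric[OF _ _ p(2)]) (use emeasure_lborel_ball_finite in auto)
 moreover have "sqrt (pi * area (ball x r)) = pi * r"
  using r by (simp add: measure_ball2 real_sqrt_mult power2_eq_square)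
 ultimately have "2 * pi * r <= p" by simp
 thus ?thesis using p \<open>perimeter (ball x r) <= ereal (2 * pi * r)\<close> by auto
qed

section \<open>Asymmetry and deficit\<close>

lemma sym_diff_measure:
 assumes A: "A \<in> sets M" "emeasure M A < \<infinity>" and B: "B \<in> sets M" "emeasure M B < \<infinity>" 
 shows "measure M (sym_diff A B) = measure M A + measure M B - 2 * measure M (A \<inter> B)"
proof -
 have d: "measure M (A - B) = measure M A - measure M (A \<inter> B)" "measure M (B - A) = measure M B - measure M (A \<inter> B)"
  using measure_Diff[of M A "A \<inter> B"] measure_Diff[of M B "A \<inter> B"] A B by (auto simp: Diff_Int Int_commute)
 have "measure M (sym_diff A B) = measure M (A - B) + measure M (B - A)"
  using A B finarea_mono[of M A "A - B"] finarea_mono[of M B "B - A"] by (intro measure_Union) auto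
 thus ?thesis using d by simp
qed

lemma measure_Un_le: 
 assumes "A \<in> sets M" "B \<in> sets M" "emeasure M A < \<infinity>" "emeasure M B < \<infinity>" "C \<subseteq> A \<union> B"
 shows "measure M C <= measure M A + measure M B"
proof -
 have "emeasure M (A \<union> B) < \<infinity>" using assms emeasure_subadditive[of A M B] by (auto intro: le_less_trans)
 hence "measure M C <= measure M (A \<union> B)" using assms by (intro area_mono) auto
 also have "... <= measure M A + measure M B" using assms by (intro measure_Un_le) auto
 finally show ?thesis .
qed

definition area_radius :: "(real^2) set => real" where "area_radius \<Omega> = sqrt (area \<Omega> / pi)"
definition overlap :: "(real^2) set => real => real^2 => real" where "overlap \<Omega> r x = area (\<Omega> \<inter> ball x r)"

text \<open>The area is a parameter so that the normalisation to pi, with comparison disks of radius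
  1, is a mere instance.\<close>

locale planar =
 fixes \<Omega> :: "(real^2) set" and a
 assumes borel[measurable]: "\<Omega> \<in> sets borel" and fin: "finarea \<Omega>" and pos: "0 < a" and area: "area \<Omega> = a"
begin

abbreviation r where "r \<equiv> sqrt (a / pi)"

lemma r_pos: "0 < r" using pos by simp

lemma r_sq: "pi * r^2 = a" using pos by simp

lemma eab: "equal_area_ball \<Omega> x = ball x r" by (simp add: equal_area_ball_def area)

lemma finB: "finarea (ball x r)" using emeasure_lborel_ball_finite by auto

lemma sd: "area (sym_diff \<Omega> (ball x r)) = 2 * (a - overlap \<Omega> r x)"
 using sym_diff_measure[OF _ fin _ finB, of x] r_pos r_sq by (simp add: overlap_def area measure_ball2)

lemma ovl_range: "0 <= overlap \<Omega> r x" "overlap \<Omega> r x <= a"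
 unfolding overlap_def using area_mono[OF _ _ fin, of "\<Omega> \<inter> ball x r"] area by auto

lemma asym: "fasym \<Omega> = (INF x. 2 * (a - overlap \<Omega> r x) / a)"
 unfolding fraenkel_asymmetry_def eab sd area ..

lemma asym_bdd: "bdd_below (range (\<lambda>x. 2 * (a - overlap \<Omega> r x) / a))"
 using ovl_range pos by (intro bdd_belowI[of _ 0]) auto

lemma asym_le: "fasym \<Omega> <= 2 * (a - overlap \<Omega> r x) / a"
 unfolding asym by (rule cINF_lower[OF asym_bdd]) auto

lemma asym_ge: "(\<And>x. overlap \<Omega> r x <= M) ==> 2 * (a - M) / a <= fasym \<Omega>"
 unfolding asym using pos by (intro cINF_greatest) (auto simp: divide_right_mono)

lemma asym_nonneg: "0 <= fasym \<Omega>"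
 using asym_ge[of a] ovl_range by simp

lemma asym_le2: "fasym \<Omega> <= 2"
 using order_trans[OF asym_le[of 0]] ovl_range[of 0] pos by (simp add: divide_le_eq)

lemma asym_approx: "0 < e ==> \<exists>x. 2 * (a - overlap \<Omega> r x) / a < fasym \<Omega> + e"
 using cINF_less_iff[OF _ asym_bdd, of "fasym \<Omega> + e"] unfolding asym by simp

lemma overlap_le: "overlap \<Omega> r x <= a * (1 - fasym \<Omega> / 2)"
 using asym_le[of x] pos by (simp add: field_simps)

end

text \<open>The intersection contains the ball about x of radius r - dist x y. Hence the overlap of
  a set with a moving ball is Lipschitz in the centre.\<close>

lemma ball_overlap_lower:
 fixes x y :: "real^2" assumes r: "0 < r"
 shows "area (ball x r) - area (ball x r \<inter> ball y r) <= 2 * pi * r * dist x y"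
proof (cases "dist x y <= r")
 case True
 have "ball x (r - dist x y) \<subseteq> ball x r \<inter> ball y r"
 proof
  fix z assume "z \<in> ball x (r - dist x y)"
  hence "dist x z < r - dist x y" by simp
  moreover have "dist y z <= dist x y + dist x z" using dist_triangle[of y z x] by (simp add: dist_commute)
  moreover have "0 <= dist x y" by simp
  ultimately have "dist x z < r" "dist y z < r" by linarith+
  thus "z \<in> ball x r \<inter> ball y r" by simp
 qed
 moreover have "finarea (ball x r \<inter> ball y r)"
  by (rule finarea_mono[of lborel "ball x r"]) (use emeasure_lborel_ball_finite[of x r] in simp_all)
 ultimately have "area (ball x (r - dist x y)) <= area (ball x r \<inter> ball y r)"
  by (intro area_mono) simp_all
 moreover have "area (ball x (r - dist x y)) = pi * (r - dist x y)^2" using True by (simp add: measure_ball2)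
 moreover have "area (ball x r) = pi * r^2" using r by (simp add: measure_ball2)
 moreover have "pi * r^2 - pi * (r - dist x y)^2 <= 2 * pi * r * dist x y"
 proof -
  have "pi * r^2 - pi * (r - dist x y)^2 = 2 * pi * r * dist x y - pi * (dist x y)^2"
   by (simp add: power2_eq_square algebra_simps)
  thus ?thesis by simp
 qed
 ultimately show ?thesis by linarith
next
 case False
 have "area (ball x r) = pi * r^2" using r by (simp add: measure_ball2)
 also have "... <= 2 * pi * r * dist x y" using False r by (simp add: power2_eq_square mult_left_mono mult_mono)
 finally show ?thesis using measure_nonneg[of lborel "ball x r \<inter> ball y r"] by linarith
qed

lemma is_ball_asymmetry:
 assumes "\<Omega> \<in> sets borel" "is_ball \<Omega>" shows "fasym \<Omega> = 0"
proof -
 obtain x s where s: "0 < s" "sym_diff \<Omega> (ball x s) \<in> null_sets lborel" using assms by (auto simp: is_ball_def)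
 have "emeasure lborel \<Omega> = emeasure lborel (ball x s)"
 proof (rule emeasure_eq_AE)
  show "AE y in lborel. y \<in> \<Omega> \<longleftrightarrow> y \<in> ball x s" using AE_not_in[OF s(2)] by eventually_elim auto
 qed (use assms in auto)
 hence m: "area \<Omega> = pi * s^2" and f: "finarea \<Omega>"
  using s measure_ball2[of s x] emeasure_lborel_ball_finite[of x s] by (auto simp: measure_def)
 interpret planar \<Omega> "pi * s^2" by unfold_locales (use assms m f s in auto)
 have "sqrt (pi * s^2 / pi) = s" using s by simp
 hence "area (sym_diff \<Omega> (ball x r)) = 0" using s(2) by (simp add: measure_def null_setsD1)
 hence ov: "overlap \<Omega> r x = pi * s^2" unfolding sd by argo
 show ?thesis using asym_le[of x] asym_nonneg unfolding ov by simp
qed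

text \<open>The infimum over centres is attained here: near-optimal centres stay bounded, and the
  overlap is continuous in the centre.\<close>

lemma asymmetry_zero_is_ball:
 assumes "planar \<Omega> a" "fasym \<Omega> = 0" shows "is_ball \<Omega>"
proof -
 interpret planar \<Omega> a by fact
 have "\<exists>x. 2 * (a - overlap \<Omega> r x) / a < 1 / real (n + 2)" for n :: nat
  using asym_approx[of "1 / real (n + 2)"] assms(2) by simp
 then obtain x where x: "\<And>n::nat. 2 * (a - overlap \<Omega> r (x n)) / a < 1 / real (n + 2)" by metis
 have x': "2 * (a - overlap \<Omega> r (x n)) < a / real (n + 2)" for n
  using x[of n] pos by (simp add: field_simps)
 \<comment> \<open>Both balls contain more than three quarters of the area of \<Omega>, so they
   cannot be disjoint.\<close>
 have bd: "dist (x 0) (x n) < 2 * r" for n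
 proof (rule ccontr)
  assume "\<not> dist (x 0) (x n) < 2 * r"
  hence "ball (x 0) r \<inter> ball (x n) r = {}" by (intro disjoint_ballI) simp
  moreover have "emeasure lborel (\<Omega> \<inter> ball y r) \<noteq> \<infinity>" for y using finarea_mono[OF fin, of "\<Omega> \<inter> ball y r"] by auto
  ultimately have "area (\<Omega> \<inter> ball (x 0) r) + area (\<Omega> \<inter> ball (x n) r) = area ((\<Omega> \<inter> ball (x 0) r) \<union> (\<Omega> \<inter> ball (x n) r))"
   by (intro measure_Union[symmetric]) auto
  also have "... <= area \<Omega>" by (intro area_mono fin) auto
  finally have "overlap \<Omega> r (x 0) + overlap \<Omega> r (x n) <= a" by (simp add: overlap_def area)
  moreover have "a / real (n + 2) <= a / 2" using pos by (intro divide_left_mono) auto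
  moreover have "2 * (a - overlap \<Omega> r (x 0)) < a / 2" using x'[of 0] by simp
  ultimately show False using x'[of n] pos by argo
 qed
 have "range x \<subseteq> cball (x 0) (2 * r)" using less_imp_le[OF bd] by auto
 then obtain l q where l: "strict_mono q" "(x \<circ> q) \<longlonglongrightarrow> l"
  using compact_imp_seq_compact[OF compact_cball[of "x 0" "2*r"]] unfolding seq_compact_def by blast
 have "a - overlap \<Omega> r l <= 0"
 proof (rule LIMSEQ_le_const)
  show "(\<lambda>n. a * (1 / real (q n + 2)) / 2 + 2 * pi * r * dist ((x \<circ> q) n) l) \<longlonglongrightarrow> 0"
  proof -
   have "(\<lambda>n. 1 / real (n + 2)) \<longlonglongrightarrow> 0" using LIMSEQ_ignore_initial_segment[OF lim_1_over_n, of 2] by simp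
   from LIMSEQ_subseq_LIMSEQ[OF this l(1)] have "(\<lambda>n. 1 / real (q n + 2)) \<longlonglongrightarrow> 0" by (simp add: o_def)
   moreover have "(\<lambda>n. dist ((x \<circ> q) n) l) \<longlonglongrightarrow> 0" using l(2) by (rule tendsto_dist_iff[THEN iffD1])
   ultimately have "(\<lambda>n. a * (1 / real (q n + 2)) / 2 + 2 * pi * r * dist ((x \<circ> q) n) l) \<longlonglongrightarrow> a * 0 / 2 + 2 * pi * r * 0" 
    by (intro tendsto_intros) simp_all
   thus ?thesis by simp
  qed
  have "a - overlap \<Omega> r l <= a * (1 / real (q n + 2)) / 2 + 2 * pi * r * dist ((x \<circ> q) n) l" for n
  proof -
   let ?y = "x (q n)"
   have "overlap \<Omega> r ?y <= area (\<Omega> \<inter> ball l r) + area (ball ?y r - ball l r)"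
    unfolding overlap_def using finB finarea_mono[OF fin, of "\<Omega> \<inter> ball l r"] finarea_mono[OF finB, of "ball ?y r - ball l r" ?y]
    by (intro measure_Un_le) auto
   also have "area (ball ?y r - ball l r) = area (ball ?y r) - area (ball ?y r \<inter> ball l r)"
    using measure_Diff[of lborel "ball ?y r" "ball ?y r \<inter> ball l r"] finB[of ?y] by (simp add: Diff_Int)
   also have "... <= 2 * pi * r * dist ?y l" by (rule ball_overlap_lower[OF r_pos])
   finally have "overlap \<Omega> r ?y <= overlap \<Omega> r l + 2 * pi * r * dist ?y l" by (simp add: overlap_def)
   moreover have "a - overlap \<Omega> r ?y <= a * (1 / real (q n + 2)) / 2"
   proof -
    have half: "X <= Y / 2" if "2 * X < Y" for X Y :: real using that by simp
    show ?thesis unfolding times_divide_eq_right mult_1_right by (rule half[OF x'])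
   qed
   ultimately show ?thesis by simp
  qed
  thus "\<exists>N. \<forall>n\<ge>N. a - overlap \<Omega> r l <= a * (1 / real (q n + 2)) / 2 + 2 * pi * r * dist ((x \<circ> q) n) l" by blast
 qed
 hence "area (sym_diff \<Omega> (ball l r)) = 0" using sd[of l] ovl_range[of l] by simp
 moreover have "finarea (sym_diff \<Omega> (ball l r))"
 proof -
  have "emeasure lborel (\<Omega> \<union> ball l r) <= emeasure lborel \<Omega> + emeasure lborel (ball l r)" by (intro emeasure_subadditive) auto
  also have "... < \<infinity>" using fin finB[of l] by simp
  finally show ?thesis by (rule finarea_mono) auto
 qed
 ultimately have "sym_diff \<Omega> (ball l r) \<in> null_sets lborel"
  by (auto simp: null_sets_def emeasure_eq_ennreal_measure less_top)
 thus ?thesis unfolding is_ball_def using r_pos by blast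
qed

section \<open>Admissible sets and scale invariance of the quotient\<close>

lemma admissible_planar:
 assumes "admissible \<Omega>" shows "planar \<Omega> (area \<Omega>)"
 using assms unfolding admissible_def planar_def by (auto simp: measure_def enn2real_positive_iff less_top)

lemma admissible_iff: "admissible \<Omega> \<longleftrightarrow> (\<exists>a. planar \<Omega> a \<and> fasym \<Omega> \<noteq> 0)"
proof
 assume A: "admissible \<Omega>"
 have "fasym \<Omega> \<noteq> 0" using asymmetry_zero_is_ball[OF admissible_planar[OF A]] A by (auto simp: admissible_def)
 thus "\<exists>a. planar \<Omega> a \<and> fasym \<Omega> \<noteq> 0" using admissible_planar[OF A] by blast
next
 assume "\<exists>a. planar \<Omega> a \<and> fasym \<Omega> \<noteq> 0"
 then obtain a where "planar \<Omega> a" and n: "fasym \<Omega> \<noteq> 0" by blast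
 then interpret planar \<Omega> a by simp
 have "emeasure lborel \<Omega> \<noteq> 0" using area pos by (auto simp: measure_def)
 thus "admissible \<Omega>" unfolding admissible_def using is_ball_asymmetry[OF borel] n fin by (auto simp: zero_less_iff_neq_zero)
qed

context planar
begin

lemma deficit: "isoperimetric_deficit \<Omega> = (perimeter \<Omega> - ereal (2 * sqrt (pi * a))) / ereal (2 * sqrt (pi * a))"
proof -
 have "pi * r = sqrt (pi * a)"
 proof -
  have "sqrt (pi * a) = sqrt (pi^2 * (a / pi))" by (simp add: power2_eq_square)
  thus ?thesis by (simp only: real_sqrt_mult) simp
 qed
 hence "2 * pi * r = 2 * sqrt (pi * a)" by simp
 thus ?thesis
  unfolding isoperimetric_deficit_def eab perimeter_ball[OF r_pos] by (simp only:)
qed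

lemma quotient_real:
 assumes "perimeter \<Omega> = ereal p" "fasym \<Omega> \<noteq> 0"
 shows "isoperimetric_quotient \<Omega> = ereal ((p / (2 * sqrt (pi * a)) - 1) / (fasym \<Omega>)^2)"
proof -
 have "0 < sqrt (pi * a)" using pos by simp
 thus ?thesis unfolding isoperimetric_quotient_def deficit assms(1) using assms(2) pos
  by (simp add: diff_divide_distrib)
qed

lemma quotient_infinite:
 assumes "perimeter \<Omega> = \<infinity>" "fasym \<Omega> \<noteq> 0"
 shows "isoperimetric_quotient \<Omega> = \<infinity>"
 unfolding isoperimetric_quotient_def deficit assms(1) using assms(2) pos
 by (simp add: divide_ereal_def)

lemma iso: "perimeter \<Omega> = ereal p ==> 2 * sqrt (pi * a) <= p"
 using isoperimetric[OF borel fin, of p] by (simp add: area flip: perimeter_le_iff)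

end

lemma asymmetry_aff:
 assumes "planar \<Omega> a" "0 < c" shows "fasym (aff v c ` \<Omega>) = fasym \<Omega>" "planar (aff v c ` \<Omega>) (c^2 * a)"
proof -
 interpret A: planar \<Omega> a by fact
 show P: "planar (aff v c ` \<Omega>) (c^2 * a)"
 proof
  show "finarea (aff v c ` \<Omega>)" using A.fin assms(2) by (simp add: emeasure_aff_image ennreal_mult_less_top less_top)
  show "area (aff v c ` \<Omega>) = c^2 * a" using assms(2) A.area by (simp add: measure_aff_image)
 qed (use assms(2) A.pos in \<open>auto intro: borel_aff_image\<close>)
 interpret B: planar "aff v c ` \<Omega>" "c^2 * a" by fact
 have Br: "B.r = c * A.r" using assms(2) by (simp add: real_sqrt_mult real_sqrt_divide)
 have img: "ball (aff v c x) (c * A.r) = aff v c ` ball x A.r" for x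
 proof -
  have "y \<in> ball (aff v c x) (c * A.r) \<longleftrightarrow> y \<in> aff v c ` ball x A.r" for y
  proof -
   have "dist (aff v c x) y = c * dist x ((y - v) /\<^sub>R c)"
   proof -
    have "aff v c x - y = c *\<^sub>R (x - (y - v) /\<^sub>R c)" using assms(2) by (simp add: aff_def algebra_simps)
    thus ?thesis using assms(2) by (simp add: dist_norm)
   qed
   thus ?thesis using assms(2) by (simp add: aff_image_vimage)
  qed
  thus ?thesis by blast
 qed
 have o: "overlap (aff v c ` \<Omega>) B.r (aff v c x) = c^2 * overlap \<Omega> A.r x" for x
 proof -
  have "aff v c ` \<Omega> \<inter> ball (aff v c x) (c * A.r) = aff v c ` (\<Omega> \<inter> ball x A.r)"
   unfolding img using inj_aff[OF assms(2), of v] by (simp add: image_Int)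
  thus ?thesis unfolding overlap_def Br using assms(2) by (simp add: measure_aff_image)
 qed
 have key: "2 * (c^2 * a - c^2 * t) / (c^2 * a) = 2 * (a - t) / a" for t
 proof -
  have "2 * (c^2 * a - c^2 * t) / (c^2 * a) = (c^2 * (2 * (a - t))) / (c^2 * a)" by (simp add: algebra_simps)
  also have "... = 2 * (a - t) / a" using assms(2) by (intro mult_divide_mult_cancel_left) simp
  finally show ?thesis .
 qed
 have sur: "\<exists>x. y = aff v c x" for y using aff_image_vimage[OF assms(2), of v UNIV] by blast
 show "fasym (aff v c ` \<Omega>) = fasym \<Omega>"
 proof (rule antisym)
  show "fasym (aff v c ` \<Omega>) <= fasym \<Omega>"
   unfolding A.asym
  proof (rule cINF_greatest)
   fix x show "fasym (aff v c ` \<Omega>) <= 2 * (a - overlap \<Omega> A.r x) / a"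
    using B.asym_le[of "aff v c x"] unfolding o key .
  qed simp
  show "fasym \<Omega> <= fasym (aff v c ` \<Omega>)"
   unfolding B.asym
  proof (rule cINF_greatest)
   fix y
   obtain x where y: "y = aff v c x" using sur by blast
   show "fasym \<Omega> <= 2 * (c^2 * a - overlap (aff v c ` \<Omega>) B.r y) / (c^2 * a)"
    using A.asym_le[of x] unfolding y o key .
  qed simp
 qed
qed

lemma quotient_aff:
 assumes "planar \<Omega> a" "0 < c" "fasym \<Omega> \<noteq> 0" shows "isoperimetric_quotient (aff v c ` \<Omega>) = isoperimetric_quotient \<Omega>"
proof -
 interpret A: planar \<Omega> a by fact
 interpret B: planar "aff v c ` \<Omega>" "c^2 * a" by (rule asymmetry_aff[OF assms(1,2)])
 note e = asymmetry_aff(1)[OF assms(1,2)] perimeter_aff[OF A.borel assms(2)]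
 show ?thesis
 proof (cases "perimeter \<Omega>")
  case (real p)
  have "sqrt (pi * (c^2 * a)) = c * sqrt (pi * a)" using assms(2) by (simp add: real_sqrt_mult)
  thus ?thesis using A.quotient_real[OF real assms(3)] B.quotient_real[of "c * p"] real e assms by simp
 next
  case PInf
  thus ?thesis using A.quotient_infinite B.quotient_infinite e assms by simp
 next
  case MInf thus ?thesis using perimeter_nonneg[of \<Omega>] by simp
 qed
qed

text \<open>The centres are at distance 6, so a disk of radius sqrt 2 meets at most one of the two
  disks and covers at most half of the area. The asymmetry is therefore at least 1, and the deficit
  is at most sqrt 2 - 1.\<close>

lemma two_balls:
 obtains \<Omega> where "admissible \<Omega>" "isoperimetric_quotient \<Omega> <= ereal (sqrt 2 - 1)"
proof -
 define w where "w = vec2 6 0"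
 define \<Omega> where "\<Omega> = ball (0::real^2) 1 \<union> ball w 1"
 have dw: "dist 0 w = 6" by (simp add: w_def norm_vec2)
 have dj: "ball (0::real^2) 1 \<inter> ball w 1 = {}" by (rule disjoint_ballI) (use dw in simp)
 have fb: "finarea (ball (x::real^2) 1)" for x using emeasure_lborel_ball_finite by auto
 have m: "area \<Omega> = 2 * pi" unfolding \<Omega>_def using dj fb by (subst measure_Union) (auto simp: measure_ball2 less_top)
 have f: "finarea \<Omega>" unfolding \<Omega>_def using fb emeasure_subadditive[of "ball (0::real^2) 1" lborel "ball w 1"] 
  by (auto intro: le_less_trans)
 interpret planar \<Omega> "2 * pi" by unfold_locales (use m f in \<open>auto simp: \<Omega>_def\<close>)
 have r2: "sqrt (2 * pi / pi) = sqrt 2" by simp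
 have s2: "sqrt 2 < 3/2" by (rule real_less_lsqrt) (auto simp: power2_eq_square)
 have "overlap \<Omega> r x <= pi" for x
 proof -
  have "\<exists>y. \<Omega> \<inter> ball x (sqrt 2) \<subseteq> ball y 1"
  proof (cases "ball 0 1 \<inter> ball x (sqrt 2) = {}")
   case True thus ?thesis unfolding \<Omega>_def by (intro exI[of _ w]) auto
  next
   case False
   then obtain z where z: "dist 0 z < 1" "dist x z < sqrt 2" by auto
   have "\<not> (dist w v < 1 \<and> dist x v < sqrt 2)" for v
    using z s2 dw dist_triangle[of 0 w v] dist_triangle[of 0 v z] dist_triangle[of z v x] dist_commute[of z x] dist_commute[of v w] by linarith
   thus ?thesis unfolding \<Omega>_def by (intro exI[of _ 0]) auto
  qed
  then obtain y where "\<Omega> \<inter> ball x (sqrt 2) \<subseteq> ball y 1" ..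
  hence "overlap \<Omega> (sqrt 2) x <= area (ball y 1)" unfolding overlap_def by (intro area_mono fb) auto
  thus ?thesis by (simp add: r2 measure_ball2)
 qed
 from asym_ge[OF this] have l1: "1 <= fasym \<Omega>" by simp
 have "per_le \<Omega> (4 * pi)" unfolding per_le_def
 proof
  fix phi assume phi: "phi \<in> test_fields"
  have "per_le (ball c 1) (2 * pi * 1)" for c using perimeter_ball[of 1 c] by (simp flip: perimeter_le_iff)
  moreover have "(LINT x:\<Omega>|lborel. divergence phi x) = (LINT x:ball 0 1|lborel. divergence phi x) + (LINT x:ball w 1|lborel. divergence phi x)"
   unfolding \<Omega>_def using dj phi by (intro set_integral_Un divergence_set_integrable) auto
  ultimately show "(LINT x:\<Omega>|lborel. divergence phi x) <= 4 * pi"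
   using per_leD[OF _ phi, of "ball 0 1" "2 * pi * 1"] per_leD[OF _ phi, of "ball w 1" "2 * pi * 1"] by simp
 qed
 hence pl: "perimeter \<Omega> <= ereal (4 * pi)" by (simp add: perimeter_le_iff)
 hence "perimeter \<Omega> < \<infinity>" by (rule le_less_trans) simp
 then obtain p where p: "perimeter \<Omega> = ereal p" by (rule perimeter_real)
 hence p4: "p <= 4 * pi" using pl by simp
 have pp: "2 * sqrt (pi * (2 * pi)) <= p" by (rule iso[OF p])
 have sq: "sqrt (pi * (2 * pi)) = sqrt 2 * pi"
 proof -
  have "sqrt (pi * (2 * pi)) = sqrt (2 * pi^2)" by (simp add: power2_eq_square algebra_simps)
  thus ?thesis by (simp add: real_sqrt_mult)
 qed
 have "p / (2 * sqrt (pi * (2 * pi))) - 1 <= 4 * pi / (2 * sqrt (pi * (2 * pi))) - 1"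
  using p4 by (intro diff_right_mono divide_right_mono) auto
 also have "... = sqrt 2 - 1" unfolding sq by (simp add: field_simps)
 finally have d: "p / (2 * sqrt (pi * (2 * pi))) - 1 <= sqrt 2 - 1" .
 have d0: "0 <= p / (2 * sqrt (pi * (2 * pi))) - 1" using pp by (simp add: le_divide_eq)
 have "(p / (2 * sqrt (pi * (2 * pi))) - 1) / (fasym \<Omega>)^2 <= (p / (2 * sqrt (pi * (2 * pi))) - 1) / 1"
  using l1 d0 by (intro divide_left_mono) (auto simp: power_mono[of 1 _ 2, simplified])
 with d have "isoperimetric_quotient \<Omega> <= ereal (sqrt 2 - 1)"
  using quotient_real[OF p] l1 by simp
 moreover have "admissible \<Omega>" unfolding admissible_iff using l1 planar_axioms by (intro exI[of _ "2*pi"]) auto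
 ultimately show thesis using that by blast
qed

section \<open>Wirtinger inequalities\<close>

definition J :: "(real => real) => real" where "J f = integral {0..2*pi} f"

abbreviation Jc :: "(real => real) => nat => real" where "Jc f k == J (\<lambda>x. f x * cos (real k * x))"
abbreviation Js :: "(real => real) => nat => real" where "Js f k == J (\<lambda>x. f x * sin (real k * x))"
abbreviation J2 :: "(real => real) => real" where "J2 f == J (\<lambda>x. (f x)^2)"
abbreviation cont :: "(real => real) => bool" where "cont f \<equiv> continuous_on {0..2*pi} f"

lemma J_add: "cont f ==> cont g ==> J (\<lambda>x. f x + g x) = J f + J g"
 unfolding J_def by (intro Henstock_Kurzweil_Integration.integral_add integrable_continuous_real)
lemma J_diff: "cont f ==> cont g ==> J (\<lambda>x. f x - g x) = J f - J g"
 unfolding J_def by (intro Henstock_Kurzweil_Integration.integral_diff integrable_continuous_real)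
lemma J_cmult: "J (\<lambda>x. c * f x) = c * J f" unfolding J_def by simp
lemma J_mono: "cont f ==> cont g ==> (\<And>x. x \<in> {0..2*pi} ==> f x <= g x) ==> J f <= J g"
 unfolding J_def by (intro integral_le integrable_continuous_real)
lemma J_const: "J (\<lambda>x. c) = 2 * pi * c" unfolding J_def by simp
lemma J_nonneg: "cont f ==> (\<And>x. x \<in> {0..2*pi} ==> 0 <= f x) ==> 0 <= J f"
 using J_mono[of "\<lambda>x. 0" f] by (simp add: J_const)
lemma J_cong: "(\<And>x. x \<in> {0..2*pi} ==> f x = g x) ==> J f = J g"
 unfolding J_def by (rule Henstock_Kurzweil_Integration.integral_cong)
lemma J_sum: "finite I ==> (\<And>i. i \<in> I ==> cont (f i)) ==> J (\<lambda>x. \<Sum>i\<in>I. f i x) = (\<Sum>i\<in>I. J (f i))"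
 unfolding J_def by (intro Henstock_Kurzweil_Integration.integral_sum integrable_continuous_real) auto
lemma J_abs: "cont f ==> \<bar>J f\<bar> <= J (\<lambda>x. \<bar>f x\<bar>)"
proof -
 assume f: "cont f"
 hence c: "cont (\<lambda>x. \<bar>f x\<bar>)" "cont (\<lambda>x. - \<bar>f x\<bar>)" by (auto intro!: continuous_intros)
 have "J f <= J (\<lambda>x. \<bar>f x\<bar>)" using f c by (intro J_mono) auto
 moreover have "J (\<lambda>x. - \<bar>f x\<bar>) <= J f" using f c by (intro J_mono) auto
 ultimately show ?thesis using J_cmult[of "-1" "\<lambda>x. \<bar>f x\<bar>"] by simp
qed

lemma J_close:
 assumes "cont f" "cont g" "\<And>x. x \<in> {0..2*pi} ==> \<bar>f x - g x\<bar> <= d" shows "\<bar>J f - J g\<bar> <= 2 * pi * d"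
proof -
 have "\<bar>J (\<lambda>x. f x - g x)\<bar> <= J (\<lambda>x. \<bar>f x - g x\<bar>)" by (intro J_abs continuous_intros assms)
 also have "... <= J (\<lambda>x. d)" by (intro J_mono continuous_intros assms)
 finally show ?thesis using assms by (simp add: J_const J_diff)
qed

lemma J_FTC: "(\<And>x. (F has_real_derivative f x) (at x)) ==> J f = F (2*pi) - F 0"
 unfolding J_def
 by (intro integral_unique fundamental_theorem_of_calculus) 
  (auto simp: has_real_derivative_iff_has_vector_derivative intro: has_vector_derivative_at_within)

lemma J_FTC': "(\<And>x. x \<in> {0..2*pi} ==> (F has_real_derivative f x) (at x)) ==> J f = F (2*pi) - F 0"
 unfolding J_def
 by (intro integral_unique fundamental_theorem_of_calculus) 
  (auto simp: has_real_derivative_iff_has_vector_derivative intro: has_vector_derivative_at_within)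

lemma J_CS:
 assumes "cont f" "cont g" shows "(J (\<lambda>x. f x * g x))^2 <= J2 f * J2 g"
proof -
 have c: "cont (\<lambda>x. (f x)^2)" "cont (\<lambda>x. (g x)^2)" "cont (\<lambda>x. f x * g x)" using assms by (auto intro!: continuous_intros)
 have q: "0 <= J2 f + 2 * t * J (\<lambda>x. f x * g x) + t^2 * J2 g" for t
 proof -
  have "0 <= J (\<lambda>x. (f x + t * g x)^2)" using assms by (intro J_nonneg) (auto intro!: continuous_intros)
  also have "... = J (\<lambda>x. (f x)^2 + (2 * t * (f x * g x) + t^2 * (g x)^2))"
   by (intro J_cong) (simp add: power2_eq_square algebra_simps)
  also have "... = J2 f + (2 * t * J (\<lambda>x. f x * g x) + t^2 * J2 g)"
   using c by (simp add: J_add J_cmult continuous_intros)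
  finally show ?thesis by simp
 qed
 define a b d where "a = J2 g" and "b = J (\<lambda>x. f x * g x)" and "d = J2 f"
 have a0: "0 <= a" "0 <= d" unfolding a_def d_def using c by (auto intro!: J_nonneg)
 have q': "0 <= d + 2 * t * b + t^2 * a" for t using q by (simp add: a_def b_def d_def)
 have "b^2 <= d * a"
 proof (cases "a = 0")
  case True
  have "b = 0"
  proof (rule ccontr)
   assume b: "b \<noteq> 0"
   show False using q'[of "- (d + 1) / b"] b True a0 by simp
  qed
  thus ?thesis using True by simp
 next
  case False
  hence "0 <= a * (d + 2 * (- b / a) * b + (- b / a)^2 * a)" by (intro mult_nonneg_nonneg q' a0(1))
  also have "... = d * a - b^2" using False by (simp add: field_simps power2_eq_square)
  finally show ?thesis by simp
 qed
 thus ?thesis by (simp add: a_def b_def d_def)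
qed

lemma J_cos: "J (\<lambda>x. cos (of_int k * x)) = (if k = 0 then 2 * pi else 0)" and J_sin: "J (\<lambda>x. sin (of_int k * x)) = 0"
proof -
 have s: "sin (of_int k * (2 * pi)) = 0" "cos (of_int k * (2 * pi)) = 1" for k :: int
  using sin_int_2pin[of k] cos_int_2pin[of k] by (simp_all add: mult.commute)
 show "J (\<lambda>x. cos (of_int k * x)) = (if k = 0 then 2 * pi else 0)"
 proof (cases "k = 0")
  case False
  have "J (\<lambda>x. cos (of_int k * x)) = sin (of_int k * (2 * pi)) / of_int k - sin (of_int k * 0) / of_int k"
   using False by (intro J_FTC) (auto intro!: derivative_eq_intros)
  thus ?thesis using False s by simp
 qed (simp add: J_const)
 show "J (\<lambda>x. sin (of_int k * x)) = 0"
 proof (cases "k = 0")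
  case False
  have "J (\<lambda>x. sin (of_int k * x)) = - cos (of_int k * (2 * pi)) / of_int k - - cos (of_int k * 0) / of_int k"
   using False by (intro J_FTC) (auto intro!: derivative_eq_intros)
  thus ?thesis using False s by simp
 qed (simp add: J_const)
qed

lemma J_orth:
 fixes j k :: nat
 shows "J (\<lambda>x. cos (real j * x) * cos (real k * x)) = (if j = k then (if k = 0 then 2 * pi else pi) else 0)"
  "J (\<lambda>x. sin (real j * x) * sin (real k * x)) = (if j = k \<and> k \<noteq> 0 then pi else 0)"
  "J (\<lambda>x. sin (real j * x) * cos (real k * x)) = 0"
  "J (\<lambda>x. cos (real j * x) * sin (real k * x)) = 0"
proof -
 have c: "cont (\<lambda>x. cos (of_int m * x))" "cont (\<lambda>x. sin (of_int m * x))" for m by (auto intro!: continuous_intros)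
 have a: "of_int (int j - int k) * x = real j * x - real k * x" "of_int (int j + int k) * x = real j * x + real k * x" for x :: real
  by (simp_all add: algebra_simps)
 have "J (\<lambda>x. cos (real j * x) * cos (real k * x)) = J (\<lambda>x. (1/2) * (cos (of_int (int j - int k) * x) + cos (of_int (int j + int k) * x)))"
  unfolding a by (intro J_cong) (simp add: cos_add cos_diff)
 also have "... = (1/2) * (J (\<lambda>x. cos (of_int (int j - int k) * x)) + J (\<lambda>x. cos (of_int (int j + int k) * x)))"
  unfolding J_cmult by (subst J_add[OF c(1) c(1)]) simp
 finally show "J (\<lambda>x. cos (real j * x) * cos (real k * x)) = (if j = k then (if k = 0 then 2 * pi else pi) else 0)"
  unfolding J_cos by (auto simp: algebra_simps)
 have "J (\<lambda>x. sin (real j * x) * sin (real k * x)) = J (\<lambda>x. (1/2) * (cos (of_int (int j - int k) * x) - cos (of_int (int j + int k) * x)))"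
  unfolding a by (intro J_cong) (simp add: cos_add cos_diff)
 also have "... = (1/2) * (J (\<lambda>x. cos (of_int (int j - int k) * x)) - J (\<lambda>x. cos (of_int (int j + int k) * x)))"
  unfolding J_cmult by (subst J_diff[OF c(1) c(1)]) simp
 finally show "J (\<lambda>x. sin (real j * x) * sin (real k * x)) = (if j = k \<and> k \<noteq> 0 then pi else 0)"
  unfolding J_cos by (auto simp: algebra_simps)
 have "J (\<lambda>x. sin (real j * x) * cos (real k * x)) = J (\<lambda>x. (1/2) * (sin (of_int (int j - int k) * x) + sin (of_int (int j + int k) * x)))"
  unfolding a by (intro J_cong) (simp add: sin_add sin_diff)
 also have "... = (1/2) * (J (\<lambda>x. sin (of_int (int j - int k) * x)) + J (\<lambda>x. sin (of_int (int j + int k) * x)))"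
  unfolding J_cmult by (subst J_add[OF c(2) c(2)]) simp
 finally show "J (\<lambda>x. sin (real j * x) * cos (real k * x)) = 0" unfolding J_sin by simp
 have "J (\<lambda>x. cos (real j * x) * sin (real k * x)) = J (\<lambda>x. (1/2) * (sin (of_int (int j + int k) * x) - sin (of_int (int j - int k) * x)))"
  unfolding a by (intro J_cong) (simp add: sin_add sin_diff)
 also have "... = (1/2) * (J (\<lambda>x. sin (of_int (int j + int k) * x)) - J (\<lambda>x. sin (of_int (int j - int k) * x)))"
  unfolding J_cmult by (subst J_diff[OF c(2) c(2)]) simp
 finally show "J (\<lambda>x. cos (real j * x) * sin (real k * x)) = 0" unfolding J_sin by simp
qed

section \<open>Trigonometric polynomials and their density\<close>

definition trig :: "nat set => (nat => real) => (nat => real) => real => real" where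
 "trig I a b x = (\<Sum>k\<in>I. a k * cos (real k * x) + b k * sin (real k * x))"

lemma continuous_on_trig[continuous_intros]: "continuous_on S (trig I a b)"
 unfolding trig_def by (intro continuous_intros)

lemma trig_deriv: "(trig I a b has_real_derivative trig I (\<lambda>k. real k * b k) (\<lambda>k. - real k * a k) x) (at x)"
 unfolding trig_def by (rule DERIV_sum) (auto intro!: derivative_eq_intros simp: algebra_simps)

lemma J_mult_trig:
 assumes "finite I" "cont f"
 shows "J (\<lambda>x. f x * trig I a b x) = (\<Sum>k\<in>I. a k * Jc f k + b k * Js f k)"
proof -
 have "J (\<lambda>x. f x * trig I a b x) = J (\<lambda>x. \<Sum>k\<in>I. a k * (f x * cos (real k * x)) + b k * (f x * sin (real k * x)))"
  unfolding trig_def by (intro J_cong) (simp add: sum_distrib_left algebra_simps)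
 also have "... = (\<Sum>k\<in>I. J (\<lambda>x. a k * (f x * cos (real k * x)) + b k * (f x * sin (real k * x))))"
  using assms by (intro J_sum) (auto intro!: continuous_intros)
 also have "... = (\<Sum>k\<in>I. a k * Jc f k + b k * Js f k)"
  using assms by (intro sum.cong refl) (subst J_add, auto intro!: continuous_intros simp: J_cmult)
 finally show ?thesis .
qed

lemma J_trig_coeff:
 assumes "finite I" "k \<noteq> 0"
 shows "Jc (trig I a b) k = (if k \<in> I then pi * a k else 0)"
  "Js (trig I a b) k = (if k \<in> I then pi * b k else 0)"
proof -
 have "Jc (trig I a b) k = J (\<lambda>x. cos (real k * x) * trig I a b x)" by (simp add: mult.commute)
 also have "... = (\<Sum>j\<in>I. a j * J (\<lambda>x. cos (real k * x) * cos (real j * x)) + b j * J (\<lambda>x. cos (real k * x) * sin (real j * x)))"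
  by (intro J_mult_trig assms continuous_intros)
 also have "... = (\<Sum>j\<in>I. if j = k then pi * a k else 0)"
  using assms by (intro sum.cong refl) (auto simp: J_orth)
 finally show "Jc (trig I a b) k = (if k \<in> I then pi * a k else 0)" using assms by (simp add: sum.delta)
 have "Js (trig I a b) k = J (\<lambda>x. sin (real k * x) * trig I a b x)" by (simp add: mult.commute)
 also have "... = (\<Sum>j\<in>I. a j * J (\<lambda>x. sin (real k * x) * cos (real j * x)) + b j * J (\<lambda>x. sin (real k * x) * sin (real j * x)))"
  by (intro J_mult_trig assms continuous_intros)
 also have "... = (\<Sum>j\<in>I. if j = k then pi * b k else 0)"
  using assms by (intro sum.cong refl) (auto simp: J_orth)
 finally show "Js (trig I a b) k = (if k \<in> I then pi * b k else 0)" using assms by (simp add: sum.delta)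
qed

lemma J_trig_square:
 assumes "finite I" "0 \<notin> I"
 shows "J2 (trig I a b) = pi * (\<Sum>k\<in>I. (a k)^2 + (b k)^2)"
proof -
 have "J2 (trig I a b) = (\<Sum>k\<in>I. a k * Jc (trig I a b) k + b k * Js (trig I a b) k)"
  unfolding power2_eq_square by (intro J_mult_trig assms continuous_intros)
 also have "... = (\<Sum>k\<in>I. pi * ((a k)^2 + (b k)^2))"
 proof (intro sum.cong refl)
  fix k assume "k \<in> I"
  hence "k \<noteq> 0" using assms(2) by metis
  from J_trig_coeff[OF assms(1) this] \<open>k \<in> I\<close>
  show "a k * Jc (trig I a b) k + b k * Js (trig I a b) k = pi * ((a k)^2 + (b k)^2)"
   by (simp add: power2_eq_square algebra_simps)
 qed
 finally show ?thesis by (simp add: sum_distrib_left)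
qed

text \<open>This class is closed under products by the product-to-sum formulas. It mediates between
  polynomials on the unit circle and the explicit coefficient lists of \<open>trig\<close>.\<close>

inductive TP :: "(real => real) => bool" where
 TP_cos: "TP (\<lambda>x. c * cos (real k * x))"
| TP_sin: "TP (\<lambda>x. c * sin (real k * x))"
| TP_add: "TP f ==> TP g ==> TP (\<lambda>x. f x + g x)"

lemma TP_cos_int: "TP (\<lambda>x. c * cos (of_int k * x))" and TP_sin_int: "TP (\<lambda>x. c * sin (of_int k * x))"
proof -
 have "\<exists>n. k = int n \<or> k = - int n" by (cases k rule: int_cases2) auto
 then obtain n where n: "k = int n \<or> k = - int n" ..
 show "TP (\<lambda>x. c * cos (of_int k * x))" using n TP_cos[of c n] by auto
 show "TP (\<lambda>x. c * sin (of_int k * x))" using n TP_sin[of c n] TP_sin[of "-c" n] by auto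
qed

lemma TP_mult_cos: "TP f ==> TP (\<lambda>x. (c * cos (real k * x)) * f x)"
proof (induction rule: TP.induct)
 case (TP_cos d j)
 have "TP (\<lambda>x. (c*d/2) * cos (of_int (int k - int j) * x) + (c*d/2) * cos (of_int (int k + int j) * x))"
  by (intro TP_add TP_cos_int)
 moreover have "(c*d/2) * cos (of_int (int k - int j) * x) + (c*d/2) * cos (of_int (int k + int j) * x) = (c * cos (real k * x)) * (d * cos (real j * x))" for x
  by (simp add: left_diff_distrib distrib_right cos_add cos_diff) (simp add: field_simps)
 ultimately show ?case by simp
next
 case (TP_sin d j)
 have "TP (\<lambda>x. (c*d/2) * sin (of_int (int k + int j) * x) + (-c*d/2) * sin (of_int (int k - int j) * x))"
  by (intro TP_add TP_sin_int)
 moreover have "(c*d/2) * sin (of_int (int k + int j) * x) + (-c*d/2) * sin (of_int (int k - int j) * x) = (c * cos (real k * x)) * (d * sin (real j * x))" for x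
  by (simp add: left_diff_distrib distrib_right sin_add sin_diff) (simp add: field_simps)
 ultimately show ?case by simp
next
 case (TP_add f g)
 from TP.TP_add[OF TP_add.IH] show ?case by (simp add: algebra_simps)
qed

lemma TP_mult_sin: "TP f ==> TP (\<lambda>x. (c * sin (real k * x)) * f x)"
proof (induction rule: TP.induct)
 case (TP_cos d j)
 have "TP (\<lambda>x. (c*d/2) * sin (of_int (int k - int j) * x) + (c*d/2) * sin (of_int (int k + int j) * x))"
  by (intro TP_add TP_sin_int)
 moreover have "(c*d/2) * sin (of_int (int k - int j) * x) + (c*d/2) * sin (of_int (int k + int j) * x) = (c * sin (real k * x)) * (d * cos (real j * x))" for x
  by (simp add: left_diff_distrib distrib_right sin_add sin_diff) (simp add: field_simps)
 ultimately show ?case by simp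
next
 case (TP_sin d j)
 have "TP (\<lambda>x. (c*d/2) * cos (of_int (int k - int j) * x) + (-c*d/2) * cos (of_int (int k + int j) * x))"
  by (intro TP_add TP_cos_int)
 moreover have "(c*d/2) * cos (of_int (int k - int j) * x) + (-c*d/2) * cos (of_int (int k + int j) * x) = (c * sin (real k * x)) * (d * sin (real j * x))" for x
  by (simp add: left_diff_distrib distrib_right cos_add cos_diff) (simp add: field_simps)
 ultimately show ?case by simp
next
 case (TP_add f g)
 from TP.TP_add[OF TP_add.IH] show ?case by (simp add: algebra_simps)
qed

lemma TP_mult: "TP f ==> TP g ==> TP (\<lambda>x. f x * g x)"
proof (induction rule: TP.induct)
 case (TP_add f h)
 from TP.TP_add[OF TP_add.IH(1)[OF TP_add.prems] TP_add.IH(2)[OF TP_add.prems]] show ?case by (simp add: algebra_simps)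
qed (auto intro: TP_mult_cos TP_mult_sin)

lemma TP_imp_trig: "TP f ==> \<exists>n a b. f = trig {..n} a b"
proof (induction rule: TP.induct)
 case (TP_cos c k)
 have "(\<Sum>j\<le>k. (if j = k then c else 0) * cos (real j * x)) = (\<Sum>j\<le>k. if j = k then c * cos (real k * x) else 0)" for x
  by (intro sum.cong) auto
 hence "(\<lambda>x. c * cos (real k * x)) = trig {..k} (\<lambda>j. if j = k then c else 0) (\<lambda>j. 0)"
  by (auto simp: trig_def fun_eq_iff)
 thus ?case by blast
next
 case (TP_sin c k)
 have "(\<Sum>j\<le>k. (if j = k then c else 0) * sin (real j * x)) = (\<Sum>j\<le>k. if j = k then c * sin (real k * x) else 0)" for x
  by (intro sum.cong) auto
 hence "(\<lambda>x. c * sin (real k * x)) = trig {..k} (\<lambda>j. 0) (\<lambda>j. if j = k then c else 0)"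
  by (auto simp: trig_def fun_eq_iff)
 thus ?case by blast
next
 case (TP_add f g)
 then obtain n a b m c d where f: "f = trig {..n} a b" and g: "g = trig {..m} c d" by blast
 have ext: "trig {..n} a b = trig {..N} (\<lambda>k. if k <= n then a k else 0) (\<lambda>k. if k <= n then b k else 0)" if "n <= N" for n N a b
  unfolding trig_def fun_eq_iff using that by (auto intro!: sum.mono_neutral_cong_left split: if_splits)
 have "(\<lambda>x. f x + g x) = trig {..max n m} (\<lambda>k. (if k <= n then a k else 0) + (if k <= m then c k else 0)) (\<lambda>k. (if k <= n then b k else 0) + (if k <= m then d k else 0))"
  unfolding f g ext[of n "max n m", OF max.cobounded1] ext[of m "max n m", OF max.cobounded2]
  by (simp add: trig_def fun_eq_iff algebra_simps sum.distrib[symmetric])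
 thus ?case by blast
qed

lemma TP_real_polynomial:
 fixes p :: "complex => real" assumes "real_polynomial_function p" shows "TP (\<lambda>x. p (cis x))"
 using assms
proof (induction rule: real_polynomial_function.induct)
 case (linear f)
 then interpret bounded_linear f .
 have "f (cis x) = f 1 * cos (real 1 * x) + f \<i> * sin (real 1 * x)" for x
 proof -
  have "f (cis x) = f (cos x *\<^sub>R 1 + sin x *\<^sub>R \<i>)" by (rule arg_cong[of _ _ f]) (simp add: complex_eq_iff)
  also have "... = f 1 * cos (real 1 * x) + f \<i> * sin (real 1 * x)" by (simp only: add scaleR) simp
  finally show ?thesis .
 qed
 thus ?case using TP_add[OF TP_cos[of "f 1" 1] TP_sin[of "f \<i>" 1]] by simp
next
 case (const c)
 thus ?case using TP_cos[of c 0] by simp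
qed (auto intro: TP_add TP_mult)

text \<open>\<open>w\<close> is read as a function on the unit circle, where the theorem of Stone
  and Weierstrass applies.\<close>

lemma trig_dense:
 assumes w: "continuous_on {0..2*pi} w" "w 0 = w (2*pi)" and e: "0 < e"
 obtains n a b where "\<And>x. x \<in> {0..2*pi} ==> \<bar>w x - trig {..n} a b x\<bar> < e"
proof -
 define c where "c = (\<lambda>x. cis x)"
 have cc: "continuous_on {0..2*pi} c" unfolding c_def by (intro continuous_intros)
 \<comment> \<open>The choice of the angle is immaterial: only 0 and 2 pi give the same point, and
   \<open>w\<close> agrees there.\<close>
 define f where "f = (\<lambda>z. w (SOME x. x \<in> {0..2*pi} \<and> c x = z))"
 have fc: "f (c x) = w x" if x: "x \<in> {0..2*pi}" for x
 proof -
  define y where "y = (SOME y. y \<in> {0..2*pi} \<and> c y = c x)"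
  have y: "y \<in> {0..2*pi}" "c y = c x" using someI_ex[of "\<lambda>y. y \<in> {0..2*pi} \<and> c y = c x"] x unfolding y_def by blast+
  have "w y = w x"
  proof (cases "x = 2*pi \<or> y = 2*pi")
   case True
   have *: "u = 0 \<or> u = 2*pi" if u: "u \<in> {0..2*pi}" "cos u = 1" for u
   proof -
    obtain k :: int where "u = of_int k * (2 * pi)" using u(2) unfolding cos_one_2pi_int by (auto simp: mult.assoc)
    moreover have "0 <= k" using u(1) \<open>u = _\<close> pi_gt_zero not_le[of pi 0] by (auto simp: zero_le_mult_iff)
    moreover have "k <= 1" 
    proof -
     have "of_int k * (2 * pi) <= 1 * (2 * pi)" using u(1) \<open>u = _\<close> by simp
     hence "real_of_int k <= 1" using pi_gt_zero mult_le_cancel_right_pos[of "2*pi"] by force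
     thus ?thesis by simp
    qed
    ultimately have "k = 0 \<or> k = 1" by linarith
    thus ?thesis using \<open>u = _\<close> by auto
   qed
   have "cos x = cos y" using y(2) unfolding c_def by (simp add: complex_eq_iff)
   hence "cos x = 1" "cos y = 1" using True by auto
   thus ?thesis using *[of x] *[of y] x y w(2) by auto
  next
   case False
   have "sin y = sin x \<and> cos y = cos x" using y(2) unfolding c_def by (simp add: complex_eq_iff)
   then obtain n :: int where n: "y = x + 2 * pi * of_int n" unfolding sin_cos_eq_iff by auto
   have "x < 2 * pi" "y < 2 * pi" "0 <= x" "0 <= y" using x y(1) False by auto
   hence "\<bar>2 * pi * of_int n\<bar> < 2 * pi * 1" using n by linarith
   hence "2 * pi * \<bar>real_of_int n\<bar> < 2 * pi * 1" by (simp add: abs_mult)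
   hence "\<bar>real_of_int n\<bar> < 1" by simp
   hence "n = 0" by linarith
   hence "x = y" using n by simp
   thus ?thesis by simp
  qed
  thus ?thesis by (simp add: f_def y_def)
 qed
 have img: "compact (c ` {0..2*pi})" by (intro compact_continuous_image cc compact_Icc)
 \<comment> \<open>\<open>c\<close> maps compact sets to compact sets, so preimages of closed sets
   under \<open>f\<close> are closed.\<close>
 have "continuous_on (c ` {0..2*pi}) f"
 proof (rule continuous_on_closed_vimage[THEN iffD2, rule_format])
  show "closed (c ` {0..2*pi})" by (rule compact_imp_closed[OF img])
  fix B :: "real set" assume B: "closed B"
  have "f -` B \<inter> c ` {0..2*pi} = c ` (w -` B \<inter> {0..2*pi})" using fc by auto
  moreover have "compact (w -` B \<inter> {0..2*pi})"
  proof -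
   have "closed (w -` B \<inter> {0..2*pi})" by (rule continuous_on_closed_vimage[THEN iffD1, rule_format, OF _ w(1) B]) simp
   moreover have "bounded (w -` B \<inter> {0..2*pi})" by (rule bounded_subset[OF bounded_closed_interval[of 0 "2*pi"]]) auto
   ultimately show ?thesis by (simp only: compact_eq_bounded_closed)
  qed
  hence "compact (c ` (w -` B \<inter> {0..2*pi}))" by (intro compact_continuous_image continuous_on_subset[OF cc]) auto
  ultimately show "closed (f -` B \<inter> c ` {0..2*pi})" by (simp add: compact_imp_closed)
 qed
 from Stone_Weierstrass_real_polynomial_function[OF img this e]
 obtain p where p: "real_polynomial_function p" "\<And>z. z \<in> c ` {0..2*pi} ==> \<bar>f z - p z\<bar> < e" by metis
 obtain n a b where t: "(\<lambda>x. p (cis x)) = trig {..n} a b" using TP_imp_trig[OF TP_real_polynomial[OF p(1)]] by blast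
 show thesis
 proof (rule that)
  fix x assume x: "x \<in> {0..2*pi}"
  have "trig {..n} a b x = p (c x)" using fun_cong[OF t, of x] by (simp add: c_def)
  thus "\<bar>w x - trig {..n} a b x\<bar> < e" using p(2)[of "c x"] fc[OF x] x by auto
 qed
qed

lemma J_parts:
 assumes f: "\<And>x. x \<in> {0..2*pi} ==> (f has_real_derivative f' x) (at x)" "cont f'" "f 0 = f (2*pi)"
  and g: "\<And>x. x \<in> {0..2*pi} ==> (g has_real_derivative g' x) (at x)" "cont g'" "g 0 = g (2*pi)"
 shows "J (\<lambda>x. f' x * g x) = - J (\<lambda>x. f x * g' x)"
proof -
 have cf: "cont f" "cont g" using f(1) g(1) by (meson DERIV_isCont continuous_at_imp_continuous_on)+
 have "J (\<lambda>x. f' x * g x + f x * g' x) = f (2*pi) * g (2*pi) - f 0 * g 0"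
  by (rule J_FTC') (use f(1) g(1) in \<open>auto intro!: derivative_eq_intros\<close>)
 moreover have "J (\<lambda>x. f' x * g x + f x * g' x) = J (\<lambda>x. f' x * g x) + J (\<lambda>x. f x * g' x)"
  using f g cf by (intro J_add continuous_intros)
 ultimately show ?thesis using f(3) g(3) by simp
qed

lemma trig_periodic: "trig I a b 0 = trig I a b (2*pi)"
proof -
 have "sin (real k * (2 * pi)) = 0" "cos (real k * (2 * pi)) = 1" for k
  using sin_int_2pin[of "int k"] cos_int_2pin[of "int k"] by (simp_all add: mult.commute)
 thus ?thesis by (simp add: trig_def)
qed

lemma J_trig_coeff0:
 assumes "finite I" "0 \<notin> I" shows "Jc (trig I a b) 0 = 0" "Js (trig I a b) 0 = 0"
proof -
 have "Jc (trig I a b) 0 = J (\<lambda>x. cos (real 0 * x) * trig I a b x)" by (simp add: mult.commute)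
 also have "... = (\<Sum>j\<in>I. a j * J (\<lambda>x. cos (real 0 * x) * cos (real j * x)) + b j * J (\<lambda>x. cos (real 0 * x) * sin (real j * x)))"
  by (intro J_mult_trig assms continuous_intros)
 also have "... = 0" using assms(2) unfolding J_orth by (intro sum.neutral) auto
 finally show "Jc (trig I a b) 0 = 0" .
qed (simp add: J_const)

text \<open>The proof avoids Fourier series. In the pairing of \<open>w\<close> with an
  approximating trigonometric polynomial only the modes from 3 on survive; moving a derivative from
  their antiderivative onto \<open>w\<close> gains the factor 1/3, and then the polynomial tends to
  \<open>w\<close>.\<close>

lemma wirtinger3:
 assumes w: "\<And>x. x \<in> {0..2*pi} ==> (w has_real_derivative w' x) (at x)" "cont w'" "w 0 = w (2*pi)"
  and orth: "\<And>k. k <= 2 ==> Jc w k = 0" "\<And>k. k <= 2 ==> Js w k = 0"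
 shows "9 * J2 w <= J2 w'"
proof -
 have cw: "cont w" using w(1) by (meson DERIV_isCont continuous_at_imp_continuous_on)
 have "\<forall>m. \<exists>n a b. \<forall>x\<in>{0..2*pi}. \<bar>w x - trig {..n} a b x\<bar> < inverse (real (Suc m))"
  using trig_dense[OF cw w(3)] by (metis inverse_positive_iff_positive of_nat_0_less_iff zero_less_Suc)
 then obtain n a b where p: "\<And>m x. x \<in> {0..2*pi} ==> \<bar>w x - trig {..n m} (a m) (b m) x\<bar> < inverse (real (Suc m))" by metis
 define P where "P = (\<lambda>m. trig {..n m} (a m) (b m))"
 have cP: "cont (P m)" for m unfolding P_def by (intro continuous_intros)
 have bound: "9 * (J (\<lambda>x. w x * P m x))^2 <= J2 w' * J2 (P m)" for m
 proof -
  define I where "I = {3..n m}"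
  define p3 where "p3 = trig I (a m) (b m)"
  \<comment> \<open>The periodic antiderivative of \<open>p3\<close>: a mode of order k is divided
    by k >= 3, whence 9 J2 q <= J2 p3.\<close>
  define q where "q = trig I (\<lambda>k. - b m k / real k) (\<lambda>k. a m k / real k)"
  have fI: "finite I" "0 \<notin> I" by (auto simp: I_def)
  have c3: "cont p3" "cont q" unfolding p3_def q_def by (intro continuous_intros)+
  have dq: "(q has_real_derivative p3 x) (at x)" for x
  proof -
   have "trig I (\<lambda>k. real k * (a m k / real k)) (\<lambda>k. - real k * (- b m k / real k)) = p3"
    unfolding p3_def trig_def
   proof (intro ext sum.cong refl)
    fix x k assume "k \<in> I"
    hence "real k \<noteq> 0" using fI(2) by (metis of_nat_eq_0_iff)
    thus "real k * (a m k / real k) * cos (real k * x) + - real k * (- b m k / real k) * sin (real k * x) = a m k * cos (real k * x) + b m k * sin (real k * x)"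
     by simp
   qed
   thus ?thesis using trig_deriv[of I "\<lambda>k. - b m k / real k" "\<lambda>k. a m k / real k" x] by (simp add: q_def)
  qed
  have e: "J (\<lambda>x. f x * p3 x) = (\<Sum>k\<in>I. a m k * Jc f k + b m k * Js f k)" if "cont f" for f
   unfolding p3_def by (rule J_mult_trig[OF fI(1) that])
  have "J (\<lambda>x. w x * P m x) = (\<Sum>k\<in>{..n m}. a m k * Jc w k + b m k * Js w k)"
   unfolding P_def by (rule J_mult_trig[OF _ cw]) simp
  also have "... = (\<Sum>k\<in>I. a m k * Jc w k + b m k * Js w k)"
  proof (rule sum.mono_neutral_right)
   show "\<forall>k\<in>{..n m} - I. a m k * Jc w k + b m k * Js w k = 0"
   proof
    fix k assume "k \<in> {..n m} - I"
    hence "k <= 2" by (auto simp: I_def)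
    thus "a m k * Jc w k + b m k * Js w k = 0" using orth by simp
   qed
  qed (auto simp: I_def)
  also have "... = J (\<lambda>x. w x * p3 x)" using e[OF cw] by simp
  also have "... = - J (\<lambda>x. w' x * q x)"
   using J_parts[OF w, of q p3] dq c3 trig_periodic by (simp add: q_def)
  finally have 1: "(J (\<lambda>x. w x * P m x))^2 = (J (\<lambda>x. w' x * q x))^2" by simp
  have "(J (\<lambda>x. w' x * q x))^2 <= J2 w' * J2 q" by (rule J_CS[OF w(2) c3(2)])
  moreover have "9 * J2 q <= J2 p3"
  proof -
   have "9 * J2 q = pi * (\<Sum>k\<in>I. 9 * ((- b m k / real k)^2 + (a m k / real k)^2))"
    unfolding q_def J_trig_square[OF fI] by (simp add: sum_distrib_left algebra_simps)
   also have "... <= pi * (\<Sum>k\<in>I. (a m k)^2 + (b m k)^2)"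
   proof (intro mult_left_mono sum_mono)
    fix k assume "k \<in> I"
    hence "3^2 <= (real k)^2" by (intro power_mono) (auto simp: I_def)
    hence k: "9 <= (real k)^2" by simp
    have "9 * ((- b m k / real k)^2 + (a m k / real k)^2) = (9 / (real k)^2) * ((a m k)^2 + (b m k)^2)"
     by (simp add: power_divide add_divide_distrib algebra_simps)
    also have "... <= 1 * ((a m k)^2 + (b m k)^2)" using k by (intro mult_right_mono) (auto simp: divide_le_eq_1)
    finally show "9 * ((- b m k / real k)^2 + (a m k / real k)^2) <= (a m k)^2 + (b m k)^2" by simp
   qed simp
   also have "... = J2 p3" unfolding p3_def J_trig_square[OF fI] ..
   finally show ?thesis .
  qed
  moreover have "J2 p3 <= J2 (P m)"
  proof -
   have pp: "J (\<lambda>x. P m x * p3 x) = J2 p3"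
   proof -
    have "J (\<lambda>x. P m x * p3 x) = (\<Sum>k\<in>I. a m k * Jc (P m) k + b m k * Js (P m) k)"
     by (rule e[OF cP])
    also have "... = (\<Sum>k\<in>I. pi * ((a m k)^2 + (b m k)^2))"
    proof (intro sum.cong refl)
     fix k assume k: "k \<in> I"
     hence "k \<noteq> 0" "k \<in> {..n m}" by (auto simp: I_def)
     with J_trig_coeff[of "{..n m}" k "a m" "b m"]
     show "a m k * Jc (P m) k + b m k * Js (P m) k = pi * ((a m k)^2 + (b m k)^2)"
      unfolding P_def by (simp add: power2_eq_square algebra_simps)
    qed
    finally show ?thesis unfolding p3_def J_trig_square[OF fI] by (simp add: sum_distrib_left)
   qed
   have "0 <= J (\<lambda>x. (P m x - p3 x)^2)" using cP c3 by (intro J_nonneg) (auto intro!: continuous_intros)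
   also have "... = J (\<lambda>x. (P m x)^2 - (2 * (P m x * p3 x) - (p3 x)^2))"
    by (intro J_cong) (simp add: power2_eq_square algebra_simps)
   also have "... = J2 (P m) - (2 * J (\<lambda>x. P m x * p3 x) - J2 p3)"
    using cP[of m] c3(1) by (subst J_diff; (subst J_diff)?) (auto intro!: continuous_intros simp: J_cmult)
   finally show ?thesis using pp by simp
  qed
  moreover have "0 <= J2 w'" using w(2) by (intro J_nonneg) (auto intro!: continuous_intros)
  ultimately have "9 * (J (\<lambda>x. w' x * q x))^2 <= J2 w' * J2 (P m)"
   using mult_left_mono[of "9 * J2 q" "J2 (P m)" "J2 w'"] by linarith
  thus ?thesis unfolding 1 .
 qed
 obtain M where M: "\<And>x. x \<in> {0..2*pi} ==> \<bar>w x\<bar> <= M" "0 <= M"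
 proof -
  have "bounded (w ` {0..2*pi})" by (intro compact_imp_bounded compact_continuous_image cw compact_Icc)
  then obtain B where "\<forall>x\<in>w ` {0..2*pi}. norm x <= B" using bounded_iff by blast
  thus thesis using that[of "\<bar>B\<bar>"] by force
 qed
 have ie: "(\<lambda>m. inverse (real (Suc m))) \<longlonglongrightarrow> 0" by (rule LIMSEQ_inverse_real_of_nat)
 have c2: "cont (\<lambda>x. (w x)^2)" "cont (\<lambda>x. w x * P m x)" "cont (\<lambda>x. (P m x)^2)" for m using cw cP by (auto intro!: continuous_intros)
 have lim1: "(\<lambda>m. J (\<lambda>x. w x * P m x)) \<longlonglongrightarrow> J2 w"
 proof (rule LIM_zero_cancel, rule Lim_null_comparison)
  show "(\<lambda>m. 2 * pi * (M * inverse (real (Suc m)))) \<longlonglongrightarrow> 0" by (rule tendsto_eq_intros ie refl | simp)+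
  have "\<bar>J (\<lambda>x. w x * P m x) - J2 w\<bar> <= 2 * pi * (M * inverse (real (Suc m)))" for m
  proof (rule J_close[OF c2(2,1)])
   fix x assume x: "x \<in> {0..2*pi}"
   have "w x * P m x - (w x)^2 = - (w x * (w x - P m x))" by (simp add: power2_eq_square algebra_simps)
   hence "\<bar>w x * P m x - (w x)^2\<bar> = \<bar>w x\<bar> * \<bar>w x - P m x\<bar>" by (simp only: abs_minus_cancel abs_mult)
   also have "... <= M * inverse (real (Suc m))" using M x p[of x m] unfolding P_def by (intro mult_mono) auto
   finally show "\<bar>w x * P m x - (w x)^2\<bar> <= M * inverse (real (Suc m))" .
  qed
  thus "\<forall>\<^sub>F m in sequentially. norm (J (\<lambda>x. w x * P m x) - J2 w) <= 2 * pi * (M * inverse (real (Suc m)))" by simp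
 qed
 have lim2: "(\<lambda>m. J2 (P m)) \<longlonglongrightarrow> J2 w"
 proof (rule LIM_zero_cancel, rule Lim_null_comparison)
  show "(\<lambda>m. 2 * pi * ((2 * M + 1) * inverse (real (Suc m)))) \<longlonglongrightarrow> 0" by (rule tendsto_eq_intros ie refl | simp)+
  have "\<bar>J2 (P m) - J2 w\<bar> <= 2 * pi * ((2 * M + 1) * inverse (real (Suc m)))" for m
  proof (rule J_close[OF c2(3,1)])
   fix x assume x: "x \<in> {0..2*pi}"
   have d: "\<bar>w x - P m x\<bar> < inverse (real (Suc m))" using p[of x m] x unfolding P_def .
   also have "... <= 1" by (simp add: inverse_le_1_iff)
   finally have "\<bar>P m x + w x\<bar> <= 2 * M + 1" using M(1)[OF x] by linarith
   moreover have "(P m x)^2 - (w x)^2 = (P m x + w x) * (P m x - w x)" by (simp add: power2_eq_square algebra_simps)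
   ultimately show "\<bar>(P m x)^2 - (w x)^2\<bar> <= (2 * M + 1) * inverse (real (Suc m))"
    using d M(2) by (simp only: abs_mult) (intro mult_mono; simp add: abs_minus_commute)
  qed
  thus "\<forall>\<^sub>F m in sequentially. norm (J2 (P m) - J2 w) <= 2 * pi * ((2 * M + 1) * inverse (real (Suc m)))" by simp
 qed
 have fin: "9 * (J2 w)^2 <= J2 w' * J2 w"
  by (rule LIMSEQ_le[OF tendsto_mult[OF tendsto_const tendsto_power[OF lim1]] tendsto_mult[OF tendsto_const lim2]]) (use bound in auto)
 have "0 <= J2 w" "0 <= J2 w'" using c2 w(2) by (auto intro!: J_nonneg continuous_intros)
 thus ?thesis
 proof (cases "J2 w = 0")
  case False
  with \<open>0 <= J2 w\<close> have "0 < J2 w" by simp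
  moreover have "(9 * J2 w) * J2 w <= J2 w' * J2 w"
   using fin by (simp add: power2_eq_square)
  ultimately show ?thesis by (simp only: mult_le_cancel_right_pos)
 qed simp
qed

text \<open>In amplitude and phase the function is a multiple of cos (2 x - phi). Every half period
  of the cosine contributes 2 to the antiderivative of its absolute value, whatever the
  phase.\<close>

lemma J_abs_mode2: "J (\<lambda>x. \<bar>trig {2} (\<lambda>_. a) (\<lambda>_. b) x\<bar>) = 4 * sqrt (a^2 + b^2)"
proof -
 obtain phi where ph: "a = sqrt (a^2 + b^2) * cos phi" "b = sqrt (a^2 + b^2) * sin phi"
 proof (cases "sqrt (a^2 + b^2) = 0")
  case True
  thus thesis using that[of 0] by (simp add: sum_power2_eq_zero_iff)
 next
  case False
  define \<rho> where "\<rho> = sqrt (a^2 + b^2)"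
  have r: "\<rho> \<noteq> 0" "\<rho>^2 = a^2 + b^2" using False by (auto simp: \<rho>_def)
  have "(a / \<rho>)^2 + (b / \<rho>)^2 = 1" unfolding power_divide add_divide_distrib[symmetric] r(2)[symmetric] using r(1) by simp
  then obtain t where "a / \<rho> = cos t" "b / \<rho> = sin t" by (rule sincos_total_2pi)
  hence "a = \<rho> * cos t" "b = \<rho> * sin t" using r(1) by (simp_all add: field_simps)
  thus thesis unfolding \<rho>_def by (rule that)
 qed
 have "continuous_on UNIV (\<lambda>x::real. \<bar>cos x\<bar>)" by (intro continuous_intros)
 then obtain H where H: "\<And>x. (H has_real_derivative \<bar>cos x\<bar>) (at x)" using antiderivative_ex by blast
 have "H (y + pi) - H y = H (- (pi/2) + pi) - H (- (pi/2))" for y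
 proof -
  have "((\<lambda>y. H (y + pi) - H y) has_real_derivative 0) (at y)" for y
   using DERIV_shift[of H "\<bar>cos (y + pi)\<bar>" y pi] H[of "y+pi"] H[of y] by (auto intro!: derivative_eq_intros)
  thus ?thesis using DERIV_isconst_all[of "\<lambda>y. H (y + pi) - H y" y "- (pi/2)"] by blast
 qed
 moreover have "H (pi/2) - H (- (pi/2)) = sin (pi/2) - sin (- (pi/2))"
 proof -
  have "H (pi/2) - sin (pi/2) = H (- (pi/2)) - sin (- (pi/2))"
  proof (rule DERIV_isconst2[of "- (pi/2)" "pi/2" "\<lambda>x. H x - sin x" "pi/2"])
   show "continuous_on {- (pi/2)..pi/2} (\<lambda>x. H x - sin x)"
    using H by (intro continuous_intros) (meson DERIV_isCont continuous_at_imp_continuous_on)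
   show "((\<lambda>x. H x - sin x) has_real_derivative 0) (at x)" if "- (pi/2) < x" "x < pi/2" for x
    using H[of x] cos_gt_zero_pi[OF that] by (auto intro!: derivative_eq_intros)
  qed (use pi_gt_zero in auto)
  thus ?thesis by simp
 qed
 moreover have "- (pi/2) + pi = pi/2" by simp
 ultimately have "H (y + pi) - H y = 2" for y by simp
 hence per: "H (y + pi) = H y + 2" for y by (metis add.commute diff_add_cancel)
 have "H (4 * pi - phi) = H (- phi) + 8"
  using per[of "-phi"] per[of "-phi + pi"] per[of "-phi + pi + pi"] per[of "-phi + pi + pi + pi"] by (simp add: algebra_simps)
 moreover have "J (\<lambda>x. \<bar>cos (2 * x - phi)\<bar>) = H (2 * (2*pi) - phi) / 2 - H (2 * 0 - phi) / 2"
 proof (rule J_FTC)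
  fix x
  have "((\<lambda>x. H (2 * x - phi)) has_real_derivative \<bar>cos (2 * x - phi)\<bar> * 2) (at x)"
   by (rule DERIV_chain2[OF H]) (auto intro!: derivative_eq_intros)
  thus "((\<lambda>x. H (2 * x - phi) / 2) has_real_derivative \<bar>cos (2 * x - phi)\<bar>) (at x)" by (auto intro!: derivative_eq_intros)
 qed
 ultimately have J4: "J (\<lambda>x. \<bar>cos (2 * x - phi)\<bar>) = 4" by (simp add: add_divide_distrib)
 have "\<bar>trig {2} (\<lambda>_. a) (\<lambda>_. b) x\<bar> = sqrt (a^2 + b^2) * \<bar>cos (2 * x - phi)\<bar>" for x
 proof -
  define \<rho> where "\<rho> = sqrt (a^2 + b^2)"
  have ph': "a = \<rho> * cos phi" "b = \<rho> * sin phi" using ph unfolding \<rho>_def .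
  have "trig {2} (\<lambda>_. a) (\<lambda>_. b) x = a * cos (2 * x) + b * sin (2 * x)" by (simp add: trig_def)
  also have "... = \<rho> * cos (2 * x - phi)" unfolding ph' cos_diff by (simp add: algebra_simps)
  finally have "trig {2} (\<lambda>_. a) (\<lambda>_. b) x = sqrt (a^2 + b^2) * cos (2 * x - phi)" unfolding \<rho>_def .
  thus ?thesis by (simp add: abs_mult)
 qed
 thus ?thesis by (simp add: J_cmult J4)
qed


text \<open>The Cauchy-Schwarz inequality for the vectors (sqrt a, sqrt c) and (sqrt b, sqrt d), in
  a form free of roots.\<close>

lemma weighted_two_square_bound:
 fixes X Y a b c d :: real
 assumes "X^2 <= a * b" "Y^2 <= c * d" "0 <= a" "0 <= b" "0 <= c" "0 <= d"
 shows "(X + Y)^2 <= (a + c) * (b + d)"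
proof -
 have "(2 * (X * Y))^2 <= (a * d + c * b)^2"
 proof -
  have "X^2 * Y^2 <= (a * b) * (c * d)" using assms by (intro mult_mono) auto
  hence "(2 * (X * Y))^2 <= 4 * ((a * d) * (c * b))" by (simp add: power_mult_distrib algebra_simps)
  also have "... <= (a * d + c * b)^2" 
   using zero_le_power2[of "a * d - c * b"] by (simp add: power2_eq_square algebra_simps)
  finally show ?thesis .
 qed
 moreover have "0 <= a * d + c * b" using assms by simp
 ultimately have "2 * (X * Y) <= a * d + c * b" by (metis abs_le_square_iff abs_of_nonneg abs_le_D1)
 thus ?thesis using assms(1,2) by (simp add: power2_eq_square algebra_simps)
qed

text \<open>The constant comes from splitting \<open>w\<close> into its modes of order 2 and of order at least 3, and from the fact
 that a function with values in \<open>[-1, 1]\<close> has at most the amplitude \<open>4 / pi\<close> in mode 2.\<close>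

lemma trig_coercive:
 assumes w: "\<And>x. x \<in> {0..2*pi} ==> (w has_real_derivative w' x) (at x)" "cont w'" "w 0 = w (2*pi)"
  and orth: "\<And>k. k <= 1 ==> Jc w k = 0" "\<And>k. k <= 1 ==> Js w k = 0"
 shows "(J (\<lambda>x. \<bar>w x\<bar>))^2 <= (pi / 4 + 10 / (3 * pi)) * (J2 w' - J2 w)"
proof -
 have cw: "cont w" using w(1) by (meson DERIV_isCont continuous_at_imp_continuous_on)
 define A where "A = Jc w 2 / pi"
 define B where "B = Js w 2 / pi"
 define T where "T = (\<lambda>a b. trig {2} (\<lambda>_. a) (\<lambda>_. b))"
 have T: "cont (T a b)" "(T a b has_real_derivative T (2 * b) (- 2 * a) x) (at x)" "T a b 0 = T a b (2*pi)" for a b x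
  using trig_deriv[of "{2}" "\<lambda>_. a" "\<lambda>_. b" x] trig_periodic by (auto simp: T_def trig_def intro!: continuous_intros)
 have Tsq: "J2 (T a b) = pi * (a^2 + b^2)" for a b unfolding T_def by (subst J_trig_square) auto
 have mT: "J (\<lambda>x. f x * T a b x) = a * Jc f 2 + b * Js f 2" if "cont f" for f a b
  unfolding T_def using J_mult_trig[OF _ that, of "{2}" "\<lambda>_. a" "\<lambda>_. b"] by simp
 define v where "v = (\<lambda>x. w x - T A B x)"
 define v' where "v' = (\<lambda>x. w' x - T (2 * B) (- 2 * A) x)"
 have v: "(v has_real_derivative v' x) (at x)" if "x \<in> {0..2*pi}" for x
  unfolding v_def v'_def by (intro DERIV_diff w(1) that T(2))
 have cv: "cont v" "cont v'" "v 0 = v (2*pi)" unfolding v_def v'_def using cw w T by (auto intro!: continuous_intros)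
 have vo: "Jc v k = 0" "Js v k = 0" if k: "k <= 2" for k
 proof -
  have "Jc v k = Jc w k - Jc (T A B) k"
   unfolding v_def left_diff_distrib using cw T by (intro J_diff continuous_intros)
  moreover have "Js v k = Js w k - Js (T A B) k"
   unfolding v_def left_diff_distrib using cw T by (intro J_diff continuous_intros)
  moreover have "k = 0 \<or> k = 1 \<or> k = 2" using k by auto
  ultimately show "Jc v k = 0" "Js v k = 0"
   using orth[of k] J_trig_coeff0[of "{2}"] J_trig_coeff[of "{2}" k] unfolding T_def A_def B_def by auto
 qed
 define S where "S = J2 v"
 have W3: "9 * S <= J2 v'" unfolding S_def by (rule wirtinger3[OF v cv(2,3) vo])
 have S0: "0 <= S" unfolding S_def using cv by (intro J_nonneg continuous_intros) auto
 have vT: "J (\<lambda>x. v x * T a b x) = 0" for a b unfolding mT[OF cv(1)] vo[OF order_refl] by simp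
 have sq: "J (\<lambda>x. (f x + g x)^2) = J2 f + 2 * J (\<lambda>x. f x * g x) + J2 g" if "cont f" "cont g" for f g
 proof -
  have "J (\<lambda>x. (f x + g x)^2) = J (\<lambda>x. ((f x)^2 + 2 * (f x * g x)) + (g x)^2)" by (intro J_cong) (simp add: power2_eq_square algebra_simps)
  also have "... = J2 f + 2 * J (\<lambda>x. f x * g x) + J2 g"
   using that by (subst J_add; (subst J_add)?) (auto intro!: continuous_intros simp: J_cmult)
  finally show ?thesis .
 qed
 have w2: "J2 w = S + pi * (A^2 + B^2)"
  using sq[OF cv(1) T(1), of A B] vT[of A B] Tsq[of A B] unfolding S_def by (simp add: v_def)
 have w'2: "J2 w' = J2 v' + 4 * (pi * (A^2 + B^2))"
 proof -
  have "J (\<lambda>x. v' x * T (2 * B) (- 2 * A) x) = - J (\<lambda>x. v x * T (2 * (- 2 * A)) (- 2 * (2 * B)) x)"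
   by (rule J_parts[OF v cv(2,3) T(2) T(1) T(3)])
  thus ?thesis using sq[OF cv(2) T(1), of "2 * B" "- 2 * A"] vT Tsq[of "2 * B" "- 2 * A"]
   by (simp add: v'_def power_mult_distrib algebra_simps)
 qed
 define Q where "Q = J2 w' - J2 w"
 define K where "K = pi / 4 + 10 / (3 * pi)"
 have K0: "0 < K" by (simp add: K_def add_pos_pos)
 \<comment> \<open>The quadratic form multiplies mode k by k^2 - 1, which is 3 for mode 2 and at
   least 8 for the rest.\<close>
 have Q: "3 * pi * (A^2 + B^2) + 8 * S <= Q" using W3 unfolding Q_def w2 w'2 by (simp add: algebra_simps)
 have Q0: "0 <= Q" by (rule order_trans[OF _ Q]) (use S0 in simp)
 have est: "J (\<lambda>x. \<bar>w x\<bar>) - 2 * pi * \<delta> <= sqrt (K * Q)" if d: "0 < \<delta>" for \<delta>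
 proof -
  \<comment> \<open>A continuous substitute for the sign of \<open>w\<close>. The integral of |w|
    becomes a pairing with \<open>s\<close>, up to \<delta>, and the pairing splits over the
    modes.\<close>
  define s where "s = (\<lambda>x. w x / sqrt ((w x)^2 + \<delta>^2))"
  have rt: "0 < sqrt ((w x)^2 + \<delta>^2)" "\<bar>w x\<bar> <= sqrt ((w x)^2 + \<delta>^2)" "sqrt ((w x)^2 + \<delta>^2) <= \<bar>w x\<bar> + \<delta>" for x
   using d sqrt_sum_squares_le_sum[of "\<bar>w x\<bar>" \<delta>] by (auto intro!: real_le_rsqrt real_sqrt_gt_zero add_nonneg_pos)
  have cs: "cont s" unfolding s_def using rt(1) by (intro continuous_intros cw) (auto simp: less_imp_neq[THEN not_sym])
  have s1: "\<bar>s x\<bar> <= 1" for x using rt[of x] by (simp add: s_def divide_le_eq_1)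
  have sw: "\<bar>w x\<bar> - \<delta> <= s x * w x" for x
  proof -
   have "(\<bar>w x\<bar> - \<delta>) * sqrt ((w x)^2 + \<delta>^2) <= w x * w x"
   proof (cases "\<bar>w x\<bar> <= \<delta>")
    case True thus ?thesis using rt(1)[of x] by (intro order_trans[OF mult_nonpos_nonneg]) auto
   next
    case False
    hence "(\<bar>w x\<bar> - \<delta>) * sqrt ((w x)^2 + \<delta>^2) <= (\<bar>w x\<bar> - \<delta>) * (\<bar>w x\<bar> + \<delta>)" using rt by (intro mult_left_mono) auto
    also have "... = \<bar>w x\<bar>^2 - \<delta>^2" by (simp add: power2_eq_square algebra_simps)
    also have "... <= w x * w x" by (simp add: power2_eq_square)
    finally show ?thesis .
   qed
   thus ?thesis using rt(1)[of x] by (simp add: s_def pos_le_divide_eq)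
  qed
  define a where "a = Jc s 2 / pi"
  define b where "b = Js s 2 / pi"
  define E where "E = a^2 + b^2"
  have E0: "0 <= E" by (simp add: E_def)
  have sT: "J (\<lambda>x. s x * T c d x) = pi * (a * c + b * d)" for c d
   using mT[OF cs, of c d] by (simp add: a_def b_def algebra_simps)
  \<comment> \<open>Pairing \<open>s\<close> with its own mode 2 gives pi E. As |s| <= 1, this is at
    most the L1 norm 4 sqrt E of that mode, so the amplitude sqrt E is at most 4 / pi.\<close>
  have "pi * E = J (\<lambda>x. s x * T a b x)" unfolding sT E_def by (simp add: power2_eq_square)
  also have "... <= J (\<lambda>x. \<bar>T a b x\<bar>)"
  proof (rule J_mono)
   fix x
   have "s x * T a b x <= \<bar>s x\<bar> * \<bar>T a b x\<bar>" by (simp flip: abs_mult)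
   also have "... <= 1 * \<bar>T a b x\<bar>" by (intro mult_right_mono s1) auto
   finally show "s x * T a b x <= \<bar>T a b x\<bar>" by simp
  qed (use cs T in \<open>auto intro!: continuous_intros\<close>)
  also have "... = 4 * sqrt E" unfolding T_def E_def by (rule J_abs_mode2)
  finally have "pi * (sqrt E * sqrt E) <= 4 * sqrt E" using E0 by simp
  hence "pi * sqrt E <= 4" 
  proof (cases "sqrt E = 0")
   case False
   hence "0 < sqrt E" using E0 by simp
   moreover have "(pi * sqrt E) * sqrt E <= 4 * sqrt E" using \<open>pi * (sqrt E * sqrt E) <= 4 * sqrt E\<close> by (simp add: mult.assoc)
   ultimately show ?thesis by (simp only: mult_le_cancel_right_pos)
  qed simp
  hence "(pi * sqrt E)^2 <= 4^2" using E0 by (intro power_mono) auto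
  moreover have "(pi * sqrt E)^2 = pi^2 * E" using E0 by (simp add: power_mult_distrib)
  ultimately have "pi^2 * E <= 4^2" by (simp only:)
  hence E16: "pi * (pi * E) <= 16" by (simp add: power2_eq_square)
  have ss: "J2 s <= 2 * pi"
  proof -
   have "J2 s <= J (\<lambda>x. 1)" using cs s1 by (intro J_mono) (auto intro!: continuous_intros simp: abs_square_le_1)
   thus ?thesis by (simp add: J_const)
  qed
  have r: "J (\<lambda>x. (s x - T a b x)^2) = J2 s - pi * E"
  proof -
   have "J2 s = J (\<lambda>x. ((s x - T a b x) + T a b x)^2)" by simp
   also have "... = J (\<lambda>x. (s x - T a b x)^2) + 2 * J (\<lambda>x. (s x - T a b x) * T a b x) + J2 (T a b)"
    using cs T by (intro sq continuous_intros)
   also have "J (\<lambda>x. (s x - T a b x) * T a b x) = J (\<lambda>x. s x * T a b x) - J2 (T a b)"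
    unfolding left_diff_distrib power2_eq_square using cs T by (intro J_diff continuous_intros)
   finally show ?thesis unfolding sT Tsq E_def by (simp add: power2_eq_square algebra_simps)
  qed
  define X where "X = J (\<lambda>x. s x * T A B x)"
  define Y where "Y = J (\<lambda>x. s x * v x)"
  have X: "X^2 <= (3 * pi * (A^2 + B^2)) * (pi * E / 3)"
  proof -
   have "X^2 = pi^2 * (a * A + b * B)^2" unfolding X_def sT by (simp add: power_mult_distrib)
   also have "(a * A + b * B)^2 <= (A^2 + B^2) * E"
    using zero_le_power2[of "a * B - b * A"] unfolding E_def by (simp add: power2_eq_square algebra_simps)
   finally show ?thesis by (simp add: power2_eq_square mult_left_mono algebra_simps)
  qed
  have Y: "Y^2 <= (8 * S) * ((2 * pi - pi * E) / 8)"
  proof -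
   have "Y = J (\<lambda>x. (s x - T a b x) * v x)"
   proof -
    have "J (\<lambda>x. (s x - T a b x) * v x) = Y - J (\<lambda>x. v x * T a b x)"
     unfolding left_diff_distrib Y_def mult.commute[of "T a b _"] using cs T cv by (intro J_diff continuous_intros)
    thus ?thesis using vT by simp
   qed
   hence "Y^2 <= (J2 s - pi * E) * S"
    unfolding r[symmetric] S_def using J_CS[of "\<lambda>x. s x - T a b x" v] cs T cv by (auto intro!: continuous_intros)
   also have "... <= (2 * pi - pi * E) * S" using ss S0 by (intro mult_right_mono) auto
   finally show ?thesis by (simp add: mult.commute)
  qed
  have r0: "0 <= 2 * pi - pi * E"
  proof -
   have "0 <= J (\<lambda>x. (s x - T a b x)^2)" using cs T by (intro J_nonneg continuous_intros) auto
   thus ?thesis using r ss by linarith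
  qed
  \<comment> \<open>Each part of \<open>s\<close> is weighted by the inverse of the factor 3 or 8.
    The sum is pi / 4 + (5/24) pi E, and E <= 16 / pi^2 turns it into \<open>K\<close>.\<close>
  have "(X + Y)^2 <= (3 * pi * (A^2 + B^2) + 8 * S) * (pi * E / 3 + (2 * pi - pi * E) / 8)"
   using X Y S0 E0 r0 by (intro weighted_two_square_bound) auto
  also have "... <= Q * K"
  proof (intro mult_mono Q)
   have "pi * E <= 16 / pi" using E16 pi_gt_zero by (simp add: pos_le_divide_eq mult.commute)
   hence "(5/24) * (pi * E) <= (5/24) * (16 / pi)" by (intro mult_left_mono) auto
   thus "pi * E / 3 + (2 * pi - pi * E) / 8 <= K" by (simp add: K_def field_simps)
  qed (use Q0 E0 r0 in auto)
  finally have "X + Y <= sqrt (K * Q)" using real_le_rsqrt by (simp add: mult.commute)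
  moreover have "J (\<lambda>x. \<bar>w x\<bar>) - 2 * pi * \<delta> <= X + Y"
  proof -
   have "J (\<lambda>x. \<bar>w x\<bar>) - 2 * pi * \<delta> = J (\<lambda>x. \<bar>w x\<bar> - \<delta>)" using cw by (subst J_diff) (auto intro!: continuous_intros simp: J_const)
   also have "... <= J (\<lambda>x. s x * w x)" using sw cs cw by (intro J_mono) (auto intro!: continuous_intros)
   also have "... = J (\<lambda>x. s x * T A B x + s x * v x)" by (intro J_cong) (simp add: v_def algebra_simps)
   also have "... = X + Y" unfolding X_def Y_def using cs T cv by (intro J_add continuous_intros)
   finally show ?thesis .
  qed
  ultimately show ?thesis by linarith
 qed
 have "J (\<lambda>x. \<bar>w x\<bar>) <= sqrt (K * Q)"
 proof (rule field_le_epsilon)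
  fix e :: real assume "0 < e"
  thus "J (\<lambda>x. \<bar>w x\<bar>) <= sqrt (K * Q) + e" using est[of "e / (2 * pi)"] by simp
 qed
 moreover have "0 <= J (\<lambda>x. \<bar>w x\<bar>)" using cw by (intro J_nonneg continuous_intros) auto
 ultimately have "(J (\<lambda>x. \<bar>w x\<bar>))^2 <= (sqrt (K * Q))^2" by (intro power_mono)
 thus ?thesis using K0 Q0 by (simp add: K_def[symmetric] Q_def[symmetric])
qed

section \<open>Nearly circular profiles\<close>

text \<open>Inequalities between integrals along a ray are proved below by comparing the derivatives
  of two antiderivatives.\<close>

lemma deriv_le:
 fixes f g :: "real => real"
 assumes "a <= b" "\<And>x. (f has_real_derivative f' x) (at x)" "\<And>x. (g has_real_derivative g' x) (at x)"
  and "\<And>x. a <= x ==> x <= b ==> f' x <= g' x"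
 shows "f b - f a <= g b - g a"
proof -
 have "g a - f a <= g b - f b"
 proof (rule DERIV_nonneg_imp_nondecreasing[OF assms(1)])
  fix x assume x: "a <= x" "x <= b"
  have "((\<lambda>x. g x - f x) has_real_derivative g' x - f' x) (at x)" by (intro DERIV_diff assms)
  thus "\<exists>y. ((\<lambda>x. g x - f x) has_real_derivative y) (at x) \<and> 0 <= y" using assms(4)[OF x] by (intro exI[of _ "g' x - f' x"]) auto
 qed
 thus ?thesis by simp
qed

lemma integral_antiderivative:
 fixes F :: "real => real"
 assumes "a <= b" "\<And>x. (F has_real_derivative f x) (at x)" shows "integral {a..b} f = F b - F a"
 using assms by (intro integral_unique fundamental_theorem_of_calculus)
  (auto simp: has_real_derivative_iff_has_vector_derivative intro: has_vector_derivative_at_within)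

text \<open>\<open>u\<close> is the mollified indicator along a ray from the centre. \<open>DD \<rho>\<close> is the contribution of the ray to the symmetric
 difference with a region bounded at the distance \<open>\<rho>\<close>.\<close>

locale ray =
 fixes u u' :: "real => real"
 assumes der: "\<And>r. (u has_real_derivative u' r) (at r)" and cu': "continuous_on UNIV u'"
  and u0: "\<And>r. 0 <= u r" and u1: "\<And>r. u r <= 1" and uR: "u (3/2) = 0"
begin

text \<open>If \<open>u\<close> were a sharp decreasing step it would be the indicator of [0, ell].
  \<open>gam\<close> measures the increase of \<open>u\<close>, weighted by the radius,
  \<open>qq\<close> its deviation from the values 0 and 1, and \<open>nn\<close> is its L1 distance
  to the step at 1.\<close>

definition ell where "ell = integral {0..3/2} u"
definition gam where "gam = integral {0..3/2} (\<lambda>r. max 0 (u' r) * r)"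
definition qq where "qq = integral {0..3/2} (\<lambda>r. u r * (1 - u r))"
definition mass where "mass = integral {0..3/2} (\<lambda>r. u r * r)"
definition DD where "DD \<rho> = integral {0..\<rho>} (\<lambda>r. (1 - u r) * r) + integral {\<rho>..3/2} (\<lambda>r. u r * r)"
definition nn where "nn = integral {0..1} (\<lambda>r. 1 - u r) + integral {1..3/2} u"

lemma cu: "continuous_on S u"
 using der by (meson DERIV_isCont continuous_at_imp_continuous_on)

lemma primitives:
 obtains U K G Q M where 
  "\<And>r. (U has_real_derivative u r) (at r)" "U 0 = 0"
  "\<And>r. (K has_real_derivative max 0 (u' r)) (at r)" "K 0 = 0"
  "\<And>r. (G has_real_derivative max 0 (u' r) * r) (at r)" "G 0 = 0"
  "\<And>r. (Q has_real_derivative u r * (1 - u r)) (at r)" "Q 0 = 0"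
  "\<And>r. (M has_real_derivative u r * r) (at r)" "M 0 = 0"
proof -
 have ex: "\<exists>F. (\<forall>r. (F has_real_derivative f r) (at r)) \<and> F 0 = 0" if cf: "continuous_on UNIV f" for f :: "real => real"
 proof -
  obtain F where F: "\<And>r. (F has_real_derivative f r) (at r)" using antiderivative_ex[OF cf] by metis
  have "((\<lambda>r. F r - F 0) has_real_derivative f r) (at r)" for r using DERIV_diff[OF F[of r] DERIV_const[of "F 0"]] by simp
  thus ?thesis by (intro exI[of _ "\<lambda>r. F r - F 0"]) auto
 qed
 have c: "continuous_on UNIV u" "continuous_on UNIV (\<lambda>r. max 0 (u' r))" "continuous_on UNIV (\<lambda>r. max 0 (u' r) * r)"
  "continuous_on UNIV (\<lambda>r. u r * (1 - u r))" "continuous_on UNIV (\<lambda>r. u r * r)"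
  using cu cu' by (auto intro!: continuous_intros)
 show thesis using ex[OF c(1)] ex[OF c(2)] ex[OF c(3)] ex[OF c(4)] ex[OF c(5)] that by blast
qed

text \<open>For a sharp decreasing step the mass is ell^2 / 2 and DD t is |ell^2 - t^2| / 2. The
  deviations from these identities are bounded by \<open>gam\<close> and \<open>qq\<close>. The
  facts share their antiderivatives, hence a single proof.\<close>

lemma ray_facts:
 shows abs_radial: "integral {0..3/2} (\<lambda>r. \<bar>u' r\<bar> * r) = ell + 2 * gam"
  and gam0: "0 <= gam" and qq0: "0 <= qq" and ell0: "0 <= ell" and ell32: "ell <= 3/2"
  and excess0: "0 <= mass - ell^2 / 2" and excess: "mass - ell^2 / 2 <= 3/2 * (gam + qq)"
  and n_le: "nn <= 4 * DD 1 + gam" and n_le': "0 < \<rho> ==> \<rho> <= 1 ==> nn <= \<rho> + DD 1 / \<rho>"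
  and ell_n: "\<bar>ell - 1\<bar> <= nn" and nn0: "0 <= nn"
  and DD_le: "1/2 <= t ==> 0 < \<eta> ==> t + \<eta> <= 3/2 ==>
   DD t <= \<bar>ell^2 - t^2\<bar> / 2 + (mass - ell^2 / 2) + 3 * (\<eta> + 2 * gam + 3 * qq / \<eta>)"
  and DD_eq: "0 <= t ==> t <= 3/2 ==> DD t = t^2 / 2 - 2 * integral {0..t} (\<lambda>r. u r * r) + mass"
proof -
 obtain U K G Q M where U: "\<And>r. (U has_real_derivative u r) (at r)" "U 0 = 0"
  and K: "\<And>r. (K has_real_derivative max 0 (u' r)) (at r)" "K 0 = 0"
  and G: "\<And>r. (G has_real_derivative max 0 (u' r) * r) (at r)" "G 0 = 0"
  and Q: "\<And>r. (Q has_real_derivative u r * (1 - u r)) (at r)" "Q 0 = 0"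
  and M: "\<And>r. (M has_real_derivative u r * r) (at r)" "M 0 = 0"
  using primitives by blast
 have eq: "ell = U (3/2)" "gam = G (3/2)" "qq = Q (3/2)" "mass = M (3/2)"
  unfolding ell_def gam_def qq_def mass_def
  using integral_antiderivative[OF _ U(1), of 0 "3/2"] integral_antiderivative[OF _ G(1), of 0 "3/2"]
   integral_antiderivative[OF _ Q(1), of 0 "3/2"] integral_antiderivative[OF _ M(1), of 0 "3/2"] U G Q M by auto
 have dc: "((\<lambda>x. c) has_real_derivative 0) (at x)" for c x :: real by (rule DERIV_const)
 have di: "((\<lambda>x. c * x) has_real_derivative c) (at x)" for c x :: real by (auto intro!: derivative_eq_intros)
 have Gm: "G s <= G t" if "0 <= s" "s <= t" for s t using deriv_le[OF that(2) dc[of 0] G(1)] that by simp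
 have Qm: "Q s <= Q t" if "s <= t" for s t using deriv_le[OF that dc[of 0] Q(1)] u0 u1 by simp
 have Um: "U s <= U t" if "s <= t" for s t using deriv_le[OF that dc[of 0] U(1)] u0 by simp
 have Ul: "U t - U s <= t - s" if "s <= t" for s t using deriv_le[OF that U(1) di[of 1]] u1 by simp
 have inc: "u t - u s <= K t - K s" if "s <= t" for s t using deriv_le[OF that der K(1)] by simp
 show "0 <= gam" "0 <= qq" "0 <= ell" unfolding eq using Gm[of 0 "3/2"] Qm[of 0 "3/2"] Um[of 0 "3/2"] U G Q by auto
 show "ell <= 3/2" unfolding eq using Ul[of 0 "3/2"] U by simp
 have DG: "((\<lambda>s. s * K t - (s * K s - G s)) has_real_derivative K t - K s) (at s)" for s t
  by (rule DERIV_cong[OF DERIV_diff[OF DERIV_cmult_right[OF DERIV_ident] DERIV_diff[OF DERIV_mult[OF DERIV_ident K(1)] G(1)]]])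
   (simp add: algebra_simps)
 have DU: "((\<lambda>s. s - U s) has_real_derivative 1 - u s) (at s)" for s by (intro DERIV_diff DERIV_ident U)
 \<comment> \<open>The length missing before x is the integral of 1 - u s, and 1 - u s <= 1 - u x +
   (K x - K s). By parts the integral of K x - K s over [0, x] is G x.\<close>
 have hole: "x - U x <= x * (1 - u x) + G x" if "0 <= x" for x
 proof -
  have "(x - U x) - (0 - U 0) <= ((1 - u x) * x + (x * K x - (x * K x - G x))) - ((1 - u x) * 0 + (0 * K x - (0 * K 0 - G 0)))"
  proof (rule deriv_le[OF that DU DERIV_add[OF di DG]])
   fix s assume "0 <= s" "s <= x"
   thus "1 - u s <= 1 - u x + (K x - K s)" using inc[of s x] by simp
  qed
  thus ?thesis using U G by (simp add: mult.commute)
 qed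
 have e': "u t * (t - U t) <= G t + Q t" if "0 <= t" for t
 proof -
  have "u t * (t - U t) - u t * (0 - U 0) <= ((t * K t - (t * K t - G t)) + Q t) - ((0 * K t - (0 * K 0 - G 0)) + Q 0)"
  proof (rule deriv_le[OF that DERIV_cmult[OF DU] DERIV_add[OF DG Q(1)]])
   fix s assume s: "0 <= s" "s <= t"
   show "u t * (1 - u s) <= K t - K s + u s * (1 - u s)"
   proof -
    have "(u t - u s) * (1 - u s) <= K t - K s"
    proof (cases "u t <= u s")
     case True
     moreover have "0 <= K t - K s" using deriv_le[OF s(2) dc[of 0] K(1)] by simp
     ultimately show ?thesis using u1[of s] by (intro order_trans[OF mult_nonpos_nonneg]) auto
    next
     case False
     hence "(u t - u s) * (1 - u s) <= (u t - u s) * 1" using u0[of s] by (intro mult_left_mono) auto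
     thus ?thesis using inc[OF s(2)] by simp
    qed
    thus ?thesis by (simp add: algebra_simps)
   qed
  qed
  thus ?thesis using U G Q by simp
 qed
 \<comment> \<open>The excess of the mass over ell^2 / 2 is the integral of u t (t - U t): it counts
   a gap that lies closer to the centre than a filled point.\<close>
 have De: "((\<lambda>t. M t - (U t)^2 / 2) has_real_derivative u t * (t - U t)) (at t)" for t
  by (rule DERIV_cong[OF DERIV_diff[OF M(1) DERIV_cdivide[OF DERIV_power[OF U(1)]]]]) (simp add: algebra_simps)
 have "(M (3/2) - (U (3/2))^2 / 2) - (M 0 - (U 0)^2 / 2) <= (G (3/2) + Q (3/2)) * (3/2) - (G (3/2) + Q (3/2)) * 0"
 proof (rule deriv_le[OF _ De di])
  fix t :: real assume t: "0 <= t" "t <= 3/2"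
  show "u t * (t - U t) <= G (3/2) + Q (3/2)" using e'[OF t(1)] Gm[OF t] Qm[OF t(2)] by linarith
 qed simp
 thus "mass - ell^2 / 2 <= 3/2 * (gam + qq)" unfolding eq using U M by (simp add: algebra_simps)
 have "0 - 0 <= (M (3/2) - (U (3/2))^2 / 2) - (M 0 - (U 0)^2 / 2)"
 proof (rule deriv_le[OF _ dc De])
  fix t :: real assume t: "0 <= t"
  thus "0 <= u t * (t - U t)" using Ul[of 0 t] U u0[of t] by simp
 qed simp
 thus ex0: "0 <= mass - ell^2 / 2" unfolding eq using U M by simp
 \<comment> \<open>Here |u'| = - u' + 2 max 0 u', and the integral of - u' r equals ell by parts
   because u (3/2) = 0.\<close>
 show "integral {0..3/2} (\<lambda>r. \<bar>u' r\<bar> * r) = ell + 2 * gam"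
 proof -
  have "integral {0..3/2} (\<lambda>r. \<bar>u' r\<bar> * r) = integral {0..3/2} (\<lambda>r. (u r - (u' r * r + u r)) + 2 * (max 0 (u' r) * r))"
   by (intro Henstock_Kurzweil_Integration.integral_cong) (auto simp: max_def abs_if)
  also have "... = (U (3/2) - u (3/2) * (3/2) + 2 * G (3/2)) - (U 0 - u 0 * 0 + 2 * G 0)"
  proof (rule integral_antiderivative)
   fix x
   have "((\<lambda>x. u x * x) has_real_derivative u' x * x + u x) (at x)"
    by (rule DERIV_cong[OF DERIV_mult[OF der DERIV_ident]]) simp
   from DERIV_add[OF DERIV_diff[OF U(1) this] DERIV_cmult[OF G(1), of 2]]
   show "((\<lambda>x. U x - u x * x + 2 * G x) has_real_derivative u x - (u' x * x + u x) + 2 * (max 0 (u' x) * x)) (at x)" .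
  qed simp
  finally show ?thesis using U G uR by (simp add: eq)
 qed
 have DM: "((\<lambda>s. s^2 / 2 - M s) has_real_derivative (1 - u s) * s) (at s)" for s
  by (rule DERIV_cong[OF DERIV_diff[OF DERIV_cdivide[OF DERIV_power[OF DERIV_ident]] M(1)]]) (simp add: algebra_simps)
 have DDe: "DD t = (t^2 / 2 - M t) + (M (3/2) - M t)" if "0 <= t" "t <= 3/2" for t
  unfolding DD_def using integral_antiderivative[OF that(1) DM] integral_antiderivative[OF that(2) M(1)] M by simp
 show "DD t = t^2 / 2 - 2 * integral {0..t} (\<lambda>r. u r * r) + mass" if "0 <= t" "t <= 3/2" for t
  using DDe[OF that] integral_antiderivative[OF that(1) M(1)] M eq by simp
 have nne: "nn = (1 - U 1) + (U (3/2) - U 1)"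
  unfolding nn_def using integral_antiderivative[OF _ DU, of 0 1] integral_antiderivative[OF _ U(1), of 1 "3/2"] U by simp
 have out: "U (3/2) - U 1 <= M (3/2) - M 1"
  by (rule deriv_le[OF _ U(1) M(1)]) (use u0 mult_left_mono[of 1 _ "u _"] in auto)
 have out0: "0 <= U (3/2) - U 1" using Um[of 1 "3/2"] by simp
 have in0: "0 <= 1 - U 1" using Ul[of 0 1] U by simp
 show "\<bar>ell - 1\<bar> <= nn" "0 <= nn" using out0 in0 by (auto simp: eq nne)
 have inM: "s^2/2 - M s <= t^2/2 - M t" if "0 <= s" "s <= t" for s t
  using deriv_le[OF that(2) dc[of 0] DM] that u1 by simp
 \<comment> \<open>The weight r in \<open>DD\<close> degenerates at the centre. On [1/2, 1] it costs
   a factor 2; the gap inside [0, 1/2] is compared, by means of \<open>hole\<close>, with the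
   weighted gap at every s in [1/2, 1].\<close>
 show "nn <= 4 * DD 1 + gam"
 proof -
  have 1: "(1 - U 1) - (1/2 - U (1/2)) <= 2 * (1^2/2 - M 1) - 2 * ((1/2)^2/2 - M (1/2))"
  proof (rule deriv_le[OF _ DU DERIV_cmult[OF DM]])
   fix s :: real assume s: "1/2 <= s"
   show "1 - u s <= 2 * ((1 - u s) * s)" using mult_left_mono[of 1 "2 * s" "1 - u s"] s u1[of s] by (simp add: algebra_simps)
  qed simp
  have 2: "(1/2 - U (1/2)) * 1 - (1/2 - U (1/2)) * (1/2) <= ((1^2/2 - M 1) + G (3/2) * 1) - (((1/2)^2/2 - M (1/2)) + G (3/2) * (1/2))"
  proof (rule deriv_le[OF _ di DERIV_add[OF DM di]])
   fix s :: real assume s: "1/2 <= s" "s <= 1"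
   show "1/2 - U (1/2) <= (1 - u s) * s + G (3/2)"
    using Ul[of "1/2" s] hole[of s] Gm[of s "3/2"] s by (simp add: mult.commute)
  qed simp
  have "0^2/2 - M 0 <= (1/2)^2/2 - M (1/2)" by (rule inM) auto
  moreover have "DD 1 = (1^2/2 - M 1) + (M (3/2) - M 1)" by (rule DDe) auto
  moreover have "i + (ur - u1) <= 4 * dd + g" 
   if "m0 <= h" "m0 = 0" "dd = D + (mr - m1)" "i - a <= 2 * D - 2 * h" "a * 1 - a * (1/2) <= (D + g * 1) - (h + g * (1/2))" "ur - u1 <= mr - m1" "0 <= ur - u1"
   for i ur u1 dd g m0 h D mr m1 a :: real using that by argo
  moreover have "0^2/2 - M 0 = 0" using M(2) by simp
  ultimately show ?thesis using 1 2 out out0 unfolding nne eq by blast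
 qed
 show "nn <= \<rho> + DD 1 / \<rho>" if r: "0 < \<rho>" "\<rho> <= 1" for \<rho>
 proof -
  have "(1 - U 1) - (\<rho> - U \<rho>) <= inverse \<rho> * (1^2/2 - M 1) - inverse \<rho> * (\<rho>^2/2 - M \<rho>)"
  proof (rule deriv_le[OF _ DU DERIV_cmult[OF DM]])
   fix s :: real assume s: "\<rho> <= s"
   hence "1 <= inverse \<rho> * s" using r by (simp add: field_simps)
   thus "1 - u s <= inverse \<rho> * ((1 - u s) * s)" using mult_left_mono[of 1 "inverse \<rho> * s" "1 - u s"] u1[of s] by (simp add: algebra_simps)
  qed (use r in simp)
  moreover have "0 <= inverse \<rho> * (\<rho>^2/2 - M \<rho>)" using inM[of 0 \<rho>] M r by simp
  moreover have "\<rho> - U \<rho> <= \<rho>" using Um[of 0 \<rho>] U r by simp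
  moreover have "M (3/2) - M 1 <= inverse \<rho> * (M (3/2) - M 1)"
  proof -
   have "1 <= inverse \<rho>" using r by (simp add: one_le_inverse)
   from mult_right_mono[OF this order_trans[OF out0 out]] show ?thesis by simp
  qed
  ultimately have "nn <= \<rho> + (inverse \<rho> * (1^2/2 - M 1) + inverse \<rho> * (M (3/2) - M 1))" using out unfolding nne by linarith
  also have "inverse \<rho> * (1^2/2 - M 1) + inverse \<rho> * (M (3/2) - M 1) = DD 1 / \<rho>"
  proof -
   have "DD 1 = (1^2/2 - M 1) + (M (3/2) - M 1)" by (rule DDe) auto
   thus ?thesis by (simp only: divide_inverse distrib_right mult.commute[of "inverse \<rho>"])
  qed
  finally show ?thesis .
 qed
 show "DD t <= \<bar>ell^2 - t^2\<bar> / 2 + (mass - ell^2 / 2) + 3 * (\<eta> + 2 * gam + 3 * qq / \<eta>)"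
  if t: "1/2 <= t" "0 < \<eta>" "t + \<eta> <= 3/2" for t \<eta>
 proof -
  \<comment> \<open>\<open>A\<close> is the gap before t and \<open>B\<close> the part beyond t,
    both as lengths. At a point x just after t a small u x makes \<open>B\<close> small and a small
    1 - u x makes \<open>A\<close> small, up to \<eta> and \<open>gam\<close>. Averaging over
    [t, t + \<eta>] bounds the smaller of the two, and comparing t with ell decides which one it
    is.\<close>
  define A where "A = t - U t"
  define B where "B = U (3/2) - U t"
  have pt: "min A B <= \<eta> + 2 * gam + 3 * (u x * (1 - u x))" if x: "t <= x" "x <= t + \<eta>" for x
  proof -
   have xr: "1/2 <= x" "x <= 3/2" using x t by auto
   have KG: "K s - K x <= 2 * gam" if s: "x <= s" "s <= 3/2" for s
   proof -
    have "K s - K x <= 2 * G s - 2 * G x"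
    proof (rule deriv_le[OF s(1) K(1) DERIV_cmult[OF G(1)]])
     fix y assume "x <= y"
     hence "1 <= 2 * y" using xr by simp
     thus "max 0 (u' y) <= 2 * (max 0 (u' y) * y)" using mult_left_mono[of 1 "2*y" "max 0 (u' y)"] by simp
    qed
    moreover have "0 <= G x" using Gm[of 0 x] G xr by simp
    ultimately show ?thesis using Gm[of s "3/2"] s xr eq by simp
   qed
   have "U (3/2) - U x <= (u x + 2 * gam) * (3/2) - (u x + 2 * gam) * x"
   proof (rule deriv_le[OF xr(2) U(1) di])
    fix s assume s: "x <= s" "s <= 3/2"
    show "u s <= u x + 2 * gam" using inc[OF s(1)] KG[OF s] by simp
   qed
   also have "... = (u x + 2 * gam) * (3/2 - x)" by (simp add: algebra_simps)
   also have "... <= (u x + 2 * gam) * 1" using xr u0[of x] \<open>0 <= gam\<close> by (intro mult_left_mono) auto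
   finally have Bx: "B <= \<eta> + u x + 2 * gam" using Ul[OF x(1)] x unfolding B_def by argo
   have "x * (1 - u x) <= 3/2 * (1 - u x)" using xr u1[of x] by (intro mult_right_mono) auto
   hence Ax: "A <= 3/2 * (1 - u x) + gam" using hole[of x] Ul[OF x(1)] Gm[of x "3/2"] xr unfolding A_def eq by linarith
   have mn: "min (u x) (1 - u x) <= 2 * (u x * (1 - u x))"
   proof (cases "u x <= 1/2")
    case True thus ?thesis using mult_left_mono[of "1/2" "1 - u x" "u x"] u0[of x] by (simp add: min_def)
   next
    case False thus ?thesis using mult_right_mono[of "1/2" "u x" "1 - u x"] u1[of x] by (simp add: min_def)
   qed
   show ?thesis
   proof (cases "u x <= 1 - u x")
    case True
    hence "u x <= 2 * (u x * (1 - u x))" using mn by simp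
    moreover have "0 <= u x * (1 - u x)" using u0[of x] u1[of x] by simp
    ultimately show ?thesis using Bx min.cobounded2[of A B] by argo
   next
    case False
    hence "1 - u x <= 2 * (u x * (1 - u x))" using mn by simp
    thus ?thesis using Ax \<open>0 <= gam\<close> t min.cobounded1[of A B] by argo
   qed
  qed
  have "min A B * (t + \<eta>) - min A B * t <= ((\<eta> + 2 * gam) * (t + \<eta>) + 3 * Q (t + \<eta>)) - ((\<eta> + 2 * gam) * t + 3 * Q t)"
   by (rule deriv_le[OF _ di DERIV_add[OF di DERIV_cmult[OF Q(1)]]]) (use pt t in auto)
  hence "min A B * \<eta> <= (\<eta> + 2 * gam) * \<eta> + 3 * (Q (t + \<eta>) - Q t)" by (simp add: algebra_simps)
  also have "... <= (\<eta> + 2 * gam) * \<eta> + 3 * qq" using Qm[OF t(3)] Qm[of 0 t] Q t eq by simp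
  finally have mAB: "min A B <= \<eta> + 2 * gam + 3 * qq / \<eta>" using t(2) by (simp add: field_simps)
  have e0: "0 <= M (3/2) - (U (3/2))^2 / 2" using ex0 by (simp add: eq)
  show ?thesis
  proof (cases "t <= ell")
   case True
   hence "min A B = A" by (simp add: A_def B_def eq)
   have "(t^2/2 - M t) - (0^2/2 - M 0) <= 3/2 * (t - U t) - 3/2 * (0 - U 0)"
   proof (rule deriv_le[OF _ DM DERIV_cmult[OF DU]])
    fix s assume "0 <= s" "s <= t"
    thus "(1 - u s) * s <= 3/2 * (1 - u s)" using mult_right_mono[of s "3/2" "1 - u s"] u1[of s] t by (simp add: mult.commute)
   qed (use t in simp)
   hence "t^2/2 - M t <= 3/2 * A" using U M by (simp add: A_def)
   hence "DD t <= (ell^2 - t^2) / 2 + (mass - ell^2 / 2) + 3 * A" using DDe[of t] t unfolding eq by (simp add: diff_divide_distrib)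
   moreover have "(ell^2 - t^2) / 2 <= \<bar>ell^2 - t^2\<bar> / 2" by (intro divide_right_mono) auto
   ultimately show ?thesis using mAB unfolding \<open>min A B = A\<close> by argo
  next
   case False
   hence "min A B = B" by (simp add: A_def B_def eq)
   have "M (3/2) - M t <= 3/2 * U (3/2) - 3/2 * U t"
   proof (rule deriv_le[OF _ M(1) DERIV_cmult[OF U(1)]])
    fix s assume "t <= s" "s <= (3/2::real)"
    thus "u s * s <= 3/2 * u s" using mult_right_mono[of s "3/2" "u s"] u0[of s] by (simp add: mult.commute)
   qed (use t in simp)
   hence "DD t <= (t^2 - ell^2) / 2 + 3 * B" using DDe[of t] t e0 unfolding eq B_def by (simp add: diff_divide_distrib)
   moreover have "(t^2 - ell^2) / 2 <= \<bar>ell^2 - t^2\<bar> / 2" by (intro divide_right_mono) auto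
   ultimately show ?thesis using mAB ex0 unfolding \<open>min A B = B\<close> by argo
  qed
 qed
qed

end

lemma sqrt_one_minus: "0 <= x ==> x <= 1 ==> 1 - x / 2 - x^2 / 2 <= sqrt (1 - x)" for x :: real
proof -
 assume x: "0 <= x" "x <= 1"
 have "(1 - x / 2 - x^2 / 2)^2 <= 1 - x"
 proof -
  have "(1 - x) - (1 - x / 2 - x^2 / 2)^2 = x^2 * (3 - 2 * x - x^2) / 4" by (simp add: power2_eq_square field_simps)
  moreover have "x^2 <= 1" using x by (simp add: abs_square_le_1)
  hence "0 <= 3 - 2 * x - x^2" using x by linarith
  hence "0 <= x^2 * (3 - 2 * x - x^2) / 4" by (intro divide_nonneg_nonneg mult_nonneg_nonneg) auto
  ultimately show ?thesis by linarith
 qed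
 thus ?thesis by (rule real_le_rsqrt)
qed

text \<open>Cauchy-Schwarz with the unit vector (sqrt (1 - b^2), b), which is the tilted radial
  direction in polar components.\<close>

lemma sqrt_cs: "b^2 <= 1 ==> sqrt (1 - b^2) * \<bar>x\<bar> + b * y <= sqrt (x^2 + y^2)" for b x y :: real
proof (rule real_le_rsqrt)
 assume b: "b^2 <= 1"
 define c where "c = sqrt (1 - b^2)"
 have c: "c^2 = 1 - b^2" using b by (simp add: c_def)
 have "x^2 + y^2 - (c * \<bar>x\<bar> + b * y)^2 = (b * \<bar>x\<bar> - c * y)^2 + (1 - c^2 - b^2) * (x^2 + y^2)"
  by (simp add: power2_eq_square algebra_simps)
 hence "0 <= x^2 + y^2 - (c * \<bar>x\<bar> + b * y)^2" using c by simp
 thus "(sqrt (1 - b^2) * \<bar>x\<bar> + b * y)^2 <= x^2 + y^2" by (simp add: c_def)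
qed

lemma cont_param_int:
 fixes f :: "real => real => real"
 assumes "continuous_on UNIV (\<lambda>p. f (fst p) (snd p))"
 shows "continuous_on S (\<lambda>t. integral {a..b} (f t))"
proof -
 have "continuous_on (UNIV \<times> cbox a b) (\<lambda>(x, t). f x t)"
  using continuous_on_subset[OF assms, of "UNIV \<times> cbox a b"] by (simp add: case_prod_unfold)
 from integral_continuous_on_param[OF this] show ?thesis by (auto intro: continuous_on_subset)
qed

lemma J_lin: "cont f ==> cont g ==> J (\<lambda>x. a * f x + g x) = a * J f + J g"
 by (subst J_add) (auto intro!: continuous_intros simp: J_cmult)

lemma J_mode1:
 "J (\<lambda>x. cos x) = 0" "J (\<lambda>x. sin x) = 0" "J (\<lambda>x. cos x * cos x) = pi" "J (\<lambda>x. sin x * sin x) = pi"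
 "J (\<lambda>x. sin x * cos x) = 0" "J (\<lambda>x. cos x * sin x) = 0"
 using J_cos[of 1] J_sin[of 1] J_orth[of 1 1] by auto

lemma J_minus_modes:
 assumes f: "cont f"
 shows "J (\<lambda>x. (f x - (\<alpha> + \<beta> * cos x + \<gamma> * sin x))^2) =
   J2 f - 2 * (\<alpha> * J f + \<beta> * J (\<lambda>x. f x * cos x) + \<gamma> * J (\<lambda>x. f x * sin x)) + 2 * pi * \<alpha>^2 + pi * (\<beta>^2 + \<gamma>^2)"
  and "J (\<lambda>x. f x - (\<alpha> + \<beta> * cos x + \<gamma> * sin x)) = J f - 2 * pi * \<alpha>"
  and "J (\<lambda>x. (f x - (\<alpha> + \<beta> * cos x + \<gamma> * sin x)) * cos x) = J (\<lambda>x. f x * cos x) - pi * \<beta>"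
  and "J (\<lambda>x. (f x - (\<alpha> + \<beta> * cos x + \<gamma> * sin x)) * sin x) = J (\<lambda>x. f x * sin x) - pi * \<gamma>"
proof -
 note lin = J_lin J_cmult J_const J_mode1 f continuous_on_add continuous_on_mult continuous_on_const continuous_on_cos continuous_on_sin continuous_on_id continuous_on_power
 have "J (\<lambda>x. (f x - (\<alpha> + \<beta> * cos x + \<gamma> * sin x))^2) =
  J (\<lambda>x. 1 * (f x)^2 + ((-2 * \<alpha>) * f x + ((-2 * \<beta>) * (f x * cos x) + ((-2 * \<gamma>) * (f x * sin x) + ((2 * \<alpha> * \<beta>) * cos x
   + ((2 * \<alpha> * \<gamma>) * sin x + (\<beta>^2 * (cos x * cos x) + ((2 * \<beta> * \<gamma>) * (sin x * cos x) + (\<gamma>^2 * (sin x * sin x) + \<alpha>^2)))))))))"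
  by (intro J_cong) (simp add: power2_eq_square algebra_simps)
 also have "... = J2 f - 2 * (\<alpha> * J f + \<beta> * J (\<lambda>x. f x * cos x) + \<gamma> * J (\<lambda>x. f x * sin x)) + 2 * pi * \<alpha>^2 + pi * (\<beta>^2 + \<gamma>^2)"
  by (simp only: lin; simp add: algebra_simps)
 finally show "J (\<lambda>x. (f x - (\<alpha> + \<beta> * cos x + \<gamma> * sin x))^2) =
   J2 f - 2 * (\<alpha> * J f + \<beta> * J (\<lambda>x. f x * cos x) + \<gamma> * J (\<lambda>x. f x * sin x)) + 2 * pi * \<alpha>^2 + pi * (\<beta>^2 + \<gamma>^2)" .
 have "J (\<lambda>x. f x - (\<alpha> + \<beta> * cos x + \<gamma> * sin x)) = J (\<lambda>x. 1 * f x + ((-\<beta>) * cos x + ((- \<gamma>) * sin x + (- \<alpha>))))"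
  by (intro J_cong) (simp add: algebra_simps)
 also have "... = J f - 2 * pi * \<alpha>" by (simp only: lin; simp)
 finally show "J (\<lambda>x. f x - (\<alpha> + \<beta> * cos x + \<gamma> * sin x)) = J f - 2 * pi * \<alpha>" .
 have "J (\<lambda>x. (f x - (\<alpha> + \<beta> * cos x + \<gamma> * sin x)) * cos x) = J (\<lambda>x. 1 * (f x * cos x) + ((-\<beta>) * (cos x * cos x) + ((- \<gamma>) * (sin x * cos x) + (- \<alpha>) * cos x)))"
  by (intro J_cong) (simp add: algebra_simps)
 also have "... = J (\<lambda>x. f x * cos x) - pi * \<beta>" by (simp only: lin; simp)
 finally show "J (\<lambda>x. (f x - (\<alpha> + \<beta> * cos x + \<gamma> * sin x)) * cos x) = J (\<lambda>x. f x * cos x) - pi * \<beta>" .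
 have "J (\<lambda>x. (f x - (\<alpha> + \<beta> * cos x + \<gamma> * sin x)) * sin x) = J (\<lambda>x. 1 * (f x * sin x) + ((-\<beta>) * (sin x * cos x) + ((- \<gamma>) * (sin x * sin x) + (- \<alpha>) * sin x)))"
  by (intro J_cong) (simp add: algebra_simps)
 also have "... = J (\<lambda>x. f x * sin x) - pi * \<gamma>" by (simp only: lin; simp)
 finally show "J (\<lambda>x. (f x - (\<alpha> + \<beta> * cos x + \<gamma> * sin x)) * sin x) = J (\<lambda>x. f x * sin x) - pi * \<gamma>" .
qed

text \<open>Mode 1 contributes nothing to J2 w' - J2 w, and mode 0 contributes - 2 pi \<mu>^2.
  Removing both therefore only adds the last term to the right-hand side of
  \<open>trig_coercive\<close>.\<close>

lemma trig_coercive_modes: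
 fixes w w' :: "real => real"
 defines "\<mu> \<equiv> J w / (2 * pi)" and "c \<equiv> J (\<lambda>x. w x * cos x) / pi" and "s \<equiv> J (\<lambda>x. w x * sin x) / pi"
 assumes w: "\<And>x. (w has_real_derivative w' x) (at x)" "cont w'" "w 0 = w (2*pi)"
 shows "(J (\<lambda>x. \<bar>w x - (\<mu> + c * cos x + s * sin x)\<bar>))^2 <= (pi / 4 + 10 / (3 * pi)) * (J2 w' - J2 w + 2 * pi * \<mu>^2)"
proof -
 have cw: "cont w" using w(1) by (meson DERIV_isCont continuous_at_imp_continuous_on)
 have coeff: "J w = 2 * pi * \<mu>" "J (\<lambda>x. w x * cos x) = pi * c" "J (\<lambda>x. w x * sin x) = pi * s" by (simp_all add: \<mu>_def c_def s_def)
 note orth = J_minus_modes(2-4)[OF cw, of \<mu> c s, unfolded coeff, simplified]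
 have "(J (\<lambda>x. \<bar>w x - (\<mu> + c * cos x + s * sin x)\<bar>))^2 <= (pi / 4 + 10 / (3 * pi)) *
  (J (\<lambda>x. (w' x - (0 + s * cos x + (- c) * sin x))^2) - J (\<lambda>x. (w x - (\<mu> + c * cos x + s * sin x))^2))"
 proof (rule trig_coercive)
  show "((\<lambda>x. w x - (\<mu> + c * cos x + s * sin x)) has_real_derivative w' x - (0 + s * cos x + (- c) * sin x)) (at x)" for x
   using w(1)[of x] by (auto intro!: derivative_eq_intros)
  show "cont (\<lambda>x. w' x - (0 + s * cos x + (- c) * sin x))" by (intro continuous_intros w(2))
  fix k :: nat assume "k <= 1"
  hence "k = 0 \<or> k = 1" by auto
  thus "J (\<lambda>x. (w x - (\<mu> + c * cos x + s * sin x)) * cos (real k * x)) = 0" "J (\<lambda>x. (w x - (\<mu> + c * cos x + s * sin x)) * sin (real k * x)) = 0"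
   using orth by (auto simp: J_const)
 qed (use w(3) in simp)
 also have "J (\<lambda>x. (w' x - (0 + s * cos x + (- c) * sin x))^2) = J2 w' - pi * (c^2 + s^2)"
 proof -
  have "J (\<lambda>x. w' x * cos x) = - J (\<lambda>x. w x * (- sin x))"
   by (intro J_parts w continuous_intros) (auto intro!: derivative_eq_intros)
  also have "... = pi * s" using J_cmult[of "-1" "\<lambda>x. w x * sin x"] coeff by simp
  finally have 1: "J (\<lambda>x. w' x * cos x) = pi * s" .
  have "J (\<lambda>x. w' x * sin x) = - J (\<lambda>x. w x * cos x)"
   by (intro J_parts w continuous_intros) (auto intro!: derivative_eq_intros)
  hence 2: "J (\<lambda>x. w' x * sin x) = - (pi * c)" using coeff by simp
  show ?thesis unfolding J_minus_modes(1)[OF w(2)] 1 2 by (simp add: power2_eq_square algebra_simps)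
 qed
 also have "J (\<lambda>x. (w x - (\<mu> + c * cos x + s * sin x))^2) = J2 w - 2 * pi * \<mu>^2 - pi * (c^2 + s^2)"
  unfolding J_minus_modes(1)[OF cw] coeff by (simp add: power2_eq_square algebra_simps)
 finally show ?thesis by (simp add: algebra_simps)
qed

text \<open>\<open>W\<close> is the mollified indicator in polar coordinates, with radial and angular derivatives \<open>Wr\<close> and \<open>Wt\<close>, and
 \<open>k\<^sup>4\<close> is the asymmetry. The third argument of \<open>H3\<close> is the polar equation of the unit circle about \<open>(c, s)\<close>.\<close>

locale profile =
 fixes W Wr Wt :: "real => real => real" and k P m :: real
 assumes ray: "\<And>th. ray (W th) (Wr th)"
  and dt: "\<And>th r. ((\<lambda>th. W th r) has_real_derivative Wt th r) (at th)"
  and cW: "continuous_on UNIV (\<lambda>p. W (fst p) (snd p))" and cWr: "continuous_on UNIV (\<lambda>p. Wr (fst p) (snd p))"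
  and cWt: "continuous_on UNIV (\<lambda>p. Wt (fst p) (snd p))"
  and per: "\<And>r. W (2*pi) r = W 0 r"
  and k: "0 < k" "k <= 1 / 100000000"
  and H1: "J (\<lambda>th. integral {0..3/2} (\<lambda>r. sqrt ((Wr th r * r)^2 + (Wt th r)^2))) <= P"
  and H2: "J (\<lambda>th. ray.mass (W th)) = pi - m" "0 <= m" "m <= k^12"
  and H3: "\<And>c s h. \<bar>c\<bar> <= 1/10 ==> \<bar>s\<bar> <= 1/10 ==> cont h ==>
   (\<And>th. th \<in> {0..2*pi} ==> ray.DD (W th) (c * cos th + s * sin th + sqrt (1 - (c^2 + s^2) + (c * cos th + s * sin th)^2)) <= h th) ==> pi * k^4 <= k^12 + J h"
  and H3': "J (\<lambda>th. ray.DD (W th) 1) <= 7 * k^4"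
  and H4: "J (\<lambda>th. ray.qq (W th)) <= k^16"
  and H5: "P <= 2 * pi + 3 * k^8"
begin

sublocale R: ray "W th" "Wr th" for th by (rule ray)

text \<open>One further power of \<open>k\<close> absorbs any constant up to 10^8, so error terms
  can be compared by their exponents. The deficit is of the order k^8.\<close>

lemma powers: "0 < k^n" "k^(Suc n) <= k^n / 100000000"
proof -
 show p: "0 < k^n" using k by simp
 have "k * k^n <= (1 / 100000000) * k^n" by (intro mult_right_mono k) (use p in simp)
 thus "k^(Suc n) <= k^n / 100000000" by simp
qed

lemma pw:
 shows "0 < k^4" and "0 < k^5" and "0 < k^6" and "0 < k^7" and "0 < k^8" and "0 < k^9" and "0 < k^10" and "0 < k^11" and "0 < k^12" and "0 < k^13" and "0 < k^14" and "0 < k^15" and "0 < k^16"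
  and "k^5 <= k^4 / 100000000" and "k^6 <= k^5 / 100000000" and "k^7 <= k^6 / 100000000" and "k^8 <= k^7 / 100000000" and "k^9 <= k^8 / 100000000" and "k^10 <= k^9 / 100000000" and "k^11 <= k^10 / 100000000" and "k^12 <= k^11 / 100000000" and "k^13 <= k^12 / 100000000" and "k^14 <= k^13 / 100000000" and "k^15 <= k^14 / 100000000" and "k^16 <= k^15 / 100000000"
 using powers(1) powers(2)[of 4] powers(2)[of 5] powers(2)[of 6] powers(2)[of 7] powers(2)[of 8] powers(2)[of 9] powers(2)[of 10] powers(2)[of 11] powers(2)[of 12] powers(2)[of 13] powers(2)[of 14] powers(2)[of 15] k(1) by (simp_all del: power_Suc)

definition "l th = ray.ell (W th)"
definition "g th = ray.gam (Wr th)"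
definition "q th = ray.qq (W th)"
definition "e th = ray.mass (W th) - (l th)^2 / 2"
definition "v th = l th - 1"
definition "n th = ray.nn (W th)"
definition "p th = integral {0..3/2} (Wt th)"
text \<open>\<open>p\<close> is the angular derivative of \<open>l\<close> by \<open>dl\<close>.
  Clipping it at k keeps sqrt (1 - b^2) within k^2 of 1, while b p still dominates both b^2 and k |p
  - b|.\<close>

definition "b th = max (- k) (min k (p th))"

lemma c_l: "continuous_on S l" unfolding l_def R.ell_def by (rule cont_param_int[OF cW])

lemma c_g: "continuous_on S g"
 unfolding g_def R.gam_def by (rule cont_param_int) (intro continuous_intros cWr)

lemma c_q: "continuous_on S q"
 unfolding q_def R.qq_def by (rule cont_param_int) (intro continuous_intros cW)

lemma c_mass: "continuous_on S (\<lambda>th. ray.mass (W th))"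
 unfolding R.mass_def by (rule cont_param_int) (intro continuous_intros cW)

lemma c_e: "continuous_on S e" unfolding e_def by (intro continuous_intros c_mass c_l) auto
lemma c_v: "continuous_on S v" unfolding v_def by (intro continuous_intros c_l)
lemma c_p: "continuous_on S p" unfolding p_def by (rule cont_param_int[OF cWt])
lemma c_b: "continuous_on S b" unfolding b_def by (intro continuous_intros c_p)

lemma c_n: "continuous_on S n"
proof -
 have 1: "continuous_on S (\<lambda>th. integral {0..1} (\<lambda>r. 1 - W th r))" "continuous_on S (\<lambda>th. integral {1..3/2} (W th))"
  by (rule cont_param_int; intro continuous_intros cW)+
 thus ?thesis unfolding n_def R.nn_def by (intro continuous_intros)
qed

lemma c_D1: "continuous_on S (\<lambda>th. ray.DD (W th) 1)"
proof -
 have 1: "continuous_on S (\<lambda>th. integral {0..1} (\<lambda>r. (1 - W th r) * r))" "continuous_on S (\<lambda>th. integral {1..3/2} (\<lambda>r. W th r * r))"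
  by (rule cont_param_int; intro continuous_intros cW)+
 thus ?thesis unfolding R.DD_def by (intro continuous_intros)
qed

lemmas cs = c_l c_g c_q c_mass c_e c_v c_p c_b c_n c_D1

lemma dl: "(l has_real_derivative p th) (at th)"
proof -
 have "((\<lambda>x. integral (cbox 0 (3/2)) (W x)) has_field_derivative integral (cbox 0 (3/2)) (Wt th)) (at th within UNIV)"
 proof (rule leibniz_rule_field_derivative)
  show "W x integrable_on cbox 0 (3 / 2)" for x using R.cu by (intro integrable_continuous) auto
  show "continuous_on (UNIV \<times> cbox 0 (3 / 2)) (\<lambda>(x, t). Wt x t)"
   using continuous_on_subset[OF cWt, of "UNIV \<times> cbox 0 (3/2)"] by (simp add: case_prod_unfold)
 qed (use dt in auto)
 thus ?thesis unfolding l_def[abs_def] R.ell_def p_def by simp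
qed

lemma dv: "(v has_real_derivative p th) (at th)"
 unfolding v_def[abs_def] using DERIV_diff[OF dl[of th] DERIV_const[of 1]] by simp

lemma l_per: "l (2*pi) = l 0"
proof -
 have "W (2*pi) = W 0" using per by auto
 thus ?thesis by (simp add: l_def)
qed

lemma b_facts: "(b th)^2 <= b th * p th" "\<bar>p th - b th\<bar> * k <= b th * p th" "(b th)^2 <= k^2" "0 <= b th * p th"
proof -
 consider "p th > k" | "p th < - k" | "\<bar>p th\<bar> <= k" by linarith
 thus "(b th)^2 <= b th * p th" "\<bar>p th - b th\<bar> * k <= b th * p th" "(b th)^2 <= k^2"
 proof (atomize (full), cases)
  case 1
  hence "b th = k" using k by (simp add: b_def)
  thus "(b th)^2 <= b th * p th \<and> \<bar>p th - b th\<bar> * k <= b th * p th \<and> (b th)^2 <= k^2"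
   using 1 k by (simp add: power2_eq_square algebra_simps)
 next
  case 2
  hence "b th = - k" using k by (simp add: b_def)
  thus "(b th)^2 <= b th * p th \<and> \<bar>p th - b th\<bar> * k <= b th * p th \<and> (b th)^2 <= k^2"
   using 2 k mult_left_mono[of k "- p th" k] by (simp add: power2_eq_square algebra_simps)
 next
  case 3
  hence "b th = p th" by (auto simp: b_def)
  moreover have "(p th)^2 <= k^2" using 3 k by (simp add: abs_le_square_iff[symmetric])
  ultimately show "(b th)^2 <= b th * p th \<and> \<bar>p th - b th\<bar> * k <= b th * p th \<and> (b th)^2 <= k^2"
   by (simp add: power2_eq_square)
 qed
 thus "0 <= b th * p th" using zero_le_power2[of "b th"] by linarith
qed

lemma ray_signs: "0 <= g th" "0 <= q th" "0 <= l th" "l th <= 3/2" "0 <= e th" "e th <= 3/2 * (g th + q th)" "\<bar>v th\<bar> <= n th" "0 <= n th"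
 "n th <= 4 * ray.DD (W th) 1 + g th" "0 < \<rho> ==> \<rho> <= 1 ==> n th <= \<rho> + ray.DD (W th) 1 / \<rho>"
 unfolding g_def q_def l_def e_def v_def n_def
 by (rule R.gam0 R.qq0 R.ell0 R.ell32 R.excess0 R.excess R.ell_n R.nn0 R.n_le R.n_le'; assumption?)+

lemma k_sq: "0 < k^2" "k^2 <= 1 / 10000000000000000"
 using powers(1)[of 2] power_mono[OF k(2), of 2] k by (auto simp: power_divide)

text \<open>The length density is tested with one direction (sqrt (1 - b^2), b) for the whole ray.
  The radial part then integrates to l + 2 g by \<open>abs_radial\<close>, and the angular part to b
  p.\<close>

lemma lower_integrand:
 "l th - l th * (b th)^2 * (1 + k^2) / 2 + 2 * (1 - k^2) * g th + b th * p th <= integral {0..3/2} (\<lambda>r. sqrt ((Wr th r * r)^2 + (Wt th r)^2))"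
proof -
 define c where "c = sqrt (1 - (b th)^2)"
 have b1: "(b th)^2 <= 1" using b_facts(3)[of th] k_sq by linarith
 have c1: "continuous_on S (\<lambda>r. Wr th r)" "continuous_on S (\<lambda>r. Wt th r)" for S
  by (rule continuous_on_compose2[OF cWr, of S "\<lambda>r. (th, r)", simplified] continuous_on_compose2[OF cWt, of S "\<lambda>r. (th, r)", simplified]; intro continuous_intros)+
 have "c * (l th + 2 * g th) + b th * p th = integral {0..3/2} (\<lambda>r. c * (\<bar>Wr th r\<bar> * r) + b th * Wt th r)"
  unfolding l_def g_def R.abs_radial[symmetric] p_def
  using c1 by (subst Henstock_Kurzweil_Integration.integral_add) (auto intro!: integrable_continuous_real continuous_intros)
 also have "... <= integral {0..3/2} (\<lambda>r. sqrt ((Wr th r * r)^2 + (Wt th r)^2))"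
 proof (rule integral_le)
  fix r :: real assume "r \<in> {0..3/2}"
  thus "c * (\<bar>Wr th r\<bar> * r) + b th * Wt th r <= sqrt ((Wr th r * r)^2 + (Wt th r)^2)"
   using sqrt_cs[OF b1, of "Wr th r * r" "Wt th r"] by (simp add: c_def abs_mult)
 qed (use c1 in \<open>auto intro!: integrable_continuous_real continuous_intros\<close>)
 finally have 1: "c * (l th + 2 * g th) + b th * p th <= integral {0..3/2} (\<lambda>r. sqrt ((Wr th r * r)^2 + (Wt th r)^2))" .
 have b4: "((b th)^2)^2 <= k^2 * (b th)^2" using mult_right_mono[OF b_facts(3)[of th], of "(b th)^2"] by (simp add: power2_eq_square)
 have c_lo: "1 - (b th)^2 * (1 + k^2) / 2 <= c"
 proof -
  have "(b th)^2 * (1 + k^2) = (b th)^2 + k^2 * (b th)^2" by (simp add: algebra_simps)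
  thus ?thesis using sqrt_one_minus[of "(b th)^2"] b1 b4 unfolding c_def by simp argo
 qed
 moreover have "(b th)^2 * (1 + k^2) / 2 <= k^2"
 proof -
  have "(b th)^2 * (1 + k^2) <= k^2 * 2" using b_facts(3)[of th] k_sq by (intro mult_mono) auto
  thus ?thesis by simp
 qed
 ultimately have "1 - k^2 <= c" by linarith
 hence "(1 - k^2) * (2 * g th) <= c * (2 * g th)" using ray_signs by (intro mult_right_mono) auto
 moreover have "(1 - (b th)^2 * (1 + k^2) / 2) * l th <= c * l th" using ray_signs c_lo by (intro mult_right_mono) auto
 ultimately show ?thesis using 1 by (simp add: algebra_simps)
qed

definition "X = J (\<lambda>th. b th * p th)"
definition "G = J g"
definition "N = J n"
definition "V = J2 v"

lemma c_int: "cont (\<lambda>th. integral {0..3/2} (\<lambda>r. sqrt ((Wr th r * r)^2 + (Wt th r)^2)))"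
 by (rule cont_param_int) (intro continuous_intros cWr cWt)

lemma Jv: "J v = - m - V / 2 - J e"
proof -
 have "pi - m = J (\<lambda>th. (1/2 + v th) + ((1/2) * (v th)^2 + e th))"
  unfolding H2(1)[symmetric] by (intro J_cong) (simp add: e_def v_def power2_eq_square field_simps)
 also have "... = J (\<lambda>th. 1/2 + v th) + J (\<lambda>th. (1/2) * (v th)^2 + e th)" by (intro J_add continuous_intros cs)
 also have "J (\<lambda>th. 1/2 + v th) = pi + J v" by (subst J_add) (auto intro!: continuous_intros cs simp: J_const)
 also have "J (\<lambda>th. (1/2) * (v th)^2 + e th) = J (\<lambda>th. (1/2) * (v th)^2) + J e" by (intro J_add continuous_intros cs)
 also have "J (\<lambda>th. (1/2) * (v th)^2) = (1/2) * V" unfolding V_def by (rule J_cmult)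
 finally show ?thesis by simp
qed

lemma Je: "0 <= J e" "J e <= 3/2 * (G + J q)"
proof -
 show "0 <= J e" using ray_signs by (intro J_nonneg cs)
 have "J e <= J (\<lambda>th. 3/2 * (g th + q th))" using ray_signs by (intro J_mono continuous_intros cs)
 also have "... = 3/2 * (G + J q)" unfolding J_cmult G_def by (subst J_add) (auto intro!: cs)
 finally show "J e <= 3/2 * (G + J q)" .
qed

lemma G0: "0 <= G" unfolding G_def using ray_signs by (intro J_nonneg cs)
lemma X0: "0 <= X" unfolding X_def using b_facts by (intro J_nonneg continuous_intros cs)
lemma N0: "0 <= N" unfolding N_def using ray_signs by (intro J_nonneg cs)
lemma V0: "0 <= V" unfolding V_def by (intro J_nonneg continuous_intros cs) auto

text \<open>The integral of \<open>l\<close> is fixed by the area: \<open>Jv\<close> expresses it as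
  2 pi minus m, V / 2 and J e. The function \<open>h\<close> is what remains of b p after the tilt
  has been paid for.\<close>

lemma master:
 assumes s: "\<And>th. th \<in> {0..2*pi} ==> l th * (b th)^2 * (1 + k^2) / 2 + h th <= b th * p th" and h: "cont h"
 shows "2 * pi - m - V / 2 - J e + 2 * (1 - k^2) * G + J h <= P"
proof -
 have "2 * pi + J v + 2 * (1 - k^2) * G + J h = J (\<lambda>th. (1 + v th) + (2 * (1 - k^2) * g th + h th))"
  unfolding G_def using h
  by (subst J_add; (subst J_add)?; (subst J_add)?) (auto intro!: continuous_intros cs simp: J_const J_cmult)
 also have "... <= J (\<lambda>th. integral {0..3/2} (\<lambda>r. sqrt ((Wr th r * r)^2 + (Wt th r)^2)))"
 proof (rule J_mono)
  fix th assume "th \<in> {0..2*pi}"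
  from s[OF this] lower_integrand[of th]
  show "(1 + v th) + (2 * (1 - k^2) * g th + h th) <= integral {0..3/2} (\<lambda>r. sqrt ((Wr th r * r)^2 + (Wt th r)^2))"
   by (simp add: v_def)
 qed (use h c_int in \<open>auto intro!: continuous_intros cs\<close>)
 finally show ?thesis using H1 Jv by linarith
qed

text \<open>Only l <= 3/2 is known here. Tilting then spends slightly more than three quarters of b
  p, which leaves 6/25; of 2 G the excess J e takes at most 3/2 G, which leaves 12/25. The term V /
  2 has still to be absorbed.\<close>

lemma stage1: "12/25 * G + 6/25 * X <= 4 * k^8 + V / 2"
proof -
 have "2 * pi - m - V / 2 - J e + 2 * (1 - k^2) * G + J (\<lambda>th. 6/25 * (b th * p th)) <= P"
 proof (rule master)
  fix th
  have "l th * (b th)^2 * (1 + k^2) <= (3/2) * (b th * p th) * (1 + 1/10000000000000000)"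
   using ray_signs[of th] b_facts[of th] k_sq by (intro mult_mono) auto
  moreover have "L / 2 + 6/25 * t <= t" if "L <= (3/2) * t * (1 + 1/10000000000000000)" "0 <= t" for L t :: real using that by argo
  ultimately show "l th * (b th)^2 * (1 + k^2) / 2 + 6/25 * (b th * p th) <= b th * p th"
   using b_facts(4)[of th] by blast
 qed (intro continuous_intros cs)
 moreover have "J (\<lambda>th. 6/25 * (b th * p th)) = 6/25 * X" unfolding X_def by (rule J_cmult)
 moreover have "k^2 * G <= (1/10000000000000000) * G" using k_sq G0 by (intro mult_right_mono) auto
 moreover have "J q <= k^16" using H4 by (simp add: q_def[abs_def])
 ultimately show ?thesis using Je H2 H5 G0 pw by (simp add: algebra_simps)
qed

text \<open>The first bound has the right order k^4 but contains \<open>G\<close>. The second, from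
  splitting each ray at radius k^2, is cruder but unconditional; it makes the coefficients in the
  products N G and N X / k small.\<close>

lemma N_le: "N <= 28 * k^4 + G" "N <= 14 * k^2"
proof -
 have "N <= J (\<lambda>th. 4 * ray.DD (W th) 1 + g th)" unfolding N_def using ray_signs by (intro J_mono continuous_intros cs)
 also have "... = 4 * J (\<lambda>th. ray.DD (W th) 1) + G" unfolding G_def by (subst J_add) (auto intro!: continuous_intros cs simp: J_cmult)
 finally show "N <= 28 * k^4 + G" using H3' by simp
 have "N <= J (\<lambda>th. k^2 + (1 / k^2) * ray.DD (W th) 1)" unfolding N_def using ray_signs(10)[of "k^2"] k_sq
  by (intro J_mono continuous_intros cs) auto
 also have "... = J (\<lambda>th. k^2) + J (\<lambda>th. (1 / k^2) * ray.DD (W th) 1)" by (intro J_add continuous_intros cs)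
 also have "J (\<lambda>th. (1 / k^2) * ray.DD (W th) 1) = (1 / k^2) * J (\<lambda>th. ray.DD (W th) 1)" by (rule J_cmult)
 also have "J (\<lambda>th. k^2) = 2 * pi * k^2" by (simp add: J_const)
 also have "(1 / k^2) * J (\<lambda>th. ray.DD (W th) 1) <= (1 / k^2) * (7 * k^4)" using H3' by (intro mult_left_mono) auto
 also have "(1 / k^2) * (7 * k^4) = 7 * k^2" using k by (simp add: power2_eq_square power4_eq_xxxx)
 also have "2 * pi * k^2 <= 7 * k^2" using pi_approx by (intro mult_right_mono) auto
 finally show "N <= 14 * k^2" by linarith
qed

definition "Z = J (\<lambda>th. \<bar>b th\<bar>)"

lemma Z: "0 <= Z" "Z^2 <= 63/10 * X"
proof -
 show "0 <= Z" unfolding Z_def by (intro J_nonneg continuous_intros cs) auto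
 have "(J (\<lambda>th. 1 * \<bar>b th\<bar>))^2 <= J (\<lambda>th. 1^2) * J (\<lambda>th. \<bar>b th\<bar>^2)" by (intro J_CS continuous_intros cs)
 moreover have "J (\<lambda>th. \<bar>b th\<bar>^2) <= X" unfolding X_def using b_facts by (intro J_mono continuous_intros cs) auto
 ultimately have "Z^2 <= 2 * pi * X" unfolding Z_def by (simp add: J_const) (meson mult_left_mono order_trans pi_ge_zero zero_le_mult_iff zero_le_numeral)
 also have "... <= 63/10 * X" using pi_approx X0 by (intro mult_right_mono) auto
 finally show "Z^2 <= 63/10 * X" .
qed

lemma J_pb: "J (\<lambda>th. \<bar>p th - b th\<bar>) <= X / k"
proof -
 have "J (\<lambda>th. \<bar>p th - b th\<bar>) <= J (\<lambda>th. (1/k) * (b th * p th))"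
  using b_facts(2) k by (intro J_mono continuous_intros cs) (auto simp: field_simps)
 also have "... = (1/k) * X" unfolding X_def by (rule J_cmult)
 finally show ?thesis by simp
qed

lemma FTC_bound:
 assumes F: "\<And>x. (F has_real_derivative f x) (at x)" and f: "cont f" and st: "s \<in> {0..2*pi}" "t \<in> {0..2*pi}"
 shows "\<bar>F t - F s\<bar> <= J (\<lambda>x. \<bar>f x\<bar>)"
proof -
 have *: "\<bar>F t - F s\<bar> <= J (\<lambda>x. \<bar>f x\<bar>)" if "s <= t" "s \<in> {0..2*pi}" "t \<in> {0..2*pi}" for s t
 proof -
  have sub: "{s..t} \<subseteq> {0..2*pi}" using that by auto
  have "\<bar>F t - F s\<bar> = norm (integral {s..t} f)" using integral_antiderivative[OF that(1) F] by simp
  also have "... <= integral {s..t} (\<lambda>x. \<bar>f x\<bar>)"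
   using continuous_on_subset[OF f sub] by (intro integral_norm_bound_integral integrable_continuous_real continuous_intros) auto
  also have "... <= integral {0..2*pi} (\<lambda>x. \<bar>f x\<bar>)"
   using continuous_on_subset[OF f sub] f sub by (intro integral_subset_le integrable_continuous_real continuous_intros) auto
  finally show ?thesis by (simp add: J_def)
 qed
 show ?thesis using *[of s t] *[of t s] st by (cases "s <= t") (auto simp: abs_minus_commute)
qed

lemma v_sup: assumes "th \<in> {0..2*pi}" shows "\<bar>v th\<bar> <= N / 6 + X / k + Z"
proof -
 have Jp: "J (\<lambda>x. \<bar>p x\<bar>) <= X / k + Z"
 proof -
  have "J (\<lambda>x. \<bar>p x\<bar>) <= J (\<lambda>x. \<bar>p x - b x\<bar> + \<bar>b x\<bar>)" by (intro J_mono continuous_intros cs) auto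
  also have "... = J (\<lambda>x. \<bar>p x - b x\<bar>) + Z" unfolding Z_def by (intro J_add continuous_intros cs)
  finally show ?thesis using J_pb by simp
 qed
 have "2 * pi * \<bar>v th\<bar> = J (\<lambda>x. \<bar>v th\<bar>)" by (simp add: J_const)
 also have "... <= J (\<lambda>x. n x + (X / k + Z))"
 proof (rule J_mono)
  fix x assume "x \<in> {0..2*pi}"
  hence "\<bar>v th - v x\<bar> <= X / k + Z" using FTC_bound[OF dv c_p, of x th] assms Jp by auto
  thus "\<bar>v th\<bar> <= n x + (X / k + Z)" using ray_signs(7)[of x] by linarith
 qed (intro continuous_intros cs)+
 also have "... = N + 2 * pi * (X / k + Z)" unfolding N_def by (subst J_add) (auto intro!: continuous_intros cs simp: J_const)
 finally have "\<bar>v th\<bar> <= N / (2 * pi) + (X / k + Z)" using pi_gt_zero by (simp add: field_simps)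
 moreover have "N / (2 * pi) <= N / 6" using N0 pi_gt3 by (intro divide_left_mono) auto
 ultimately show ?thesis by linarith
qed

lemma V_le: assumes "\<And>th. th \<in> {0..2*pi} ==> \<bar>v th\<bar> <= S" shows "V <= S * N"
proof -
 have "V <= J (\<lambda>th. S * n th)" unfolding V_def
 proof (rule J_mono)
  fix th assume "th \<in> {0..2*pi}"
  hence "\<bar>v th\<bar> * \<bar>v th\<bar> <= S * n th" using assms ray_signs(7)[of th] order_trans[OF abs_ge_zero assms] by (intro mult_mono) auto
  thus "(v th)^2 <= S * n th" by (simp add: power2_eq_square)
 qed (intro continuous_intros cs)+
 thus ?thesis by (simp add: J_cmult N_def)
qed

lemma stage2: "X <= 30000 * k^8" "G <= 11100 * k^8" "N <= 29 * k^4" "th \<in> {0..2*pi} ==> \<bar>v th\<bar> <= 500 * k^4"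
proof -
 have V: "V <= (N / 6 + X / k + Z) * N" by (rule V_le[OF v_sup])
 have NXk: "N * (X / k) <= 14 * (k * X)"
 proof -
  have "N * (X / k) <= (14 * k^2) * (X / k)" using N_le X0 k by (intro mult_right_mono) auto
  thus ?thesis using k by (simp add: power2_eq_square)
 qed
 have kX: "k * X <= (1/100000000) * X" using k X0 by (intro mult_right_mono) auto
 \<comment> \<open>With weight 1/50 the term Z^2 is at most 0.126 X. Half of it enters
   \<open>stage1\<close>, so more than 17/100 of the available 6/25 of \<open>X\<close>
   survives.\<close>
 have NZ: "N * Z <= 1/50 * Z^2 + 25/2 * N^2"
  using zero_le_power2[of "Z - 25 * N"] by (simp add: power2_eq_square algebra_simps)
 have NG: "N * G <= (14/10000000000000000) * G"
 proof -
  have "N * G <= (14 * (1/10000000000000000)) * G" using N_le(2) k_sq G0 by (intro mult_right_mono) auto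
  thus ?thesis by simp
 qed
 have k8: "(k^4)^2 = k^8" by (simp flip: power_mult)
 have "N^2 <= N * (28 * k^4 + G)" unfolding power2_eq_square using N_le(1) N0 by (intro mult_left_mono)
 moreover have "28 * k^4 * N <= N^2 / 2 + 392 * k^8"
  using zero_le_power2[of "N - 28 * k^4"] k8 by (simp add: power2_eq_square algebra_simps)
 ultimately have N2: "N^2 <= 784 * k^8 + 1/500 * G" using NG G0 by (simp add: algebra_simps)
 have "V <= N^2 / 6 + N * (X / k) + N * Z" using V by (simp add: power2_eq_square algebra_simps)
 hence "V <= N^2 / 6 + (14/100000000) * X + (1/50 * (63/10 * X) + 25/2 * N^2)" using NXk kX NZ Z by linarith
 hence "23/50 * G + 17/100 * X <= 5100 * k^8" using stage1 N2 X0 G0 powers(1)[of 8] by linarith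
 thus X: "X <= 30000 * k^8" and G: "G <= 11100 * k^8" using X0 G0 by linarith+
 show N: "N <= 29 * k^4" using N_le(1) G pw by linarith
 have Zk: "Z <= 440 * k^4"
 proof (rule power2_le_imp_le)
  have "Z^2 <= 193600 * k^8" using Z(2) X powers(1)[of 8] by linarith
  thus "Z^2 <= (440 * k^4)^2" unfolding power_mult_distrib k8 by simp
 qed (use k in auto)
 have Xk: "X / k <= 30000 * k^7" using X k by (simp add: field_simps power_numeral_reduce)
 show "\<bar>v th\<bar> <= 500 * k^4" if "th \<in> {0..2*pi}" using v_sup[OF that] N Zk Xk pw by linarith
qed

lemma Jq: "J q <= k^16" using H4 by (simp add: q_def[abs_def])

lemma V_stage2: "V <= 14500 * k^8"
proof -
 have "V <= (500 * k^4) * N" by (rule V_le[OF stage2(4)])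
 also have "... <= (500 * k^4) * (29 * k^4)" using stage2(3) k by (intro mult_left_mono) auto
 also have "... = 14500 * k^8" by (simp flip: power_add)
 finally show ?thesis .
qed

text \<open>Now l <= 1 + 500 k^4, so the tilt spends one half of b^2 instead of three quarters of b
  p, and one half of b^2 remains up to terms of order k^2 b^2.\<close>

lemma lower_stage3: "(J2 b - V) / 2 - 30001 * k^10 <= P - 2 * pi"
proof -
 have J2: "J2 b <= X" unfolding X_def using b_facts by (intro J_mono continuous_intros cs) auto
 have "2 * pi - m - V / 2 - J e + 2 * (1 - k^2) * G + J (\<lambda>th. (1/2 - k^2) * (b th)^2) <= P"
 proof (rule master)
  fix th assume th: "th \<in> {0..2*pi}"
  have k42: "k^4 <= k^2 / 10000000000000000" 
   using mult_left_mono[OF k_sq(2), of "k^2"] by (simp add: power2_eq_square power4_eq_xxxx)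
  moreover have "l th <= 1 + 500 * k^4" using stage2(4)[OF th] by (simp add: v_def)
  ultimately have "l th <= 1 + k^2 / 2" using k_sq by linarith
  hence "l th * (1 + k^2) <= (1 + k^2 / 2) * (1 + k^2)" using k_sq by (intro mult_right_mono) auto
  also have "... = 1 + 3/2 * k^2 + k^4 / 2" by (simp add: field_simps power2_eq_square power4_eq_xxxx)
  also have "... <= 1 + 2 * k^2" using k42 k_sq by linarith
  finally have "l th * (1 + k^2) * (b th)^2 <= (1 + 2 * k^2) * (b th)^2" by (intro mult_right_mono) auto
  thus "l th * (b th)^2 * (1 + k^2) / 2 + (1/2 - k^2) * (b th)^2 <= b th * p th"
   using b_facts(1)[of th] by (simp add: field_simps)
 qed (intro continuous_intros cs)
 moreover have "J (\<lambda>th. (1/2 - k^2) * (b th)^2) = (1/2 - k^2) * J2 b" by (rule J_cmult)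
 moreover have "k^2 * J2 b <= 30000 * k^10"
 proof -
  have "k^2 * J2 b <= k^2 * (30000 * k^8)" using J2 stage2(1) by (intro mult_left_mono) auto
  also have "... = 30000 * k^10" by (simp flip: power_add)
  finally show ?thesis .
 qed
 moreover have "k^2 * G <= (1/10000000000000000) * G" using k_sq G0 by (intro mult_right_mono) auto
 moreover have "2 * (1 - k^2) * G = 2 * G - 2 * (k^2 * G)" by (simp add: algebra_simps)
 moreover have "(1/2 - k^2) * J2 b = J2 b / 2 - k^2 * J2 b" by (simp add: algebra_simps)
 ultimately show ?thesis using Je(2) Jq H2(3) pw G0 by argo
qed

text \<open>The mean of \<open>b\<close>; subtracting it makes the antiderivative in
  \<open>w_exists\<close> periodic.\<close>

definition "\<beta> = J b / (2 * pi)"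

lemma Jb: "\<bar>J b\<bar> <= X / k"
proof -
 have "J p = 0" using J_FTC[OF dl] l_per by simp
 hence "J b = - J (\<lambda>th. p th - b th)" by (subst J_diff) (auto intro: cs)
 thus ?thesis using J_abs[of "\<lambda>th. p th - b th"] J_pb by (simp add: continuous_on_diff cs)
qed

text \<open>The derivative \<open>p\<close> of \<open>v\<close> is controlled only in L1 beyond the
  clipping, so \<open>v\<close> is unfit for an energy estimate. The function \<open>w\<close> has
  the clipped derivative and stays uniformly close to \<open>v\<close>, because the L1 norm of p - b
  is at most X / k.\<close>

lemma w_exists:
 obtains w where "\<And>th. (w has_real_derivative b th - \<beta>) (at th)" "w 0 = w (2*pi)" "\<And>th. th \<in> {0..2*pi} ==> \<bar>v th - w th\<bar> <= 60000 * k^7"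
proof -
 obtain B where B: "\<And>x. (B has_real_derivative b x) (at x)" using antiderivative_ex[OF c_b] by metis
 define w where "w th = v 0 + (B th - B 0) - \<beta> * th" for th
 show thesis
 proof
  show "(w has_real_derivative b th - \<beta>) (at th)" for th
   unfolding w_def[abs_def] by (auto intro!: derivative_eq_intros B)
  show "w 0 = w (2*pi)" using J_FTC[OF B] by (simp add: w_def \<beta>_def)
  fix th assume th: "th \<in> {0..2*pi}"
  have "\<bar>(v th - B th) - (v 0 - B 0)\<bar> <= J (\<lambda>x. \<bar>p x - b x\<bar>)"
   by (rule FTC_bound[OF DERIV_diff[OF dv B]]) (use th in \<open>auto intro!: continuous_intros cs\<close>)
  moreover have "\<bar>\<beta> * th\<bar> <= \<bar>J b\<bar>"
  proof -
   have "\<bar>\<beta> * th\<bar> <= \<bar>\<beta>\<bar> * (2 * pi)" unfolding abs_mult using th by (intro mult_left_mono) auto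
   also have "... = \<bar>J b\<bar>" by (simp add: \<beta>_def)
   finally show ?thesis .
  qed
  moreover have "X / k <= 30000 * k^7" using stage2(1) k by (simp add: field_simps power_numeral_reduce)
  ultimately show "\<bar>v th - w th\<bar> <= 60000 * k^7" using J_pb Jb unfolding w_def by linarith
 qed
qed

text \<open>To first order the polar graph 1 + c cos th + s sin th is the unit circle about (c, s),
  where c and s are the first modes of \<open>w\<close>. By \<open>H3\<close> the set differs from
  that disk by at least pi k^4 up to small errors, so the rest of \<open>w\<close> has L1 norm at
  least about pi k^4, and the coercivity estimate converts this into energy.\<close>

lemma conclusion: "2 * pi + 2 * pi * (83/200) * k^8 <= P"
proof -
 obtain w where w: "\<And>th. (w has_real_derivative b th - \<beta>) (at th)" "w 0 = w (2*pi)"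
  and vw: "\<And>th. th \<in> {0..2*pi} ==> \<bar>v th - w th\<bar> <= 60000 * k^7" using w_exists by blast
 have cw: "continuous_on S w" for S using w(1) by (meson DERIV_isCont continuous_at_imp_continuous_on)
 have wb: "\<bar>w th\<bar> <= 501 * k^4" if "th \<in> {0..2*pi}" for th
  using vw[OF that] stage2(4)[OF that] pw by argo
 define \<mu> where "\<mu> = J w / (2 * pi)"
 define c where "c = J (\<lambda>x. w x * cos x) / pi"
 define s where "s = J (\<lambda>x. w x * sin x) / pi"
 define wt where "wt th = w th - (\<mu> + c * cos th + s * sin th)" for th
 define A where "A = J (\<lambda>th. \<bar>wt th\<bar>)"
 define K where "K = pi / 4 + 10 / (3 * pi)"
 have cwt: "continuous_on S wt" for S unfolding wt_def by (intro continuous_intros cw)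
 have A2: "A^2 <= K * (J (\<lambda>x. (b x - \<beta>)^2) - J2 w + 2 * pi * \<mu>^2)"
  unfolding A_def wt_def \<mu>_def c_def s_def K_def by (rule trig_coercive_modes) (auto intro!: w continuous_intros cs)
 have Jb2: "J (\<lambda>x. (b x - \<beta>)^2) <= J2 b"
 proof -
  have "J (\<lambda>x. (b x - \<beta>)^2) = J2 b - 2 * pi * \<beta>^2"
   using J_minus_modes(1)[OF c_b, of \<beta> 0 0] by (simp add: \<beta>_def power2_eq_square)
  thus ?thesis by simp
 qed
 have coef: "\<bar>J (\<lambda>x. w x * t x)\<bar> <= pi * (1002 * k^4)" if t: "\<And>x. \<bar>t x\<bar> <= 1" "cont t" for t
 proof -
  have "\<bar>J (\<lambda>x. w x * t x)\<bar> <= J (\<lambda>x. \<bar>w x * t x\<bar>)" by (intro J_abs continuous_intros cw t)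
  also have "... <= J (\<lambda>x. 501 * k^4)"
  proof (rule J_mono)
   fix x assume "x \<in> {0..2*pi}"
   hence "\<bar>w x\<bar> * \<bar>t x\<bar> <= (501 * k^4) * 1" using wb t by (intro mult_mono) auto
   thus "\<bar>w x * t x\<bar> <= 501 * k^4" by (simp add: abs_mult)
  qed (intro continuous_intros cw t)+
  finally show ?thesis by (simp add: J_const)
 qed
 have c: "\<bar>c\<bar> <= 1002 * k^4" using coef[of cos, OF abs_cos_le_one] continuous_on_cos[OF continuous_on_id, of "{0..2*pi}"] unfolding c_def by (simp add: abs_divide pos_divide_le_eq mult.commute)
 have s: "\<bar>s\<bar> <= 1002 * k^4" using coef[of sin, OF abs_sin_le_one] continuous_on_sin[OF continuous_on_id, of "{0..2*pi}"] unfolding s_def by (simp add: abs_divide pos_divide_le_eq mult.commute)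
 have pi6: "2 * pi * x <= 63/10 * x" if "0 <= x" for x using that pi_approx by (intro mult_right_mono) auto
 have mu: "\<bar>\<mu>\<bar> <= 100000 * k^7"
 proof -
  have "\<bar>J v\<bar> <= 30000 * k^8" using Jv V_stage2 V0 Je stage2(2) Jq H2(2,3) pw by argo
  moreover have "\<bar>J v - J w\<bar> <= 2 * pi * (60000 * k^7)" by (rule J_close[OF _ _ vw]) (auto intro: cw cs)
  moreover have "2 * pi * (60000 * k^7) <= 63/10 * (60000 * k^7)" by (rule pi6) (use k in simp)
  ultimately have "\<bar>J w\<bar> <= 500000 * k^7" using pw by argo
  also have "... <= (100000 * k^7) * (2 * pi)" using pi_gt3 pw by simp
  finally show ?thesis unfolding \<mu>_def by (simp add: abs_divide pos_divide_le_eq)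
 qed
 have mu2: "2 * pi * \<mu>^2 <= k^10"
 proof -
  have "\<mu>^2 <= (100000 * k^7)^2" using mu by (metis abs_ge_zero power2_abs power_mono)
  also have "... = 10000000000 * k^14" by (simp add: power_mult_distrib flip: power_mult)
  finally have "\<mu>^2 <= 10000000000 * k^14" .
  moreover have "2 * pi * (\<mu>^2) <= 63/10 * (\<mu>^2)" by (rule pi6) (rule zero_le_power2)
  ultimately show ?thesis using pw by argo
 qed
 have Vw: "V <= J2 w + 4 * k^10"
 proof -
  have "\<bar>V - J2 w\<bar> <= 2 * pi * (60060000 * k^11)" unfolding V_def
  proof (rule J_close)
   fix x assume x: "x \<in> {0..2*pi}"
   have "\<bar>v x - w x\<bar> * \<bar>v x + w x\<bar> <= (60000 * k^7) * (1001 * k^4)"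
    using vw[OF x] wb[OF x] stage2(4)[OF x] k by (intro mult_mono) auto
   moreover have "(v x)^2 - (w x)^2 = (v x - w x) * (v x + w x)" by (simp add: power2_eq_square algebra_simps)
   ultimately show "\<bar>(v x)^2 - (w x)^2\<bar> <= 60060000 * k^11" by (simp add: abs_mult flip: power_add)
  qed (intro continuous_intros cs cw)+
  moreover have "2 * pi * (60060000 * k^11) <= 63/10 * (60060000 * k^11)" by (rule pi6) (use k in simp)
  ultimately show ?thesis using pw by argo
 qed
 have K: "0 < K" "K <= 18466/10000"
 proof -
  have "10 / (3 * pi) <= 10 / (3 * (31415/10000))" using pi_approx by (intro divide_left_mono) auto
  thus "K <= 18466/10000" using pi_approx unfolding K_def by simp
  show "0 < K" unfolding K_def by (simp add: add_pos_pos)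
 qed
 have "A^2 <= K * (J2 b - V + 5 * k^10)"
  by (rule order_trans[OF A2 mult_left_mono]) (use Jb2 Vw mu2 K in auto)
 moreover have "J2 b - V + 5 * k^10 <= 2 * (P - 2 * pi) + 60020 * k^10" using lower_stage3 pw by argo
 ultimately have A3: "A^2 <= K * (2 * (P - 2 * pi) + 60020 * k^10)" using K by (meson mult_left_mono order_trans less_imp_le)
 have "k * k^3 <= (1 / 100000000) * 1" using k by (intro mult_mono power_le_one) auto
 hence k4: "k^4 <= 1 / 100000000" by (simp add: power_numeral_reduce)
 have c1: "\<bar>c\<bar> <= 1/10" and s1: "\<bar>s\<bar> <= 1/10" using c s k4 by argo+
 define \<sigma> where "\<sigma> = c^2 + s^2"
 have sg: "0 <= \<sigma>" "\<sigma> <= 2010000 * k^8"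
 proof -
  have "c^2 <= (1002 * k^4)^2" "s^2 <= (1002 * k^4)^2" using c s by (metis abs_ge_zero power2_abs power_mono)+
  moreover have "(1002 * k^4)^2 = 1004004 * k^8" by (simp add: power_mult_distrib flip: power_mult)
  ultimately show "\<sigma> <= 2010000 * k^8" using pw unfolding \<sigma>_def by linarith
 qed (simp add: \<sigma>_def)
 define \<tau> where "\<tau> th = c * cos th + s * sin th" for th
 define \<rho> where "\<rho> th = \<tau> th + sqrt (1 - \<sigma> + (\<tau> th)^2)" for th
 \<comment> \<open>This is \<open>DD_le\<close> with \<eta> = k^8. After integration |wt| is the
   leading part and everything else is of order k^7.\<close>
 define h where "h th = \<bar>wt th\<bar> + 180000 * k^7 + e th + 3 * (k^8 + 2 * g th + (3 / k^8) * q th)" for th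
 have ct: "continuous_on S \<tau>" "continuous_on S h" for S unfolding \<tau>_def h_def by (intro continuous_intros cs cwt)+
 have "pi * k^4 <= k^12 + J h"
 proof (rule H3[OF c1 s1])
  fix th assume th: "th \<in> {0..2*pi}"
  have t1: "\<bar>\<tau> th\<bar> <= 2004 * k^4"
  proof -
   have "\<bar>c * cos th\<bar> <= \<bar>c\<bar> * 1" "\<bar>s * sin th\<bar> <= \<bar>s\<bar> * 1" unfolding abs_mult by (intro mult_left_mono; simp)+
   thus ?thesis using c s unfolding \<tau>_def by linarith
  qed
  have t2: "(\<tau> th)^2 <= \<sigma>"
  proof -
   have "\<sigma> = (\<tau> th)^2 + (c * sin th - s * cos th)^2" 
   proof -
    have "(\<tau> th)^2 + (c * sin th - s * cos th)^2 = \<sigma> * ((sin th)^2 + (cos th)^2)" unfolding \<tau>_def \<sigma>_def by algebra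
    thus ?thesis by simp
   qed
   thus ?thesis by simp
  qed
  define y where "y = 1 - \<sigma> + (\<tau> th)^2"
  have y: "1 - \<sigma> <= y" "y <= 1" "0 <= y" using t2 sg k4 pw zero_le_power2[of "\<tau> th"] unfolding y_def by argo+
  have sq: "1 - \<sigma> <= sqrt y" "sqrt y <= 1"
  proof -
   have "y * y <= y * 1" using y by (intro mult_left_mono) auto
   hence "y <= sqrt y" using y by (intro real_le_rsqrt) (simp add: power2_eq_square)
   thus "1 - \<sigma> <= sqrt y" using y by simp
   show "sqrt y <= 1" using y by simp
  qed
  have rho: "\<rho> th = \<tau> th + sqrt y" by (simp add: \<rho>_def y_def)
  have r1: "1/2 <= \<rho> th" "\<rho> th + k^8 <= 3/2" using sq sg t1 k4 pw unfolding rho by argo+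
  have "ray.DD (W th) (\<rho> th) <= \<bar>(l th)^2 - (\<rho> th)^2\<bar> / 2 + e th + 3 * (k^8 + 2 * g th + 3 * q th / k^8)"
   unfolding l_def e_def g_def q_def by (rule R.DD_le[OF r1(1) _ r1(2)]) (use k in auto)
  moreover have "\<bar>(l th)^2 - (\<rho> th)^2\<bar> / 2 <= \<bar>wt th\<bar> + 180000 * k^7"
  proof -
   have "l th - \<rho> th = wt th + (v th - w th) + \<mu> + (1 - sqrt y)" unfolding wt_def v_def rho \<tau>_def by simp
   hence d1: "\<bar>l th - \<rho> th\<bar> <= \<bar>wt th\<bar> + 170000 * k^7" using vw[OF th] mu sq sg pw by argo
   have "l th - \<rho> th = v th - \<tau> th + (1 - sqrt y)" unfolding v_def rho by simp
   hence d2: "\<bar>l th - \<rho> th\<bar> <= 2600 * k^4" using stage2(4)[OF th] t1 sq sg pw by argo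
   have "\<bar>l th + \<rho> th\<bar> / 2 <= 1 + 1300 * k^4" 
   proof -
    have "0 <= l th + \<rho> th" using r1 ray_signs(3)[of th] by linarith
    hence "\<bar>l th + \<rho> th\<bar> = l th + (\<tau> th + sqrt y)" by (simp add: rho)
    thus ?thesis using stage2(4)[OF th] t1 sq pw unfolding v_def by argo
   qed
   hence "\<bar>l th - \<rho> th\<bar> * (\<bar>l th + \<rho> th\<bar> / 2) <= \<bar>l th - \<rho> th\<bar> * (1 + 1300 * k^4)" by (intro mult_left_mono) auto
   also have "... = \<bar>l th - \<rho> th\<bar> + \<bar>l th - \<rho> th\<bar> * (1300 * k^4)" by (simp add: algebra_simps)
   also have "\<bar>l th - \<rho> th\<bar> * (1300 * k^4) <= (2600 * k^4) * (1300 * k^4)" using d2 k by (intro mult_right_mono) auto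
   also have "... = 3380000 * k^8" by (simp flip: power_add)
   also have "\<bar>l th - \<rho> th\<bar> * (\<bar>l th + \<rho> th\<bar> / 2) = \<bar>(l th)^2 - (\<rho> th)^2\<bar> / 2" by (simp flip: abs_mult add: square_diff_square_factored power2_eq_square mult.commute)
   finally have "\<bar>(l th)^2 - (\<rho> th)^2\<bar> / 2 <= \<bar>l th - \<rho> th\<bar> + 3380000 * k^8" by simp
   thus ?thesis using d1 pw by argo
  qed
  ultimately show "ray.DD (W th) (c * cos th + s * sin th + sqrt (1 - (c^2 + s^2) + (c * cos th + s * sin th)^2)) <= h th"
   unfolding \<rho>_def \<tau>_def \<sigma>_def h_def by simp
 qed (rule ct)
 moreover have "J h <= A + 1200000 * k^7"
 proof -
  define d where "d = 180000 * k^7 + 3 * k^8"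
  have "J h = J (\<lambda>th. 1 * \<bar>wt th\<bar> + (1 * e th + (6 * g th + ((9 / k^8) * q th + d))))"
   unfolding h_def d_def by (intro J_cong) (simp add: algebra_simps)
  also have "... = 1 * A + J (\<lambda>th. 1 * e th + (6 * g th + ((9 / k^8) * q th + d)))"
   unfolding A_def by (intro J_lin continuous_intros cs cwt)
  also have "J (\<lambda>th. 1 * e th + (6 * g th + ((9 / k^8) * q th + d))) = 1 * J e + J (\<lambda>th. 6 * g th + ((9 / k^8) * q th + d))"
   by (intro J_lin continuous_intros cs)
  also have "J (\<lambda>th. 6 * g th + ((9 / k^8) * q th + d)) = 6 * G + J (\<lambda>th. (9 / k^8) * q th + d)"
   unfolding G_def by (intro J_lin continuous_intros cs)
  also have "J (\<lambda>th. (9 / k^8) * q th + d) = (9 / k^8) * J q + J (\<lambda>th. d)" by (intro J_lin continuous_intros cs)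
  also have "J (\<lambda>th. d) = 2 * pi * d" by (rule J_const)
  also have "(9 / k^8) * J q <= (9 / k^8) * k^16" using Jq k by (intro mult_left_mono) auto
  also have "(9 / k^8) * k^16 = 9 * k^8" using k by (simp add: field_simps flip: power_add)
  finally have "J h <= 1 * A + (1 * J e + (6 * G + (9 * k^8 + 2 * pi * (180000 * k^7 + 3 * k^8))))" by (simp add: d_def)
  moreover have "2 * pi * (180000 * k^7 + 3 * k^8) <= 63/10 * (180000 * k^7 + 3 * k^8)" by (rule pi6) (use k in simp)
  ultimately show ?thesis using Je(2) stage2(2) Jq pw by argo
 qed
 moreover have "(314159/100000) * k^4 <= pi * k^4" using pi_approx k by (intro mult_right_mono) auto
 ultimately have "(31415/10000) * k^4 <= A" using pw by argo
 hence "((31415/10000) * k^4)^2 <= A^2" using k by (intro power_mono) auto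
 also have "((31415/10000) * k^4)^2 = (986902225/100000000) * k^8" by (simp add: power_mult_distrib power_divide flip: power_mult)
 also have "A^2 <= (18466/10000) * (2 * (P - 2 * pi) + 60020 * k^10)"
 proof -
  have "0 <= K * (2 * (P - 2 * pi) + 60020 * k^10)" using A3 zero_le_power2[of A] by linarith
  hence "0 <= 2 * (P - 2 * pi) + 60020 * k^10" using K by (simp add: zero_le_mult_iff)
  thus ?thesis using A3 K(2) by (meson mult_right_mono order_trans)
 qed
 \<comment> \<open>Numerically 9.869 / (2 * 1.8466) is about 2.67, while 2 * 0.415 * 3.142 is about
   2.61. The difference pays for the error terms.\<close>
 finally have "2 * (83/200) * (3142/1000) * k^8 <= P - 2 * pi" using pw by argo
 moreover have "2 * pi * (83/200) * k^8 <= 2 * (83/200) * (3142/1000) * k^8" using pi_approx k by (intro mult_right_mono) auto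
 ultimately show ?thesis by linarith
qed

end

section \<open>Polar coordinates\<close>

definition polar :: "real^2 => real^2" where "polar x = vec2 (x $ 2 * cos (x $ 1)) (x $ 2 * sin (x $ 1))"
text \<open>Coordinate 1 is the angle and coordinate 2 the radius. On the open strip
  \<open>polar\<close> is injective, and its image misses only part of the horizontal axis.\<close>

definition polar_strip :: "real => (real^2) set" where "polar_strip R = {x. 0 < x $ 1 \<and> x $ 1 < 2 * pi \<and> 0 < x $ 2 \<and> x $ 2 < R}"

lemma polar_measurable[measurable]: "polar \<in> borel_measurable borel"
 unfolding polar_def[abs_def] by measurable

lemma polar_strip_measurable[measurable]: "polar_strip R \<in> sets borel" unfolding polar_strip_def by measurable

lemma norm_polar: "0 <= x $ 2 ==> norm (polar x) = x $ 2"
proof -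
 assume "0 <= x $ 2"
 have "(x $ 2 * cos (x $ 1))^2 + (x $ 2 * sin (x $ 1))^2 = (x $ 2)^2 * ((sin (x $ 1))^2 + (cos (x $ 1))^2)" by algebra
 thus ?thesis using \<open>0 <= x $ 2\<close> by (simp add: polar_def norm_vec2)
qed

lemma inj_polar: "inj_on polar (polar_strip R)"
proof (rule inj_onI)
 fix x y assume x: "x \<in> polar_strip R" and y: "y \<in> polar_strip R" and e: "polar x = polar y"
 have r: "x $ 2 = y $ 2" using norm_polar[of x] norm_polar[of y] x y e by (simp add: polar_strip_def)
 have "vec2 (x $ 2 * cos (x $ 1)) (x $ 2 * sin (x $ 1)) $ i = vec2 (y $ 2 * cos (y $ 1)) (y $ 2 * sin (y $ 1)) $ i" for i using e by (simp add: polar_def)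
 from this[of 1] this[of 2] have "sin (y $ 1) = sin (x $ 1)" "cos (y $ 1) = cos (x $ 1)" using x r by (auto simp: polar_strip_def)
 then obtain n :: int where n: "y $ 1 = x $ 1 + 2 * pi * n" using sin_cos_eq_iff by blast
 have "\<bar>2 * pi * n\<bar> < 2 * pi" using n x y by (auto simp: polar_strip_def)
 hence "\<bar>real_of_int n\<bar> < 1" by (simp add: abs_mult)
 hence "x $ 1 = y $ 1" using n by simp
 thus "x = y" using r by (simp add: vec_eq_iff forall_2)
qed

lemma polar_surj:
 assumes "norm y < R" "y $ 2 \<noteq> 0" obtains x where "x \<in> polar_strip R" "polar x = y"
proof -
 have y0: "0 < norm y" using assms by auto
 have "(y $ 1 / norm y)^2 + (y $ 2 / norm y)^2 = 1"
 proof -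
  have "(y $ 1)^2 + (y $ 2)^2 = (norm y)^2" by (simp add: norm_vec2)
  thus ?thesis unfolding power_divide add_divide_distrib[symmetric] using y0 by simp
 qed
 from sincos_total_2pi[OF this] obtain t where t: "0 <= t" "t < 2 * pi" "y $ 1 / norm y = cos t" "y $ 2 / norm y = sin t" by auto
 have "t \<noteq> 0" using t(4) assms(2) y0 by auto
 show thesis
 proof (rule that[of "vec2 t (norm y)"])
  show "vec2 t (norm y) \<in> polar_strip R" using t \<open>t \<noteq> 0\<close> y0 assms by (simp add: polar_strip_def)
  have "norm y * cos t = y $ 1" "norm y * sin t = y $ 2" using t(3,4) y0 by (simp_all add: field_simps)
  thus "polar (vec2 t (norm y)) = y" by (simp add: polar_def vec2_eta)
 qed
qed

lemma polar_derivative: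
 "(polar has_derivative (\<lambda>h. vec2 (h $ 2 * cos (x $ 1) - x $ 2 * sin (x $ 1) * h $ 1) (h $ 2 * sin (x $ 1) + x $ 2 * cos (x $ 1) * h $ 1))) (at x within S)"
 (is "(_ has_derivative ?D) _")
proof -
 have "\<forall>i. ((\<lambda>x. polar x $ i) has_derivative (\<lambda>h. ?D h $ i)) (at x within S)"
  unfolding forall_2 polar_def vec2_nth
  by (intro conjI) (auto intro!: derivative_eq_intros bounded_linear.has_derivative[OF bounded_linear_vec_nth] simp: algebra_simps)
 thus ?thesis using has_derivative_componentwise_within[of polar ?D x S] 
  by (auto simp: Basis_vec_def inner_axis)
qed

lemma polar_det:
 "\<bar>det (matrix (\<lambda>h. vec2 (h $ 2 * cos (x $ 1) - x $ 2 * sin (x $ 1) * h $ 1) (h $ 2 * sin (x $ 1) + x $ 2 * cos (x $ 1) * h $ 1)))\<bar> = \<bar>x $ 2\<bar>"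
proof -
 have "det (matrix (\<lambda>h. vec2 (h $ 2 * cos (x $ 1) - x $ 2 * sin (x $ 1) * h $ 1) (h $ 2 * sin (x $ 1) + x $ 2 * cos (x $ 1) * h $ 1)))
  = - (x $ 2 * sin (x $ 1) * sin (x $ 1)) - cos (x $ 1) * (x $ 2 * cos (x $ 1))"
  unfolding det_2 matrix_def by (simp add: axis_def)
 also have "... = - (x $ 2) * ((sin (x $ 1))^2 + (cos (x $ 1))^2)" by algebra
 finally have "det (matrix (\<lambda>h. vec2 (h $ 2 * cos (x $ 1) - x $ 2 * sin (x $ 1) * h $ 1) (h $ 2 * sin (x $ 1) + x $ 2 * cos (x $ 1) * h $ 1))) = - (x $ 2)" by simp
 thus ?thesis by simp
qed

text \<open>The change of variables for injective maps gives the measure of the image of the strip;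
  up to sign the Jacobian determinant is the radius. The image differs from the target only inside a
  line.\<close>

lemma polar_emeasure:
 assumes E[measurable]: "E \<in> sets borel"
 shows "emeasure lborel (E \<inter> ball 0 R) = (\<integral>\<^sup>+x. ind E (polar x) * (ennreal (x $ 2) * ind (polar_strip R) x) \<partial>lborel)"
proof -
 define A where "A = polar_strip R \<inter> polar -` E"
 have A[measurable]: "A \<in> sets borel" unfolding A_def using measurable_sets[OF polar_measurable E] by auto
 have fin: "finarea (E \<inter> ball 0 R)" 
  by (rule finarea_mono[of lborel "ball 0 R"]) (use emeasure_lborel_ball_finite[of 0 R] in auto)
 have "finarea (polar_strip R)"
 proof (rule finarea_bounded)
  show "polar_strip R \<subseteq> cball 0 (2 * pi + R)"
  proof
   fix x assume "x \<in> polar_strip R"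
   thus "x \<in> cball 0 (2 * pi + R)" using norm_le_l1_cart[of x] by (auto simp: polar_strip_def sum_2)
  qed
 qed
 hence finA: "finarea A" by (rule finarea_mono) (auto simp: A_def)
 have si: "set_integrable lborel A (\<lambda>x. \<bar>x $ 2\<bar>)"
  by (rule set_integrable_bounded_finite[OF A finA, where B = R]) (auto simp: A_def polar_strip_def)
 note hk = set_borel_integral_eq_integral[OF si]
 have img: "measure lebesgue (polar ` A) = integral A (\<lambda>x. \<bar>x $ 2\<bar>)"
  using measure_differentiable_image_eq[of A polar, OF _ polar_derivative inj_on_subset[OF inj_polar], of R] A hk(1)
  unfolding polar_det by (simp add: A_def)
 have "negligible (sym_diff (E \<inter> ball 0 R) (polar ` A))"
 proof (rule negligible_subset)
  show "negligible {y::real^2. y $ 2 = 0}" by (rule negligible_standard_hyperplane_cart)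
  show "sym_diff (E \<inter> ball 0 R) (polar ` A) \<subseteq> {y. y $ 2 = 0}"
  proof
   fix y assume y: "y \<in> sym_diff (E \<inter> ball 0 R) (polar ` A)"
   show "y \<in> {y. y $ 2 = 0}"
   proof (rule ccontr)
    assume n: "y \<notin> {y. y $ 2 = 0}"
    have "polar ` A \<subseteq> E \<inter> ball 0 R" using norm_polar by (auto simp: A_def polar_strip_def)
    hence yE: "y \<in> E \<inter> ball 0 R" "y \<notin> polar ` A" using y by auto
    then obtain x where "x \<in> polar_strip R" "polar x = y" using polar_surj[of y R] n by auto
    thus False using yE by (auto simp: A_def)
   qed
  qed
 qed
 hence "measure lebesgue (polar ` A) = measure lebesgue (E \<inter> ball 0 R)"
  using fin E by (intro measure_negligible_symdiff) (auto simp: fmeasurable_def)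
 hence m: "area (E \<inter> ball 0 R) = integral A (\<lambda>x. \<bar>x $ 2\<bar>)" using img by (simp add: measure_completion)
 have "emeasure lborel (E \<inter> ball 0 R) = ennreal (area (E \<inter> ball 0 R))" using fin by (intro emeasure_eq_ennreal_measure) auto
 also have "... = ennreal (LINT x:A|lborel. \<bar>x $ 2\<bar>)" unfolding m hk(2) ..
 also have "... = (\<integral>\<^sup>+x. ennreal (ind A x *\<^sub>R \<bar>x $ 2\<bar>) \<partial>lborel)"
  using si unfolding set_integrable_def set_lebesgue_integral_def by (intro nn_integral_eq_integral[symmetric]) auto
 also have "... = (\<integral>\<^sup>+x. ind E (polar x) * (ennreal (x $ 2) * ind (polar_strip R) x) \<partial>lborel)"
  by (intro nn_integral_cong) (auto simp: A_def polar_strip_def indicator_def)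
 finally show ?thesis .
qed

text \<open>The identity for sets says that a restricted Lebesgue measure equals an image measure,
  so it passes to all nonnegative measurable functions without approximation.\<close>

lemma polar_nn_integral:
 assumes f[measurable]: "f \<in> borel_measurable borel"
 shows "(\<integral>\<^sup>+x. f x * ind (ball 0 R) x \<partial>lborel) =
  (\<integral>\<^sup>+th. (\<integral>\<^sup>+r. f (vec2 (r * cos th) (r * sin th)) * ennreal r * ind {0<..<R} r \<partial>lborel) * ind {0<..<2*pi} th \<partial>lborel)"
proof -
 define w where "w x = ennreal (x $ 2) * ind (polar_strip R) x" for x
 have [measurable]: "w \<in> borel_measurable borel" unfolding w_def by measurable
 have [measurable]: "(ind (ball 0 R) :: real^2 => ennreal) \<in> borel_measurable borel" by (rule borel_measurable_indicator) simp
 have "density lborel (ind (ball 0 R)) = distr (density lborel w) borel polar"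
 proof (rule measure_eqI)
  fix E assume "E \<in> sets (density lborel (ind (ball (0::real^2) R)))"
  hence E[measurable]: "E \<in> sets borel" by simp
  have "emeasure (density lborel (ind (ball 0 R))) E = emeasure lborel (E \<inter> ball 0 R)"
   by (subst emeasure_density) (auto simp: nn_integral_indicator[symmetric] indicator_inter_arith simp del: nn_integral_indicator intro!: nn_integral_cong simp: mult.commute)
  also have "... = (\<integral>\<^sup>+x. ind E (polar x) * w x \<partial>lborel)" unfolding w_def by (rule polar_emeasure[OF E])
  also have "... = emeasure (distr (density lborel w) borel polar) E"
   by (subst emeasure_distr, simp, simp, subst emeasure_density) (auto intro!: nn_integral_cong measurable_sets_borel[OF polar_measurable E] simp: indicator_def)
  finally show "emeasure (density lborel (ind (ball 0 R))) E = emeasure (distr (density lborel w) borel polar) E" .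
 qed simp
 hence "(\<integral>\<^sup>+x. f x \<partial>density lborel (ind (ball 0 R))) = (\<integral>\<^sup>+x. f x \<partial>distr (density lborel w) borel polar)" by simp
 also have "(\<integral>\<^sup>+x. f x \<partial>density lborel (ind (ball 0 R))) = (\<integral>\<^sup>+x. f x * ind (ball 0 R) x \<partial>lborel)"
  by (subst nn_integral_density) (auto simp: mult.commute)
 also have "(\<integral>\<^sup>+x. f x \<partial>distr (density lborel w) borel polar) = (\<integral>\<^sup>+x. w x * f (polar x) \<partial>lborel)"
  by (subst nn_integral_distr) (auto simp: nn_integral_density)
 also have "... = (\<integral>\<^sup>+th. (\<integral>\<^sup>+r. w (vec2 th r) * f (polar (vec2 th r)) \<partial>lborel) \<partial>lborel)"
  by (rule nn_integral_vec2) measurable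
 also have "... = (\<integral>\<^sup>+th. (\<integral>\<^sup>+r. f (vec2 (r * cos th) (r * sin th)) * ennreal r * ind {0<..<R} r \<partial>lborel) * ind {0<..<2*pi} th \<partial>lborel)"
 proof (intro nn_integral_cong)
  fix th :: real
  show "(\<integral>\<^sup>+r. w (vec2 th r) * f (polar (vec2 th r)) \<partial>lborel) = (\<integral>\<^sup>+r. f (vec2 (r * cos th) (r * sin th)) * ennreal r * ind {0<..<R} r \<partial>lborel) * ind {0<..<2*pi} th"
  proof (cases "th \<in> {0<..<2*pi}")
   case True
   thus ?thesis by (simp, intro nn_integral_cong) (auto simp: w_def polar_strip_def polar_def indicator_def mult.commute)
  next
   case False
   hence "w (vec2 th r) = 0" for r by (auto simp: w_def polar_strip_def)
   thus ?thesis using False by simp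
  qed
 qed
 finally show ?thesis .
qed

lemma nn_integral_interval:
 fixes f :: "real => real"
 assumes "continuous_on {a..b} f" "\<And>x. x \<in> {a..b} ==> 0 <= f x"
 shows "(\<integral>\<^sup>+x. ennreal (f x) * ind {a<..<b} x \<partial>lborel) = ennreal (integral {a..b} f)"
proof -
 have si: "set_integrable lborel {a..b} f" using assms(1) by (rule borel_integrable_atLeastAtMost')
 have "(\<integral>\<^sup>+x. ennreal (f x) * ind {a<..<b} x \<partial>lborel) = (\<integral>\<^sup>+x. ennreal (ind {a..b} x *\<^sub>R f x) \<partial>lborel)"
 proof (rule nn_integral_cong_AE)
  have "AE x in lborel. x \<noteq> a" "AE x in lborel. x \<noteq> b" by (rule AE_lborel_singleton)+
  thus "AE x in lborel. ennreal (f x) * ind {a<..<b} x = ennreal (ind {a..b} x *\<^sub>R f x)"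
   by eventually_elim (auto simp: indicator_def)
 qed
 also have "... = ennreal (LINT x:{a..b}|lborel. f x)"
  using si assms(2) unfolding set_integrable_def set_lebesgue_integral_def by (intro nn_integral_eq_integral) (auto simp: indicator_def)
 finally show ?thesis unfolding set_borel_integral_eq_integral(2)[OF si] .
qed

lemma nn_integral_circle:
 fixes F :: "real => real => real"
 assumes "continuous_on UNIV (\<lambda>p. F (fst p) (snd p))" "\<And>th r. 0 <= r ==> 0 <= F th r"
 shows "(\<integral>\<^sup>+th. (\<integral>\<^sup>+r. ennreal (F th r) * ind {0<..<R} r \<partial>lborel) * ind {0<..<2*pi} th \<partial>lborel) = ennreal (J (\<lambda>th. integral {0..R} (F th)))"
proof -
 have c: "continuous_on S (F th)" for S th
  by (rule continuous_on_compose2[OF assms(1), of S "\<lambda>r. (th, r)", simplified]) (intro continuous_intros)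
 have "(\<integral>\<^sup>+r. ennreal (F th r) * ind {0<..<R} r \<partial>lborel) = ennreal (integral {0..R} (F th))" for th
  by (rule nn_integral_interval[OF c]) (use assms(2) in auto)
 thus ?thesis unfolding J_def using assms(2)
  by (simp, subst nn_integral_interval) (auto intro!: cont_param_int assms(1) integral_nonneg integrable_continuous_real c)
qed

section \<open>Sets close to a disk\<close>

lemma polar_J:
 assumes f: "continuous_on UNIV f" and f0: "\<And>x. 0 <= f x"
 shows "(\<integral>\<^sup>+x. ennreal (f x) * ind (ball 0 R) x \<partial>lborel) = ennreal (J (\<lambda>th. integral {0..R} (\<lambda>r. f (vec2 (r * cos th) (r * sin th)) * r)))"
proof -
 have [measurable]: "f \<in> borel_measurable borel" by (rule borel_measurable_continuous_onI[OF f])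
 have "(\<integral>\<^sup>+x. ennreal (f x) * ind (ball 0 R) x \<partial>lborel) =
  (\<integral>\<^sup>+th. (\<integral>\<^sup>+r. ennreal (f (vec2 (r * cos th) (r * sin th))) * ennreal r * ind {0<..<R} r \<partial>lborel) * ind {0<..<2*pi} th \<partial>lborel)"
  by (rule polar_nn_integral) measurable
 also have "... = (\<integral>\<^sup>+th. (\<integral>\<^sup>+r. ennreal (f (vec2 (r * cos th) (r * sin th)) * r) * ind {0<..<R} r \<partial>lborel) * ind {0<..<2*pi} th \<partial>lborel)"
 proof (intro nn_integral_cong arg_cong2[where f="(*)"] refl)
  fix th r :: real
  show "ennreal (f (vec2 (r * cos th) (r * sin th))) * ennreal r = ennreal (f (vec2 (r * cos th) (r * sin th)) * r)"
   using f0 by (cases "0 <= r") (auto simp: ennreal_mult ennreal_neg mult_nonneg_nonpos)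
 qed
 also have "... = ennreal (J (\<lambda>th. integral {0..R} (\<lambda>r. f (vec2 (r * cos th) (r * sin th)) * r)))"
  by (rule nn_integral_circle) (use f0 in \<open>auto intro!: continuous_intros continuous_on_compose2[OF f]\<close>)
 finally show ?thesis .
qed

text \<open>Let \<tau> be the component of the centre along the ray. Completing the square gives (r
  - \<tau>)^2 < y with |\<tau>| < sqrt y: the origin is inside the disk, and each ray leaves it
  exactly once.\<close>

lemma in_shifted_ball_iff:
 assumes r: "0 <= r" and cs: "c^2 + s^2 < 1"
 shows "vec2 (r * cos th) (r * sin th) \<in> ball (vec2 c s) 1 \<longleftrightarrow>
  r < c * cos th + s * sin th + sqrt (1 - (c^2 + s^2) + (c * cos th + s * sin th)^2)"
proof -
 define \<tau> where "\<tau> = c * cos th + s * sin th"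
 define y where "y = 1 - (c^2 + s^2) + \<tau>^2"
 have y: "\<tau>^2 < y" using cs by (simp add: y_def)
 hence ty: "\<bar>\<tau>\<bar> < sqrt y" by (metis abs_ge_zero power2_abs real_less_rsqrt)
 have "(c - r * cos th)^2 + (s - r * sin th)^2 = r^2 * ((sin th)^2 + (cos th)^2) - 2 * r * \<tau> + (c^2 + s^2)"
  unfolding \<tau>_def by algebra
 also have "... = (r - \<tau>)^2 + 1 - y" by (simp add: y_def power2_eq_square algebra_simps)
 finally have e: "(c - r * cos th)^2 + (s - r * sin th)^2 = (r - \<tau>)^2 + 1 - y" .
 have "vec2 (r * cos th) (r * sin th) \<in> ball (vec2 c s) 1 \<longleftrightarrow> (r - \<tau>)^2 < y"
  by (simp add: dist_norm norm_vec2 e)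
 also have "... \<longleftrightarrow> \<bar>r - \<tau>\<bar> < sqrt y" by (metis real_sqrt_abs real_sqrt_less_iff)
 also have "... \<longleftrightarrow> r < \<tau> + sqrt y" using ty r by auto
 finally show ?thesis by (simp add: y_def \<tau>_def)
qed

lemma measure_sym_diff_le:
 assumes A[measurable]: "A \<in> sets borel" "finarea A" and B[measurable]: "B \<in> sets borel" "finarea B"
  and u: "u \<in> borel_measurable lborel" and d: "(\<integral>\<^sup>+x. ennreal \<bar>u x - ind A x\<bar> \<partial>lborel) <= ennreal \<delta>" and e: "(\<integral>\<^sup>+x. ennreal \<bar>u x - ind B x\<bar> \<partial>lborel) <= ennreal \<eta>"
  and 0: "0 <= \<delta>" "0 <= \<eta>"
 shows "area (sym_diff A B) <= \<delta> + \<eta>"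
proof -
 have [measurable]: "u \<in> borel_measurable borel" using u by simp
 have "emeasure lborel (sym_diff A B) = (\<integral>\<^sup>+x. ind (sym_diff A B) x \<partial>lborel)" by simp
 also have "... <= (\<integral>\<^sup>+x. ennreal \<bar>u x - ind A x\<bar> + ennreal \<bar>u x - ind B x\<bar> \<partial>lborel)"
  by (intro nn_integral_mono) (auto simp: indicator_def ennreal_plus[symmetric] ennreal_1[symmetric] simp del: ennreal_plus ennreal_1 split: if_splits)
 also have "... <= ennreal \<delta> + ennreal \<eta>" by (subst nn_integral_add) (auto intro: add_mono d e)
 finally have "emeasure lborel (sym_diff A B) <= ennreal (\<delta> + \<eta>)" using 0 by simp
 thus ?thesis using 0 by (simp add: measure_def enn2real_leI)
qed

text \<open>This supplies the data of the locale \<open>profile\<close> from a mollified indicator,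
  in polar coordinates, at a scale so fine that the mollification errors fall below the powers of
  \<open>k\<close> in the locale's assumptions.\<close>

lemma perimeter_lower_near_disk:
 assumes A[measurable]: "A \<in> sets borel" and sub: "A \<subseteq> cball 0 (7/5)" and p: "per_le A P" and k: "0 < k" "k <= 1 / 100000000"
  and m: "area A = pi - m" "0 <= m" "m <= k^12"
  and lo: "\<And>x. pi * k^4 <= area (sym_diff A (ball x 1)) + k^12 / 2"
  and up: "area (sym_diff A (ball 0 1)) <= 13/2 * k^4"
  and P: "P <= 2 * pi + 3 * k^8"
 shows "2 * pi + 2 * pi * (83/200) * k^8 <= P"
proof -
 \<comment> \<open>The exponent 40 is generous: after division by k^18 the error has to stay below
   k^16 in the bound for \<open>ray.qq\<close>.\<close>
 define \<delta> where "\<delta> = k^40"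
 have d0: "0 < \<delta>" using k by (simp add: \<delta>_def)
 obtain eps0 where e0: "0 < eps0" "\<And>eps. 0 < eps ==> eps < eps0 ==> (LINT x|lborel. \<bar>mu eps A x - ind A x\<bar>) < \<delta>"
  by (rule mu_L1[OF A sub d0]) blast
 \<comment> \<open>As 7/5 + 1/20 < 3/2, the mollified function vanishes from radius 3/2 on.\<close>
 define eps where "eps = min (eps0 / 2) (1/20)"
 have e: "0 < eps" "eps <= 1/20" "eps < eps0" using e0 by (auto simp: eps_def)
 define u where "u = mu eps A"
 define G where "G = gmu eps A"
 have finA: "finarea A" by (rule finarea_bounded[OF sub])
 have iA: "integ (ind A :: real^2 => real)" by (rule integ_bounded[OF A sub])
 have C1: "C1w u (\<lambda>x. blinfun_inner_right (G x))" unfolding u_def G_def by (rule C1w_conv[OF iA e(1)])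
 have cu: "continuous_on S u" and cG: "continuous_on S G" for S
  unfolding G_def using C1w_cont[OF C1] continuous_on_cgrad[OF iA e(1)] by auto
 have [measurable]: "u \<in> borel_measurable borel" by (rule borel_measurable_continuous_onI[OF cu])
 have u01: "0 <= u x" "u x <= 1" for x using mu_range[OF iA e(1)] by (auto simp: u_def)
 have uz: "u x = 0" if "3/2 <= norm x" for x using mu_zero_outside[OF e(1) sub, of x] that e(2) by (simp add: u_def)
 have iu: "integ u" "(LINT x|lborel. u x) = pi - m" using mu_integral[OF A finA e(1)] m by (auto simp: u_def)
 have L1: "(\<integral>\<^sup>+x. ennreal \<bar>u x - ind A x\<bar> \<partial>lborel) <= ennreal \<delta>"
 proof -
  have "(\<integral>\<^sup>+x. ennreal \<bar>u x - ind A x\<bar> \<partial>lborel) = ennreal (LINT x|lborel. \<bar>u x - ind A x\<bar>)"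
   using iu iA by (intro nn_integral_eq_integral) auto
  also have "... <= ennreal \<delta>" using e0(2)[OF e(1,3)] by (intro ennreal_leI) (simp add: u_def)
  finally show ?thesis .
 qed
 define \<gamma> where "\<gamma> th r = vec2 (r * cos th) (r * sin th)" for th r
 have ng: "norm (\<gamma> th r) = \<bar>r\<bar>" for th r
 proof -
  have "(r * cos th)^2 + (r * sin th)^2 = r^2 * ((sin th)^2 + (cos th)^2)" by algebra
  thus ?thesis by (simp add: \<gamma>_def norm_vec2)
 qed
 define W where "W th r = u (\<gamma> th r)" for th r
 define Wr where "Wr th r = G (\<gamma> th r) \<bullet> vec2 (cos th) (sin th)" for th r
 define Wt where "Wt th r = G (\<gamma> th r) \<bullet> vec2 (- r * sin th) (r * cos th)" for th r
 have c\<gamma>: "continuous_on UNIV (\<lambda>p. \<gamma> (fst p) (snd p))" unfolding \<gamma>_def by (intro continuous_intros)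
 have "continuous_on UNIV (\<lambda>p. W (fst p) (snd p))" unfolding W_def by (rule continuous_on_compose2[OF cu c\<gamma>]) auto
 moreover have cG\<gamma>: "continuous_on UNIV (\<lambda>p. G (\<gamma> (fst p) (snd p)))" by (rule continuous_on_compose2[OF cG c\<gamma>]) auto
 hence "continuous_on UNIV (\<lambda>p. Wr (fst p) (snd p))" "continuous_on UNIV (\<lambda>p. Wt (fst p) (snd p))"
  unfolding Wr_def Wt_def by (auto intro!: continuous_intros)
 ultimately have cW: "continuous_on UNIV (\<lambda>p. W (fst p) (snd p))" "continuous_on UNIV (\<lambda>p. Wr (fst p) (snd p))" "continuous_on UNIV (\<lambda>p. Wt (fst p) (snd p))"
  by auto
 have cWs: "continuous_on S (\<lambda>r. W th r)" for S th
  by (rule continuous_on_compose2[OF cW(1), of S "\<lambda>r. (th, r)", simplified]) (intro continuous_intros)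
 have chain: "((\<lambda>t. u (c t)) has_real_derivative G (c t) \<bullet> c') (at t)" if "(c has_vector_derivative c') (at t)" for c c' t
  using has_derivative_compose[OF that[unfolded has_vector_derivative_def] C1w_deriv[OF C1]]
  by (simp add: has_real_derivative_iff_has_vector_derivative has_vector_derivative_def inner_commute)
 have vd: "((\<lambda>t. vec2 (f t) (g t)) has_vector_derivative vec2 f' g') (at t)"
  if "(f has_real_derivative f') (at t)" "(g has_real_derivative g') (at t)" for f g f' g' t
 proof -
  have d: "vec2 a b = a *\<^sub>R axis 1 1 + b *\<^sub>R axis 2 1" for a b by (auto simp: vec_eq_iff forall_2 axis_def)
  show ?thesis unfolding d using that by (auto intro!: derivative_eq_intros simp: has_real_derivative_iff_has_vector_derivative[symmetric])
 qed
 have dWr: "(W th has_real_derivative Wr th r) (at r)" for th r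
  unfolding W_def[abs_def] Wr_def \<gamma>_def by (intro chain vd) (auto intro!: derivative_eq_intros)
 have dWt: "((\<lambda>th. W th r) has_real_derivative Wt th r) (at th)" for th r
  unfolding W_def[abs_def] Wt_def \<gamma>_def by (intro chain vd) (auto intro!: derivative_eq_intros)
 have W01: "0 <= W th r" "W th r <= 1" for th r using u01 by (auto simp: W_def)
 have ry: "ray (W th) (Wr th)" for th
 proof
  show "continuous_on UNIV (Wr th)"
   by (rule continuous_on_compose2[OF cW(2), of UNIV "\<lambda>r. (th, r)", simplified]) (intro continuous_intros)
  show "W th (3/2) = 0" unfolding W_def by (rule uz) (simp add: ng)
 qed (use dWr W01 in auto)
 have mass: "ray.mass (W th) = integral {0..3/2} (\<lambda>r. W th r * r)" and qq: "ray.qq (W th) = integral {0..3/2} (\<lambda>r. W th r * (1 - W th r))"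
  and DD: "ray.DD (W th) \<rho> = integral {0..\<rho>} (\<lambda>r. (1 - W th r) * r) + integral {\<rho>..3/2} (\<lambda>r. W th r * r)" for th \<rho>
  using ray.mass_def[OF ry] ray.qq_def[OF ry] ray.DD_def[OF ry] by auto
 have ub: "ennreal (f x) = ennreal (f x) * ind (ball 0 (3/2)) x" if "norm x \<ge> 3/2 ==> f x = 0" for f x
  using that by (auto simp: indicator_def)
 have J0: "0 <= J (\<lambda>th. integral {0..3/2} (F th))" if "continuous_on UNIV (\<lambda>p. F (fst p) (snd p))" "\<And>th r. 0 <= r ==> 0 <= F th r" for F :: "real => real => real"
 proof (rule J_nonneg)
  show "cont (\<lambda>th. integral {0..3/2} (F th))" by (rule cont_param_int[OF that(1)])
  have "continuous_on {0..3/2} (F th)" for th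
   by (rule continuous_on_compose2[OF that(1), of "{0..3/2}" "\<lambda>r. (th, r)", simplified]) (intro continuous_intros)
  thus "0 <= integral {0..3/2} (F th)" for th
   using that(2) by (intro integral_nonneg integrable_continuous_real) auto
 qed
 have nnD: "(\<integral>\<^sup>+x. ennreal \<bar>u x - ind (ball (vec2 c s) 1) x\<bar> \<partial>lborel) = (\<integral>\<^sup>+th. ennreal (ray.DD (W th) (\<rho> th)) * ind {0<..<2*pi} th \<partial>lborel)"
  and DD0: "0 <= ray.DD (W th') (\<rho> th')"
  if c: "\<bar>c\<bar> <= 1/10" and s: "\<bar>s\<bar> <= 1/10" and r: "\<And>th. \<rho> th = c * cos th + s * sin th + sqrt (1 - (c^2 + s^2) + (c * cos th + s * sin th)^2)" for c s \<rho> th'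
 proof -
  have c2: "c^2 <= 1/100" "s^2 <= 1/100" using power_mono[OF c, of 2] power_mono[OF s, of 2] by (simp_all add: power_divide)
  hence cs: "c^2 + s^2 < 1" by simp
  have \<rho>: "0 <= \<rho> th" "\<rho> th <= 3/2" for th
  proof -
   define \<tau> where "\<tau> = c * cos th + s * sin th"
   have "\<bar>c * cos th\<bar> <= \<bar>c\<bar> * 1" "\<bar>s * sin th\<bar> <= \<bar>s\<bar> * 1" unfolding abs_mult by (intro mult_left_mono; simp)+
   hence t: "\<bar>\<tau>\<bar> <= 1/5" using c s unfolding \<tau>_def by linarith
   hence t2: "\<tau>^2 <= 1/25" using power_mono[OF t, of 2] by (simp add: power_divide)
   define \<sigma> kap where "\<sigma> = c^2 + s^2" and "kap = \<tau>^2"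
   have st: "0 <= \<sigma>" "\<sigma> <= 1/50" "0 <= kap" "kap <= 1/25" using c2 t2 by (auto simp: \<sigma>_def kap_def)
   have "sqrt (1 - \<sigma> + kap) <= 6/5" by (rule real_le_lsqrt) (use st in \<open>auto simp: power_divide\<close>)
   moreover have "4/5 <= sqrt (1 - \<sigma> + kap)" by (rule real_le_rsqrt) (use st in \<open>auto simp: power_divide\<close>)
   ultimately show "0 <= \<rho> th" "\<rho> th <= 3/2" using t unfolding r \<tau>_def \<sigma>_def kap_def by linarith+
  qed
  have cts: "continuous_on S (\<lambda>r. (1 - W th r) * r)" "continuous_on S (\<lambda>r. W th r * r)" for S th by (intro continuous_intros cWs)+
  have nn: "0 <= integral {0..\<rho> th} (\<lambda>r. (1 - W th r) * r)" "0 <= integral {\<rho> th..3/2} (\<lambda>r. W th r * r)" for th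
   using W01 \<rho>[of th] by (auto intro!: integral_nonneg integrable_continuous_real cts)
  thus "0 <= ray.DD (W th') (\<rho> th')" unfolding DD using nn[of th'] by simp
  let ?B = "ball (vec2 c s) 1"
  let ?f = "\<lambda>x. ennreal \<bar>u x - ind ?B x\<bar>"
  have [measurable]: "?B \<in> sets borel" by simp
  have inball: "x \<in> ball 0 (3/2)" if "x \<in> ?B" for x
  proof -
   have "norm (vec2 c s) <= \<bar>c\<bar> + \<bar>s\<bar>" using norm_le_l1_cart[of "vec2 c s"] by (simp add: sum_2)
   moreover have "norm x <= norm (vec2 c s) + dist (vec2 c s) x" by (simp add: dist_norm norm_minus_commute norm_triangle_sub)
   ultimately show ?thesis using that c s by simp
  qed
  have "(\<integral>\<^sup>+x. ?f x \<partial>lborel) = (\<integral>\<^sup>+x. ?f x * ind (ball 0 (3/2)) x \<partial>lborel)"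
  proof (intro nn_integral_cong ub)
   fix x :: "real^2" assume x: "3/2 <= norm x"
   hence "x \<notin> ?B" using inball[of x] by auto
   thus "\<bar>u x - ind (?B) x\<bar> = 0" using uz[OF x] by simp
  qed
  also have "... = (\<integral>\<^sup>+th. (\<integral>\<^sup>+r. ?f (vec2 (r * cos th) (r * sin th)) * ennreal r * ind {0<..<3/2} r \<partial>lborel) * ind {0<..<2*pi} th \<partial>lborel)"
   by (rule polar_nn_integral) measurable
  also have "... = (\<integral>\<^sup>+th. ennreal (ray.DD (W th) (\<rho> th)) * ind {0<..<2*pi} th \<partial>lborel)"
  proof (intro nn_integral_cong arg_cong2[where f="(*)"] refl)
   fix th
   have "(\<integral>\<^sup>+r. ?f (vec2 (r * cos th) (r * sin th)) * ennreal r * ind {0<..<3/2} r \<partial>lborel)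
    = (\<integral>\<^sup>+r. (ennreal ((1 - W th r) * r) * ind {0<..<\<rho> th} r + ennreal (W th r * r) * ind {\<rho> th<..<3/2} r) \<partial>lborel)"
   proof (rule nn_integral_cong_AE)
    have "AE r in lborel. r \<noteq> \<rho> th" by (rule AE_lborel_singleton)
    thus "AE r in lborel. ?f (vec2 (r * cos th) (r * sin th)) * ennreal r * ind {0<..<3/2} r
     = ennreal ((1 - W th r) * r) * ind {0<..<\<rho> th} r + ennreal (W th r * r) * ind {\<rho> th<..<3/2} r"
    proof eventually_elim
     fix x assume ne: "x \<noteq> \<rho> th"
     show "?f (vec2 (x * cos th) (x * sin th)) * ennreal x * ind {0<..<3/2} x
      = ennreal ((1 - W th x) * x) * ind {0<..<\<rho> th} x + ennreal (W th x * x) * ind {\<rho> th<..<3/2} x"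
     proof (cases "0 < x")
      case True
      hence i: "vec2 (x * cos th) (x * sin th) \<in> ?B \<longleftrightarrow> x < \<rho> th" unfolding r by (intro in_shifted_ball_iff cs) simp
      have w: "u (vec2 (x * cos th) (x * sin th)) = W th x" by (simp add: W_def \<gamma>_def)
      show ?thesis using True i ne \<rho>[of th] W01[of th x] unfolding w by (cases "x < \<rho> th") (auto simp: indicator_def ennreal_mult)
     next
      case False
      thus ?thesis using \<rho>[of th] by (auto simp: indicator_def)
     qed
    qed
   qed
   also have "... = (\<integral>\<^sup>+r. ennreal ((1 - W th r) * r) * ind {0<..<\<rho> th} r \<partial>lborel) + (\<integral>\<^sup>+r. ennreal (W th r * r) * ind {\<rho> th<..<3/2} r \<partial>lborel)"
    using borel_measurable_continuous_onI[OF cts(1)] borel_measurable_continuous_onI[OF cts(2)] by (intro nn_integral_add) auto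
   also have "... = ennreal (integral {0..\<rho> th} (\<lambda>r. (1 - W th r) * r)) + ennreal (integral {\<rho> th..3/2} (\<lambda>r. W th r * r))"
    using W01 \<rho>[of th] by (intro arg_cong2[where f="(+)"] nn_integral_interval cts) auto
   also have "... = ennreal (ray.DD (W th) (\<rho> th))" unfolding DD using nn[of th] by simp
   finally show "(\<integral>\<^sup>+r. ?f (vec2 (r * cos th) (r * sin th)) * ennreal r * ind {0<..<3/2} r \<partial>lborel)
    = ennreal (ray.DD (W th) (\<rho> th))" .
  qed
  finally show "(\<integral>\<^sup>+x. ?f x \<partial>lborel) = (\<integral>\<^sup>+th. ennreal (ray.DD (W th) (\<rho> th)) * ind {0<..<2*pi} th \<partial>lborel)" .
 qed
 have kp: "k^n <= k^j" if "j <= n" for n j using k that by (intro power_decreasing) auto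
 have powk: "8 * k^(Suc n) <= k^n" "2 * k^(Suc n) <= k^n" for n
 proof -
  have "(8 * k) * k^n <= 1 * k^n" "(2 * k) * k^n <= 1 * k^n" using k by (intro mult_right_mono; simp)+
  thus "8 * k^(Suc n) <= k^n" "2 * k^(Suc n) <= k^n" by (simp_all add: mult.assoc)
 qed
 interpret profile W Wr Wt k P m
 proof
  show "W (2*pi) r = W 0 r" for r by (simp add: W_def \<gamma>_def)
  show "J (\<lambda>th. integral {0..3/2} (\<lambda>r. sqrt ((Wr th r * r)^2 + (Wt th r)^2))) <= P"
  proof -
   have P0: "0 <= P" using p by (rule per_le_nonneg)
   have e: "sqrt ((Wr th r * r)^2 + (Wt th r)^2) = norm (G (\<gamma> th r)) * r" if "r \<in> {0..3/2}" for th r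
   proof -
    define a b where "a = G (\<gamma> th r) $ 1" and "b = G (\<gamma> th r) $ 2"
    have "((a * cos th + b * sin th) * r)^2 + (b * (r * cos th) - a * (r * sin th))^2 = (a^2 + b^2) * r^2 * ((sin th)^2 + (cos th)^2)" by algebra
    thus ?thesis using that by (simp add: Wr_def Wt_def inner_vec2 norm_vec2 a_def b_def real_sqrt_mult)
   qed
   have "ennreal (J (\<lambda>th. integral {0..3/2} (\<lambda>r. sqrt ((Wr th r * r)^2 + (Wt th r)^2)))) = ennreal (J (\<lambda>th. integral {0..3/2} (\<lambda>r. norm (G (\<gamma> th r)) * r)))"
    by (intro arg_cong[where f=ennreal] J_cong Henstock_Kurzweil_Integration.integral_cong e)
   also have "... = (\<integral>\<^sup>+x. ennreal (norm (G x)) * ind (ball 0 (3/2)) x \<partial>lborel)"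
    unfolding \<gamma>_def by (rule polar_J[symmetric]) (auto intro!: continuous_intros cG)
   also have "... <= (\<integral>\<^sup>+x. ennreal (norm (G x)) \<partial>lborel)" by (intro nn_integral_mono) (auto simp: indicator_def)
   also have "... <= ennreal P" unfolding G_def by (rule gradient_bound[OF A finA p \<open>0 < eps\<close>])
   finally show ?thesis using P0 by (simp add: ennreal_le_iff)
  qed
  show "J (\<lambda>th. ray.mass (W th)) = pi - m"
  proof -
   have "ennreal (J (\<lambda>th. ray.mass (W th))) = (\<integral>\<^sup>+x. ennreal (u x) * ind (ball 0 (3/2)) x \<partial>lborel)"
    unfolding mass W_def \<gamma>_def by (rule polar_J[OF cu u01(1), symmetric])
   also have "... = (\<integral>\<^sup>+x. ennreal (u x) \<partial>lborel)" by (intro nn_integral_cong ub[symmetric] uz)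
   also have "... = ennreal (pi - m)" using iu u01 by (subst nn_integral_eq_integral) auto
   finally have "ennreal (J (\<lambda>th. ray.mass (W th))) = ennreal (pi - m)" .
   moreover have "0 <= J (\<lambda>th. ray.mass (W th))" unfolding mass by (rule J0) (use W01 in \<open>auto intro!: continuous_intros cW\<close>)
   moreover have "0 <= pi - m" using m(1) by (metis measure_nonneg)
   ultimately show ?thesis by simp
  qed
  show "J (\<lambda>th. ray.qq (W th)) <= k^16"
  proof -
   \<comment> \<open>Integration over the plane controls u (1 - u) only with the weight r. On
     [0, \<eta>] the function is bounded by 1, and beyond \<eta> the missing weight costs a factor 1
     / \<eta>.\<close>
   define \<eta> where "\<eta> = k^18"
   have eta: "0 < \<eta>" "\<eta> <= 1" using k by (auto simp: \<eta>_def intro: power_le_one)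
   define w where "w th r = W th r * (1 - W th r)" for th r
   have w01: "0 <= w th r" "w th r <= 1" for th r unfolding w_def using W01[of th r] mult_mono[of "W th r" 1 "1 - W th r" 1] by auto
   have cw: "continuous_on S (w th)" for S th unfolding w_def by (intro continuous_intros cWs)
   have cw2: "continuous_on UNIV (\<lambda>p. w (fst p) (snd p))" unfolding w_def by (intro continuous_intros cW)
   have "integral {0..3/2} (w th) <= \<eta> + (1/\<eta>) * integral {0..3/2} (\<lambda>r. w th r * r)" for th
   proof -
    have "integral {0..3/2} (w th) = integral {0..\<eta>} (w th) + integral {\<eta>..3/2} (w th)"
     using eta by (intro Henstock_Kurzweil_Integration.integral_combine[symmetric] integrable_continuous_real cw) auto
    moreover have "integral {0..\<eta>} (w th) <= integral {0..\<eta>} (\<lambda>r. 1)"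
     using w01 by (intro integral_le integrable_continuous_real cw) auto
    moreover have "integral {\<eta>..3/2} (w th) <= integral {\<eta>..3/2} (\<lambda>r. (1/\<eta>) * (w th r * r))"
    proof (rule integral_le)
     fix r assume "r \<in> {\<eta>..3/2}"
     hence "w th r * \<eta> <= w th r * r" using w01 by (intro mult_left_mono) auto
     thus "w th r <= (1/\<eta>) * (w th r * r)" using eta by (simp add: field_simps)
    qed (use eta in \<open>auto intro!: integrable_continuous_real continuous_intros cw\<close>)
    moreover have "integral {\<eta>..3/2} (\<lambda>r. (1/\<eta>) * (w th r * r)) <= integral {0..3/2} (\<lambda>r. (1/\<eta>) * (w th r * r))"
     using eta w01 by (intro integral_subset_le integrable_continuous_real continuous_intros cw) auto
    ultimately show ?thesis using eta by simp
   qed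
   hence "J (\<lambda>th. integral {0..3/2} (w th)) <= J (\<lambda>th. \<eta> + (1/\<eta>) * integral {0..3/2} (\<lambda>r. w th r * r))"
    by (intro J_mono continuous_intros cont_param_int cw2)
   also have "... = J (\<lambda>th. \<eta>) + J (\<lambda>th. (1/\<eta>) * integral {0..3/2} (\<lambda>r. w th r * r))"
    by (intro J_add continuous_intros cont_param_int cw2)
   also have "J (\<lambda>th. (1/\<eta>) * integral {0..3/2} (\<lambda>r. w th r * r)) = (1/\<eta>) * J (\<lambda>th. integral {0..3/2} (\<lambda>r. w th r * r))" by (rule J_cmult)
   also have "J (\<lambda>th. integral {0..3/2} (\<lambda>r. w th r * r)) <= \<delta>"
   proof -
    have "ennreal (J (\<lambda>th. integral {0..3/2} (\<lambda>r. w th r * r))) = (\<integral>\<^sup>+x. ennreal (u x * (1 - u x)) * ind (ball 0 (3/2)) x \<partial>lborel)"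
     unfolding w_def W_def \<gamma>_def by (rule polar_J[symmetric]) (use u01 in \<open>auto intro!: continuous_intros cu mult_nonneg_nonneg\<close>)
    also have "... <= (\<integral>\<^sup>+x. ennreal \<bar>u x - ind A x\<bar> \<partial>lborel)"
    proof (intro nn_integral_mono)
     fix x
     have "u x * (1 - u x) <= \<bar>u x - ind A x\<bar>" using u01[of x] mult_left_mono[of "1 - u x" 1 "u x"] mult_right_mono[of "u x" 1 "1 - u x"] by (auto simp: indicator_def)
     thus "ennreal (u x * (1 - u x)) * ind (ball 0 (3/2)) x <= ennreal \<bar>u x - ind A x\<bar>" by (auto simp: indicator_def intro: ennreal_leI)
    qed
    also have "... <= ennreal \<delta>" by (rule L1)
    finally show ?thesis using d0 by (simp add: ennreal_le_iff)
   qed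
   finally have "J (\<lambda>th. ray.qq (W th)) <= 2 * pi * k^18 + (1/k^18) * k^40" using eta unfolding qq w_def J_const \<eta>_def \<delta>_def
    by (simp add: divide_right_mono)
   also have "(1/k^18) * k^40 = k^22" using k by (simp add: field_simps flip: power_add)
   also have "k^22 <= k^18" by (rule kp) simp
   also have "2 * pi * k^18 <= 7 * k^18" using pi_approx k by (intro mult_right_mono) auto
   also have "7 * k^18 + k^18 <= k^17" using powk(1)[of 17] by simp
   also have "k^17 <= k^16" by (rule kp) simp
   finally show ?thesis by simp
  qed
  show "pi * k^4 <= k^12 + J h"
   if c: "\<bar>c\<bar> <= 1/10" and s: "\<bar>s\<bar> <= 1/10" and h: "cont h"
    "\<And>th. th \<in> {0..2*pi} ==> ray.DD (W th) (c * cos th + s * sin th + sqrt (1 - (c^2 + s^2) + (c * cos th + s * sin th)^2)) <= h th" for c s h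
  proof -
   define \<rho> where "\<rho> th = c * cos th + s * sin th + sqrt (1 - (c^2 + s^2) + (c * cos th + s * sin th)^2)" for th
   note D = nnD[OF c s \<rho>_def] DD0[OF c s \<rho>_def]
   have h0: "0 <= h th" if "th \<in> {0..2*pi}" for th using D(2)[of th] h(2)[OF that] unfolding \<rho>_def by linarith
   have "(\<integral>\<^sup>+x. ennreal \<bar>u x - ind (ball (vec2 c s) 1) x\<bar> \<partial>lborel) <= (\<integral>\<^sup>+th. ennreal (h th) * ind {0<..<2*pi} th \<partial>lborel)"
    unfolding D(1) using h(2) by (intro nn_integral_mono) (auto simp: indicator_def \<rho>_def intro!: ennreal_leI)
   also have "... = ennreal (J h)" unfolding J_def by (rule nn_integral_interval[OF h(1) h0])
   finally have "area (sym_diff A (ball (vec2 c s) 1)) <= \<delta> + J h"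
    using d0 J_nonneg[OF h(1) h0] emeasure_lborel_ball_finite[of "vec2 c s" 1] by (intro measure_sym_diff_le[OF A finA _ _ _ L1]) auto
   moreover have "\<delta> <= k^12 / 2"
   proof -
    have "k^40 <= k^13" by (rule kp) simp
    also have "k^13 <= k^12 / 2" using powk(2)[of 12] by simp
    finally show ?thesis by (simp add: \<delta>_def)
   qed
   ultimately show ?thesis using lo[of "vec2 c s"] by linarith
  qed
  show "J (\<lambda>th. ray.DD (W th) 1) <= 7 * k^4"
  proof -
   have z: "\<bar>0\<bar> <= (1/10::real)" "\<And>th. (1::real) = 0 * cos th + 0 * sin th + sqrt (1 - (0^2 + 0^2) + (0 * cos th + 0 * sin th)^2)" by auto
   note D = nnD[OF z(1) z(1) z(2)] DD0[OF z(1) z(1) z(2)]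
   have v0: "vec2 0 0 = 0" by (simp add: vec_eq_iff forall_2)
   have cD: "continuous_on S (\<lambda>th. ray.DD (W th) 1)" for S
    unfolding DD by (intro continuous_intros cont_param_int cW)
   have "ennreal (J (\<lambda>th. ray.DD (W th) 1)) = (\<integral>\<^sup>+x. ennreal \<bar>u x - ind (ball 0 1) x\<bar> \<partial>lborel)"
    unfolding D(1)[unfolded v0] J_def using nn_integral_interval[OF cD D(2)] by simp
   also have "... <= (\<integral>\<^sup>+x. ennreal \<bar>u x - ind A x\<bar> + ind (sym_diff A (ball 0 1)) x \<partial>lborel)"
    by (intro nn_integral_mono) (auto simp: indicator_def ennreal_plus[symmetric] ennreal_1[symmetric] simp del: ennreal_plus ennreal_1 split: if_splits intro!: ennreal_leI)
   also have "... = (\<integral>\<^sup>+x. ennreal \<bar>u x - ind A x\<bar> \<partial>lborel) + emeasure lborel (sym_diff A (ball 0 1))"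
    using borel_measurable_indicator[of "sym_diff A (ball 0 1)" lborel] A by (subst nn_integral_add) auto
   also have "... <= ennreal \<delta> + ennreal (13/2 * k^4)"
   proof (intro add_mono L1)
    have "finarea (sym_diff A (ball 0 1))"
     by (rule finarea_bounded[where R="7/5"]) (use sub in auto)
    hence "emeasure lborel (sym_diff A (ball 0 1)) = ennreal (area (sym_diff A (ball 0 1)))" by (intro emeasure_eq_ennreal_measure) auto
    also have "... <= ennreal (13/2 * k^4)" using up by (rule ennreal_leI)
    finally show "emeasure lborel (sym_diff A (ball 0 1)) <= ennreal (13/2 * k^4)" .
   qed
   also have "... = ennreal (\<delta> + 13/2 * k^4)" using d0 k by simp
   finally have "J (\<lambda>th. ray.DD (W th) 1) <= \<delta> + 13/2 * k^4" using d0 k by (subst (asm) ennreal_le_iff) auto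
   moreover have "\<delta> <= k^4 / 2"
   proof -
    have "k^40 <= k^5" by (rule kp) simp
    also have "k^5 <= k^4 / 2" using powk(2)[of 4] by simp
    finally show ?thesis by (simp add: \<delta>_def)
   qed
   ultimately show ?thesis by linarith
  qed
 qed (use ray.der[OF ry] ray.cu'[OF ry] ray.u0[OF ry] ray.u1[OF ry] ray.uR[OF ry] dWt cW k m P in auto)
 show ?thesis by (rule conclusion)
qed

text \<open>The far part is cut off to reach a set inside the disk of radius 7/5. The removed area
  is of order k^16: the gain sqrt (pi m) would otherwise bring the perimeter below the isoperimetric
  bound.\<close>

lemma perimeter_lower_centred:
 assumes pl: "planar \<Omega> pi" and p: "per_le \<Omega> p" and k: "0 < k" "k <= 1 / 100000000" and asy: "fasym \<Omega> = k^4"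
  and near: "area (sym_diff \<Omega> (ball 0 1)) <= 32/10 * k^4" and pu: "p <= 2 * pi + 3 * k^8"
 shows "2 * pi + 2 * pi * (83/200) * k^8 <= p"
proof -
 interpret planar \<Omega> pi by fact
 have [measurable]: "rad \<in> borel_measurable borel" by (rule borel_measurable_C1w[OF C1w_rad])
 have kp: "k^4 <= 1 / 1000000" "k^8 <= k^4 / 1000000" "0 < k^4"
 proof -
  have "k * k^3 <= (1 / 100000000) * 1" using k by (intro mult_mono power_le_one) auto
  thus *: "k^4 <= 1 / 1000000" by (simp add: power_numeral_reduce)
  have "k^4 * k^4 <= k^4 * (1 / 1000000)" using * k by (intro mult_left_mono) auto
  thus "k^8 <= k^4 / 1000000" by (simp flip: power_add)
  show "0 < k^4" using k by simp
 qed
 \<comment> \<open>The level belongs to the radius 11/10, as 1 + 121/100 = 221/100. Raising it by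
   less than 1/5 keeps the radius below 7/5.\<close>
 define s0 where "s0 = sqrt (221/100 :: real)"
 have s0: "1 <= s0" "s0^2 = 221/100" by (auto simp: s0_def real_le_rsqrt)
 have far: "\<Omega> \<inter> {x. s < rad x} \<subseteq> \<Omega> - ball 0 1" if "s0 <= s" for s
 proof
  fix x assume x: "x \<in> \<Omega> \<inter> {x. s < rad x}"
  hence "\<not> norm x <= sqrt (s0^2 - 1)" using rad_le_iff[OF s0(1), of x] that by auto
  moreover have "(1::real) <= sqrt (s0^2 - 1)" using s0 by (simp add: real_le_rsqrt)
  ultimately have "1 < norm x" by linarith
  thus "x \<in> \<Omega> - ball 0 1" using x by auto
 qed
 have sdfin: "finarea (sym_diff A (ball x 1))" if "A \<subseteq> \<Omega>" "A \<in> sets borel" for A x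
 proof -
  have "finarea (\<Omega> \<union> ball x 1)"
   using emeasure_subadditive[of \<Omega> lborel "ball x 1"] fin emeasure_lborel_ball_finite[of x 1] by (auto intro: le_less_trans)
  thus ?thesis by (rule finarea_mono) (use that borel in auto)
 qed
 have mfar: "area (\<Omega> \<inter> {x. s < rad x}) <= 32/10 * k^4" if "s0 <= s" for s
 proof -
  have "area (\<Omega> \<inter> {x. s < rad x}) <= area (sym_diff \<Omega> (ball 0 1))"
   using far[OF that] sdfin[of \<Omega> 0] by (intro area_mono) auto
  thus ?thesis using near by simp
 qed
 have "sqrt (area (\<Omega> \<inter> {x. s0 < rad x})) <= 1/50"
  using mfar[of s0] kp by (intro real_le_lsqrt) (auto simp: power2_eq_square)
 moreover have "1 <= sqrt pi" using pi_gt3 by simp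
 ultimately have h: "sqrt (area (\<Omega> \<inter> {x. s0 < rad x})) < sqrt pi / 4 * (1/5)" by linarith
 have "(0::real) < 1/5" by simp
 from isoperimetric_truncation[OF borel fin p C1w_rad norm_rad this h]
 obtain s A m where s: "s0 <= s" "s < s0 + 1/5" "A = \<Omega> \<inter> {x. rad x <= s}" and md: "m = area (\<Omega> \<inter> {x. s < rad x})"
  and pA: "per_le A (p - sqrt (pi * m))" and A: "A \<in> sets borel" and Afin: "finarea A" and mA: "area A = area \<Omega> - m"
  .
 note mA = mA[unfolded area]
 have m0: "0 <= m" "m <= 32/10 * k^4" using mfar[OF s(1)] by (auto simp: md)
 have Asub: "A \<subseteq> cball 0 (7/5)"
 proof
  fix x assume "x \<in> A"
  hence "norm x <= sqrt (s^2 - 1)" using rad_le_iff[of s x] s s0 by simp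
  also have "sqrt (s^2 - 1) <= 7/5"
  proof (rule real_le_lsqrt)
   have "s0 <= 3/2" unfolding s0_def by (rule real_le_lsqrt) (auto simp: power2_eq_square)
   hence "s * s <= 17/10 * (17/10)" using s s0 by (intro mult_mono) auto
   have "s0 <= 149/100" unfolding s0_def by (rule real_le_lsqrt) (auto simp: power2_eq_square)
   hence "s * s <= 169/100 * (169/100)" using s s0 by (intro mult_mono) auto
   thus "s^2 - 1 <= (7/5)^2" by (simp add: power2_eq_square)
  qed simp
  finally show "x \<in> cball 0 (7/5)" by simp
 qed
 have m4: "m <= 4 * k^16"
 proof -
  define y where "y = sqrt m"
  have y: "0 <= y" "y * y = m" using m0 by (auto simp: y_def)
  have y1: "y <= 1/50" unfolding y_def using m0 kp by (intro real_le_lsqrt) (auto simp: power2_eq_square)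
  have "pi - m <= sqrt (pi * (pi - m))"
  proof (rule real_le_rsqrt)
   have "(pi - m) * (pi - m) <= pi * (pi - m)" using m0 kp pi_gt3 by (intro mult_right_mono) auto
   thus "(pi - m)^2 <= pi * (pi - m)" by (simp add: power2_eq_square)
  qed
  hence "2 * (pi - m) <= p - sqrt pi * y" using isoperimetric[OF A Afin pA] by (simp add: mA real_sqrt_mult y_def)
  moreover have "17/10 * y <= sqrt pi * y"
  proof -
   have "17/10 <= sqrt pi" by (rule real_le_rsqrt) (use pi_gt3 in \<open>simp add: power2_eq_square\<close>)
   thus ?thesis using y by (intro mult_right_mono) auto
  qed
  moreover have "y * y <= 1/50 * y" using y y1 by (intro mult_right_mono) auto
  ultimately have "y <= 2 * k^8" using pu y by argo
  hence "y * y <= (2 * k^8) * (2 * k^8)" using y by (intro mult_mono) auto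
  thus ?thesis using y by (simp flip: power_add)
 qed
 have k16: "4 * k^16 <= k^12 / 2"
 proof -
  have "k^12 * k^4 <= k^12 * (1/1000000)" using kp k by (intro mult_left_mono) auto
  moreover have "0 < k^12" using k by simp
  ultimately have "4 * (k^12 * k^4) <= k^12 / 2" by argo
  thus ?thesis by (simp flip: power_add)
 qed
 have split: "area (sym_diff A (ball x 1)) <= area (sym_diff \<Omega> (ball x 1)) + m"
  "area (sym_diff \<Omega> (ball x 1)) <= area (sym_diff A (ball x 1)) + m" for x
  unfolding md using sdfin[of \<Omega> x] sdfin[of A x] finarea_mono[OF fin, of "\<Omega> \<inter> {x. s < rad x}"]
  by (intro measure_Un_le; auto simp: s(3))+
 have "2 * pi + 2 * pi * (83/200) * k^8 <= p - sqrt (pi * m)"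
 proof (rule perimeter_lower_near_disk[OF A Asub pA k mA m0(1)])
  show "m <= k^12" using m4 k16 zero_less_power[OF k(1), of 12] by linarith
  show "p - sqrt (pi * m) <= 2 * pi + 3 * k^8" using pu m0 pi_gt_zero by (smt (verit) real_sqrt_ge_zero mult_nonneg_nonneg)
  show "area (sym_diff A (ball 0 1)) <= 13/2 * k^4" using split(1)[of 0] near m0(2) kp(3) by linarith
  fix x
  have "k^4 <= area (sym_diff \<Omega> (ball x 1)) / pi" using asym_le[of x] sd[of x] asy by simp
  hence "pi * k^4 <= area (sym_diff \<Omega> (ball x 1))" using pi_gt_zero by (simp add: pos_le_divide_eq mult.commute)
  thus "pi * k^4 <= area (sym_diff A (ball x 1)) + k^12 / 2" using split(2)[of x] m4 k16 by linarith
 qed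
 thus ?thesis using m0 pi_gt_zero by (smt (verit) real_sqrt_ge_zero mult_nonneg_nonneg)
qed

text \<open>The asymmetry is written as a fourth power to make the intermediate scales integral
  powers of \<open>k\<close>. If p > 2 pi + 3 k^8 the bound is immediate, since 2 pi * 0.415 < 3;
  otherwise a translation moves a near-optimal centre to the origin.\<close>

lemma perimeter_lower_local:
 assumes pl: "planar \<Omega> pi" and p: "per_le \<Omega> p" and l: "0 < fasym \<Omega>" "fasym \<Omega> <= (1 / 100000000)^4"
 shows "2 * pi + 2 * pi * (83/200) * (fasym \<Omega>)^2 <= p"
proof -
 interpret planar \<Omega> pi by fact
 define k where "k = root 4 (fasym \<Omega>)"
 have k4: "fasym \<Omega> = k^4" using l by (simp add: k_def)
 have k8: "(k^4)^2 = k^8" by (simp flip: power_mult)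
 have k: "0 < k" "k <= 1 / 100000000"
 proof -
  show "0 < k" using l by (simp add: k_def)
  show "k <= 1 / 100000000" using l(2) unfolding k4 by (rule power_le_imp_le_base[of _ 3, simplified]) simp
 qed
 show ?thesis
 proof (cases "p <= 2 * pi + 3 * k^8")
  case False
  have "2 * pi * (83/200) * k^8 <= 3 * k^8" using pi_approx k by (intro mult_right_mono) auto
  thus ?thesis using False unfolding k4 k8 by linarith
 next
  case True
  obtain x where x: "2 * (pi - overlap \<Omega> r x) / pi < fasym \<Omega> + fasym \<Omega> / 100"
   using asym_approx[of "fasym \<Omega> / 100"] l by auto
  define \<Omega>' where "\<Omega>' = aff (- x) 1 ` \<Omega>"
  have T: "fasym \<Omega>' = k^4" "planar \<Omega>' pi"
   using asymmetry_aff[OF pl zero_less_one, of "- x"] k4 by (simp_all add: \<Omega>'_def)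
  have "per_le \<Omega>' p" using per_le_aff[OF borel zero_less_one p, of "- x"] by (simp add: \<Omega>'_def)
  moreover have "area (sym_diff \<Omega>' (ball 0 1)) <= 32/10 * k^4"
  proof -
   have "sym_diff \<Omega>' (ball 0 1) = aff (- x) 1 ` (sym_diff \<Omega> (ball x 1))"
    unfolding \<Omega>'_def aff_image_vimage[OF zero_less_one] by (auto simp: dist_norm algebra_simps)
   hence "area (sym_diff \<Omega>' (ball 0 1)) = area (sym_diff \<Omega> (ball x 1))"
    by (simp only:) (subst measure_aff_image; simp)
   also have "... = 2 * (pi - overlap \<Omega> r x)" using sd[of x] by simp
   also have "... <= (101/100 * k^4) * pi" using x pi_gt_zero unfolding k4 by (simp add: pos_divide_less_eq)
   also have "... <= (101/100 * k^4) * (316/100)" using pi_approx k by (intro mult_left_mono) auto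
   also have "... <= 32/10 * k^4" using k by simp
   finally show ?thesis .
  qed
  ultimately show ?thesis using perimeter_lower_centred[OF T(2) _ k T(1) _ True] unfolding k4 k8 by blast
 qed
qed

section \<open>Compression into a bounded region\<close>

lemma test_field_shift:
 assumes phi: "phi \<in> test_fields"
 shows "(\<lambda>x. phi (x - v)) \<in> test_fields" "divergence (\<lambda>x. phi (x - v)) x = divergence phi (x - v)"
proof -
 from test_fieldsE[OF phi] obtain D R where D: "C1w phi D" "\<And>x. R < norm x ==> phi x = 0" "\<And>x. norm (phi x) <= 1" 
  "\<And>x. divergence phi x = dv (D x)" by metis
 have C: "C1w (\<lambda>x. phi (x - v)) (\<lambda>x. D (x - v))"
  unfolding C1w_def
 proof (intro conjI allI)
  fix x
  have "((\<lambda>x. x - v) has_derivative (\<lambda>h. h)) (at x)" by (auto intro!: derivative_eq_intros)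
  from has_derivative_compose[OF this C1w_deriv[OF D(1)]]
  show "((\<lambda>x. phi (x - v)) has_derivative blinfun_apply (D (x - v))) (at x)" by simp
  show "continuous_on UNIV (\<lambda>x. D (x - v))"
   by (rule continuous_on_compose2[OF C1w_contD[OF D(1), of UNIV]]) (auto intro!: continuous_intros)
 qed
 show "(\<lambda>x. phi (x - v)) \<in> test_fields"
 proof (rule test_fieldsI[OF C])
  show "phi (x - v) = 0" if "R + norm v < norm x" for x
  proof (rule D(2))
   show "R < norm (x - v)" using that norm_triangle_ineq2[of x v] by linarith
  qed
 qed (rule D(3))
 show "divergence (\<lambda>x. phi (x - v)) x = divergence phi (x - v)" by (simp add: divergence_C1w[OF C] D(4))
qed

text \<open>Removing a slab of width more than 2 and pushing the right part against the gap costs no perimeter,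
 and no unit disk meets both parts afterwards.\<close>

lemma cut_and_shift:
 assumes A[measurable]: "A \<in> sets borel" and fin: "finarea A" and p: "per_le A p"
  and light: "area (A \<inter> {x. \<bar>x $ 1 - c\<bar> < 4}) <= \<mu>" "sqrt \<mu> < sqrt pi / 4"
 obtains A' m where "A' \<in> sets borel" "finarea A'" "0 <= m" "m <= \<mu>" "per_le A' (p - sqrt (pi * m))"
  "area A' = area A - m"
  "\<And>x. \<exists>y. area (A' \<inter> ball x 1) <= area (A \<inter> ball y 1)"
  "\<And>x. x \<in> A' ==> \<exists>y\<in>A. x $ 2 = y $ 2 \<and> (x $ 1 = y $ 1 \<and> y $ 1 < c - 14/5 \<or> x $ 1 = y $ 1 - 3 \<and> c + 14/5 < y $ 1)"
proof -
 define L where "L x = vec2 (x $ 1) 0" for x :: "real^2"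
 have L: "bounded_linear L" unfolding L_def
  by (rule bounded_linear_intro[where K=1]) (auto simp: vec_eq_iff forall_2 norm_vec2)
 \<comment> \<open>Superlevel sets of \<open>d\<close> are slabs about the line
   \<open>x $ 1 = c\<close>. A level from -4 up to -3 removes only points with |x $ 1 - c| < 4, and
   leaves only points with |x $ 1 - c| > sqrt 8 > 14/5.\<close>
 define d where "d x = 0 - rad (L x - vec2 c 0)" for x
 define Dd where "Dd x = 0 - (blinfun_inner_right ((L x - vec2 c 0) /\<^sub>R rad (L x - vec2 c 0)) o\<^sub>L (Blinfun L - 0))" for x
 have Cd: "C1w d Dd" unfolding d_def Dd_def
  by (intro C1w_diff C1w_const C1w_compose[OF C1w_rad] C1w_linear L)
 have Dd1: "norm (Dd x) <= 1" for x
 proof -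
  have "norm (Blinfun L) <= 1"
  proof (rule norm_blinfun_bound)
   show "norm (blinfun_apply (Blinfun L) x) <= 1 * norm x" for x
    using L by (auto simp: bounded_linear_Blinfun_apply L_def norm_vec2 real_sqrt_le_iff intro: order_trans[OF _ real_sqrt_le_mono])
  qed simp
  hence "norm (blinfun_inner_right ((L x - vec2 c 0) /\<^sub>R rad (L x - vec2 c 0))) * norm (Blinfun L) <= 1 * 1"
   by (intro mult_mono norm_rad) auto
  thus ?thesis unfolding Dd_def using norm_blinfun_compose[of "blinfun_inner_right ((L x - vec2 c 0) /\<^sub>R rad (L x - vec2 c 0))" "Blinfun L"] by simp
 qed
 have dx: "d x = - sqrt (1 + (x $ 1 - c)^2)" for x
  by (simp add: d_def rad_def L_def inner_vec2 power2_eq_square)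
 have [measurable]: "d \<in> borel_measurable borel" by (rule borel_measurable_C1w[OF Cd])
 have lm: "area (A \<inter> {x. -4 < d x}) <= \<mu>"
 proof -
  have "A \<inter> {x. -4 < d x} \<subseteq> A \<inter> {x. \<bar>x $ 1 - c\<bar> < 4}"
  proof
   fix x assume x: "x \<in> A \<inter> {x. -4 < d x}"
   hence "sqrt (1 + (x $ 1 - c)^2) < 4" by (simp add: dx)
   hence "1 + (x $ 1 - c)^2 < 4^2" using real_sqrt_less_iff[of "1 + (x $ 1 - c)^2" "4^2"] by simp
   hence "\<bar>x $ 1 - c\<bar>^2 < 4^2" by simp
   hence "\<bar>x $ 1 - c\<bar> < 4" by (rule power2_less_imp_less) simp
   thus "x \<in> A \<inter> {x. \<bar>x $ 1 - c\<bar> < 4}" using x by simp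
  qed
  hence "area (A \<inter> {x. -4 < d x}) <= area (A \<inter> {x. \<bar>x $ 1 - c\<bar> < 4})"
   using finarea_mono[OF fin, of "A \<inter> {x. \<bar>x $ 1 - c\<bar> < 4}"] by (intro area_mono) auto
  thus ?thesis using light(1) by simp
 qed
 have "sqrt (area (A \<inter> {x. -4 < d x})) < sqrt pi / 4 * 1"
  using le_less_trans[OF real_sqrt_le_mono[OF lm] light(2)] by simp
 then obtain s A1 m where s: "-4 <= s" "s < -4 + 1" and A1_def: "A1 = A \<inter> {x. d x <= s}" and p1: "per_le A1 (p - sqrt (pi * m))"
  and m: "m = area (A \<inter> {x. s < d x})" "m <= area (A \<inter> {x. -4 < d x})"
  and A1[measurable]: "A1 \<in> sets borel" and fin1: "finarea A1" and mA: "area A1 = area A - m"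
  by (rule isoperimetric_truncation[OF A fin p Cd Dd1 zero_less_one])
 have gap: "14/5 < \<bar>x $ 1 - c\<bar>" if "x \<in> A1" for x
 proof -
  have "3 < sqrt (1 + (x $ 1 - c)^2)" using that s(2) by (simp add: A1_def dx)
  hence "3^2 < 1 + (x $ 1 - c)^2" using real_sqrt_less_iff[of "3^2" "1 + (x $ 1 - c)^2"] by simp
  hence "(14/5)^2 < \<bar>x $ 1 - c\<bar>^2" by (simp add: power2_eq_square)
  thus ?thesis by (rule power2_less_imp_less) simp
 qed
 \<comment> \<open>The gap is wider than 28/5. After the shift by 3 more than 13/5 is left, which
   exceeds the diameter 2 of a unit disk.\<close>
 define v :: "real^2" where "v = vec2 (-3) 0"
 define AL where "AL = A1 \<inter> {x. x $ 1 < c}"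
 define AR where "AR = A1 \<inter> {x. c <= x $ 1}"
 have [measurable]: "AL \<in> sets borel" "AR \<in> sets borel" unfolding AL_def AR_def by measurable
 have finL: "finarea AL" and finR: "finarea AR"
  by (rule finarea_mono[OF fin1]; auto simp: AL_def AR_def)+
 define BR where "BR = aff v 1 ` AR"
 have [measurable]: "BR \<in> sets borel" unfolding BR_def by (rule borel_aff_image) auto
 have finB: "finarea BR" using finR by (simp add: BR_def emeasure_aff_image)
 have xL: "x $ 1 < c - 14/5" if "x \<in> AL" for x using gap[of x] that by (auto simp: AL_def)
 have xR: "c + 14/5 < x $ 1" if "x \<in> AR" for x using gap[of x] that by (auto simp: AR_def)
 have xB: "c - 1/5 < x $ 1" if "x \<in> BR" for x using xR that by (force simp: BR_def aff_def v_def)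
 have dis: "AL \<inter> BR = {}" "AL \<inter> AR = {}" using xL xB by (force simp: AL_def AR_def)+
 have un: "AL \<union> AR = A1" by (auto simp: AL_def AR_def)
 show thesis
 proof
  show "AL \<union> BR \<in> sets borel" by simp
  show "finarea (AL \<union> BR)"
   using emeasure_subadditive[of AL lborel BR] finL finB by (auto intro: le_less_trans)
  show "0 <= m" by (simp add: m(1))
  show "m <= \<mu>" using m(2) lm by simp
  have "area (AL \<union> BR) = area AL + area BR"
   using finL finB dis by (intro measure_Union) auto
  also have "area BR = area AR" by (simp add: BR_def measure_aff_image)
  also have "area AL + area AR = area A1"
   unfolding un[symmetric] using finL finR dis by (intro measure_Union[symmetric]) auto
  finally show "area (AL \<union> BR) = area A - m" unfolding mA .
  show "per_le (AL \<union> BR) (p - sqrt (pi * m))"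
   unfolding per_le_def
  proof
   fix phi assume phi: "phi \<in> test_fields"
   note sh = test_field_shift[OF phi, of "- v"]
   \<comment> \<open>The field \<Psi> is \<open>phi\<close> to the left of the gap and the translate
     of \<open>phi\<close> to the right. The transition lies inside the gap, so it adds nothing to
     the flux.\<close>
   obtain H h where H: "\<And>t. (H has_real_derivative h t) (at t)" "continuous_on UNIV h" "\<And>t. t <= c - 2 ==> H t = 1"
    "\<And>t. c + 2 <= t ==> H t = 0" "\<And>t. 0 <= H t" "\<And>t. H t <= 1" "\<And>t. t <= c - 2 \<or> c + 2 <= t ==> h t = 0"
    by (rule C1_cut[of "c - 2" "c + 2" 1]) auto
   have d1: "C1w (\<lambda>x::real^2. x $ 1) (\<lambda>x. Blinfun (\<lambda>x. x $ 1))" by (rule C1w_linear[OF bounded_linear_vec_nth])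
   define \<Psi> where "\<Psi> = (\<lambda>x. phi (x - (- v)) + H (x $ 1) *\<^sub>R (phi x - phi (x - (- v))))"
   note cc = test_field_convex_combination[OF phi sh(1) d1 H(1,2,5,6), folded \<Psi>_def]
   have dL: "divergence \<Psi> x = divergence phi x" if "x \<in> AL" for x
    unfolding cc(2) using H(3,7)[of "x $ 1"] xL[OF that] by simp
   have dR: "divergence \<Psi> x = divergence phi (x + v)" if "x \<in> AR" for x
    unfolding cc(2) using H(4,7)[of "x $ 1"] xR[OF that] sh(2)[of x] by simp
   have si: "set_integrable lborel B (divergence \<xi>)" if "\<xi> \<in> test_fields" "B \<in> sets borel" for B \<xi>
    using divergence_set_integrable[OF that(1)] that(2) by auto
   have "(LINT x:AL \<union> BR|lborel. divergence phi x) = (LINT x:AL|lborel. divergence phi x) + (LINT x:BR|lborel. divergence phi x)"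
    by (intro set_integral_Un dis si phi) auto
   also have "(LINT x:BR|lborel. divergence phi x) = (LINT x:AR|lborel. divergence phi (x + v))"
    unfolding BR_def using divergence_borel[OF phi] by (subst integral_aff_image) (auto simp: aff_def add.commute)
   also have "... = (LINT x:AR|lborel. divergence \<Psi> x)" using dR by (intro set_lebesgue_integral_cong) auto
   also have "(LINT x:AL|lborel. divergence phi x) = (LINT x:AL|lborel. divergence \<Psi> x)" using dL by (intro set_lebesgue_integral_cong) auto
   also have "(LINT x:AL|lborel. divergence \<Psi> x) + (LINT x:AR|lborel. divergence \<Psi> x) = (LINT x:A1|lborel. divergence \<Psi> x)"
    unfolding un[symmetric] by (intro set_integral_Un[symmetric] dis si cc) auto
   also have "... <= p - sqrt (pi * m)" by (rule per_leD[OF p1 cc(1)])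
   finally show "(LINT x:AL \<union> BR|lborel. divergence phi x) <= p - sqrt (pi * m)" .
  qed
  show "\<exists>y\<in>A. x $ 2 = y $ 2 \<and> (x $ 1 = y $ 1 \<and> y $ 1 < c - 14/5 \<or> x $ 1 = y $ 1 - 3 \<and> c + 14/5 < y $ 1)" if xx: "x \<in> AL \<union> BR" for x
  proof (cases "x \<in> AL")
   case True
   thus ?thesis using xL by (auto simp: AL_def A1_def)
  next
   case False
   then obtain y where "y \<in> AR" "x = aff v 1 y" using xx by (auto simp: BR_def)
   thus ?thesis using xR[of y] by (intro bexI[of _ y]) (auto simp: AR_def A1_def aff_def v_def)
  qed
  fix x :: "real^2"
  have b1: "\<bar>x $ 1 - y $ 1\<bar> < 1" if "y \<in> ball x 1" for y
   using that component_le_norm_cart[of "x - y" 1] by (simp add: dist_norm)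
  have finy: "finarea (A \<inter> ball y 1)" for y by (rule finarea_mono[OF fin]) auto
  show "\<exists>y. area ((AL \<union> BR) \<inter> ball x 1) <= area (A \<inter> ball y 1)"
  \<comment> \<open>The number c - 3/2 is the midpoint of the new gap from c - 14/5 to c - 1/5. A
    unit disk centred to its left misses the right part, and any other one misses the left
    part.\<close>
  proof (cases "x $ 1 < c - 3/2")
   case True
   have "y \<notin> BR" if "y \<in> ball x 1" for y
   proof
    assume "y \<in> BR" thus False using True b1[OF that] xB[of y] by linarith
   qed
   hence "(AL \<union> BR) \<inter> ball x 1 \<subseteq> A \<inter> ball x 1" by (auto simp: AL_def A1_def)
   hence "area ((AL \<union> BR) \<inter> ball x 1) <= area (A \<inter> ball x 1)"
    using finy by (intro area_mono) auto
   thus ?thesis by blast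
  next
   case False
   have nL: "y \<notin> AL" if "y \<in> ball x 1" for y
   proof
    assume "y \<in> AL" thus False using False b1[OF that] xL[of y] by linarith
   qed
   have "(AL \<union> BR) \<inter> ball x 1 \<subseteq> aff v 1 ` (A \<inter> ball (x - v) 1)"
   proof
    fix z assume z: "z \<in> (AL \<union> BR) \<inter> ball x 1"
    hence "z \<in> BR" using nL by blast
    then obtain y where y: "y \<in> AR" "z = v + y" by (auto simp: BR_def aff_def)
    moreover have "dist (x - v) y = dist x z" unfolding y(2) dist_norm by (simp add: algebra_simps)
    ultimately show "z \<in> aff v 1 ` (A \<inter> ball (x - v) 1)" using z by (auto simp: AR_def A1_def aff_def)
   qed
   moreover have "aff v 1 ` (A \<inter> ball (x - v) 1) \<in> sets borel" by (rule borel_aff_image) auto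
   ultimately have "area ((AL \<union> BR) \<inter> ball x 1) <= area (aff v 1 ` (A \<inter> ball (x - v) 1))"
    using finy[of "x - v"] by (intro area_mono) (auto simp: emeasure_aff_image)
   also have "... = area (A \<inter> ball (x - v) 1)" by (subst measure_aff_image) auto
   finally show ?thesis by blast
  qed
 qed
qed

text \<open>Bounding the overlaps with unit disks from above bounds the asymmetry from below.\<close>

definition compressed :: "nat => (real^2) set => real => (real^2) set => real => bool" where
 "compressed N A p A' p' \<longleftrightarrow> A' \<in> sets borel \<and> finarea A' \<and> per_le A' p' \<and>
  (\<exists>m\<ge>0. area A' = area A - m \<and> p' <= p - sqrt (pi * m) \<and> sqrt pi * m <= sqrt (pi / N) * (p - p')) \<and>
  (\<forall>x. \<exists>y. area (A' \<inter> ball x 1) <= area (A \<inter> ball y 1))"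

text \<open>For m <= pi / N the gain dominates the lost area linearly, with a factor that shrinks
  with \<open>N\<close>. Linear bounds add up over any number of cuts, so the total lost area is
  small however far the set extends.\<close>

lemma perimeter_gain:
 assumes "0 <= m" "m <= pi / N" shows "sqrt pi * m <= sqrt (pi / N) * sqrt (pi * m)"
proof -
 have "sqrt m <= sqrt (pi / N)" using assms by simp
 hence "sqrt (pi * m) * sqrt m <= sqrt (pi * m) * sqrt (pi / N)" using assms by (intro mult_left_mono) auto
 moreover have "sqrt (pi * m) * sqrt m = sqrt pi * m" using assms by (simp add: real_sqrt_mult)
 ultimately show ?thesis by (simp only: mult.commute)
qed

lemma compressed_refl: "A \<in> sets borel ==> finarea A ==> per_le A p ==> compressed N A p A p"
 unfolding compressed_def by (auto intro!: exI[of _ "0::real"])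

lemma compressed_trans:
 assumes "compressed N A p B q" "compressed N B q C r" shows "compressed N A p C r"
proof -
 obtain m where m: "0 <= m" "area B = area A - m" "q <= p - sqrt (pi * m)" "sqrt pi * m <= sqrt (pi / N) * (p - q)"
  using assms(1) by (auto simp: compressed_def)
 obtain l where l: "0 <= l" "area C = area B - l" "r <= q - sqrt (pi * l)" "sqrt pi * l <= sqrt (pi / N) * (q - r)"
  using assms(2) by (auto simp: compressed_def)
 have "sqrt (pi * (m + l)) <= sqrt (pi * m) + sqrt (pi * l)"
  using sqrt_add_le_add_sqrt[of "pi * m" "pi * l"] m l by (simp add: algebra_simps)
 hence "r <= p - sqrt (pi * (m + l))" using m l by linarith
 moreover have "sqrt pi * (m + l) <= sqrt (pi / N) * (p - r)" using m(4) l(4) by (simp add: algebra_simps)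
 ultimately show ?thesis using assms m(1,2) l(1,2) unfolding compressed_def by (smt (verit) order_trans)
qed

lemma compressed_swp:
 assumes "A \<in> sets borel" "finarea A" "per_le A p" shows "compressed N A p (swp ` A) p"
proof -
 have "area (swp ` A \<inter> ball x 1) = area (A \<inter> ball (swp x) 1)" for x
 proof -
  have "swp ` (A \<inter> ball (swp x) 1) = swp ` A \<inter> ball x 1"
   unfolding vimage_swp by (auto simp: dist_norm simp flip: swp_diff)
  thus ?thesis using emeasure_swp_image[of "A \<inter> ball (swp x) 1"] assms(1) by (simp add: measure_def)
 qed
 thus ?thesis using assms emeasure_swp_image[of A] unfolding compressed_def
  by (auto intro!: borel_swp_image per_le_swp exI[of _ "0::real"] simp: measure_def)
qed

lemma compressed_shift:
 assumes "A \<in> sets borel" "finarea A" "per_le A p" shows "compressed N A p (aff v 1 ` A) p"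
proof -
 have "area (aff v 1 ` A \<inter> ball x 1) = area (A \<inter> ball (x - v) 1)" for x
 proof -
  have "aff v 1 ` (A \<inter> ball (x - v) 1) = aff v 1 ` A \<inter> ball x 1"
   unfolding aff_image_vimage[OF zero_less_one] by (auto simp: dist_norm algebra_simps)
  thus ?thesis using measure_aff_image[of "A \<inter> ball (x - v) 1" 1 v] assms(1) by simp
 qed
 thus ?thesis using assms per_le_aff[of A 1 p v] unfolding compressed_def
  by (auto intro!: borel_aff_image exI[of _ "0::real"] simp: measure_aff_image emeasure_aff_image)
qed

text \<open>\<open>n\<close> counts rounds, each of which shortens the extent by 3. As long as the
  extent exceeds 8 N, one of N disjoint windows of width 8 has area at most pi / N, and 17 <= N
  makes it light enough to be cut.\<close>

lemma compress_horizontally: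
 assumes "A \<in> sets borel" "finarea A" "per_le A p" "area A <= pi" "17 <= N"
  and "\<And>x. x \<in> A ==> a <= x $ 1 \<and> x $ 1 <= b" "b <= a + 8 * real N + 3 * real n"
 shows "\<exists>A' p'. compressed N A p A' p' \<and> (\<forall>x\<in>A'. a <= x $ 1 \<and> x $ 1 <= a + 8 * real N \<and> (\<exists>y\<in>A. x $ 2 = y $ 2))"
 using assms
proof (induction n arbitrary: A p b)
 case 0
 thus ?case using compressed_refl[of A p N] by fastforce
next
 case (Suc n)
 note [measurable] = Suc.prems(1)
 show ?case
 proof (cases "b <= a + 8 * real N")
  case True
  thus ?thesis using Suc.prems compressed_refl[of A p N] by fastforce
 next
  case False
  define c where "c j = a + 4 + 8 * real j" for j
  define W where "W j = A \<inter> {x. \<bar>x $ 1 - c j\<bar> < 4}" for j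
  have W[measurable]: "W j \<in> sets borel" for j unfolding W_def by measurable
  have Wf: "finarea (W j)" for j by (rule finarea_mono[OF Suc.prems(2)]) (auto simp: W_def)
  have "disjoint_family_on W {..<N}"
   unfolding disjoint_family_on_def
  proof (intro ballI impI)
   fix i j assume "i \<in> {..<N}" "j \<in> {..<N}" "i \<noteq> j"
   hence "1 <= \<bar>real i - real j\<bar>" by (cases "i < j") auto
   thus "W i \<inter> W j = {}" unfolding W_def c_def by (auto simp: abs_if split: if_splits)
  qed
  hence "(\<Sum>j<N. area (W j)) = area (\<Union>j<N. W j)"
   using Wf by (intro measure_finite_Union[symmetric]) (auto simp: less_top[symmetric])
  also have "... <= area A" using Suc.prems(2) by (intro area_mono) (auto simp: W_def)
  finally have sum: "(\<Sum>j<N. area (W j)) <= pi" using Suc.prems(4) by simp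
  have "\<exists>j<N. area (W j) <= pi / N"
  proof (rule ccontr)
   assume "\<not> ?thesis"
   moreover have "{..<N} \<noteq> {}" using Suc.prems(5) by (auto simp: lessThan_empty_iff)
   ultimately have "(\<Sum>j<N. pi / N) < (\<Sum>j<N. area (W j))" by (intro sum_strict_mono) (auto simp: not_le)
   thus False using sum Suc.prems(5) by simp
  qed
  then obtain j where j: "j < N" "area (W j) <= pi / N" by blast
  have "sqrt (pi / N) < sqrt pi / 4"
  proof -
   have "4 < sqrt (real N)" using Suc.prems(5) by (intro real_less_rsqrt) auto
   thus ?thesis unfolding real_sqrt_divide using Suc.prems(5) by (intro divide_strict_left_mono) auto
  qed
  from cut_and_shift[OF Suc.prems(1-3) j(2)[unfolded W_def] this]
  obtain B m where B: "B \<in> sets borel" "finarea B" "0 <= m" "m <= pi / N" "per_le B (p - sqrt (pi * m))"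
   "area B = area A - m"
   "\<And>x. \<exists>y. area (B \<inter> ball x 1) <= area (A \<inter> ball y 1)"
   "\<And>x. x \<in> B ==> \<exists>y\<in>A. x $ 2 = y $ 2 \<and> (x $ 1 = y $ 1 \<and> y $ 1 < c j - 14/5 \<or> x $ 1 = y $ 1 - 3 \<and> c j + 14/5 < y $ 1)"
   by blast
  have AB: "compressed N A p B (p - sqrt (pi * m))" unfolding compressed_def using perimeter_gain[OF B(3,4)] B(1-3,5-7) by (auto intro!: exI[of _ m])
  have cj: "a + 4 <= c j" "c j <= b - 4" using j(1) False by (auto simp: c_def)
  have "\<exists>A' p'. compressed N B (p - sqrt (pi * m)) A' p' \<and> (\<forall>x\<in>A'. a <= x $ 1 \<and> x $ 1 <= a + 8 * real N \<and> (\<exists>y\<in>B. x $ 2 = y $ 2))"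
  proof (rule Suc.IH[OF B(1,2,5) _ Suc.prems(5)])
   show "area B <= pi" using B(3,6) Suc.prems(4) by simp
   show "a <= x $ 1 \<and> x $ 1 <= b - 3" if xB: "x \<in> B" for x
   proof -
    obtain y where y: "y \<in> A" "x $ 1 = y $ 1 \<and> y $ 1 < c j - 14/5 \<or> x $ 1 = y $ 1 - 3 \<and> c j + 14/5 < y $ 1"
     using B(8)[OF xB] by blast
    from y(2) show ?thesis using Suc.prems(6)[OF y(1)] cj by (elim disjE) linarith+
   qed
   show "b - 3 <= a + 8 * real N + 3 * real n" using Suc.prems(7) by simp
  qed
  then obtain A' p' where A': "compressed N B (p - sqrt (pi * m)) A' p'" "\<forall>x\<in>A'. a <= x $ 1 \<and> x $ 1 <= a + 8 * real N \<and> (\<exists>y\<in>B. x $ 2 = y $ 2)"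
   by blast
  have "\<exists>y\<in>A. x $ 2 = y $ 2" if xA: "x \<in> A'" for x
  proof -
   obtain y where "y \<in> B" "x $ 2 = y $ 2" using A'(2) xA by blast
   thus ?thesis using B(8)[of y] by auto
  qed
  thus ?thesis using compressed_trans[OF AB A'(1)] A'(2) by blast
 qed
qed

text \<open>Compression along the first axis is followed, after an interchange of the axes, by
  compression along the second. A horizontal compression creates no new second coordinates, so the
  second pass preserves the bound from the first.\<close>

lemma compress_bounded:
 assumes A: "A \<in> sets borel" "A \<subseteq> cball 0 R" and p: "per_le A p" "area A <= pi" and N: "17 <= N"
 obtains A' p' where "compressed N A p A' p'" "A' \<subseteq> cball 0 (16 * real N)"
proof -
 have fin: "finarea A" by (rule finarea_bounded[OF A(2)])
 obtain n where n: "2 * R <= real n" using real_arch_simple by blast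
 have n': "R <= - R + 8 * real N + 3 * real n" using n by simp
 have c1: "\<bar>x $ i\<bar> <= R" if "x \<in> A" for x i using A(2) that component_le_norm_cart[of x i] by auto
 obtain B q where B: "compressed N A p B q" "\<And>x. x \<in> B ==> - R <= x $ 1 \<and> x $ 1 <= - R + 8 * real N \<and> (\<exists>y\<in>A. x $ 2 = y $ 2)"
  using compress_horizontally[OF A(1) fin p N _ n'] c1 by (metis abs_le_iff minus_le_iff)
 have Bf: "B \<in> sets borel" "finarea B" "per_le B q" "area B <= pi" using B(1) p(2) by (auto simp: compressed_def)
 have BC: "compressed N B q (swp ` B) q" by (rule compressed_swp[OF Bf(1-3)])
 have Cf: "swp ` B \<in> sets borel" "finarea (swp ` B)" "per_le (swp ` B) q" "area (swp ` B) <= pi"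
  using BC Bf(4) by (auto simp: compressed_def)
 have C: "- R <= x $ 1 \<and> x $ 1 <= R" if xB: "x \<in> swp ` B" for x
 proof -
  obtain z where z: "z \<in> B" "x = swp z" using xB by auto
  then obtain y where "y \<in> A" "z $ 2 = y $ 2" using B(2) by blast
  thus ?thesis using c1[of y 2] z by auto
 qed
 obtain D s where D: "compressed N (swp ` B) q D s" "\<And>x. x \<in> D ==> - R <= x $ 1 \<and> x $ 1 <= - R + 8 * real N \<and> (\<exists>y\<in>swp ` B. x $ 2 = y $ 2)"
  using compress_horizontally[OF Cf N C n'] by blast
 have Df: "D \<in> sets borel" "finarea D" "per_le D s" using D(1) by (auto simp: compressed_def)
 have sub: "aff (vec2 R R) 1 ` D \<subseteq> cball 0 (16 * real N)"
 proof
  fix z assume "z \<in> aff (vec2 R R) 1 ` D"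
  then obtain x where x: "x \<in> D" "z = vec2 R R + x" by (auto simp: aff_def)
  have "- R <= x $ 2 \<and> x $ 2 <= - R + 8 * real N" using D(2)[OF x(1)] B(2) by auto
  hence "\<bar>z $ 1\<bar> <= 8 * real N" "\<bar>z $ 2\<bar> <= 8 * real N" using D(2)[OF x(1)] x(2) by auto
  thus "z \<in> cball 0 (16 * real N)" using norm_le_l1_cart[of z] by (simp add: sum_2)
 qed
 have "compressed N A p (aff (vec2 R R) 1 ` D) s"
  using compressed_trans[OF compressed_trans[OF compressed_trans[OF B(1) BC] D(1)] compressed_shift[OF Df]] .
 thus thesis using sub that by blast
qed

lemma truncate_to_bounded:
 assumes A[measurable]: "A \<in> sets borel" and fin: "finarea A" and p: "per_le A p" and N: "17 <= N"
 obtains B q R where "compressed N A p B q" "B \<subseteq> cball 0 R"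
proof -
 have "0 < pi / N" using N by simp
 then obtain n where n: "area (A \<inter> {x. real n < rad x}) < pi / N" "2 <= n" by (rule tail_measure_small[OF A fin])
 have "sqrt (pi / N) < sqrt pi / 4"
 proof -
  have "4 < sqrt (real N)" using N by (intro real_less_rsqrt) auto
  thus ?thesis unfolding real_sqrt_divide using N by (intro divide_strict_left_mono) auto
 qed
 hence "sqrt (area (A \<inter> {x. real n < rad x})) < sqrt pi / 4 * 1" using real_sqrt_less_mono[OF n(1)] by linarith
 then obtain s B m where s: "real n <= s" and B_def: "B = A \<inter> {x. rad x <= s}" and m_def: "m = area (A \<inter> {x. s < rad x})"
  and B: "per_le B (p - sqrt (pi * m))" "B \<in> sets borel" "finarea B" "area B = area A - m"
  and mn: "m <= area (A \<inter> {x. real n < rad x})"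
  by (rule isoperimetric_truncation[OF A fin p C1w_rad norm_rad zero_less_one])
 have m: "0 <= m" "m <= pi / N" using n(1) mn by (auto simp: m_def)
 have "\<exists>y. area (B \<inter> ball x 1) <= area (A \<inter> ball y 1)" for x
  using finarea_mono[OF fin, of "A \<inter> ball x 1"] by (intro exI[of _ x] area_mono) (auto simp: B_def)
 hence "compressed N A p B (p - sqrt (pi * m))"
  unfolding compressed_def using B m perimeter_gain[OF m] by auto
 moreover have "B \<subseteq> cball 0 (sqrt (s^2 - 1))"
 proof -
  have "1 <= s" using s n(2) by linarith
  thus ?thesis by (auto simp: B_def rad_le_iff)
 qed
 ultimately show thesis using that by blast
qed

lemma compress:
 assumes A: "A \<in> sets borel" "finarea A" and p: "per_le A p" "area A <= pi" and N: "17 <= N"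
 obtains A' p' where "compressed N A p A' p'" "A' \<subseteq> cball 0 (16 * real N)"
proof -
 obtain B q R where B: "compressed N A p B q" "B \<subseteq> cball 0 R" by (rule truncate_to_bounded[OF A p(1) N])
 obtain A' p' where A': "compressed N B q A' p'" "A' \<subseteq> cball 0 (16 * real N)"
  by (rule compress_bounded[OF _ B(2) _ _ N, of q]) (use B(1) p(2) in \<open>auto simp: compressed_def\<close>)
 thus thesis using compressed_trans[OF B(1) A'(1)] that by blast
qed

text \<open>With q^2 the relative loss of area, the deficit drops by q / 2, while rescaling and the
  loss of asymmetry cost only order q^2. Nonnegativity of \<delta>' together with the bound on
  \<delta> forces q to be at most of order kap, so kap' stays positive.\<close>

lemma compression_inequality:
 fixes \<delta> kap \<delta>' kap' q :: real
 assumes q: "0 <= q" "q <= 1/30" and d: "0 <= \<delta>" "\<delta> <= 21/50 * kap^2" and l: "0 < kap" "kap <= 2"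
  and d': "0 <= \<delta>'" "\<delta>' * (1 - q^2) <= \<delta> - q/2 + q^2"
  and l': "0 <= kap - 2 * q^2 ==> kap - 2 * q^2 <= kap'"
 shows "0 < kap'" "\<delta>' / kap'^2 <= \<delta> / kap^2"
proof -
 define t where "t = q^2"
 have t: "0 <= t" "t <= q / 30" using mult_right_mono[OF q(2), of q] q by (auto simp: t_def power2_eq_square)
 have ll: "kap^2 <= 2 * kap" using mult_right_mono[OF l(2), of kap] l by (simp add: power2_eq_square)
 have t1: "0 < 1 - t" using t q by linarith
 have "0 <= \<delta>' * (1 - t)" using d'(1) t1 by simp
 hence n0: "0 <= \<delta> - q/2 + t" using d'(2) by (simp add: t_def)
 hence "q * (7/15) <= 21/50 * (2 * kap)" using d(2) ll t by argo
 hence tl: "2 * t <= kap / 2" using t by argo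
 hence pos: "0 < kap - 2 * t" using l by simp
 hence lam: "kap - 2 * t <= kap'" using l' by (simp add: t_def)
 thus l0: "0 < kap'" using pos by linarith
 have "\<delta>' * kap^2 <= \<delta> * (kap - 2 * t)^2"
 proof -
  have "(\<delta> - q/2 + t) * kap^2 <= \<delta> * ((1 - t) * (kap - 2 * t)^2)"
  proof -
   have e: "(1 - t) * (kap - 2 * t)^2 = kap^2 - (4 * t * kap + t * kap^2) + 4 * t^2 * (kap + 1 - t)"
    by (simp add: power2_eq_square algebra_simps)
   have "0 <= 4 * t^2 * (kap + 1 - t)" using l t1 by simp
   hence "\<delta> * (kap^2 - (4 * t * kap + t * kap^2)) <= \<delta> * ((1 - t) * (kap - 2 * t)^2)" unfolding e using d by (intro mult_left_mono) auto
   moreover have "\<delta> * (4 * t * kap + t * kap^2) <= (21/50 * kap^2) * (12 * t)"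
   proof (rule mult_mono[OF d(2)])
    have "t * kap <= t * 2" "t * kap^2 <= t * 4" using t l ll by (intro mult_left_mono; simp)+
    thus "4 * t * kap + t * kap^2 <= 12 * t" by simp
   qed (use t l in auto)
   moreover have "(21/50 * kap^2) * (12 * t) <= (q/2 - t) * kap^2"
   proof -
    have "21/50 * (12 * t) <= q/2 - t" using t q by argo
    hence "21/50 * (12 * t) * kap^2 <= (q/2 - t) * kap^2" by (intro mult_right_mono) auto
    thus ?thesis by (simp add: algebra_simps)
   qed
   ultimately show ?thesis by (simp add: algebra_simps)
  qed
  moreover have "\<delta>' * (1 - t) * kap^2 <= (\<delta> - q/2 + t) * kap^2" using d'(2) by (intro mult_right_mono) (auto simp: t_def)
  ultimately have "(1 - t) * (\<delta>' * kap^2) <= (1 - t) * (\<delta> * (kap - 2 * t)^2)" by (simp add: algebra_simps)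
  thus ?thesis using t1 by simp
 qed
 also have "... <= \<delta> * kap'^2" using lam pos d by (intro mult_left_mono power_mono) auto
 finally show "\<delta>' / kap'^2 <= \<delta> / kap^2" using l0 l by (simp add: field_simps)
qed

lemma compress_quotient:
 assumes pl: "planar \<Omega> pi" and p: "per_le \<Omega> p" and l: "0 < fasym \<Omega>"
  and d: "p / (2 * pi) - 1 <= 21/50 * (fasym \<Omega>)^2"
 obtains \<Omega>' p' where "planar \<Omega>' pi" "\<Omega>' \<subseteq> cball 0 (10^10)" "per_le \<Omega>' p'" "0 < fasym \<Omega>'"
  "(p' / (2 * pi) - 1) / (fasym \<Omega>')^2 <= (p / (2 * pi) - 1) / (fasym \<Omega>)^2"
proof -
 interpret planar \<Omega> pi by fact
 define kap where "kap = fasym \<Omega>"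
 have l2: "0 < kap" "kap <= 2" using l asym_le2 by (auto simp: kap_def)
 \<comment> \<open>The factor sqrt (pi / N) becomes sqrt pi / 10^4. With p <= 17 the lost area is
   then at most 17/10000, which gives the bound 1/30 required by
   \<open>compression_inequality\<close>.\<close>
 define N :: nat where "N = 10^8"
 obtain A q where A: "compressed N \<Omega> p A q" "A \<subseteq> cball 0 (16 * real N)"
 proof (rule compress[OF borel fin p, of N])
  show "17 <= N" by (simp add: N_def)
 qed (auto simp: area)
 obtain m where m: "0 <= m" "area A = pi - m" "q <= p - sqrt (pi * m)" "sqrt pi * m <= sqrt (pi / N) * (p - q)"
  using A(1) by (auto simp: compressed_def area)
 have Af: "A \<in> sets borel" "finarea A" "per_le A q" 
  and ov: "\<And>x. \<exists>y. area (A \<inter> ball x 1) <= area (\<Omega> \<inter> ball y 1)" using A(1) by (auto simp: compressed_def)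
 have q0: "0 <= q" by (rule per_le_nonneg[OF Af(3)])
 \<comment> \<open>The asymmetry is at most 2 and 1 + 21/50 * 4 <= 27/10; the number 27/10 * 2 pi is
   just below 17.\<close>
 have p17: "p <= 17"
 proof -
  have "kap^2 <= 2^2" using l2 by (intro power_mono) auto
  hence "p / (2 * pi) <= 27/10" using d by (simp add: kap_def)
  hence "p <= 27/10 * (2 * pi)" by (simp add: pos_divide_le_eq)
  thus ?thesis using pi_approx by simp
 qed
 define t where "t = m / pi"
 have t: "0 <= t" "t <= 1/900"
 proof -
  have "sqrt (pi / N) = sqrt pi / 10^4" 
  proof -
   have "sqrt (10^8 :: real) = 10^4" by (rule real_sqrt_unique) auto
   thus ?thesis by (simp add: N_def real_sqrt_divide)
  qed
  hence "sqrt pi * m <= sqrt pi / 10^4 * (p - q)" using m(4) by (simp only:)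
  hence "sqrt pi * m <= sqrt pi * ((p - q) / 10^4)" by (simp only: times_divide_eq_left times_divide_eq_right)
  hence "m <= (p - q) / 10^4" by (rule mult_left_le_imp_le) simp
  hence "m <= 17/10000" using p17 q0 by simp
  thus "t <= 1/900" using pi_gt3 by (simp add: t_def pos_divide_le_eq)
  show "0 <= t" using m by (simp add: t_def)
 qed
 have mt: "pi - m = pi * (1 - t)" by (simp add: t_def algebra_simps)
 have a0: "0 < pi - m" unfolding mt using t by simp
 define c where "c = 1 / sqrt (1 - t)"
 have c0: "0 < c" using t by (simp add: c_def)
 have c2: "c^2 * (pi - m) = pi" using t by (simp add: c_def power_divide mt)
 have plA: "planar A (pi - m)" by unfold_locales (use Af a0 m in auto)
 interpret A: planar A "pi - m" by (rule plA)
 define \<Omega>' where "\<Omega>' = aff 0 c ` A"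
 have as: "fasym \<Omega>' = fasym A" and pl': "planar \<Omega>' pi"
  using asymmetry_aff[OF plA c0, of 0] by (simp_all add: \<Omega>'_def c2)
 have per': "per_le \<Omega>' (c * q)" unfolding \<Omega>'_def by (rule per_le_aff[OF Af(1) c0 Af(3)])
 interpret B: planar \<Omega>' pi by (rule pl')
 have iso': "2 * pi <= c * q" using isoperimetric[OF B.borel B.fin per'] by (simp add: B.area)
 have iso0: "2 * pi <= p" using isoperimetric[OF borel fin p] by (simp add: area)
 have c1: "c * (1 - t) <= 1"
 proof -
  have "c * (1 - t) = sqrt (1 - t)" using t by (simp add: c_def real_div_sqrt)
  thus ?thesis using t by simp
 qed
 \<comment> \<open>The comparison disk of \<open>A\<close> has radius at most 1, so it lies in a
   unit disk, whose overlap with \<open>A\<close> is at most some overlap of a unit disk with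
   \<Omega>.\<close>
 have lam: "(pi * kap - 2 * m) / (pi - m) <= fasym A"
 proof -
  have "overlap A A.r x <= pi * (1 - kap / 2)" for x
  proof -
   obtain y where y: "area (A \<inter> ball x 1) <= overlap \<Omega> r y" using ov by (auto simp: overlap_def)
   have "A.r <= 1" using m by simp
   hence "A \<inter> ball x A.r \<subseteq> A \<inter> ball x 1" using subset_ball by blast
   hence "overlap A A.r x <= area (A \<inter> ball x 1)"
    unfolding overlap_def using finarea_mono[OF Af(2), of "A \<inter> ball x 1"] Af(1) by (intro area_mono) auto
   also note y
   also have "overlap \<Omega> r y <= pi * (1 - kap / 2)" unfolding kap_def by (rule overlap_le)
   finally show ?thesis .
  qed
  hence "2 * ((pi - m) - pi * (1 - kap / 2)) / (pi - m) <= fasym A" by (rule A.asym_ge)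
  moreover have "2 * ((pi - m) - pi * (1 - kap / 2)) = pi * kap - 2 * m" by (simp add: algebra_simps)
  ultimately show ?thesis by (simp only:)
 qed
 have qs: "sqrt (pi * m) / (2 * pi) = sqrt t / 2"
 proof -
  have "sqrt (pi * m) = sqrt (pi^2 * t)" by (simp add: t_def power2_eq_square)
  also have "... = pi * sqrt t" by (simp add: real_sqrt_mult)
  finally show ?thesis by simp
 qed
 have small: "0 <= sqrt t" "sqrt t <= 1/30"
  using t(1) by simp (rule real_le_lsqrt; use t in \<open>simp add: power2_eq_square\<close>)
 have nonneg: "0 <= p / (2 * pi) - 1" "0 <= c * q / (2 * pi) - 1" using iso0 iso' by (auto simp: pos_le_divide_eq)
 have main: "(c * q / (2 * pi) - 1) * (1 - (sqrt t)^2) <= p / (2 * pi) - 1 - sqrt t / 2 + (sqrt t)^2"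
 proof -
  have "q * (c * (1 - t)) <= q * 1" using c1 q0 by (intro mult_left_mono)
  hence "c * q * (1 - t) <= p - sqrt (pi * m)" using m(3) by (simp add: algebra_simps)
  hence "c * q * (1 - t) / (2 * pi) <= (p - sqrt (pi * m)) / (2 * pi)" by (intro divide_right_mono) auto
  also have "... = p / (2 * pi) - sqrt t / 2" by (simp add: diff_divide_distrib qs)
  finally show ?thesis using t by (simp add: algebra_simps)
 qed
 have l': "kap - 2 * (sqrt t)^2 <= fasym \<Omega>'" if "0 <= kap - 2 * (sqrt t)^2"
 proof -
  have "0 <= kap - 2 * t" using that t by simp
  moreover have "pi * kap - 2 * m = pi * (kap - 2 * t)" by (simp add: t_def algebra_simps)
  ultimately have "kap - 2 * t <= (pi * kap - 2 * m) / (pi - m)"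
   using a0 m(1) mult_right_mono[of "pi - m" pi "kap - 2 * t"] by (simp add: pos_le_divide_eq mult.commute)
  thus ?thesis using lam t as by simp
 qed
 note res = compression_inequality[OF small nonneg(1) d[folded kap_def] l2 nonneg(2) main l']
 have "\<Omega>' \<subseteq> cball 0 (10^10)"
 proof
  fix z assume "z \<in> \<Omega>'"
  then obtain x where x: "x \<in> A" "z = c *\<^sub>R x" by (auto simp: \<Omega>'_def aff_def)
  have "c <= 2" 
  proof -
   have "1/2 <= sqrt (1 - t)" using t by (intro real_le_rsqrt) (auto simp: power2_eq_square)
   thus ?thesis using t by (simp add: c_def pos_divide_le_eq)
  qed
  hence "c * norm x <= 2 * (16 * real N)" using A(2) x c0 by (intro mult_mono) auto
  thus "z \<in> cball 0 (10^10)" using x c0 by (simp add: N_def)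
 qed
 thus thesis using that[OF pl' _ per' res(1)] res(2) by (simp add: kap_def)
qed

section \<open>Compactness and lower semicontinuity\<close>

text \<open>At a fixed scale the constant depends on the bounding disk and not on the set. This
  equicontinuity lets convergence spread from a dense set of points to the plane.\<close>

lemma mu_lipschitz:
 assumes A: "A \<in> sets borel" "A \<subseteq> cball 0 R" and e: "0 < eps"
 shows "\<bar>mu eps A x - mu eps A y\<bar> <= (4 / (bumpZ * eps^3) * area (cball (0::real^2) R)) * norm (x - y)"
proof -
 define L where "L = 4 / (bumpZ * eps^3) * area (cball (0::real^2) R)"
 have iA: "integ (ind A :: real^2 => real)" by (rule integ_bounded[OF A])
 have g: "norm (gmu eps A x) <= L" for x
 proof -
  have "norm (gmu eps A x) <= (LINT y|lborel. 4 / (bumpZ * eps^3) * ind (cball (0::real^2) R) y)"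
   unfolding cgrad_def
  proof (rule Bochner_Integration.integral_norm_bound_integral)
   show "integ (\<lambda>y. 4 / (bumpZ * eps^3) * ind (cball (0::real^2) R) y)"
    using emeasure_lborel_cball_finite[of 0 R] by (intro integrable_mult_right integrable_real_indicator) auto
   show "norm (ind A y *\<^sub>R mg eps (x - y)) <= 4 / (bumpZ * eps^3) * ind (cball 0 R) y" for y
    using mg_bound[OF e, of "x - y"] A(2) bumpZ_pos e by (auto simp: indicator_def)
  qed (rule conv_integrable(2)[OF iA e])
  thus ?thesis by (simp add: L_def)
 qed
 have L0: "0 <= L" using g[of 0] norm_ge_zero order_trans by blast
 have "norm (mu eps A x - mu eps A y) <= L * norm (x - y)"
 proof (rule differentiable_bound[of UNIV _ "\<lambda>x. blinfun_apply (blinfun_inner_right (gmu eps A x))"])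
  show "onorm (blinfun_apply (blinfun_inner_right (gmu eps A x))) <= L" for x
  proof (rule onorm_bound[OF L0])
   fix h
   have "norm (gmu eps A x \<bullet> h) <= norm (gmu eps A x) * norm h" by (simp add: Cauchy_Schwarz_ineq2)
   also have "... <= L * norm h" using g by (intro mult_right_mono) auto
   finally show "norm (blinfun_apply (blinfun_inner_right (gmu eps A x)) h) <= L * norm h" by simp
  qed
 qed (use C1w_deriv[OF C1w_conv[OF iA e]] in auto)
 thus ?thesis by (simp add: L_def)
qed

lemma measure_sym_diff_integral:
 assumes [measurable]: "A \<in> sets borel" "B \<in> sets borel" and "A \<subseteq> cball 0 R" "B \<subseteq> cball (0::real^2) R"
 shows "area (sym_diff A B) = (LINT x|lborel. \<bar>ind A x - ind B x\<bar>)"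
proof -
 have "(LINT x|lborel. \<bar>ind A x - ind B x :: real\<bar>) = (LINT x|lborel. ind (sym_diff A B) x :: real)"
  by (intro int_cong) (auto simp: indicator_def)
 thus ?thesis by simp
qed

text \<open>A diagonal choice over all scales 1 / (j + 1) and a countable dense set of points,
  followed by equicontinuity.\<close>

lemma mu_pointwise_subsequence:
 assumes E: "\<And>n. E n \<in> sets borel" "\<And>n. E n \<subseteq> cball (0::real^2) R"
 obtains k where "strict_mono (k::nat=>nat)" "\<And>j x. convergent (\<lambda>n. mu (1 / real (Suc j)) (E (k n)) x)"
proof -
 obtain D :: "(real^2) set" where D: "countable D" "\<And>X. open X ==> X \<noteq> {} ==> \<exists>d\<in>D. d \<in> X"
  using countable_dense_exists by blast
 define f where "f n p = mu (1 / real (Suc (fst p))) (E n) (snd p)" for n and p :: "nat \<times> (real^2)"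
 have iE: "integ (ind (E n) :: real^2 => real)" for n by (rule integ_bounded[OF E])
 obtain k where k: "strict_mono (k::nat=>nat)" "\<And>p. p \<in> UNIV \<times> D ==> \<exists>l. (\<lambda>n. f (k n) p) \<longlonglongrightarrow> l"
 proof (rule function_convergent_subsequence[of "UNIV \<times> D" f 1])
  show "countable (UNIV \<times> D :: (nat \<times> (real^2)) set)" using D(1) by simp
  show "norm (f n p) <= 1" for n p using mu_range[OF iE[of n], of "1 / real (Suc (fst p))" "snd p"] by (simp add: f_def)
 qed blast
 have "convergent (\<lambda>n. mu (1 / real (Suc j)) (E (k n)) x)" for j x
 proof -
  define eps where "eps = 1 / real (Suc j)"
  have e: "0 < eps" by (simp add: eps_def)
  define L where "L = 4 / (bumpZ * eps^3) * area (cball (0::real^2) R) + 1"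
  have L: "0 < L" using bumpZ_pos e by (auto simp: L_def intro!: add_nonneg_pos)
  have lip: "\<bar>mu eps (E n) x - mu eps (E n) y\<bar> <= L * norm (x - y)" for n y
   by (rule order_trans[OF mu_lipschitz[OF E e]]) (simp only: L_def, rule mult_right_mono, auto)
  have "Cauchy (\<lambda>n. mu eps (E (k n)) x)"
  proof (rule metric_CauchyI)
   fix \<eta> :: real assume \<eta>: "0 < \<eta>"
   have "0 < \<eta> / (4 * L)" using \<eta> L by simp
   then obtain d where d: "d \<in> D" "d \<in> ball x (\<eta> / (4 * L))"
    using D(2)[OF open_ball, of x "\<eta> / (4 * L)"] by (metis centre_in_ball empty_iff)
   have "L * norm (x - d) <= L * (\<eta> / (4 * L))" using d(2) L by (intro mult_left_mono) (auto simp: dist_norm)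
   hence Ld: "L * norm (x - d) <= \<eta> / 4" using L by simp
   obtain l where "(\<lambda>n. f (k n) (j, d)) \<longlonglongrightarrow> l" using k(2)[of "(j, d)"] d(1) by auto
   hence "Cauchy (\<lambda>n. f (k n) (j, d))" by (rule LIMSEQ_imp_Cauchy)
   then obtain M where M: "\<And>n m. n \<ge> M ==> m \<ge> M ==> dist (f (k n) (j, d)) (f (k m) (j, d)) < \<eta> / 4"
    using \<eta> unfolding Cauchy_def by (metis zero_less_divide_iff zero_less_numeral)
   show "\<exists>M. \<forall>m\<ge>M. \<forall>n\<ge>M. dist (mu eps (E (k m)) x) (mu eps (E (k n)) x) < \<eta>"
   proof (intro exI[of _ M] allI impI)
    fix m n assume "m \<ge> M" "n \<ge> M"
    hence "\<bar>mu eps (E (k m)) d - mu eps (E (k n)) d\<bar> < \<eta> / 4" using M[of m n] by (simp add: f_def eps_def dist_real_def)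
    thus "dist (mu eps (E (k m)) x) (mu eps (E (k n)) x) < \<eta>"
     using lip[of "k m" d] lip[of "k n" d] Ld \<eta> unfolding dist_real_def by linarith
   qed
  qed
  thus ?thesis by (simp add: Cauchy_convergent_iff eps_def)
 qed
 thus thesis using k(1) that by blast
qed

text \<open>By \<open>mu_rate\<close> there is one scale at which every set is close to its
  mollification. At that scale pointwise convergence is L1 convergence, by domination.\<close>

lemma L1_subsequence:
 assumes E: "\<And>n. E n \<in> sets borel" "\<And>n. E n \<subseteq> cball (0::real^2) R" "\<And>n. per_le (E n) C"
 obtains k where "strict_mono (k::nat=>nat)"
  "\<And>e. 0 < e ==> \<exists>M. \<forall>n\<ge>M. \<forall>m\<ge>M. area (sym_diff (E (k n)) (E (k m))) < e"
proof -
 obtain k where k: "strict_mono (k::nat=>nat)" "\<And>j x. convergent (\<lambda>n. mu (1 / real (Suc j)) (E (k n)) x)"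
  by (rule mu_pointwise_subsequence[of E R, OF E(1,2)]) blast
 have iE: "integ (ind (E n) :: real^2 => real)" for n by (rule integ_bounded[OF E(1,2)])
 have "\<exists>M. \<forall>n\<ge>M. \<forall>m\<ge>M. area (sym_diff (E (k n)) (E (k m))) < e" if e: "0 < e" for e
 proof -
  have C0: "0 <= C" using per_le_nonneg[OF E(3)] .
  obtain j :: nat where j: "8 * (C + 1) / e < real j" using reals_Archimedean2 by blast
  define eps where "eps = 1 / real (Suc j)"
  have ep: "0 < eps" "eps <= 1" "eps * C <= e / 8"
  proof -
   have "8 * (C + 1) < e * real (Suc j)" using j e C0 by (simp add: divide_less_eq algebra_simps)
   thus "eps * C <= e / 8" by (simp add: eps_def divide_le_eq)
  qed (auto simp: eps_def)
  define u where "u n = mu eps (E (k n))" for n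
  define g where "g x = lim (\<lambda>n. u n x)" for x
  have ug: "(\<lambda>n. u n x) \<longlonglongrightarrow> g x" for x
   using k(2)[of j x] unfolding g_def u_def eps_def by (rule convergent_LIMSEQ_iff[THEN iffD1])
  have ub[measurable]: "u n \<in> borel_measurable borel" for n unfolding u_def by (rule mu_borel[OF iE ep(1)])
  have gb[measurable]: "g \<in> borel_measurable borel" by (rule borel_measurable_LIMSEQ_real[OF ug ub])
  have u1: "\<bar>u n x\<bar> <= ind (cball 0 (R + 1)) x" for n x
  proof (cases "x \<in> cball 0 (R + 1)")
   case True thus ?thesis using mu_range[OF iE ep(1)] by (simp add: u_def)
  next
   case False
   hence "u n x = 0" unfolding u_def using mu_zero_outside(1)[OF ep(1) E(2), of x] ep(2) by simp
   thus ?thesis by simp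
  qed
  have g1: "\<bar>g x\<bar> <= ind (cball 0 (R + 1)) x" for x
   by (rule LIMSEQ_le_const2[OF tendsto_rabs[OF ug]]) (use u1 in auto)
  have iw: "integ (ind (cball 0 (R + 1)) :: real^2 => real)"
   using emeasure_lborel_cball_finite[of 0 "R + 1"] by (intro integrable_real_indicator) auto
  have iu: "integ (u n)" for n by (rule int_bound[OF iw]) (use u1 in \<open>auto intro!: AE_I2\<close>)
  have ig: "integ g" by (rule int_bound[OF iw]) (use g1 in \<open>auto intro!: AE_I2\<close>)
  have "(\<lambda>n. LINT x|lborel. \<bar>u n x - g x\<bar>) \<longlonglongrightarrow> (LINT x|lborel. \<bar>g x - g x\<bar>)"
  proof (rule integral_dominated_convergence[where w="\<lambda>x. 2 * ind (cball 0 (R + 1)) x"])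
   show "AE x in lborel. (\<lambda>n. \<bar>u n x - g x\<bar>) \<longlonglongrightarrow> \<bar>g x - g x\<bar>" by (intro AE_I2 tendsto_intros ug)
   show "AE x in lborel. norm \<bar>u n x - g x\<bar> <= 2 * ind (cball 0 (R + 1)) x" for n
   proof (rule AE_I2)
    fix x show "norm \<bar>u n x - g x\<bar> <= 2 * ind (cball 0 (R + 1)) x" using u1[of n x] g1[of x] by simp
   qed
  qed (use iw in auto)
  hence "eventually (\<lambda>n. (LINT x|lborel. \<bar>u n x - g x\<bar>) < e / 8) sequentially" using e by (intro order_tendstoD) auto
  then obtain M where M: "\<And>n. n \<ge> M ==> (LINT x|lborel. \<bar>u n x - g x\<bar>) < e / 8" by (auto simp: eventually_sequentially)
  have r: "(LINT x|lborel. \<bar>u n x - ind (E (k n)) x\<bar>) <= e / 8" for n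
   using mu_rate[OF E(1,2,3) ep(1), of "k n"] ep(3) by (simp add: u_def)
  show ?thesis
  proof (intro exI[of _ M] allI impI)
   fix n m assume nm: "n \<ge> M" "m \<ge> M"
   have "area (sym_diff (E (k n)) (E (k m))) = (LINT x|lborel. \<bar>ind (E (k n)) x - ind (E (k m)) x\<bar>)"
    by (rule measure_sym_diff_integral[OF E(1) E(1) E(2) E(2)])
   also have "... <= (LINT x|lborel. (\<bar>u n x - ind (E (k n)) x\<bar> + \<bar>u m x - ind (E (k m)) x\<bar>) + (\<bar>u n x - g x\<bar> + \<bar>u m x - g x\<bar>))"
    using iE iu ig by (intro integral_mono Bochner_Integration.integrable_add integrable_abs Bochner_Integration.integrable_diff) auto
   also have "... = ((LINT x|lborel. \<bar>u n x - ind (E (k n)) x\<bar>) + (LINT x|lborel. \<bar>u m x - ind (E (k m)) x\<bar>)) + ((LINT x|lborel. \<bar>u n x - g x\<bar>) + (LINT x|lborel. \<bar>u m x - g x\<bar>))"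
    using iE iu ig by (simp add: Bochner_Integration.integral_add)
   also have "... < e" using r[of n] r[of m] M[OF nm(1)] M[OF nm(2)] e by linarith
   finally show "area (sym_diff (E (k n)) (E (k m))) < e" .
  qed
 qed
 thus thesis using k(1) that by blast
qed

text \<open>The limit is built as the lower limit of the sets, so no limit function has to be
  recognised as an indicator. A point outside all differences from index n on never changes its
  membership, and these differences have summable area.\<close>

lemma fast_Cauchy_limit_set:
 assumes E: "\<And>n. E n \<in> sets lborel" and fast: "\<And>n. emeasure lborel (sym_diff (E n) (E (Suc n))) <= ennreal ((1/2)^n)"
 defines "F \<equiv> (\<Union>i. \<Inter>j\<in>{i..}. E j)"
 shows "F \<in> sets lborel" "emeasure lborel (sym_diff (E n) F) <= ennreal (2 * (1/2)^n)"
proof -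
 show Fm: "F \<in> sets lborel" unfolding F_def using E by (intro sets.countable_UN sets.countable_INT') auto
 define S where "S i = sym_diff (E (n + i)) (E (Suc (n + i)))" for i
 have Sm: "S i \<in> sets lborel" for i unfolding S_def using E by auto
 have step: "x \<in> E (n + i) \<longleftrightarrow> x \<in> E n" if "x \<notin> (\<Union>i. S i)" for x i
  using that by (induction i) (auto simp: S_def)
 have "sym_diff (E n) F \<subseteq> (\<Union>i. S i)"
 proof
  fix x assume x: "x \<in> sym_diff (E n) F"
  show "x \<in> (\<Union>i. S i)"
  proof (rule ccontr)
   assume n: "x \<notin> (\<Union>i. S i)"
   have "x \<in> F \<longleftrightarrow> x \<in> E n"
   proof
    assume "x \<in> F"
    then obtain i where "\<forall>j\<ge>i. x \<in> E j" by (auto simp: F_def)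
    thus "x \<in> E n" using step[OF n, of i] by auto
   next
    assume "x \<in> E n"
    hence "x \<in> E j" if "n <= j" for j using step[OF n, of "j - n"] that by simp
    thus "x \<in> F" by (auto simp: F_def)
   qed
   thus False using x by auto
  qed
 qed
 hence "emeasure lborel (sym_diff (E n) F) <= emeasure lborel (\<Union>i. S i)" using Sm by (intro emeasure_mono) auto
 also have "... <= (\<Sum>i. emeasure lborel (S i))" using Sm by (intro emeasure_subadditive_countably) auto
 also have "... <= (\<Sum>i. ennreal ((1/2)^(n + i)))" unfolding S_def using fast by (intro suminf_le) auto
 also have "... = ennreal (\<Sum>i. (1/2)^(n + i))"
  by (intro suminf_ennreal2) (auto simp: power_add intro!: summable_mult summable_geometric)
 also have "(\<Sum>i. (1/2::real)^(n + i)) = 2 * (1/2)^n"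
  by (simp add: power_add suminf_mult suminf_geometric summable_geometric)
 finally show "emeasure lborel (sym_diff (E n) F) <= ennreal (2 * (1/2)^n)" .
qed

theorem perimeter_compactness:
 assumes E: "\<And>n. E n \<in> sets borel" "\<And>n. E n \<subseteq> cball (0::real^2) R" "\<And>n. per_le (E n) C"
 obtains k F where "strict_mono (k::nat=>nat)" "F \<in> sets borel" "F \<subseteq> cball 0 R" "(\<lambda>n. area (sym_diff (E (k n)) F)) \<longlonglongrightarrow> 0"
proof -
 obtain k where k: "strict_mono (k::nat=>nat)"
  "\<And>e. 0 < e ==> \<exists>M. \<forall>n\<ge>M. \<forall>m\<ge>M. area (sym_diff (E (k n)) (E (k m))) < e"
  by (rule L1_subsequence[of E R C, OF E]) blast
 obtain M where M: "\<And>i n m. M i <= n ==> M i <= m ==> area (sym_diff (E (k n)) (E (k m))) < (1/2)^i"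
  using k(2)[of "(1/2)^_"] by (metis (no_types) half_gt_zero_iff zero_less_one zero_less_power)
 \<comment> \<open>Adding the partial sums of \<open>M\<close> makes \<open>q\<close> strictly
   increasing and at least \<open>M i\<close> at i.\<close>
 define q where "q i = i + (\<Sum>j\<le>i. M j)" for i
 have q: "strict_mono q" by (rule strict_monoI_Suc) (simp add: q_def)
 have qM: "M i <= q i" for i unfolding q_def using member_le_sum[of i "{..i}" M] by simp
 define G where "G i = E (k (q i))" for i
 have Gm: "G i \<in> sets lborel" "G i \<subseteq> cball 0 R" for i using E by (auto simp: G_def)
 have fin: "finarea (sym_diff A B)" if "A \<subseteq> cball 0 R" "B \<subseteq> cball 0 R" for A B :: "(real^2) set"
  by (rule finarea_bounded[where R=R]) (use that in auto)
 have fast: "emeasure lborel (sym_diff (G n) (G (Suc n))) <= ennreal ((1/2)^n)" for n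
 proof -
  have "area (sym_diff (G n) (G (Suc n))) < (1/2)^n"
   unfolding G_def using qM[of n] strict_mono_less_eq[OF q, of n "Suc n"] by (intro M) auto
  moreover have "emeasure lborel (sym_diff (G n) (G (Suc n))) = ennreal (area (sym_diff (G n) (G (Suc n))))"
   using fin[OF Gm(2)[of n] Gm(2)[of "Suc n"]] by (intro emeasure_eq_ennreal_measure) auto
  ultimately show ?thesis by (simp add: ennreal_leI)
 qed
 define F where "F = (\<Union>i. \<Inter>j\<in>{i..}. G j)"
 note lim = fast_Cauchy_limit_set[OF Gm(1) fast, folded F_def]
 have FR: "F \<subseteq> cball 0 R" using Gm(2) by (fastforce simp: F_def)
 have "(\<lambda>n. area (sym_diff (G n) F)) \<longlonglongrightarrow> 0"
 proof (rule tendsto_sandwich[of "\<lambda>_. 0"])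
  show "\<forall>\<^sub>F n in sequentially. area (sym_diff (G n) F) <= 2 * (1/2)^n"
   using lim(2) by (intro always_eventually allI) (simp add: measure_def enn2real_leI)
  show "(\<lambda>n. 2 * (1/2::real)^n) \<longlonglongrightarrow> 0" by (intro tendsto_mult_right_zero LIMSEQ_realpow_zero) auto
 qed auto
 thus thesis using that[OF strict_mono_o[OF k(1) q], of F] lim(1) FR by (simp add: G_def o_def)
qed

text \<open>The flux of one test field is L1 continuous in the set, since its divergence is bounded.
  The perimeter is a supremum of such functionals.\<close>

lemma perimeter_lsc:
 assumes E: "\<And>n. E n \<in> sets borel" "\<And>n. E n \<subseteq> cball (0::real^2) R" "\<And>n. per_le (E n) (p n)"
  and F: "F \<in> sets borel" "F \<subseteq> cball 0 R" and lim: "(\<lambda>n. area (sym_diff (E n) F)) \<longlonglongrightarrow> 0" and p: "p \<longlonglongrightarrow> P"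
 shows "per_le F P"
 unfolding per_le_def
proof
 fix phi assume phi: "phi \<in> test_fields"
 obtain B where B: "\<And>x. \<bar>divergence phi x\<bar> <= B" using divergence_bounded[OF phi] by blast
 note [measurable] = E(1) F(1) divergence_borel[OF phi]
 have si: "integ (\<lambda>x. ind A x *\<^sub>R divergence phi x)" if "A \<in> sets borel" for A
  using divergence_set_integrable[OF phi, of A] that by (simp add: set_integrable_def)
 have iE: "integ (ind A :: real^2 => real)" if "A \<in> sets borel" "A \<subseteq> cball 0 R" for A
  by (rule integ_bounded[OF that])
 have "(LINT x:F|lborel. divergence phi x) <= p n + B * area (sym_diff (E n) F)" for n
 proof -
  have "(LINT x:F|lborel. divergence phi x) - (LINT x:E n|lborel. divergence phi x) = (LINT x|lborel. ind F x *\<^sub>R divergence phi x - ind (E n) x *\<^sub>R divergence phi x)"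
   unfolding set_lebesgue_integral_def by (rule Bochner_Integration.integral_diff[symmetric]; rule si; simp)
  also have "... <= (LINT x|lborel. B * \<bar>ind (E n) x - ind F x\<bar>)"
  proof (rule integral_mono)
   show "integ (\<lambda>x. ind F x *\<^sub>R divergence phi x - ind (E n) x *\<^sub>R divergence phi x)" by (intro Bochner_Integration.integrable_diff si) auto
   show "integ (\<lambda>x. B * \<bar>ind (E n) x - ind F x\<bar>)"
    using iE[OF E(1,2)] iE[OF F] by (intro integrable_mult_right integrable_abs Bochner_Integration.integrable_diff) auto
   show "ind F x *\<^sub>R divergence phi x - ind (E n) x *\<^sub>R divergence phi x <= B * \<bar>ind (E n) x - ind F x\<bar>" for x
    using B[of x] by (auto simp: indicator_def abs_le_iff)
  qed
  also have "... = B * area (sym_diff (E n) F)" using measure_sym_diff_integral[OF E(1) F(1) E(2) F(2)] by simp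
  finally show ?thesis using per_leD[OF E(3) phi, of n] by linarith
 qed
 moreover have "(\<lambda>n. p n + B * area (sym_diff (E n) F)) \<longlonglongrightarrow> P + B * 0" by (intro tendsto_intros p lim)
 ultimately show "(LINT x:F|lborel. divergence phi x) <= P" using LIMSEQ_le_const[of _ P] by (metis (no_types, lifting) add.right_neutral mult_zero_right)
qed

section \<open>Existence of a minimiser\<close>

lemma sym_diff_finite:
 assumes "A \<in> sets M" "B \<in> sets M" "emeasure M A < \<infinity>" "emeasure M B < \<infinity>" shows "emeasure M (sym_diff A B) < \<infinity>"
proof -
 have "emeasure M (sym_diff A B) <= emeasure M (A \<union> B)" using assms by (intro emeasure_mono) auto
 also have "... <= emeasure M A + emeasure M B" using assms by (intro emeasure_subadditive)
 also have "... < \<infinity>" using assms by simp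
 finally show ?thesis .
qed

text \<open>For every fixed centre the overlap changes by at most the area of the symmetric
  difference; the bound passes to the infimum over centres.\<close>

lemma asymmetry_L1:
 assumes "planar A a" "planar B a"
 shows "fasym A <= fasym B + 2 / a * area (sym_diff A B)"
proof -
 interpret A: planar A a by fact
 interpret B: planar B a by fact
 have sd: "finarea (sym_diff A B)"
  by (rule sym_diff_finite) (use A.borel B.borel A.fin B.fin in auto)
 have "fasym A - 2 / a * area (sym_diff A B) <= fasym B"
  unfolding B.asym
 proof (rule cINF_greatest)
  fix x
  have "overlap B A.r x <= overlap A A.r x + area (sym_diff A B)"
   unfolding overlap_def using sd finarea_mono[OF A.fin, of "A \<inter> ball x A.r"]
   by (intro measure_Un_le) auto
  hence "2 * (a - overlap A A.r x) / a <= 2 * (a - overlap B A.r x + area (sym_diff A B)) / a"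
   using A.pos by (intro divide_right_mono) auto
  also have "... = 2 * (a - overlap B A.r x) / a + 2 / a * area (sym_diff A B)"
   using A.pos by (simp add: field_simps)
  finally show "fasym A - 2 / a * area (sym_diff A B) <= 2 * (a - overlap B A.r x) / a"
   using A.asym_le[of x] by linarith
 qed simp
 thus ?thesis by linarith
qed

lemma asymmetry_continuous:
 assumes E: "\<And>n. planar (E n) a" and F: "planar F a" and lim: "(\<lambda>n. area (sym_diff (E n) F)) \<longlonglongrightarrow> 0"
 shows "(\<lambda>n. fasym (E n)) \<longlonglongrightarrow> fasym F"
proof (rule LIM_zero_cancel, rule Lim_null_comparison)
 show "(\<lambda>n. 2 / a * area (sym_diff (E n) F)) \<longlonglongrightarrow> 0" using tendsto_mult_right_zero[OF lim] by blast
 show "\<forall>\<^sub>F n in sequentially. norm (fasym (E n) - fasym F) <= 2 / a * area (sym_diff (E n) F)"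
  using asymmetry_L1[OF E F] asymmetry_L1[OF F E] by (intro always_eventually allI) (simp add: abs_le_iff Un_commute diff_le_eq add.commute)
qed

lemma area_limit:
 assumes E: "\<And>n. planar (E n) a" and F: "F \<in> sets borel" "finarea F" and lim: "(\<lambda>n. area (sym_diff (E n) F)) \<longlonglongrightarrow> 0"
 shows "planar F a"
proof -
 have "\<bar>a - area F\<bar> <= area (sym_diff (E n) F)" for n
 proof -
  interpret E: planar "E n" a by (rule E)
  have sd: "finarea (sym_diff (E n) F)"
   by (rule sym_diff_finite) (use E.borel E.fin F in auto)
  have "area (E n) <= area F + area (sym_diff (E n) F)" "area F <= area (E n) + area (sym_diff (E n) F)"
   using sd E.fin F by (intro measure_Un_le; auto)+
  thus ?thesis by (simp add: E.area)
 qed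
 hence "\<bar>a - area F\<bar> <= 0" by (intro LIMSEQ_le_const[OF lim]) auto
 moreover have "0 < a" using planar.pos[OF E] .
 ultimately show ?thesis using F by unfold_locales auto
qed

lemma planar_quotient_le:
 assumes "planar \<Omega> pi" "per_le \<Omega> p" "0 < fasym \<Omega>"
 shows "isoperimetric_quotient \<Omega> <= ereal ((p / (2 * pi) - 1) / (fasym \<Omega>)^2)"
proof -
 interpret planar \<Omega> pi by fact
 obtain q where q: "perimeter \<Omega> = ereal q" 
  using assms(2) perimeter_nonneg[of \<Omega>] unfolding perimeter_le_iff[symmetric] by (cases "perimeter \<Omega>") auto
 have "q <= p" using assms(2) q by (simp flip: perimeter_le_iff)
 hence "(q / (2 * pi) - 1) / (fasym \<Omega>)^2 <= (p / (2 * pi) - 1) / (fasym \<Omega>)^2"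
  by (intro divide_right_mono diff_right_mono) auto
 thus ?thesis using quotient_real[OF q] assms(3) by simp
qed

lemma quotient_nonneg: assumes "admissible \<Omega>" shows "0 <= isoperimetric_quotient \<Omega>"
proof -
 interpret planar \<Omega> "area \<Omega>" by (rule admissible_planar[OF assms])
 have l: "fasym \<Omega> \<noteq> 0" using assms asymmetry_zero_is_ball[OF admissible_planar[OF assms]] by (auto simp: admissible_def)
 show ?thesis
 proof (cases "perimeter \<Omega>")
  case (real p)
  have "0 < sqrt (pi * area \<Omega>)" using pos by simp
  hence "0 <= p / (2 * sqrt (pi * area \<Omega>)) - 1" using iso[OF real] by (simp add: pos_le_divide_eq)
  thus ?thesis unfolding quotient_real[OF real l] by simp
 next
  case PInf thus ?thesis using quotient_infinite[OF _ l] by simp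
 next
  case MInf thus ?thesis using perimeter_nonneg[of \<Omega>] by simp
 qed
qed

lemma sqrt2_bounds: "sqrt 2 - 1 < 83 / 200"
proof -
 have "sqrt 2 < 283 / 200" by (rule real_less_lsqrt) (auto simp: power2_eq_square)
 thus ?thesis by simp
qed

text \<open>The set is scaled to area pi and compressed. An asymmetry below the threshold is then
  impossible: by \<open>perimeter_lower_local\<close> the quotient would be at least 83/200, which
  exceeds sqrt 2 - 1.\<close>

lemma good_competitor:
 assumes ad: "admissible \<Omega>" and v: "isoperimetric_quotient \<Omega> < ereal v" "v <= sqrt 2 - 1"
 obtains \<Omega>' p where "planar \<Omega>' pi" "\<Omega>' \<subseteq> cball 0 (10^10)" "per_le \<Omega>' p" "p <= 17" "(1 / 100000000)^4 < fasym \<Omega>'"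
  "(p / (2 * pi) - 1) / (fasym \<Omega>')^2 < v"
proof -
 define a where "a = area \<Omega>"
 have pl: "planar \<Omega> a" unfolding a_def by (rule admissible_planar[OF ad])
 then interpret P: planar \<Omega> a .
 have l: "fasym \<Omega> \<noteq> 0" using ad asymmetry_zero_is_ball[OF pl] by (auto simp: admissible_def)
 define c where "c = sqrt (pi / a)"
 have c: "0 < c" "c^2 * a = pi" using P.pos by (auto simp: c_def)
 define A where "A = aff 0 c ` \<Omega>"
 have plA: "planar A pi" using asymmetry_aff(2)[OF pl c(1), of 0] by (simp add: A_def c(2))
 then interpret A: planar A pi .
 have lA: "fasym A \<noteq> 0" using asymmetry_aff(1)[OF pl c(1), of 0] l by (simp add: A_def)
 hence lA0: "0 < fasym A" using A.asym_nonneg by linarith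
 have qA: "isoperimetric_quotient A < ereal v" using quotient_aff[OF pl c(1) l, of 0] v by (simp add: A_def)
 obtain p where p: "perimeter A = ereal p"
  using A.quotient_infinite[OF _ lA] qA perimeter_nonneg[of A] by (cases "perimeter A") auto
 have pA: "per_le A p" using p by (simp flip: perimeter_le_iff)
 have q: "(p / (2 * pi) - 1) / (fasym A)^2 < v" using A.quotient_real[OF p lA] qA by simp
 hence "p / (2 * pi) - 1 < v * (fasym A)^2" using lA by (simp add: pos_divide_less_eq)
 also have "... <= 21/50 * (fasym A)^2" using v(2) sqrt2_bounds by (intro mult_right_mono) auto
 finally have d: "p / (2 * pi) - 1 <= 21/50 * (fasym A)^2" by simp
 obtain B s where B: "planar B pi" "B \<subseteq> cball 0 (10^10)" "per_le B s" "0 < fasym B"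
  "(s / (2 * pi) - 1) / (fasym B)^2 <= (p / (2 * pi) - 1) / (fasym A)^2"
  by (rule compress_quotient[OF plA pA lA0 d])
 interpret B: planar B pi by (rule B)
 have qB: "(s / (2 * pi) - 1) / (fasym B)^2 < v" using B(5) q by linarith
 hence sB: "s / (2 * pi) - 1 < 83/200 * (fasym B)^2"
 proof -
  have "s / (2 * pi) - 1 < v * (fasym B)^2" using qB B(4) by (simp add: pos_divide_less_eq)
  also have "... <= 83/200 * (fasym B)^2" using v(2) sqrt2_bounds by (intro mult_right_mono) auto
  finally show ?thesis .
 qed
 have "s <= 17"
 proof -
  have "(fasym B)^2 <= 2^2" using B.asym_le2 B(4) by (intro power_mono) auto
  hence "s / (2 * pi) <= 27/10" using sB by simp
  hence "s <= 27/10 * (2 * pi)" by (simp add: pos_divide_le_eq)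
  thus ?thesis using pi_approx by simp
 qed
 moreover have "(1 / 100000000)^4 < fasym B"
 proof (rule ccontr)
  assume "\<not> ?thesis"
  hence "2 * pi + 2 * pi * (83/200) * (fasym B)^2 <= s" using perimeter_lower_local[OF B(1,3,4)] by simp
  hence "2 * pi * (1 + 83/200 * (fasym B)^2) <= s" by (simp add: algebra_simps)
  hence "1 + 83/200 * (fasym B)^2 <= s / (2 * pi)" by (simp add: pos_le_divide_eq mult.commute)
  thus False using sB by simp
 qed
 ultimately show thesis using that[OF B(1-3)] qB by blast
qed

theorem theorem1p1:
  shows "\<exists>\<Omega>\<^sub>0. admissible \<Omega>\<^sub>0 \<and>
    (\<forall>\<Omega>. admissible \<Omega> \<longrightarrow> isoperimetric_quotient \<Omega>\<^sub>0 \<le> isoperimetric_quotient \<Omega>)"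
proof -
 obtain T where T: "admissible T" "isoperimetric_quotient T <= ereal (sqrt 2 - 1)" by (rule two_balls)
 define Q where "Q = (INF \<Omega>\<in>{\<Omega>. admissible \<Omega>}. isoperimetric_quotient \<Omega>)"
 have Q_le: "Q <= isoperimetric_quotient \<Omega>" if "admissible \<Omega>" for \<Omega> unfolding Q_def using that by (intro INF_lower) auto
 show ?thesis
 proof (cases "ereal (sqrt 2 - 1) <= Q")
  case True
  thus ?thesis using T Q_le by (meson order_trans)
 next
  case False
  have "0 <= Q" unfolding Q_def using quotient_nonneg by (intro INF_greatest) auto
  then obtain x where x: "Q = ereal x" "x < sqrt 2 - 1" using False by (cases Q) auto
  \<comment> \<open>Numbers that decrease to the infimum and never exceed sqrt 2 - 1, so
    \<open>good_competitor\<close> applies to every one of them.\<close>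
  define v where "v n = x + (sqrt 2 - 1 - x) * (1 / real (Suc n))" for n
  have v: "x < v n" "v n <= sqrt 2 - 1" for n
  proof -
   show "x < v n" using x(2) by (simp add: v_def)
   have "(sqrt 2 - 1 - x) * (1 / real (Suc n)) <= (sqrt 2 - 1 - x) * 1" using x(2) by (intro mult_left_mono) auto
   thus "v n <= sqrt 2 - 1" by (simp add: v_def)
  qed
  have vx: "v \<longlonglongrightarrow> x"
  proof -
   have "(\<lambda>n. 1 / real (Suc n)) \<longlonglongrightarrow> 0" using LIMSEQ_inverse_real_of_nat by (simp add: divide_inverse)
   hence "(\<lambda>n. x + (sqrt 2 - 1 - x) * (1 / real (Suc n))) \<longlonglongrightarrow> x + (sqrt 2 - 1 - x) * 0" by (intro tendsto_intros)
   thus ?thesis by (simp add: v_def[abs_def])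
  qed
  have "\<exists>A p. planar A pi \<and> A \<subseteq> cball 0 (10^10) \<and> per_le A p \<and> p <= 17 \<and> (1 / 100000000)^4 < fasym A \<and>
   (p / (2 * pi) - 1) / (fasym A)^2 < v n" for n
  proof -
   have "Q < ereal (v n)" using v(1)[of n] x by simp
   then obtain \<Omega> where "admissible \<Omega>" "isoperimetric_quotient \<Omega> < ereal (v n)" unfolding Q_def INF_less_iff by auto
   from good_competitor[OF this v(2)] show ?thesis by (metis (no_types, lifting))
  qed
  then obtain E p where E: "\<And>n. planar (E n) pi" "\<And>n. E n \<subseteq> cball 0 (10^10)" "\<And>n. per_le (E n) (p n)" "\<And>n. p n <= 17"
   "\<And>n. (1 / 100000000)^4 < fasym (E n)" "\<And>n. (p n / (2 * pi) - 1) / (fasym (E n))^2 < v n"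
   by metis
  have Eb: "E n \<in> sets borel" for n by (rule planar.borel[OF E(1)])
  have E17: "per_le (E n) 17" for n using E(3)[of n] E(4)[of n] unfolding per_le_def by force
  obtain k F where k: "strict_mono (k::nat=>nat)" "F \<in> sets borel" "F \<subseteq> cball 0 (10^10)" "(\<lambda>n. area (sym_diff (E (k n)) F)) \<longlonglongrightarrow> 0"
   by (rule perimeter_compactness[of E "10^10" 17, OF Eb E(2) E17]) blast
  have "p (k n) \<in> {0..17}" for n using E(4) per_le_nonneg[OF E(3)] by auto
  \<comment> \<open>A further subsequence makes the perimeter bounds converge, as
    \<open>perimeter_lsc\<close> takes sets and bounds along the same indices.\<close>
  then obtain P r where r: "strict_mono (r::nat=>nat)" "((\<lambda>n. p (k n)) \<circ> r) \<longlonglongrightarrow> P"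
   using compact_imp_seq_compact[OF compact_Icc[of 0 "17::real"]] unfolding seq_compact_def by metis
  define j where "j n = k (r n)" for n
  have j: "strict_mono j" unfolding j_def[abs_def] using strict_mono_o[OF k(1) r(1)] by (simp add: o_def)
  have jF: "(\<lambda>n. area (sym_diff (E (j n)) F)) \<longlonglongrightarrow> 0"
   using LIMSEQ_subseq_LIMSEQ[OF k(4) r(1)] by (simp add: o_def j_def)
  have jP: "(\<lambda>n. p (j n)) \<longlonglongrightarrow> P" using r(2) by (simp add: o_def j_def)
  have F: "planar F pi" by (rule area_limit[OF E(1) k(2) finarea_bounded[OF k(3)] jF])
  have lF: "(\<lambda>n. fasym (E (j n))) \<longlonglongrightarrow> fasym F" by (rule asymmetry_continuous[OF E(1) F jF])
  have "(1 / 100000000)^4 <= fasym F" by (rule LIMSEQ_le_const[OF lF]) (use E(5) less_imp_le in blast)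
  hence l0: "0 < fasym F" by (rule less_le_trans[rotated]) simp
  have "per_le F P" by (rule perimeter_lsc[OF Eb E(2,3) k(2,3) jF jP])
  note qF = planar_quotient_le[OF F this l0]
  have "(\<lambda>n. (p (j n) / (2 * pi) - 1) / (fasym (E (j n)))^2) \<longlonglongrightarrow> (P / (2 * pi) - 1) / (fasym F)^2"
   using l0 by (intro tendsto_intros jP lF) auto
  moreover have "(\<lambda>n. v (j n)) \<longlonglongrightarrow> x" using LIMSEQ_subseq_LIMSEQ[OF vx j] by (simp add: o_def)
  ultimately have "(P / (2 * pi) - 1) / (fasym F)^2 <= x"
   by (rule LIMSEQ_le) (use E(6) less_imp_le in blast)
  hence "isoperimetric_quotient F <= Q" using qF x(1) by (simp add: order_trans)
  moreover have "admissible F" unfolding admissible_iff using F l0 by (intro exI[of _ pi]) auto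
  ultimately show ?thesis using Q_le by (meson order_trans)
 qed
qed

end
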